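(* Let $c\in\mathbb{R}^p$ and let $\beta>0$. Then there are functions $$\rho_\beta\in C^1(\mathbb{T}\times\mathbb{T}^p)\cap C(\mathbb{T},C^2(\mathbb{T}^p)),\qquad u_\beta\in C^1(\mathbb{T},C^1(\mathbb{T}^p))\cap C(\mathbb{T},C^3(\mathbb{T}^p))$$ and a number $\bar H_\beta(c)\in\mathbb{R}$ such that $\rho_\beta\ge 0$, $\int_{\mathbb{T}^p}\rho_\beta(t,x)\,dx=1$ for all $t\in\mathbb{T}$, and on $\mathbb{T}\times\mathbb{T}^p$ $$\frac{1}{2\beta}\Delta u_\beta+\partial_t u_\beta-H_{\rho_\beta}(t,x,c-\partial_x u_\beta)+\bar H_\beta(c)=0,\qquad (1)$$ $$\frac{1}{2\beta}\Delta\rho_\beta-\mathrm{div}[\rho_\beta\cdot(c-\partial_xu_\beta)]-\partial_t\rho_\beta=0.\qquad (2)$$ Moreover, among the triples $(\rho_\beta,u_\beta,\bar H_\beta(c))$ with $\rho_\beta\in C^1(\mathbb{T}\times\mathbb{T}^p)\cap C(\mathbb{T},C^2(\mathbb{T}^p))$, $\rho_\beta\ge 0$, $\int_{\mathbb{T}^p}\rho_\beta(t,x)\,dx=1$ for all $t\in\mathbb{T}$, $u_\beta\in C^1(\mathbb{T},C^1(\mathbb{T}^p))\cap C(\mathbb{T},C^3(\mathbb{T}^p))$ and $\bar H_\beta(c)\in\mathbb{R}$, which solve (1)-(2), there is one which minimizes $$\int_{\mathbb{T}\times\mathbb{T}^p}\mathcal{L}_{c,\frac12\rho_\beta}(t,x,\partial_xu_\beta)\,\rho_\beta(t,x)\,dt\,dx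 .$$
   Context: $\mathbb{T}=\mathbb{R}/\mathbb{Z}$, $\mathbb{T}^p=\mathbb{R}^p/\mathbb{Z}^p$; functions on $\mathbb{T}\times\mathbb{T}^p$ are functions of $(t,x)$ that are 1-periodic in time and $\mathbb{Z}^p$-periodic in space. Standing assumptions: $V\in C(\mathbb{T},C^3(\mathbb{T}^p))$; $W\in C^3(\mathbb{T}^p)$ with $W(x)=W(-x)$ and $W(0)=0$. For a continuous function $\psi\ge0$ on $\mathbb{T}\times\mathbb{T}^p$ put $$P_\psi(t,x)=V(t,x)+\int_{\mathbb{T}^p}W(x-x')\psi(t,x')\,dx',$$ $$\mathcal{L}_{c,\psi}(t,x,\dot x)=\tfrac12|\dot x|^2-\langle c,\dot x\rangle-P_\psi(t,x),\qquad H_\psi(t,x,q)=\tfrac12|q|^2+P_\psi(t,x).$$ In particular $\mathcal{L}_{c,\frac12\rho}$ is $\mathcal{L}_{c,\psi}$ with $\psi=\frac12\rho$. $\Delta$, $\mathrm{div}$, $\partial_x$ are taken in the space variable $x$. *)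

theory Defs
  imports "HOL-Analysis.Analysis"
begin

(* Functions on the torus R^p/Z^p are Z^p-periodic functions on real^'n, where p = CARD('n);
   functions on T x T^p are curried functions of (t,x). *)

definition periodic_space :: "(real^'n \<Rightarrow> 'a) \<Rightarrow> bool" where
  "periodic_space f \<longleftrightarrow> (\<forall>x k. (\<forall>i. k $ i \<in> \<int>) \<longrightarrow> f (x + k) = f x)"

definition periodic_time :: "(real \<Rightarrow> 'a) \<Rightarrow> bool" where
  "periodic_time f \<longleftrightarrow> (\<forall>t. f (t + 1) = f t)"

definition torus_cell :: "(real^'n) set" where
  "torus_cell = cbox 0 One"

definition time_torus_cell :: "(real \<times> (real^'n)) set" where
  "time_torus_cell = {0..1} \<times> torus_cell"


definition pd :: "'n \<Rightarrow> (real^'n \<Rightarrow> real) \<Rightarrow> real^'n \<Rightarrow> real" where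
  "pd i f x = deriv (\<lambda>s. f (x + s *\<^sub>R axis i 1)) 0"

definition pds :: "'n list \<Rightarrow> (real^'n \<Rightarrow> real) \<Rightarrow> real^'n \<Rightarrow> real" where
  "pds is f = foldr pd is f"

definition grad :: "(real^'n \<Rightarrow> real) \<Rightarrow> real^'n \<Rightarrow> real^'n" where
  "grad f x = (\<chi> i. pd i f x)"

definition divg :: "(real^'n \<Rightarrow> real^'n) \<Rightarrow> real^'n \<Rightarrow> real" where
  "divg F x = (\<Sum>i\<in>UNIV. pd i (\<lambda>y. F y $ i) x)"

definition laplacian :: "(real^'n \<Rightarrow> real) \<Rightarrow> real^'n \<Rightarrow> real" where
  "laplacian f x = (\<Sum>i\<in>UNIV. pd i (pd i f) x)"

definition dt :: "(real \<Rightarrow> real^'n \<Rightarrow> real) \<Rightarrow> real \<Rightarrow> real^'n \<Rightarrow> real" where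
  "dt f t x = deriv (\<lambda>s. f s x) t"


fun Ck :: "nat \<Rightarrow> (real^'n \<Rightarrow> real) \<Rightarrow> bool" where
  "Ck 0 f \<longleftrightarrow> continuous_on UNIV f"
| "Ck (Suc k) f \<longleftrightarrow> f differentiable_on UNIV \<and> (\<forall>i. Ck k (pd i f))"

definition Ck_torus :: "nat \<Rightarrow> (real^'n \<Rightarrow> real) set" where
  "Ck_torus k = {f. Ck k f \<and> periodic_space f}"

(* The maximum over derivatives of order at most k of their sup norms. It is a genuine norm
   on Ck_torus k only; elsewhere the supremum may be taken over an unbounded set. *)
definition Ck_norm :: "nat \<Rightarrow> (real^'n \<Rightarrow> real) \<Rightarrow> real" where
  "Ck_norm k f = (SUP (is, x) \<in> {is. length is \<le> k} \<times> UNIV. \<bar>pds is f x\<bar>)"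

(* C(T, C^k(T^p)): continuous maps from the circle into the Banach space C^k(T^p) *)
definition C0_time_Ck :: "nat \<Rightarrow> (real \<Rightarrow> real^'n \<Rightarrow> real) set" where
  "C0_time_Ck k = {f. periodic_time f \<and> (\<forall>t. f t \<in> Ck_torus k) \<and>
     (\<forall>t. ((\<lambda>s. Ck_norm k (\<lambda>x. f s x - f t x)) \<longlongrightarrow> 0) (at t))}"

(* C^1(T, C^k(T^p)): maps with a continuous derivative g taken in the Banach space C^k(T^p) *)
definition C1_time_Ck :: "nat \<Rightarrow> (real \<Rightarrow> real^'n \<Rightarrow> real) set" where
  "C1_time_Ck k = {f. periodic_time f \<and> (\<forall>t. f t \<in> Ck_torus k) \<and>
     (\<exists>g \<in> C0_time_Ck k. \<forall>t.
        ((\<lambda>h. Ck_norm k (\<lambda>x. (f (t + h) x - f t x) / h - g t x)) \<longlongrightarrow> 0) (at 0))}"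

(* C^1(T x T^p), in both variables jointly *)
definition C1_time_torus :: "(real \<Rightarrow> real^'n \<Rightarrow> real) set" where
  "C1_time_torus = {f. periodic_time f \<and> (\<forall>t. periodic_space (f t)) \<and>
     (\<exists>f' :: real \<times> (real^'n) \<Rightarrow> (real \<times> (real^'n)) \<Rightarrow>\<^sub>L real.
        (\<forall>z. ((\<lambda>(t, x). f t x) has_derivative blinfun_apply (f' z)) (at z)) \<and>
        continuous_on UNIV f')}"


definition potential ::
  "(real \<Rightarrow> real^'n \<Rightarrow> real) \<Rightarrow> (real^'n \<Rightarrow> real) \<Rightarrow> (real \<Rightarrow> real^'n \<Rightarrow> real) \<Rightarrow>
   real \<Rightarrow> real^'n \<Rightarrow> real" where
  "potential V W \<psi> t x = V t x + integral torus_cell (\<lambda>x'. W (x - x') * \<psi> t x')"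

definition lagrangian ::
  "(real \<Rightarrow> real^'n \<Rightarrow> real) \<Rightarrow> (real^'n \<Rightarrow> real) \<Rightarrow> real^'n \<Rightarrow> (real \<Rightarrow> real^'n \<Rightarrow> real) \<Rightarrow>
   real \<Rightarrow> real^'n \<Rightarrow> real^'n \<Rightarrow> real" where
  "lagrangian V W c \<psi> t x v = 1/2 * (norm v)\<^sup>2 - c \<bullet> v - potential V W \<psi> t x"

definition hamiltonian ::
  "(real \<Rightarrow> real^'n \<Rightarrow> real) \<Rightarrow> (real^'n \<Rightarrow> real) \<Rightarrow> (real \<Rightarrow> real^'n \<Rightarrow> real) \<Rightarrow>
   real \<Rightarrow> real^'n \<Rightarrow> real^'n \<Rightarrow> real" where
  "hamiltonian V W \<psi> t x q = 1/2 * (norm q)\<^sup>2 + potential V W \<psi> t x"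

definition mfg_solution ::
  "(real \<Rightarrow> real^'n \<Rightarrow> real) \<Rightarrow> (real^'n \<Rightarrow> real) \<Rightarrow> real^'n \<Rightarrow> real \<Rightarrow>
   (real \<Rightarrow> real^'n \<Rightarrow> real) \<Rightarrow> (real \<Rightarrow> real^'n \<Rightarrow> real) \<Rightarrow> real \<Rightarrow> bool" where
  "mfg_solution V W c \<beta> \<rho> u h \<longleftrightarrow>
     \<rho> \<in> C1_time_torus \<inter> C0_time_Ck 2 \<and>
     u \<in> C1_time_Ck 1 \<inter> C0_time_Ck 3 \<and>
     (\<forall>t x. \<rho> t x \<ge> 0) \<and>
     (\<forall>t. integral torus_cell (\<rho> t) = 1) \<and>
     (\<forall>t x. 1 / (2 * \<beta>) * laplacian (u t) x + dt u t x
              - hamiltonian V W \<rho> t x (c - grad (u t) x) + h = 0) \<and>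
     (\<forall>t x. 1 / (2 * \<beta>) * laplacian (\<rho> t) x
              - divg (\<lambda>y. \<rho> t y *\<^sub>R (c - grad (u t) y)) x - dt \<rho> t x = 0)"

definition action ::
  "(real \<Rightarrow> real^'n \<Rightarrow> real) \<Rightarrow> (real^'n \<Rightarrow> real) \<Rightarrow> real^'n \<Rightarrow>
   (real \<Rightarrow> real^'n \<Rightarrow> real) \<Rightarrow> (real \<Rightarrow> real^'n \<Rightarrow> real) \<Rightarrow> real" where
  "action V W c \<rho> u = integral time_torus_cell
     (\<lambda>(t, x). lagrangian V W c (\<lambda>s y. 1/2 * \<rho> s y) t x (grad (u t) x) * \<rho> t x)"

end

theory Submission
  imports Defs "HOL-Probability.Distributions" "HOL-Complex_Analysis.Great_Picard"
begin

text \<open>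
  The Hopf-Cole substitution \<open>w = exp (- \<beta> u)\<close>, \<open>v = \<rho> exp (\<beta> u)\<close> turns the system into
  the pair of linear-looking eigenvalue equations
  \<open>w\<^sub>t + a \<Delta>w + c \<bullet> \<nabla>w = - (Q - \<lambda>) w\<close> and \<open>- v\<^sub>t + a \<Delta>v - c \<bullet> \<nabla>v = - (Q - \<lambda>) v\<close> with
  \<open>a = 1 / (2 \<beta>)\<close>, \<open>\<rho>\<close> proportional to \<open>w v\<close>, and \<open>Q = \<beta> P\<^sub>\<rho>\<close> the only coupling, bounded
  independently of \<open>\<rho>\<close>. After adding a large \<open>\<mu>\<close> both become fixed point equations
  \<open>w = R ((Q + \<mu> - \<lambda>) w)\<close>, where the resolvent \<open>R\<close> of the drifted heat operator is the convolution
  with an explicit positive space-time kernel \<open>K\<close> and \<open>\<lambda>\<close> is fixed by \<open>avg w = 1\<close>.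

  Positivity of \<open>K\<close> on a period bounds \<open>w\<close> and \<open>v\<close> below by some \<open>\<delta> > 0\<close>; splitting \<open>K\<close> into a
  part of small mass and a part with integrable periodisation bounds them above by some \<open>M\<close>. The map
  is compact since translation is continuous in \<open>L\<^sup>1\<close>, so Schauder's theorem gives a fixed point, which
  the smoothing of \<open>R\<close> makes a classical solution. Conversely, every classical solution yields a fixed
  point within the same bounds. Hence the solutions correspond to a compact set of fixed points. The
  gradient of \<open>w\<close> is again a convolution and depends continuously on the fixed point, so the action
  attains its minimum.
\<close>

section \<open>Periodic functions, averages and directional derivatives\<close>

text \<open>Both equations are periodic in time, one runs backward and the other forward, and they
  are coupled, so neither can be solved as an evolution from given data. The resolvent acts on
  functions periodic in space-time and treats the two directions alike. Each factor then carries its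
  own eigenvalue; that the two agree is a separate argument about the mass of \<open>w v\<close>.
  The parameter \<open>\<mu>\<close> exceeds four times the bound on \<open>Q\<close>. This keeps
  the coefficient \<open>Q + \<mu> - \<lambda>\<close> between \<open>\<mu> / 2\<close> and
  \<open>2 * \<mu>\<close>, so positivity is preserved, and it lets the part of the kernel near time
  0 contribute at most half of the supremum. No monotonicity of the coupling is assumed that would
  force uniqueness; for this reason the bounds have to hold for every solution, not only for one
  that a fixed point theorem produces, and the minimum is sought over a whole set. In the regularity
  argument each application of \<open>R\<close> gains one derivative in space, while
  \<open>Q\<close> obtains its derivatives from \<open>V\<close> and \<open>W\<close>, however rough
  the density is; three rounds reach the required order.\<close>

definition per :: "('a::euclidean_space \<Rightarrow> 'b) \<Rightarrow> bool" where
  "per f \<longleftrightarrow> (\<forall>x. \<forall>b\<in>Basis. f (x + b) = f x)"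

text \<open>Periodicity is set in an arbitrary Euclidean space, so that one notion serves space
  (\<open>'x\<close>) and space-time (\<open>real \<times> 'x\<close>): the \<open>Basis\<close> of
  a product consists of the unit vectors of both factors, and all periods are 1.\<close>

definition cper :: "('a::euclidean_space \<Rightarrow> 'b::topological_space) \<Rightarrow> bool" where
  "cper f \<longleftrightarrow> continuous_on UNIV f \<and> per f"

definition lattice :: "'a::euclidean_space set" where
  "lattice = {k. \<forall>b\<in>Basis. k \<bullet> b \<in> \<int>}"

abbreviation cell :: "'a::euclidean_space set" where
  "cell \<equiv> cbox 0 One"

definition avg :: "('a::euclidean_space \<Rightarrow> real) \<Rightarrow> real" where
  "avg f = integral cell f"

lemma cperI: "continuous_on UNIV f \<Longrightarrow> per f \<Longrightarrow> cper f"
  by (simp add: cper_def)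

lemma cperD: "cper f \<Longrightarrow> continuous_on UNIV f" "cper f \<Longrightarrow> per f"
  by (simp_all add: cper_def)

lemma cper_continuous_on: "cper f \<Longrightarrow> continuous_on S f"
  using continuous_on_subset cperD(1) by blast

lemma per_int_Basis:
  assumes "per f" "b \<in> Basis"
  shows "f (x + of_int m *\<^sub>R b) = f x"
proof -
  have nat: "f (x + of_nat n *\<^sub>R b) = f x" for n x
  proof (induction n)
    case (Suc n)
    have "f (x + of_nat (Suc n) *\<^sub>R b) = f ((x + of_nat n *\<^sub>R b) + b)"
      by (simp add: algebra_simps)
    then show ?case
      using Suc assms by (simp add: per_def)
  qed simp
  show ?thesis
  proof (cases m rule: int_cases2)
    case (nonneg n)
    then show ?thesis using nat[of x n] by simp
  next
    case (nonpos n)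
    then show ?thesis using nat[of "x - of_nat n *\<^sub>R b" n] by simp
  qed
qed

lemma per_lattice:
  assumes "per f" "k \<in> lattice"
  shows "f (x + k) = f x"
proof -
  have "f (x + (\<Sum>b\<in>S. (k \<bullet> b) *\<^sub>R b)) = f x" if "finite S" "S \<subseteq> Basis" for S
    using that
  proof (induction S)
    case (insert b S)
    then have "k \<bullet> b \<in> \<int>"
      using assms(2) by (auto simp: lattice_def)
    then obtain m where m: "k \<bullet> b = of_int m"
      by (rule Ints_cases)
    have "f (x + (\<Sum>b\<in>insert b S. (k \<bullet> b) *\<^sub>R b)) = f ((x + (\<Sum>b\<in>S. (k \<bullet> b) *\<^sub>R b)) + of_int m *\<^sub>R b)"
      using insert m by (simp add: algebra_simps)
    also have "\<dots> = f x"
      using per_int_Basis[OF assms(1)] insert by simp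
    finally show ?case .
  qed simp
  from this[of Basis] show ?thesis
    by (simp add: euclidean_representation)
qed

lemma lattice_reduce: "\<exists>k\<in>lattice. x + k \<in> (cell :: 'a::euclidean_space set)"
proof
  let ?k = "\<Sum>b\<in>Basis. (- of_int \<lfloor>x \<bullet> b\<rfloor>) *\<^sub>R b :: 'a"
  have k: "?k \<bullet> b = - of_int \<lfloor>x \<bullet> b\<rfloor>" if "b \<in> Basis" for b
    using that by (simp only: inner_sum_left_Basis)
  show "?k \<in> lattice"
    unfolding lattice_def using k by simp
  have "0 \<le> (x + ?k) \<bullet> b \<and> (x + ?k) \<bullet> b \<le> 1" if "b \<in> Basis" for b
    unfolding inner_add_left k[OF that] by linarith
  then show "x + ?k \<in> cell"
    by (simp add: mem_box)
qed

lemma per_reduce: "per f \<Longrightarrow> \<exists>y\<in>cell. f x = f y"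
  by (metis lattice_reduce per_lattice)

lemma cper_bounded:
  fixes f :: "'a::euclidean_space \<Rightarrow> 'b::real_normed_vector"
  assumes "cper f"
  obtains M where "M > 0" "\<And>x. norm (f x) \<le> M"
proof -
  have "bounded (f ` cell)"
    by (intro compact_imp_bounded compact_continuous_image cper_continuous_on[OF assms] compact_cbox)
  then obtain M where M: "\<And>y. y \<in> cell \<Longrightarrow> norm (f y) \<le> M"
    by (force simp: bounded_iff)
  have "norm (f x) \<le> max M 1" for x
    using per_reduce[OF cperD(2)[OF assms], of x] M by fastforce
  then show ?thesis
    using that[of "max M 1"] by simp
qed

lemma cper_uniformly_continuous:
  fixes f :: "'a::euclidean_space \<Rightarrow> 'b::metric_space"
  assumes "cper f"
  shows "uniformly_continuous_on UNIV f"
  unfolding uniformly_continuous_on_def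
proof (intro allI impI)
  fix e :: real assume e: "e > 0"
  \<comment> \<open>The cell enlarged by 1 on every side: once a lattice shift has moved
    \<open>x\<close> into the cell, a point at distance below 1 from \<open>x\<close> lands here
    too.\<close>
  let ?S = "cbox (- One) (2 *\<^sub>R One) :: 'a set"
  have "uniformly_continuous_on ?S f"
    by (intro compact_uniformly_continuous cper_continuous_on[OF assms] compact_cbox)
  then obtain d where d: "d > 0" "\<And>x y. x \<in> ?S \<Longrightarrow> y \<in> ?S \<Longrightarrow> dist y x < d \<Longrightarrow> dist (f y) (f x) < e"
    unfolding uniformly_continuous_on_def using e by metis
  show "\<exists>d>0. \<forall>x\<in>UNIV. \<forall>x'\<in>UNIV. dist x' x < d \<longrightarrow> dist (f x') (f x) < e"
  proof (intro exI conjI ballI impI)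
    show "min d 1 > 0" using d by simp
    fix x y :: 'a assume xy: "dist y x < min d 1"
    obtain k where k: "k \<in> lattice" "x + k \<in> cell"
      using lattice_reduce by blast
    have x: "0 \<le> (x + k) \<bullet> b \<and> (x + k) \<bullet> b \<le> 1" if "b \<in> Basis" for b
      using k(2) that by (simp add: mem_box)
    have y: "\<bar>(y - x) \<bullet> b\<bar> < 1" if "b \<in> Basis" for b
      using Basis_le_norm[OF that, of "y - x"] xy by (simp add: dist_norm)
    have yb: "-1 \<le> (y + k) \<bullet> b \<and> (y + k) \<bullet> b \<le> 2" "-1 \<le> (x + k) \<bullet> b \<and> (x + k) \<bullet> b \<le> 2" if "b \<in> Basis" for b
      using x[OF that] y[OF that] by (auto simp: inner_diff_left inner_add_left)
    have "x + k \<in> ?S" "y + k \<in> ?S"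
      unfolding mem_box using yb by auto
    moreover have "dist (y + k) (x + k) < d"
      using xy by simp
    ultimately have "dist (f (y + k)) (f (x + k)) < e"
      using d by blast
    then show "dist (f y) (f x) < e"
      using per_lattice[OF cperD(2)[OF assms] k(1)] by simp
  qed
qed

lemma per_shift: "per f \<Longrightarrow> per (\<lambda>x. f (x + h))"
  unfolding per_def by (simp add: add.assoc add.commute[of _ h]) (simp add: add.assoc[symmetric])

lemma cper_shift: "cper f \<Longrightarrow> cper (\<lambda>x. f (x + h))"
  unfolding cper_def
  by (auto intro!: per_shift continuous_on_compose2[of UNIV f] continuous_intros)

lemma per_reflect: "per f \<Longrightarrow> per (\<lambda>x. f (- x))"
  unfolding per_def
proof (intro allI ballI)
  fix x b :: 'a assume *: "\<forall>x. \<forall>b\<in>Basis. f (x + b) = f x" and b: "b \<in> Basis"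
  then have "f ((- x - b) + b) = f (- x - b)" by blast
  then show "f (- (x + b)) = f (- x)" by simp
qed

lemma cper_reflect: "cper f \<Longrightarrow> cper (\<lambda>x. f (- x))"
  unfolding cper_def
  by (auto intro!: per_reflect continuous_on_compose2[of UNIV f] continuous_intros)

lemma cper_const: "cper (\<lambda>x. c)"
  by (simp add: cper_def per_def)

lemma cper_add: "cper f \<Longrightarrow> cper g \<Longrightarrow> cper (\<lambda>x. f x + g x :: 'b::real_normed_vector)"
  by (auto simp: cper_def per_def intro: continuous_intros)

lemma cper_diff: "cper f \<Longrightarrow> cper g \<Longrightarrow> cper (\<lambda>x. f x - g x :: 'b::real_normed_vector)"
  by (auto simp: cper_def per_def intro: continuous_intros)

lemma cper_mult: "cper f \<Longrightarrow> cper g \<Longrightarrow> cper (\<lambda>x. f x * g x :: 'b::real_normed_algebra)"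
  by (auto simp: cper_def per_def intro: continuous_intros)

lemma cper_cmult: "cper g \<Longrightarrow> cper (\<lambda>x. c * g x :: 'b::real_normed_algebra)"
  by (intro cper_mult cper_const)

lemma cper_uminus: "cper f \<Longrightarrow> cper (\<lambda>x. - f x :: 'b::real_normed_vector)"
  by (auto simp: cper_def per_def intro: continuous_intros)

lemma cper_sum: "(\<And>i. i \<in> I \<Longrightarrow> cper (f i)) \<Longrightarrow> cper (\<lambda>x. \<Sum>i\<in>I. f i x :: 'b::real_normed_vector)"
  by (auto simp: cper_def per_def intro!: continuous_intros sum.cong)

lemma cper_inverse: "cper f \<Longrightarrow> (\<And>x. f x \<noteq> (0::real)) \<Longrightarrow> cper (\<lambda>x. 1 / f x)"
  by (auto simp: cper_def per_def intro!: continuous_intros)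

lemma cper_compose:
  "cper f \<Longrightarrow> continuous_on (range f) g \<Longrightarrow> cper (\<lambda>x. g (f x))"
  by (auto simp: cper_def per_def intro: continuous_on_compose2)

lemma cper_uniform_limit:
  fixes f :: "nat \<Rightarrow> 'a::euclidean_space \<Rightarrow> 'b::metric_space"
  assumes "uniform_limit UNIV f g sequentially" "\<And>n. cper (f n)"
  shows "cper g"
proof (rule cperI)
  show "continuous_on UNIV g"
    by (rule uniform_limit_theorem[OF _ assms(1)]) (use assms(2) in \<open>auto simp: cper_def\<close>)
  have lim: "(\<lambda>n. f n x) \<longlonglongrightarrow> g x" for x
    using tendsto_uniform_limitI[OF assms(1)] by simp
  show "per g"
    unfolding per_def
  proof (intro allI ballI)
    fix x b :: 'a assume "b \<in> Basis"
    then have "f n (x + b) = f n x" for n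
      using assms(2) by (simp add: cper_def per_def)
    then show "g (x + b) = g x"
      using lim[of "x + b"] lim[of x] by (simp add: LIMSEQ_unique)
  qed
qed

lemma cper_integrable_on: "cper (f :: _ \<Rightarrow> real) \<Longrightarrow> f integrable_on cbox a b"
  by (intro integrable_continuous cper_continuous_on)

section \<open>Averages over the unit cell and their invariance\<close>

lemma avg_const: "avg (\<lambda>x::'a::euclidean_space. c) = c"
  by (simp add: avg_def content_cbox_if)

lemma avg_add: "cper f \<Longrightarrow> cper g \<Longrightarrow> avg (\<lambda>x. f x + g x) = avg f + avg g"
  unfolding avg_def by (intro integral_add cper_integrable_on)

lemma avg_diff: "cper f \<Longrightarrow> cper g \<Longrightarrow> avg (\<lambda>x. f x - g x) = avg f - avg g"
  unfolding avg_def by (intro integral_diff cper_integrable_on)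

lemma avg_cmult: "avg (\<lambda>x. c * f x) = c * avg f"
  unfolding avg_def by simp

lemma avg_divide: "avg (\<lambda>x. f x / c) = avg f / c"
  unfolding avg_def by simp

lemma avg_mono: "cper f \<Longrightarrow> cper g \<Longrightarrow> (\<And>x. f x \<le> g x) \<Longrightarrow> avg f \<le> avg g"
  unfolding avg_def by (intro integral_le cper_integrable_on)

lemma avg_nonneg: "cper f \<Longrightarrow> (\<And>x. 0 \<le> f x) \<Longrightarrow> 0 \<le> avg f"
  using avg_mono[of "\<lambda>x. 0" f] by (simp add: cper_const avg_const)

lemma avg_le_const: "cper f \<Longrightarrow> (\<And>x. f x \<le> C) \<Longrightarrow> avg f \<le> C"
  using avg_mono[of f "\<lambda>x. C"] by (simp add: cper_const avg_const)

lemma avg_ge_const: "cper f \<Longrightarrow> (\<And>x. C \<le> f x) \<Longrightarrow> C \<le> avg f"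
  using avg_mono[of "\<lambda>x. C" f] by (simp add: cper_const avg_const)

lemma avg_abs_le: "cper f \<Longrightarrow> (\<And>x. \<bar>f x\<bar> \<le> C) \<Longrightarrow> \<bar>avg f\<bar> \<le> C"
  using avg_le_const[of f C] avg_ge_const[of f "- C"] by (auto simp: abs_le_iff minus_le_iff)

lemma avg_sum: "(\<And>i. i \<in> I \<Longrightarrow> cper (f i)) \<Longrightarrow> finite I \<Longrightarrow> avg (\<lambda>x. \<Sum>i\<in>I. f i x) = (\<Sum>i\<in>I. avg (f i))"
  unfolding avg_def by (intro integral_sum cper_integrable_on)

lemma avg_uniform_limit:
  assumes "uniform_limit UNIV f g sequentially" "\<And>n. cper (f n)"
  shows "(\<lambda>n. avg (f n)) \<longlonglongrightarrow> avg g"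
proof -
  have "uniform_limit cell f g sequentially"
    using assms(1) by (rule uniform_limit_on_subset) simp
  then obtain I J where IJ: "\<And>n. (f n has_integral I n) cell" "(g has_integral J) cell" "(I \<longlongrightarrow> J) sequentially"
    by (rule uniform_limit_integral_cbox) (use assms(2) in \<open>auto intro: cper_continuous_on\<close>)
  have "avg (f n) = I n" "avg g = J" for n
    using IJ(1,2) unfolding avg_def by (simp_all add: integral_unique)
  then show ?thesis
    using IJ(3) by simp
qed

text \<open>The cell is cut at height \<open>1 - s\<close> along \<open>b\<close>. The shift moves
  the lower slab onto the part above height \<open>s\<close>; the upper slab leaves the cell and,
  moved back by one period, fills the part below \<open>s\<close>.\<close>

lemma avg_shift_unit:
  fixes f :: "'a::euclidean_space \<Rightarrow> real"
  assumes f: "cper f" and b: "b \<in> Basis" and s: "0 \<le> s" "s \<le> 1"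
  shows "avg (\<lambda>x. f (x + s *\<^sub>R b)) = avg f"
proof -
  let ?g = "\<lambda>x. f (x + s *\<^sub>R b)"
  have g: "cper ?g" by (rule cper_shift[OF f])
  define u where "u t = (\<Sum>i\<in>Basis. (if i = b then t else 1) *\<^sub>R i :: 'a)" for t :: real
  define l where "l t = t *\<^sub>R b" for t :: real
  have ui: "u t \<bullet> i = (if i = b then t else 1)" if "i \<in> Basis" for t i
    using that unfolding u_def by (simp only: inner_sum_left_Basis)
  have li: "l t \<bullet> i = (if i = b then t else 0)" if "i \<in> Basis" for t i
    using that b by (simp add: l_def inner_Basis)
  have lower: "cell \<inter> {x. x \<bullet> b \<le> t} = cbox 0 (u t)" if "t \<le> 1" for t
  proof (rule set_eqI)
    fix x
    have "x \<in> cbox 0 (u t) \<longleftrightarrow> (\<forall>i\<in>Basis. 0 \<le> x \<bullet> i \<and> x \<bullet> i \<le> (if i = b then t else 1))"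
      by (simp add: mem_box ui)
    also have "\<dots> \<longleftrightarrow> (\<forall>i\<in>Basis. 0 \<le> x \<bullet> i \<and> x \<bullet> i \<le> 1) \<and> x \<bullet> b \<le> t"
      using that b by (smt (verit))
    finally show "x \<in> cell \<inter> {x. x \<bullet> b \<le> t} \<longleftrightarrow> x \<in> cbox 0 (u t)"
      by (simp add: mem_box)
  qed
  have upper: "cell \<inter> {x. x \<bullet> b \<ge> t} = cbox (l t) One" if "0 \<le> t" for t
  proof (rule set_eqI)
    fix x
    have "x \<in> cbox (l t) One \<longleftrightarrow> (\<forall>i\<in>Basis. (if i = b then t else 0) \<le> x \<bullet> i \<and> x \<bullet> i \<le> 1)"
      by (simp add: mem_box li)
    also have "\<dots> \<longleftrightarrow> (\<forall>i\<in>Basis. 0 \<le> x \<bullet> i \<and> x \<bullet> i \<le> 1) \<and> x \<bullet> b \<ge> t"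
      using that b by (smt (verit))
    finally show "x \<in> cell \<inter> {x. x \<bullet> b \<ge> t} \<longleftrightarrow> x \<in> cbox (l t) One"
      by (simp add: mem_box)
  qed
  have split: "integral cell h = integral (cbox 0 (u t)) h + integral (cbox (l t) One) h"
    if "cper h" "0 \<le> t" "t \<le> 1" for h :: "'a \<Rightarrow> real" and t
    using integral_split[OF cper_integrable_on[OF that(1)] b, of 0 One t]
    by (simp add: lower upper that)
  have sh: "integral (cbox p q) (\<lambda>x. f (x + h)) = integral (cbox (p + h) (q + h)) f" for p q h
    using integral_shift_cbox_plus[of p q f h] by (simp add: o_def add.commute)
  have 1: "integral (cbox 0 (u (1 - s))) ?g = integral (cbox (l s) One) f"
  proof -
    have "u (1 - s) + s *\<^sub>R b = One"
      by (rule euclidean_eqI) (use b in \<open>auto simp: inner_add_left ui inner_Basis\<close>)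
    then show ?thesis
      using sh[of 0 "u (1-s)" "s *\<^sub>R b"] by (simp add: l_def)
  qed
  have 2: "integral (cbox (l (1 - s)) One) ?g = integral (cbox 0 (u s)) f"
  proof -
    have "f (x + (s *\<^sub>R b - b)) = f (x + s *\<^sub>R b)" for x
      using cperD(2)[OF f] b unfolding per_def by (metis add_diff_eq diff_add_cancel)
    then have "integral (cbox (l (1 - s)) One) ?g = integral (cbox (l (1 - s)) One) (\<lambda>x. f (x + (s *\<^sub>R b - b)))"
      by simp
    also have "\<dots> = integral (cbox (l (1-s) + (s *\<^sub>R b - b)) (One + (s *\<^sub>R b - b))) f"
      by (rule sh)
    also have "l (1-s) + (s *\<^sub>R b - b) = 0"
      by (simp add: l_def algebra_simps)
    also have "One + (s *\<^sub>R b - b) = u s"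
      by (rule euclidean_eqI) (use b in \<open>auto simp: inner_add_left inner_diff_left ui inner_Basis\<close>)
    finally show ?thesis .
  qed
  show ?thesis
    unfolding avg_def using split[OF g, of "1 - s"] split[OF f, of s] s 1 2 by simp
qed

text \<open>Coordinates are shifted one at a time, and in each of them only the fractional part of
  the shift matters.\<close>

lemma avg_shift:
  fixes f :: "'a::euclidean_space \<Rightarrow> real"
  assumes f: "cper f"
  shows "avg (\<lambda>x. f (x + h)) = avg f"
proof -
  have one: "avg (\<lambda>x. f (x + t *\<^sub>R b)) = avg f" if "cper f" "b \<in> Basis" for f b t
  proof -
    have "f (x + t *\<^sub>R b) = f (x + frac t *\<^sub>R b)" for x
    proof -
      have "f ((x + frac t *\<^sub>R b) + of_int \<lfloor>t\<rfloor> *\<^sub>R b) = f (x + frac t *\<^sub>R b)"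
        by (rule per_int_Basis) (use that cperD in auto)
      then show ?thesis by (simp add: frac_def algebra_simps)
    qed
    then show ?thesis
      using avg_shift_unit[OF that, of "frac t"] by (simp add: frac_lt_1 less_imp_le)
  qed
  have "avg (\<lambda>x. f (x + (\<Sum>b\<in>S. (h \<bullet> b) *\<^sub>R b))) = avg f" if "finite S" "S \<subseteq> Basis" for S
    using that
  proof (induction S)
    case (insert b S)
    have "avg (\<lambda>x. f (x + (\<Sum>b\<in>insert b S. (h \<bullet> b) *\<^sub>R b)))
        = avg (\<lambda>x. (\<lambda>x. f (x + (\<Sum>b\<in>S. (h \<bullet> b) *\<^sub>R b))) (x + (h \<bullet> b) *\<^sub>R b))"
      using insert by (simp add: algebra_simps)
    also have "\<dots> = avg (\<lambda>x. f (x + (\<Sum>b\<in>S. (h \<bullet> b) *\<^sub>R b)))"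
      by (rule one) (use insert cper_shift[OF f] in auto)
    finally show ?case using insert by simp
  qed simp
  from this[of Basis] show ?thesis
    by (simp add: euclidean_representation)
qed

text \<open>Reflection carries the cell to \<open>cbox (- One) 0\<close>; a translation by
  \<open>One\<close>, which a periodic function does not notice, brings it back.\<close>

lemma avg_reflect:
  fixes f :: "'a::euclidean_space \<Rightarrow> real"
  assumes f: "cper f"
  shows "avg (\<lambda>x. f (- x)) = avg f"
proof -
  have "avg (\<lambda>x. f (- x)) = avg (\<lambda>x. f (- x + One))"
    using avg_shift[OF cper_reflect[OF f], of "- One"] by (simp add: algebra_simps)
  also have "\<dots> = integral (cbox (- One) 0) (\<lambda>x. f (x + One))"
    unfolding avg_def
    using integral_reflect[of 0 "- One" "\<lambda>x. f (x + One)"] by simp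
  also have "\<dots> = avg f"
    using integral_shift_cbox_plus[of "- One" 0 f One] by (simp add: o_def add.commute avg_def)
  finally show ?thesis .
qed

lemma avg_eq_lborel:
  fixes f :: "'a::euclidean_space \<Rightarrow> real"
  assumes "cper f"
  shows "avg f = (\<integral>x. indicator cell x * f x \<partial>lborel)"
proof -
  have "set_integrable lborel cell f"
    unfolding set_integrable_def
    by (rule borel_integrable_compact) (auto intro: cper_continuous_on[OF assms])
  from set_borel_integral_eq_integral(2)[OF this] show ?thesis
    by (simp add: avg_def set_lebesgue_integral_def)
qed

text \<open>A relation that names the derivative, along an arbitrary vector: it covers time
  \<open>(1, 0)\<close> and space \<open>(0, b)\<close> alike, and suits functions whose derivative
  is known as a formula. Nothing is implied about other directions.\<close>

definition has_pd :: "('a::real_normed_vector \<Rightarrow> real) \<Rightarrow> 'a \<Rightarrow> ('a \<Rightarrow> real) \<Rightarrow> bool" where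
  "has_pd f b g \<longleftrightarrow> (\<forall>z. ((\<lambda>s. f (z + s *\<^sub>R b)) has_real_derivative g z) (at 0))"

lemma has_pd_at:
  assumes "has_pd f b g"
  shows "((\<lambda>s. f (z + s *\<^sub>R b)) has_real_derivative g (z + s *\<^sub>R b)) (at s)"
proof -
  have "((\<lambda>t. f ((z + s *\<^sub>R b) + t *\<^sub>R b)) has_real_derivative g (z + s *\<^sub>R b)) (at 0)"
    using assms unfolding has_pd_def by blast
  then have "((\<lambda>t. f (z + (t + s) *\<^sub>R b)) has_real_derivative g (z + s *\<^sub>R b)) (at 0)"
    by (simp add: algebra_simps)
  then show ?thesis
    using DERIV_shift[of "\<lambda>s. f (z + s *\<^sub>R b)" _ 0 s] by simp
qed

lemma has_pd_unique: "has_pd f b g \<Longrightarrow> has_pd f b g' \<Longrightarrow> g = g'"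
  unfolding has_pd_def by (metis DERIV_unique ext)

lemma has_pd_per:
  assumes "has_pd f b g" "per f" shows "per g"
  unfolding per_def
proof (intro allI ballI)
  fix x e :: 'a assume e: "e \<in> Basis"
  have "((\<lambda>s. f (x + e + s *\<^sub>R b)) has_real_derivative g (x + e)) (at 0)"
    using assms(1) unfolding has_pd_def by blast
  moreover have "f (x + e + s *\<^sub>R b) = f (x + s *\<^sub>R b)" for s
    using assms(2) e unfolding per_def by (metis add.assoc add.commute)
  ultimately have "((\<lambda>s. f (x + s *\<^sub>R b)) has_real_derivative g (x + e)) (at 0)"
    by simp
  then show "g (x + e) = g x"
    using assms(1) unfolding has_pd_def by (metis DERIV_unique)
qed

lemma has_pd_FTC:
  assumes "has_pd f b g" "continuous_on UNIV g" "0 \<le> h"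
  shows "((\<lambda>s. g (z + s *\<^sub>R b)) has_integral f (z + h *\<^sub>R b) - f z) {0..h}"
proof -
  have "((\<lambda>s. g (z + s *\<^sub>R b)) has_integral f (z + h *\<^sub>R b) - f (z + 0 *\<^sub>R b)) {0..h}"
    by (rule fundamental_theorem_of_calculus)
      (use assms(3) has_pd_at[OF assms(1)] in
        \<open>auto simp: has_real_derivative_iff_has_vector_derivative[symmetric] intro: has_field_derivative_at_within\<close>)
  then show ?thesis by simp
qed

text \<open>Integrating \<open>g\<close> along the segment from \<open>x\<close> to
  \<open>x + b\<close> gives \<open>f (x + b) - f x\<close>, whose mean vanishes by translation
  invariance; exchanging the two integrals gives the mean of \<open>g\<close>. On the torus this is
  integration by parts without boundary terms.\<close>

lemma avg_pd_zero:
  fixes f :: "'a::euclidean_space \<Rightarrow> real"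
  assumes fg: "has_pd f b g" and "cper f" "cper g"
  shows "avg g = 0"
proof -
  have cont: "continuous_on (cbox (0,0) (1, One)) (\<lambda>(s, x). g (x + s *\<^sub>R b))"
    unfolding split_beta
    by (intro continuous_on_compose2[OF cperD(1)[OF assms(3)]] continuous_intros) auto
  have *: "integral {0..1} (\<lambda>s. g (x + s *\<^sub>R b)) = f (x + b) - f x" for x
    using has_pd_FTC[OF fg cperD(1)[OF assms(3)], of 1 x] by (simp add: integral_unique)
  have "integral (cbox 0 1) (\<lambda>s. integral cell (\<lambda>x. g (x + s *\<^sub>R b)))
      = integral cell (\<lambda>x. integral (cbox 0 1) (\<lambda>s. g (x + s *\<^sub>R b)))"
    by (rule integral_swap_continuous[OF cont])
  also have "\<dots> = avg (\<lambda>x. f (x + b) - f x)"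
    by (simp add: * avg_def)
  also have "\<dots> = 0"
    using avg_shift[OF assms(2), of b] by (simp add: avg_diff assms cper_shift)
  finally have "integral (cbox 0 1) (\<lambda>s::real. avg (\<lambda>x. g (x + s *\<^sub>R b))) = 0"
    by (simp add: avg_def)
  then show ?thesis
    using avg_shift[OF assms(3)] by simp
qed

section \<open>Convolution with periodic functions\<close>

lemma lborel_integral_shift:
  fixes g :: "'a::euclidean_space \<Rightarrow> real"
  assumes "g \<in> borel_measurable borel"
  shows "(\<integral>y. g (h + y) \<partial>lborel) = (\<integral>y. g y \<partial>lborel)"
proof -
  have "(\<integral>y. g y \<partial>lborel) = (\<integral>y. g y \<partial>(distr lborel borel ((+) h)))"
    by (simp add: lborel_distr_plus)
  also have "\<dots> = (\<integral>y. g (h + y) \<partial>lborel)"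
    by (subst integral_distr) (use assms in auto)
  finally show ?thesis by simp
qed

lemma lborel_integrable_shift:
  fixes g :: "'a::euclidean_space \<Rightarrow> real"
  assumes "integrable lborel g"
  shows "integrable lborel (\<lambda>y. g (h + y))"
proof -
  have "integrable (distr lborel borel ((+) h)) g"
    using assms by (simp add: lborel_distr_plus)
  then show ?thesis
    by (subst (asm) integrable_distr_eq) (use assms in auto)
qed

lemma cper_measurable [measurable_dest]: "cper (f :: _ \<Rightarrow> real) \<Longrightarrow> f \<in> borel_measurable borel"
  by (intro borel_measurable_continuous_onI cperD(1))

text \<open>The argument is \<open>z + y\<close> and not \<open>z - y\<close>: a kernel supported in
  positive times then looks into the future, as a backward equation requires.\<close>

definition conv :: "('a::euclidean_space \<Rightarrow> real) \<Rightarrow> ('a \<Rightarrow> real) \<Rightarrow> 'a \<Rightarrow> real" where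
  "conv k f z = (\<integral>y. k y * f (z + y) \<partial>lborel)"

lemma conv_integrable:
  fixes k f :: "'a::euclidean_space \<Rightarrow> real"
  assumes k: "integrable lborel k" and f: "cper f"
  shows "integrable lborel (\<lambda>y. k y * f (z + y))"
proof -
  obtain M where M: "\<And>x. norm (f x) \<le> M"
    using cper_bounded[OF f] by metis
  have [measurable]: "k \<in> borel_measurable borel" "f \<in> borel_measurable borel"
    using k cper_measurable[OF f] by auto
  show ?thesis
  proof (rule Bochner_Integration.integrable_bound)
    show "integrable lborel (\<lambda>y. M * k y)" using k by simp
    show "AE y in lborel. norm (k y * f (z + y)) \<le> norm (M * k y)"
    proof (rule AE_I2)
      fix y
      have "\<bar>k y\<bar> * \<bar>f (z + y)\<bar> \<le> \<bar>k y\<bar> * \<bar>M\<bar>"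
        using M[of "z + y"] by (intro mult_left_mono) auto
      then show "norm (k y * f (z + y)) \<le> norm (M * k y)"
        by (simp add: abs_mult mult.commute)
    qed
  qed measurable
qed

lemma conv_bound:
  assumes k: "integrable lborel k" and f: "cper f" and M: "\<And>x. \<bar>f x\<bar> \<le> M"
  shows "\<bar>conv k f z\<bar> \<le> (\<integral>y. \<bar>k y\<bar> \<partial>lborel) * M"
proof -
  have "\<bar>conv k f z\<bar> \<le> (\<integral>y. \<bar>k y * f (z + y)\<bar> \<partial>lborel)"
    unfolding conv_def by (rule integral_abs_bound)
  also have "\<dots> \<le> (\<integral>y. \<bar>k y\<bar> * M \<partial>lborel)"
    by (rule integral_mono)
      (use integrable_abs[OF conv_integrable[OF k f]] integrable_abs[OF k] M in \<open>simp_all add: abs_mult mult_left_mono\<close>)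
  also have "\<dots> = (\<integral>y. \<bar>k y\<bar> \<partial>lborel) * M"
    by simp
  finally show ?thesis .
qed

lemma conv_add:
  assumes "integrable lborel k" "cper f" "cper g"
  shows "conv k (\<lambda>x. f x + g x) z = conv k f z + conv k g z"
  unfolding conv_def using conv_integrable[OF assms(1,2)] conv_integrable[OF assms(1,3)]
  by (simp add: distrib_left)

lemma conv_diff:
  assumes "integrable lborel k" "cper f" "cper g"
  shows "conv k (\<lambda>x. f x - g x) z = conv k f z - conv k g z"
  unfolding conv_def using conv_integrable[OF assms(1,2)] conv_integrable[OF assms(1,3)]
  by (simp add: right_diff_distrib)

lemma conv_cmult: "conv k (\<lambda>x. c * f x) z = c * conv k f z"
  unfolding conv_def by (subst integral_mult_right_zero[symmetric]) (simp add: mult_ac)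

lemma conv_mono:
  assumes "integrable lborel k" "cper f" "cper g" "\<And>y. 0 \<le> k y" "\<And>x. f x \<le> g x"
  shows "conv k f z \<le> conv k g z"
  unfolding conv_def
  by (rule integral_mono) (use conv_integrable assms in \<open>auto intro: mult_left_mono\<close>)

lemma conv_cper:
  assumes k: "integrable lborel k" and f: "cper f"
  shows "cper (conv k f)"
proof (rule cperI)
  obtain M where M: "\<And>x. norm (f x) \<le> M"
    using cper_bounded[OF f] by metis
  have [measurable]: "k \<in> borel_measurable borel" "f \<in> borel_measurable borel"
    using k cper_measurable[OF f] by auto
  show "continuous_on UNIV (conv k f)"
    unfolding continuous_on_sequentially
  proof (intro allI impI ballI, clarsimp simp: o_def)
    fix X :: "nat \<Rightarrow> 'a" and z assume X: "X \<longlonglongrightarrow> z"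
    show "(\<lambda>n. conv k f (X n)) \<longlonglongrightarrow> conv k f z"
      unfolding conv_def
    proof (rule integral_dominated_convergence)
      show "integrable lborel (\<lambda>y. M * \<bar>k y\<bar>)" using k by simp
      have "isCont f x" for x
        using cperD(1)[OF f] by (simp add: continuous_on_eq_continuous_at)
      then show "AE y in lborel. (\<lambda>n. k y * f (X n + y)) \<longlonglongrightarrow> k y * f (z + y)"
        by (intro AE_I2 tendsto_intros isCont_tendsto_compose[of _ f] X)
      show "AE y in lborel. norm (k y * f (X n + y)) \<le> M * \<bar>k y\<bar>" for n
        using mult_left_mono[OF M abs_ge_zero] by (intro AE_I2) (simp add: abs_mult mult.commute)
    qed measurable
  qed
  show "per (conv k f)"
    unfolding per_def
  proof (intro allI ballI)
    fix x b :: 'a assume "b \<in> Basis"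
    then have "f (x + b + y) = f (x + y)" for y
      using cperD(2)[OF f] unfolding per_def by (metis add.assoc add.commute)
    then show "conv k f (x + b) = conv k f x"
      by (simp add: conv_def)
  qed
qed

lemma conv_translate:
  assumes k: "integrable lborel k" and f: "cper f"
  shows "conv k f (z + h) = (\<integral>y. k (y - h) * f (z + y) \<partial>lborel)"
proof -
  have [measurable]: "k \<in> borel_measurable borel" "f \<in> borel_measurable borel"
    using k cper_measurable[OF f] by auto
  have "(\<integral>y. k (y - h) * f (z + y) \<partial>lborel) = (\<integral>y. k ((h + y) - h) * f (z + (h + y)) \<partial>lborel)"
    by (rule lborel_integral_shift[symmetric]) measurable
  then show ?thesis
    by (simp add: conv_def add.assoc)
qed

text \<open>Dominated convergence for the difference quotients, which the mean value inequality on
  the window of radius \<open>e\<close> bounds by \<open>G\<close>.\<close>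

lemma DERIV_integral_param:
  fixes F F' :: "real \<Rightarrow> 'a \<Rightarrow> real"
  assumes e: "e > 0"
    and int: "\<And>s. \<bar>s - s0\<bar> < e \<Longrightarrow> integrable M (F s)"
    and der: "\<And>s y. \<bar>s - s0\<bar> < e \<Longrightarrow> ((\<lambda>s. F s y) has_real_derivative F' s y) (at s)"
    and bnd: "\<And>s y. \<bar>s - s0\<bar> < e \<Longrightarrow> \<bar>F' s y\<bar> \<le> G y"
    and G: "integrable M G" and meas: "F' s0 \<in> borel_measurable M"
  shows "((\<lambda>s. \<integral>y. F s y \<partial>M) has_real_derivative (\<integral>y. F' s0 y \<partial>M)) (at s0)"
  unfolding DERIV_def tendsto_at_iff_sequentially
proof (intro allI impI)
  fix X :: "nat \<Rightarrow> real" assume X0: "\<forall>i. X i \<in> UNIV - {0}" and X: "X \<longlonglongrightarrow> 0"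
  from X e have "\<forall>\<^sub>F n in sequentially. \<bar>X n\<bar> < e"
    by (metis (mono_tags, lifting) LIMSEQ_iff eventually_sequentially diff_zero real_norm_def)
  then obtain N where N: "\<And>n. n \<ge> N \<Longrightarrow> \<bar>X n\<bar> < e"
    by (auto simp: eventually_sequentially)
  define Y where "Y n = X (n + N)" for n
  have Y: "Y \<longlonglongrightarrow> 0" "\<And>n. Y n \<noteq> 0" "\<And>n. \<bar>Y n\<bar> < e"
    using X X0 N unfolding Y_def by (auto intro: LIMSEQ_ignore_initial_segment)
  have int': "integrable M (F (s0 + Y n))" "integrable M (F s0)" for n
    using int Y e by auto
  have "(\<lambda>n. \<integral>y. (F (s0 + Y n) y - F s0 y) / Y n \<partial>M) \<longlonglongrightarrow> (\<integral>y. F' s0 y \<partial>M)"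
  proof (rule integral_dominated_convergence[OF meas _ G])
    show "(\<lambda>y. (F (s0 + Y n) y - F s0 y) / Y n) \<in> borel_measurable M" for n
      using int'(1)[of n] int'(2) by auto
    show "AE y in M. (\<lambda>n. (F (s0 + Y n) y - F s0 y) / Y n) \<longlonglongrightarrow> F' s0 y"
    proof (rule AE_I2)
      fix y
      have "((\<lambda>h. (F (s0 + h) y - F s0 y) / h) \<longlongrightarrow> F' s0 y) (at 0)"
        using der[of s0 y] e by (simp add: DERIV_def)
      then show "(\<lambda>n. (F (s0 + Y n) y - F s0 y) / Y n) \<longlonglongrightarrow> F' s0 y"
        unfolding tendsto_at_iff_sequentially using Y by (auto simp: o_def)
    qed
    fix n
    show "AE y in M. norm ((F (s0 + Y n) y - F s0 y) / Y n) \<le> G y"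
    proof (rule AE_I2)
      fix y
      have "norm (F (s0 + Y n) y - F s0 y) \<le> G y * norm ((s0 + Y n) - s0)"
      proof (rule field_differentiable_bound[of "{s. \<bar>s - s0\<bar> < e}" "\<lambda>s. F s y" "\<lambda>s. F' s y"])
        have "{s. \<bar>s - s0\<bar> < e} = ball s0 e"
          by (auto simp: dist_real_def abs_minus_commute)
        then show "convex {s. \<bar>s - s0\<bar> < e}" by simp
      qed (use der bnd Y e in \<open>auto intro: has_field_derivative_at_within\<close>)
      then show "norm ((F (s0 + Y n) y - F s0 y) / Y n) \<le> G y"
        using Y(2)[of n] by (simp add: field_simps)
    qed
  qed
  then have "(\<lambda>n. ((\<lambda>h. ((\<integral>y. F (s0 + h) y \<partial>M) - (\<integral>y. F s0 y \<partial>M)) / h) \<circ> X) (n + N)) \<longlonglongrightarrow> (\<integral>y. F' s0 y \<partial>M)"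
    using int' by (simp add: Y_def o_def)
  then show "((\<lambda>h. ((\<integral>y. F (s0 + h) y \<partial>M) - (\<integral>y. F s0 y \<partial>M)) / h) \<circ> X) \<longlonglongrightarrow> (\<integral>y. F' s0 y \<partial>M)"
    by (rule LIMSEQ_offset)
qed

lemma conv_pd:
  assumes k: "integrable lborel k" and fg: "has_pd f b g" and f: "cper f" and g: "cper g"
  shows "has_pd (conv k f) b (conv k g)"
  unfolding has_pd_def
proof
  fix z
  obtain M where M: "\<And>x. norm (g x) \<le> M"
    using cper_bounded[OF g] by metis
  have "((\<lambda>s. \<integral>y. k y * f (z + s *\<^sub>R b + y) \<partial>lborel) has_real_derivative (\<integral>y. k y * g (z + 0 *\<^sub>R b + y) \<partial>lborel)) (at 0)"
  proof (rule DERIV_integral_param[where e = 1 and G = "\<lambda>y. \<bar>k y\<bar> * M"])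
    fix s :: real and y :: 'a
    have "((\<lambda>s. f ((z + y) + s *\<^sub>R b)) has_real_derivative g ((z + y) + s *\<^sub>R b)) (at s)"
      by (rule has_pd_at[OF fg])
    then have "((\<lambda>s. f (z + s *\<^sub>R b + y)) has_real_derivative g (z + s *\<^sub>R b + y)) (at s)"
      by (simp add: add_ac)
    then show "((\<lambda>s. k y * f (z + s *\<^sub>R b + y)) has_real_derivative k y * g (z + s *\<^sub>R b + y)) (at s)"
      by (rule DERIV_cmult)
    show "\<bar>k y * g (z + s *\<^sub>R b + y)\<bar> \<le> \<bar>k y\<bar> * M"
      using M by (auto simp: abs_mult intro: mult_left_mono)
  next
    show "(\<lambda>y. k y * g (z + 0 *\<^sub>R b + y)) \<in> borel_measurable lborel"
      using conv_integrable[OF k g, of z] by auto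
  qed (use conv_integrable[OF k f] k in auto)
  then show "((\<lambda>s. conv k f (z + s *\<^sub>R b)) has_real_derivative conv k g z) (at 0)"
    by (simp add: conv_def)
qed

lemma integrable_lborel_prod:
  fixes g :: "'a::euclidean_space \<Rightarrow> real" and k :: "'b::euclidean_space \<Rightarrow> real"
  assumes g: "integrable lborel g" and k: "integrable lborel k"
  shows "integrable (lborel \<Otimes>\<^sub>M lborel) (\<lambda>(x, y). g x * k y)"
proof (rule lborel_pair.Fubini_integrable)
  have [measurable]: "g \<in> borel_measurable borel" "k \<in> borel_measurable borel"
    using g k by auto
  show "(\<lambda>(x, y). g x * k y) \<in> borel_measurable (lborel \<Otimes>\<^sub>M lborel)"
    by measurable
  show "integrable lborel (\<lambda>x. \<integral>y. norm (case (x, y) of (x, y) \<Rightarrow> g x * k y) \<partial>lborel)"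
    using g by (simp add: abs_mult)
  show "AE x in lborel. integrable lborel (\<lambda>y. case (x, y) of (x, y) \<Rightarrow> g x * k y)"
    using k by simp
qed

text \<open>Fubini, together with the invariance of the mean under translation by
  \<open>y\<close>.\<close>

lemma conv_avg:
  assumes k: "integrable lborel k" and f: "cper f"
  shows "avg (conv k f) = (\<integral>y. k y \<partial>lborel) * avg f"
proof -
  obtain M where M: "\<And>x. norm (f x) \<le> M"
    using cper_bounded[OF f] by metis
  have [measurable]: "k \<in> borel_measurable borel" "f \<in> borel_measurable borel"
    using k cper_measurable[OF f] by auto
  have ind: "integrable lborel (indicator cell :: 'a \<Rightarrow> real)"
    by (rule integrable_real_indicator) (auto simp: emeasure_lborel_cbox_eq)
  have int: "integrable (lborel \<Otimes>\<^sub>M lborel) (\<lambda>(z, y). indicator cell z * k y * f (z + y))"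
  proof (rule Bochner_Integration.integrable_bound)
    show "integrable (lborel \<Otimes>\<^sub>M lborel) (\<lambda>(z, y). indicator cell z * (M * k y))"
      using k by (intro integrable_lborel_prod ind) auto
    show "(\<lambda>(z, y). indicator cell z * k y * f (z + y)) \<in> borel_measurable (lborel \<Otimes>\<^sub>M lborel)"
      by measurable
    show "AE x in lborel \<Otimes>\<^sub>M lborel. norm (case x of (z, y) \<Rightarrow> indicator cell z * k y * f (z + y))
          \<le> norm (case x of (z, y) \<Rightarrow> indicator cell z * (M * k y))"
    proof (intro AE_I2, clarsimp simp: abs_mult)
      fix z y
      have "\<bar>f (z + y)\<bar> \<le> \<bar>M\<bar>" using M[of "z + y"] by simp
      then show "indicator cell z * \<bar>k y\<bar> * \<bar>f (z + y)\<bar> \<le> indicator cell z * (\<bar>M\<bar> * \<bar>k y\<bar>)"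
        by (simp add: mult.assoc mult.commute[of "\<bar>M\<bar>"] mult_left_mono)
    qed
  qed
  have "avg (conv k f) = (\<integral>z. (\<integral>y. indicator cell z * k y * f (z + y) \<partial>lborel) \<partial>lborel)"
    by (simp add: avg_eq_lborel[OF conv_cper[OF k f]] conv_def mult.assoc)
  also have "\<dots> = (\<integral>y. (\<integral>z. indicator cell z * k y * f (z + y) \<partial>lborel) \<partial>lborel)"
    by (rule lborel_pair.Fubini_integral[OF int, symmetric])
  also have "\<dots> = (\<integral>y. k y * avg (\<lambda>z. f (z + y)) \<partial>lborel)"
    by (intro Bochner_Integration.integral_cong refl, subst avg_eq_lborel)
      (auto intro: cper_shift f simp: mult_ac integral_mult_right_zero[symmetric] simp del: integral_mult_right_zero)
  also have "\<dots> = (\<integral>y. k y \<partial>lborel) * avg f"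
    by (simp add: avg_shift[OF f])
  finally show ?thesis .
qed

lemma integral_cbox_unit:
  fixes f :: "'a::euclidean_space \<Rightarrow> real"
  assumes f: "cper f"
  shows "(\<integral>y. indicator (cbox p (p + One)) y * f (z + y) \<partial>lborel) = avg f"
proof -
  have [measurable]: "f \<in> borel_measurable borel"
    using cper_measurable[OF f] by auto
  have "(\<integral>y. indicator (cbox p (p + One)) y * f (z + y) \<partial>lborel)
      = (\<integral>y. indicator (cbox p (p + One)) (p + y) * f (z + (p + y)) \<partial>lborel)"
    by (rule lborel_integral_shift[symmetric]) measurable
  also have "\<dots> = (\<integral>y. indicator cell y * f (y + (z + p)) \<partial>lborel)"
    by (intro Bochner_Integration.integral_cong refl arg_cong2[where f = "(*)"])
      (auto simp: indicator_def mem_box inner_add_left algebra_simps)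
  also have "\<dots> = avg (\<lambda>y. f (y + (z + p)))"
    by (rule avg_eq_lborel[symmetric]) (rule cper_shift[OF f])
  also have "\<dots> = avg f" by (rule avg_shift[OF f])
  finally show ?thesis .
qed

text \<open>A unit box, wherever it lies, carries exactly one period of \<open>f\<close>; a kernel
  that is at least \<open>d\<close> there collects at least \<open>d\<close> times the mean.\<close>

lemma conv_lower:
  assumes k: "integrable lborel k" and f: "cper f" and f0: "\<And>x. 0 \<le> f x"
    and k0: "\<And>y. 0 \<le> k y" and d: "\<And>y. y \<in> cbox p (p + One) \<Longrightarrow> d \<le> k y"
  shows "d * avg f \<le> conv k f z"
proof -
  have ind: "integrable lborel (\<lambda>y. indicator (cbox p (p + One)) y :: real)"
    by (rule integrable_real_indicator) (auto simp: emeasure_lborel_cbox_eq)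
  have "d * avg f = (\<integral>y. d * (indicator (cbox p (p + One)) y * f (z + y)) \<partial>lborel)"
    by (simp add: integral_cbox_unit[OF f])
  also have "\<dots> \<le> conv k f z"
    unfolding conv_def
  proof (rule integral_mono)
    show "integrable lborel (\<lambda>y. d * (indicator (cbox p (p + One)) y * f (z + y)))"
      using conv_integrable[OF ind f] by simp
    show "d * (indicator (cbox p (p + One)) y * f (z + y)) \<le> k y * f (z + y)" for y
      using f0[of "z + y"] k0[of y] d[of y] by (auto simp: indicator_def intro: mult_right_mono)
  qed (rule conv_integrable[OF k f])
  finally show ?thesis .
qed

text \<open>For fixed \<open>y\<close> the indicator of \<open>y - s \<in> cell\<close> has integral
  1 over \<open>s\<close>. Inserting this factor, replacing \<open>k y\<close> by \<open>g s\<close>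
  and exchanging the integrals leaves an integral of \<open>f\<close> over one unit box, that is,
  the mean. The integral over \<open>s\<close> takes the place of a sum over lattice
  translates.\<close>

lemma conv_upper:
  fixes k g f :: "'a::euclidean_space \<Rightarrow> real"
  assumes k: "integrable lborel k" and g: "integrable lborel g" and f: "cper f" and f0: "\<And>x. 0 \<le> f x"
    and k0: "\<And>y. 0 \<le> k y" and g0: "\<And>y. 0 \<le> g y"
    and kg: "\<And>y s. y - s \<in> cell \<Longrightarrow> k y \<le> g s"
  shows "conv k f z \<le> (\<integral>s. g s \<partial>lborel) * avg f"
proof -
  have [measurable]: "k \<in> borel_measurable borel" "f \<in> borel_measurable borel" "g \<in> borel_measurable borel"
    using k g cper_measurable[OF f] by auto
  have cell: "(\<integral>\<^sup>+s. ennreal (indicator cell (y - s)) \<partial>lborel) = 1" for y :: 'a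
  proof -
    have "(\<integral>\<^sup>+s. ennreal (indicator cell (y - s)) \<partial>lborel) = (\<integral>\<^sup>+s. indicator (cbox (y - One) y) s \<partial>lborel)"
      by (intro nn_integral_cong) (auto simp: indicator_def mem_box algebra_simps)
    then show ?thesis by (simp add: emeasure_lborel_cbox_eq inner_diff_left)
  qed
  have ind: "integrable lborel (\<lambda>y. indicator (cbox s (s + One)) y :: real)" for s :: 'a
    by (rule integrable_real_indicator) (auto simp: emeasure_lborel_cbox_eq)
  have inner: "(\<integral>\<^sup>+y. ennreal (f (z + y) * indicator cell (y - s)) \<partial>lborel) = ennreal (avg f)" for s
  proof -
    have "(\<integral>\<^sup>+y. ennreal (f (z + y) * indicator cell (y - s)) \<partial>lborel)
        = (\<integral>\<^sup>+y. ennreal (indicator (cbox s (s + One)) y * f (z + y)) \<partial>lborel)"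
      by (intro nn_integral_cong) (auto simp: indicator_def mem_box algebra_simps)
    also have "\<dots> = ennreal (\<integral>y. indicator (cbox s (s + One)) y * f (z + y) \<partial>lborel)"
      by (rule nn_integral_eq_integral) (use conv_integrable[OF ind f] f0 in auto)
    finally show ?thesis by (simp add: integral_cbox_unit[OF f])
  qed
  have "ennreal (conv k f z) = (\<integral>\<^sup>+y. ennreal (k y * f (z + y)) \<partial>lborel)"
    unfolding conv_def
    by (rule nn_integral_eq_integral[symmetric]) (use conv_integrable[OF k f] f0 k0 in auto)
  also have "\<dots> = (\<integral>\<^sup>+y. ennreal (k y * f (z + y)) * (\<integral>\<^sup>+s. ennreal (indicator cell (y - s)) \<partial>lborel) \<partial>lborel)"
    by (simp add: cell)
  also have "\<dots> = (\<integral>\<^sup>+y. (\<integral>\<^sup>+s. ennreal (k y * f (z + y)) * ennreal (indicator cell (y - s)) \<partial>lborel) \<partial>lborel)"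
    by (intro nn_integral_cong nn_integral_cmult[symmetric]) measurable
  also have "\<dots> \<le> (\<integral>\<^sup>+y. (\<integral>\<^sup>+s. ennreal (g s) * ennreal (f (z + y) * indicator cell (y - s)) \<partial>lborel) \<partial>lborel)"
    by (intro nn_integral_mono)
      (use kg f0 k0 g0 in \<open>auto simp: indicator_def ennreal_mult[symmetric] intro!: ennreal_leI mult_right_mono\<close>)
  also have "\<dots> = (\<integral>\<^sup>+s. (\<integral>\<^sup>+y. ennreal (g s) * ennreal (f (z + y) * indicator cell (y - s)) \<partial>lborel) \<partial>lborel)"
    by (rule lborel_pair.Fubini') measurable
  also have "\<dots> = (\<integral>\<^sup>+s. ennreal (g s) * ennreal (avg f) \<partial>lborel)"
    by (subst nn_integral_cmult) (auto simp: inner)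
  also have "\<dots> = (\<integral>\<^sup>+s. ennreal (g s) \<partial>lborel) * ennreal (avg f)"
    by (rule nn_integral_multc) measurable
  also have "(\<integral>\<^sup>+s. ennreal (g s) \<partial>lborel) = ennreal (\<integral>s. g s \<partial>lborel)"
    by (rule nn_integral_eq_integral) (use g g0 in auto)
  finally show ?thesis
    using avg_nonneg[OF f f0] g0 by (simp add: ennreal_mult[symmetric] integral_nonneg ennreal_le_iff)
qed

text \<open>Scheffe's argument: dominated convergence applied to the minimum of a kernel and its translate.\<close>

lemma translation_L1:
  fixes k :: "'a::euclidean_space \<Rightarrow> real"
  assumes k: "integrable lborel k" and k0: "\<And>y. 0 \<le> k y" and c: "AE y in lborel. isCont k y"
    and X: "X \<longlonglongrightarrow> 0"
  shows "(\<lambda>n. \<integral>y. \<bar>k (y - X n) - k y\<bar> \<partial>lborel) \<longlonglongrightarrow> 0"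
proof -
  have [measurable]: "k \<in> borel_measurable borel"
    using k by auto
  have int: "integrable lborel (\<lambda>y. k (y - h))" for h
    using lborel_integrable_shift[OF k, of "- h"] by simp
  have inteq: "(\<integral>y. k (y - h) \<partial>lborel) = (\<integral>y. k y \<partial>lborel)" for h
    using lborel_integral_shift[of k "- h"] by simp
  have minint: "integrable lborel (\<lambda>y. min (k (y - h)) (k y))" for h
    using int k by (rule integrable_min)
  have "(\<lambda>n. \<integral>y. min (k (y - X n)) (k y) \<partial>lborel) \<longlonglongrightarrow> (\<integral>y. k y \<partial>lborel)"
  proof (rule integral_dominated_convergence)
    show "AE y in lborel. (\<lambda>n. min (k (y - X n)) (k y)) \<longlonglongrightarrow> k y"
      using c
    proof eventually_elim
      case (elim y)
      have "(\<lambda>n. k (y - X n)) \<longlonglongrightarrow> k y"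
        using tendsto_diff[OF tendsto_const X, of y] by (intro isCont_tendsto_compose[OF elim]) simp
      from tendsto_min[OF this tendsto_const[of "k y"]] show ?case by simp
    qed
    show "AE y in lborel. norm (min (k (y - X n)) (k y)) \<le> k y" for n
      using k0 by (intro AE_I2) (auto simp: min_def)
  qed (use k in measurable)
  from tendsto_diff[OF tendsto_const[of "2 * (\<integral>y. k y \<partial>lborel)"] tendsto_mult[OF tendsto_const[of 2] this]]
  have "(\<lambda>n. 2 * (\<integral>y. k y \<partial>lborel) - 2 * (\<integral>y. min (k (y - X n)) (k y) \<partial>lborel)) \<longlonglongrightarrow> 0"
    by simp
  moreover have "(\<integral>y. \<bar>k (y - h) - k y\<bar> \<partial>lborel) = 2 * (\<integral>y. k y \<partial>lborel) - 2 * (\<integral>y. min (k (y - h)) (k y) \<partial>lborel)" for h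
  proof -
    have "\<bar>k (y - h) - k y\<bar> = k (y - h) + k y - 2 * min (k (y - h)) (k y)" for y
      by (auto simp: min_def)
    then show ?thesis
      using int[of h] k minint[of h] inteq[of h] by simp
  qed
  ultimately show ?thesis by simp
qed

text \<open>The modulus stems from the distance in mean between \<open>k\<close> and its translate,
  so \<open>d\<close> depends on \<open>f\<close> through the bound \<open>M\<close> alone. This
  uniformity is the source of all compactness.\<close>

lemma conv_equicontinuous:
  fixes k :: "'a::euclidean_space \<Rightarrow> real" and e M :: real
  assumes k: "integrable lborel k" and k0: "\<And>y. 0 \<le> k y" and c: "AE y in lborel. isCont k y"
    and e: "e > 0"
  obtains d where "d > 0"
    "\<And>(f::'a \<Rightarrow> real) z h. cper f \<Longrightarrow> (\<And>x. \<bar>f x\<bar> \<le> M) \<Longrightarrow> norm h < d \<Longrightarrow> \<bar>conv k f (z + h) - conv k f z\<bar> \<le> e"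
proof -
  have [measurable]: "k \<in> borel_measurable borel"
    using k by auto
  have int: "integrable lborel (\<lambda>y. k (y - h))" for h
    using lborel_integrable_shift[OF k, of "- h"] by simp
  define J where "J h = (\<integral>y. \<bar>k (y - h) - k y\<bar> \<partial>lborel)" for h
  have "(J \<longlongrightarrow> 0) (at 0)"
    unfolding tendsto_at_iff_sequentially
    using translation_L1[OF k k0 c] by (auto simp: J_def o_def)
  moreover have "e / (\<bar>M\<bar> + 1) > 0" using e by simp
  ultimately have "\<forall>\<^sub>F h in at 0. dist (J h) 0 < e / (\<bar>M\<bar> + 1)"
    by (rule tendstoD)
  then obtain d where d: "d > 0" "\<And>h. h \<noteq> 0 \<Longrightarrow> norm h < d \<Longrightarrow> J h < e / (\<bar>M\<bar> + 1)"
    unfolding eventually_at by (auto simp: J_def)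
  show thesis
  proof (rule that[OF d(1)])
    fix f :: "'a \<Rightarrow> real" and z h :: 'a assume f: "cper f" and M: "\<And>x. \<bar>f x\<bar> \<le> M" and h: "norm h < d"
    have [measurable]: "f \<in> borel_measurable borel"
      using cper_measurable[OF f] by auto
    have M0: "0 \<le> M" using M[of 0] by linarith
    have J: "J h \<le> e / (\<bar>M\<bar> + 1)"
      using d(2)[of h] h e by (cases "h = 0") (auto simp: J_def)
    have kint: "integrable lborel (\<lambda>y. k (y - h) - k y)"
      using int k by simp
    have "conv k f (z + h) - conv k f z = (\<integral>y. k (y - h) * f (z + y) \<partial>lborel) - (\<integral>y. k y * f (z + y) \<partial>lborel)"
      unfolding conv_translate[OF k f] by (simp add: conv_def)
    also have "\<dots> = conv (\<lambda>y. k (y - h) - k y) f z"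
      using conv_integrable[OF int f] conv_integrable[OF k f] by (simp add: conv_def left_diff_distrib)
    finally have "\<bar>conv k f (z + h) - conv k f z\<bar> \<le> J h * M"
      using conv_bound[OF kint f M, of z] by (simp add: J_def)
    also have "\<dots> \<le> e / (\<bar>M\<bar> + 1) * (\<bar>M\<bar> + 1)"
      using J M0 e by (intro mult_mono) auto
    also have "\<dots> = e" using M0 by simp
    finally show "\<bar>conv k f (z + h) - conv k f z\<bar> \<le> e" .
  qed
qed

text \<open>The minus sign arises because moving the result forward moves the kernel backward.
  Differentiating under the integral would call for a majorant of \<open>k'\<close> uniform over
  small translates, which the heat kernel does not admit near time 0. Instead the fundamental
  theorem along \<open>b\<close> and Fubini give an integrated identity, and this identity is
  differentiated.\<close>

lemma conv_kernel_pd: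
  fixes k k' :: "'a::euclidean_space \<Rightarrow> real"
  assumes k: "integrable lborel k" and k': "integrable lborel k'" and f: "cper f"
    and der: "\<And>y s. ((\<lambda>s. k (y + s *\<^sub>R b)) has_real_derivative k' (y + s *\<^sub>R b)) (at s)"
    and cont: "\<And>y. continuous_on UNIV (\<lambda>s. k' (y + s *\<^sub>R b))"
  shows "has_pd (conv k f) b (\<lambda>z. - conv k' f z)"
proof -
  obtain M where M: "\<And>x. norm (f x) \<le> M"
    using cper_bounded[OF f] by metis
  have [measurable]: "k \<in> borel_measurable borel" "k' \<in> borel_measurable borel" "f \<in> borel_measurable borel"
    using k k' cper_measurable[OF f] by auto
  define D where "D = conv k' f"
  have D: "cper D" unfolding D_def by (rule conv_cper[OF k' f])
  have int': "integrable lborel (\<lambda>y. k' (y - h))" for h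
    using lborel_integrable_shift[OF k', of "- h"] by simp
  have int: "integrable lborel (\<lambda>y. k (y - h))" for h
    using lborel_integrable_shift[OF k, of "- h"] by simp
  have key: "conv k f (z + h *\<^sub>R b) = conv k f z - integral {0..h} (\<lambda>s. D (z + s *\<^sub>R b))" if h: "0 \<le> h" for z h
  proof -
    have ftc: "k y - k (y - h *\<^sub>R b) = (\<integral>s. indicator {0..h} s * k' (y - s *\<^sub>R b) \<partial>lborel)" for y
    proof -
      have d: "((\<lambda>s. - k (y - s *\<^sub>R b)) has_real_derivative k' (y - s *\<^sub>R b)) (at s)" for s
      proof -
        have "((\<lambda>s. k (y + (- s) *\<^sub>R b)) has_real_derivative k' (y + (- s) *\<^sub>R b) * (- 1)) (at s)"
          by (rule DERIV_chain2[OF der]) (auto intro!: derivative_eq_intros)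
        from DERIV_minus[OF this] show ?thesis by simp
      qed
      have c: "continuous_on S (\<lambda>s. k' (y - s *\<^sub>R b))" for S
      proof -
        have "continuous_on S (\<lambda>s. k' (y + (- s) *\<^sub>R b))"
          by (rule continuous_on_compose2[OF cont[of y]]) (auto intro: continuous_intros)
        then show ?thesis by simp
      qed
      have "((\<lambda>s. k' (y - s *\<^sub>R b)) has_integral (- k (y - h *\<^sub>R b)) - (- k (y - 0 *\<^sub>R b))) {0..h}"
        by (rule fundamental_theorem_of_calculus[OF h])
          (use d in \<open>auto simp: has_real_derivative_iff_has_vector_derivative[symmetric] intro: has_field_derivative_at_within\<close>)
      moreover have "set_integrable lborel {0..h} (\<lambda>s. k' (y - s *\<^sub>R b))"
        by (rule borel_integrable_atLeastAtMost') (rule c)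
      from set_borel_integral_eq_integral(2)[OF this]
      have "(\<integral>s. indicator {0..h} s * k' (y - s *\<^sub>R b) \<partial>lborel) = integral {0..h} (\<lambda>s. k' (y - s *\<^sub>R b))"
        by (simp add: set_lebesgue_integral_def)
      ultimately show ?thesis by (simp add: integral_unique)
    qed
    have fub: "integrable (lborel \<Otimes>\<^sub>M lborel) (\<lambda>(s, y). indicator {0..h} s * (k' (y - s *\<^sub>R b) * f (z + y)))"
    proof (rule lborel_pair.Fubini_integrable)
      show m: "(\<lambda>(s, y). indicator {0..h} s * (k' (y - s *\<^sub>R b) * f (z + y))) \<in> borel_measurable (lborel \<Otimes>\<^sub>M lborel)"
        by measurable
      show "AE s in lborel. integrable lborel (\<lambda>y. case (s, y) of (s, y) \<Rightarrow> indicator {0..h} s * (k' (y - s *\<^sub>R b) * f (z + y)))"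
        using conv_integrable[OF int' f] by simp
      show "integrable lborel (\<lambda>s. \<integral>y. norm (case (s, y) of (s, y) \<Rightarrow> indicator {0..h} s * (k' (y - s *\<^sub>R b) * f (z + y))) \<partial>lborel)"
      proof (rule Bochner_Integration.integrable_bound)
        have "integrable lborel (indicator {0..h} :: real \<Rightarrow> real)"
          by (rule integrable_real_indicator) (auto simp: emeasure_lborel_Icc_eq)
        then show "integrable lborel (\<lambda>s. indicator {0..h} s * ((\<integral>y. \<bar>k' y\<bar> \<partial>lborel) * M))"
          by simp
        show "(\<lambda>s. \<integral>y. norm (case (s, y) of (s, y) \<Rightarrow> indicator {0..h} s * (k' (y - s *\<^sub>R b) * f (z + y))) \<partial>lborel) \<in> borel_measurable lborel"
          using m by measurable
        show "AE s in lborel. norm (\<integral>y. norm (case (s, y) of (s, y) \<Rightarrow> indicator {0..h} s * (k' (y - s *\<^sub>R b) * f (z + y))) \<partial>lborel)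
            \<le> norm (indicator {0..h} s * ((\<integral>y. \<bar>k' y\<bar> \<partial>lborel) * M))"
        proof (rule AE_I2)
          fix s
          have "(\<integral>y. \<bar>k' (y - s *\<^sub>R b) * f (z + y)\<bar> \<partial>lborel) \<le> (\<integral>y. \<bar>k' (y - s *\<^sub>R b)\<bar> * M \<partial>lborel)"
            by (rule integral_mono)
              (use integrable_abs[OF conv_integrable[OF int' f]] integrable_abs[OF int'] M in \<open>simp_all add: abs_mult mult_left_mono\<close>)
          also have "\<dots> = (\<integral>y. \<bar>k' y\<bar> \<partial>lborel) * M"
            using lborel_integral_shift[of "\<lambda>y. \<bar>k' y\<bar>" "- (s *\<^sub>R b)"] by simp
          finally have "(\<integral>y. \<bar>k' (y - s *\<^sub>R b) * f (z + y)\<bar> \<partial>lborel) \<le> (\<integral>y. \<bar>k' y\<bar> \<partial>lborel) * M" .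
          then show "norm (\<integral>y. norm (case (s, y) of (s, y) \<Rightarrow> indicator {0..h} s * (k' (y - s *\<^sub>R b) * f (z + y))) \<partial>lborel)
            \<le> norm (indicator {0..h} s * ((\<integral>y. \<bar>k' y\<bar> \<partial>lborel) * M))"
            by (auto simp: indicator_def intro: order_trans[OF _ abs_ge_self])
        qed
      qed
    qed
    have "conv k f z - conv k f (z + h *\<^sub>R b) = (\<integral>y. (k y - k (y - h *\<^sub>R b)) * f (z + y) \<partial>lborel)"
      unfolding conv_translate[OF k f] using conv_integrable[OF int f] conv_integrable[OF k f]
      by (simp add: conv_def left_diff_distrib)
    also have "\<dots> = (\<integral>y. (\<integral>s. indicator {0..h} s * (k' (y - s *\<^sub>R b) * f (z + y)) \<partial>lborel) \<partial>lborel)"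
      by (simp add: ftc mult.assoc[symmetric])
    also have "\<dots> = (\<integral>s. (\<integral>y. indicator {0..h} s * (k' (y - s *\<^sub>R b) * f (z + y)) \<partial>lborel) \<partial>lborel)"
      by (rule lborel_pair.Fubini_integral[OF fub])
    also have "\<dots> = (\<integral>s. indicator {0..h} s * D (z + s *\<^sub>R b) \<partial>lborel)"
      by (simp add: D_def conv_translate[OF k' f])
    also have "\<dots> = integral {0..h} (\<lambda>s. D (z + s *\<^sub>R b))"
    proof -
      have "set_integrable lborel {0..h} (\<lambda>s. D (z + s *\<^sub>R b))"
        by (rule borel_integrable_atLeastAtMost')
          (intro continuous_on_compose2[OF cperD(1)[OF D]] continuous_intros, auto)
      from set_borel_integral_eq_integral(2)[OF this] show ?thesis
        by (simp add: set_lebesgue_integral_def)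
    qed
    finally show ?thesis by simp
  qed
  show ?thesis
    unfolding has_pd_def
  proof
    fix z
    have cD: "continuous_on S (\<lambda>s. D (z - b + s *\<^sub>R b))" for S
      by (intro continuous_on_compose2[OF cperD(1)[OF D]] continuous_intros) auto
    \<comment> \<open>The point \<open>z\<close> is reached from \<open>z - b\<close> at parameter
      1, interior to \<open>{0..2}\<close>; an identity known for forward steps then gives a
      two-sided derivative.\<close>
    have "((\<lambda>s. integral {0..s} (\<lambda>s. D (z - b + s *\<^sub>R b))) has_real_derivative D (z - b + 1 *\<^sub>R b)) (at 1 within {0..2})"
      by (rule integral_has_real_derivative[OF cD]) auto
    then have "((\<lambda>s. integral {0..s} (\<lambda>s. D (z - b + s *\<^sub>R b))) has_real_derivative D z) (at 1)"
      by (simp add: at_within_Icc_at)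
    then have "((\<lambda>s. conv k f (z - b) - integral {0..s} (\<lambda>s. D (z - b + s *\<^sub>R b))) has_real_derivative (0 - D z)) (at 1)"
      by (intro derivative_intros)
    moreover have "\<forall>\<^sub>F s in nhds 1. conv k f (z - b) - integral {0..s} (\<lambda>s. D (z - b + s *\<^sub>R b)) = conv k f (z - b + s *\<^sub>R b)"
    proof -
      have "\<forall>\<^sub>F s in nhds (1::real). s > 0"
        by (rule order_tendstoD(1)[OF filterlim_ident]) auto
      then show ?thesis
        by eventually_elim (simp add: key)
    qed
    ultimately have "((\<lambda>s. conv k f (z - b + s *\<^sub>R b)) has_real_derivative - D z) (at 1)"
      by (subst DERIV_cong_ev[OF refl _ refl, symmetric]) (auto intro: eventually_mono)
    then have "((\<lambda>s. conv k f (z - b + (s + 1) *\<^sub>R b)) has_real_derivative - D z) (at 0)"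
      using DERIV_shift[of "\<lambda>s. conv k f (z - b + s *\<^sub>R b)" "- D z" 0 1] by simp
    then show "((\<lambda>s. conv k f (z + s *\<^sub>R b)) has_real_derivative - conv k' f z) (at 0)"
      by (simp add: D_def algebra_simps)
  qed
qed

section \<open>The space-time heat kernel\<close>

lemma integrable_lborel_indicatorI:
  fixes f :: "'a::euclidean_space \<Rightarrow> real"
  assumes "f \<in> borel_measurable borel" "S \<in> sets borel" "\<And>x. x \<in> S \<Longrightarrow> 0 \<le> f x" "(f has_integral I) S"
  shows "has_bochner_integral lborel (\<lambda>x. indicator S x * f x) I"
proof -
  have [measurable]: "f \<in> borel_measurable borel" "S \<in> sets borel" using assms by auto
  have "((\<lambda>x. if x \<in> S then f x else 0) has_integral I) UNIV"
    using assms(4) by (simp add: has_integral_restrict_UNIV)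
  then have I: "((\<lambda>x. indicator S x * f x) has_integral I) UNIV"
    by (rule has_integral_eq[rotated]) (auto simp: indicator_def)
  have I0: "0 \<le> I"
    by (rule has_integral_nonneg[OF assms(4)]) (use assms(3) in auto)
  have "(\<integral>\<^sup>+x. ennreal (indicator S x * f x) \<partial>lborel) = ennreal I"
    by (rule nn_integral_has_integral_lborel[OF _ _ I]) (use assms(3) in \<open>auto simp: indicator_def\<close>)
  then show ?thesis
    by (intro has_bochner_integral_nn_integral) (use assms(3) I0 in \<open>auto simp: indicator_def\<close>)
qed

lemma has_bochner_integral_exp_minus:
  fixes a :: real
  assumes "a > 0"
  shows "has_bochner_integral lborel (\<lambda>r. indicator {0..} r * exp (- a * r)) (1 / a)"
  using has_integral_exp_minus_to_infinity[OF assms, of 0]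
  by (intro integrable_lborel_indicatorI) auto

lemma integrable_exp_minus_abs:
  fixes a :: real
  assumes "a > 0"
  shows "integrable lborel (\<lambda>x. exp (- a * \<bar>x\<bar>))"
proof (rule Bochner_Integration.integrable_bound)
  let ?h = "\<lambda>r::real. indicator {0..} r * exp (- a * r)"
  have h: "integrable lborel ?h"
    using has_bochner_integral_exp_minus[OF assms] by (simp add: has_bochner_integral_iff)
  have h': "integrable lborel (\<lambda>x. ?h (0 + (-1) * x))"
    using h by (subst lborel_integrable_real_affine_iff) auto
  show "integrable lborel (\<lambda>x. ?h x + ?h (0 + (-1) * x))"
    using h h' by (rule Bochner_Integration.integrable_add)
  show "AE x in lborel. norm (exp (- a * \<bar>x\<bar>)) \<le> norm (?h x + ?h (0 + (-1) * x))"
    by (intro AE_I2) (auto simp: indicator_def)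
qed measurable

lemma integrable_prod_Basis:
  fixes f :: "real \<Rightarrow> real"
  assumes f: "integrable lborel f" and f0: "\<And>x. 0 \<le> f x"
  shows "has_bochner_integral lborel (\<lambda>x::'a::euclidean_space. \<Prod>b\<in>Basis. f (x \<bullet> b)) ((\<integral>x. f x \<partial>lborel) ^ DIM('a))"
proof -
  have [measurable]: "f \<in> borel_measurable borel" using f by auto
  have "(\<integral>\<^sup>+x. ennreal (\<Prod>b\<in>Basis. f ((x::'a) \<bullet> b)) \<partial>lborel) = (\<integral>\<^sup>+x. (\<Prod>b\<in>Basis. ennreal (f ((x::'a) \<bullet> b))) \<partial>lborel)"
    by (simp add: prod_ennreal f0)
  also have "\<dots> = (\<Prod>b\<in>(Basis::'a set). (\<integral>\<^sup>+x. ennreal (f x) \<partial>lborel))"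
    by (rule nn_integral_lborel_prod) auto
  also have "(\<integral>\<^sup>+x. ennreal (f x) \<partial>lborel) = ennreal (\<integral>x. f x \<partial>lborel)"
    by (rule nn_integral_eq_integral) (use f f0 in auto)
  also have "(\<Prod>b\<in>(Basis::'a set). ennreal (\<integral>x. f x \<partial>lborel)) = ennreal ((\<integral>x. f x \<partial>lborel) ^ DIM('a))"
    by (simp add: ennreal_power f0 integral_nonneg)
  finally show ?thesis
    by (intro has_bochner_integral_nn_integral) (auto simp: f0 prod_nonneg integral_nonneg)
qed

definition gauss :: "'x::euclidean_space \<Rightarrow> real" where
  "gauss \<zeta> = (1 / sqrt (2 * pi)) ^ DIM('x) * exp (- (\<zeta> \<bullet> \<zeta>) / 2)"

lemma gauss_pos: "0 < gauss \<zeta>"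
  by (simp add: gauss_def)

lemma gauss_nonneg [simp]: "0 \<le> gauss \<zeta>"
  using gauss_pos less_imp_le by blast

lemma gauss_continuous: "continuous_on S gauss"
  unfolding gauss_def by (intro continuous_intros) auto

lemma gauss_measurable [measurable]: "gauss \<in> borel_measurable borel"
  by (intro borel_measurable_continuous_onI gauss_continuous)

lemma gauss_le: "gauss (\<zeta>::'x::euclidean_space) \<le> exp (- (\<zeta> \<bullet> \<zeta>) / 2)"
proof -
  have "1 / sqrt (2 * pi) \<le> 1"
    using pi_ge_two by (simp add: real_le_rsqrt)
  then have "(1 / sqrt (2 * pi)) ^ DIM('x) \<le> 1"
    by (intro power_le_one) auto
  then show ?thesis unfolding gauss_def by (simp add: mult_left_le_one_le)
qed

lemma has_bochner_integral_gauss: "has_bochner_integral lborel (gauss :: 'x::euclidean_space \<Rightarrow> real) 1"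
proof -
  have "gauss = (\<lambda>\<zeta>::'x. \<Prod>b\<in>Basis. std_normal_density (\<zeta> \<bullet> b))"
  proof
    fix \<zeta> :: 'x
    have "(\<Prod>b\<in>Basis. std_normal_density (\<zeta> \<bullet> b)) = (1 / sqrt (2 * pi)) ^ DIM('x) * exp (\<Sum>b\<in>Basis. - (\<zeta> \<bullet> b)\<^sup>2 / 2)"
      by (simp add: std_normal_density_def prod.distrib exp_sum prod_constant prod_dividef power_one_over)
    also have "(\<Sum>b\<in>Basis. - (\<zeta> \<bullet> b)\<^sup>2 / 2) = - (\<zeta> \<bullet> \<zeta>) / 2"
      by (subst (2) euclidean_inner) (simp add: sum_negf sum_divide_distrib power2_eq_square)
    finally show "gauss \<zeta> = (\<Prod>b\<in>Basis. std_normal_density (\<zeta> \<bullet> b))"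
      by (simp add: gauss_def)
  qed
  moreover have "has_bochner_integral lborel (\<lambda>\<zeta>::'x. \<Prod>b\<in>Basis. std_normal_density (\<zeta> \<bullet> b)) ((\<integral>x. std_normal_density x \<partial>lborel) ^ DIM('x))"
    by (rule integrable_prod_Basis) auto
  ultimately show ?thesis by simp
qed

lemma gauss_integrable: "integrable lborel gauss"
  by (rule integrable.intros[OF has_bochner_integral_gauss])

lemma gauss_integral: "(\<integral>\<zeta>. gauss \<zeta> \<partial>lborel) = 1"
  by (rule has_bochner_integral_integral_eq[OF has_bochner_integral_gauss])

lemma integrable_exp_square:
  assumes s: "s > 0"
  shows "integrable lborel (\<lambda>\<zeta>::'x::euclidean_space. exp (- s * (\<zeta> \<bullet> \<zeta>)))"
proof -
  \<comment> \<open>Chosen with \<open>2 * \<sigma>^2 = 1 / s\<close>, so that each one-dimensional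
    factor is a multiple of a centred normal density.\<close>
  define \<sigma> where "\<sigma> = 1 / sqrt (2 * s)"
  have \<sigma>: "\<sigma> > 0" "2 * \<sigma>\<^sup>2 = 1 / s"
    using s by (auto simp: \<sigma>_def power_divide)
  have eq: "(\<lambda>x. sqrt (2 * pi * \<sigma>\<^sup>2) * normal_density 0 \<sigma> x) = (\<lambda>x. exp (- s * x\<^sup>2))"
  proof
    fix x
    have "\<sigma> \<noteq> 0" using \<sigma> by simp
    then have "sqrt (2 * pi * \<sigma>\<^sup>2) * normal_density 0 \<sigma> x = exp (- (x\<^sup>2) / (2 * \<sigma>\<^sup>2))"
      by (simp add: normal_density_def)
    then show "sqrt (2 * pi * \<sigma>\<^sup>2) * normal_density 0 \<sigma> x = exp (- s * x\<^sup>2)"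
      unfolding \<sigma>(2) using s by (simp add: field_simps)
  qed
  have "integrable lborel (\<lambda>x. sqrt (2 * pi * \<sigma>\<^sup>2) * normal_density 0 \<sigma> x)"
    using integrable_normal_density[OF \<sigma>(1), of 0] by simp
  then have "integrable lborel (\<lambda>x. exp (- s * x\<^sup>2))"
    unfolding eq .
  from integrable_prod_Basis[OF this, where 'a = 'x]
  have "integrable lborel (\<lambda>\<zeta>::'x. \<Prod>b\<in>Basis. exp (- s * (\<zeta> \<bullet> b)\<^sup>2))"
    by (simp add: has_bochner_integral_iff)
  also have "(\<lambda>\<zeta>::'x. \<Prod>b\<in>Basis. exp (- s * (\<zeta> \<bullet> b)\<^sup>2)) = (\<lambda>\<zeta>. exp (- s * (\<zeta> \<bullet> \<zeta>)))"
  proof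
    fix \<zeta> :: 'x
    show "(\<Prod>b\<in>Basis. exp (- s * (\<zeta> \<bullet> b)\<^sup>2)) = exp (- s * (\<zeta> \<bullet> \<zeta>))"
      by (subst (2) euclidean_inner) (simp add: exp_sum[symmetric] sum_negf sum_distrib_left power2_eq_square)
  qed
  finally show ?thesis .
qed

text \<open>Half of the Gaussian decay pays for the factor \<open>norm \<zeta>\<close>, by
  \<open>norm \<zeta> \<le> 1 + (\<zeta> \<bullet> \<zeta>) / 4\<close> and
  \<open>1 + x \<le> exp x\<close>.\<close>

lemma gauss_norm_le: "gauss \<zeta> * norm \<zeta> \<le> exp (- (1/4) * (\<zeta> \<bullet> \<zeta>))"
proof -
  have "norm \<zeta> \<le> 1 + (\<zeta> \<bullet> \<zeta>) / 4"
    using zero_le_power2[of "1 - norm \<zeta> / 2"]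
    by (simp add: power2_eq_square algebra_simps dot_square_norm)
  also have "\<dots> \<le> exp ((\<zeta> \<bullet> \<zeta>) / 4)"
    by (rule exp_ge_add_one_self)
  finally have "gauss \<zeta> * norm \<zeta> \<le> exp (- (\<zeta> \<bullet> \<zeta>) / 2) * exp ((\<zeta> \<bullet> \<zeta>) / 4)"
    by (intro mult_mono gauss_le) auto
  also have "\<dots> = exp (- (1/4) * (\<zeta> \<bullet> \<zeta>))"
    by (simp add: exp_add[symmetric])
  finally show ?thesis .
qed

lemma gauss_norm_integrable: "integrable lborel (\<lambda>\<zeta>. gauss \<zeta> * norm \<zeta>)"
proof (rule Bochner_Integration.integrable_bound)
  show "integrable lborel (\<lambda>\<zeta>::'a. exp (- (1/4) * (\<zeta> \<bullet> \<zeta>)))"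
    by (rule integrable_exp_square) simp
  show "AE \<zeta> in lborel. norm (gauss \<zeta> * norm \<zeta>) \<le> norm (exp (- (1/4) * (\<zeta> \<bullet> (\<zeta>::'a))))"
    using gauss_norm_le by (intro AE_I2) (auto simp: abs_mult)
qed measurable

text \<open>Gaussian integration by parts: both sides are the derivative at 0 of
  the integral of the density against a translate of \<^term>\<open>\<psi>\<close>.\<close>

lemma gauss_stein:
  fixes \<psi> \<psi>' :: "'x::euclidean_space \<Rightarrow> real"
  assumes b: "b \<in> Basis" and d: "has_pd \<psi> b \<psi>'" and M: "\<And>x. \<bar>\<psi> x\<bar> \<le> M" "\<And>x. \<bar>\<psi>' x\<bar> \<le> M'"
    and [measurable]: "\<psi> \<in> borel_measurable borel" "\<psi>' \<in> borel_measurable borel"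
  shows "(\<integral>\<zeta>. gauss \<zeta> * (\<zeta> \<bullet> b) * \<psi> \<zeta> \<partial>lborel) = (\<integral>\<zeta>. gauss \<zeta> * \<psi>' \<zeta> \<partial>lborel)"
proof -
  let ?J = "\<lambda>s. \<integral>\<zeta>. gauss \<zeta> * \<psi> (\<zeta> + s *\<^sub>R b) \<partial>lborel"
  have int: "integrable lborel (\<lambda>\<zeta>. gauss \<zeta> * \<psi> (\<zeta> + h))" for h
    by (rule Bochner_Integration.integrable_bound[of _ "\<lambda>\<zeta>. gauss \<zeta> * M"])
      (use gauss_integrable M(1) in \<open>auto simp: abs_mult intro!: mult_mono order_trans[OF M(1) abs_ge_self]\<close>)
  have J: "?J s = (\<integral>\<zeta>. gauss (\<zeta> - s *\<^sub>R b) * \<psi> \<zeta> \<partial>lborel)" for s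
    using lborel_integral_shift[of "\<lambda>\<zeta>. gauss (\<zeta> - s *\<^sub>R b) * \<psi> \<zeta>" "s *\<^sub>R b"] by (simp add: add.commute)
  have 1: "(?J has_real_derivative (\<integral>\<zeta>. gauss \<zeta> * \<psi>' (\<zeta> + 0 *\<^sub>R b) \<partial>lborel)) (at 0)"
    by (rule DERIV_integral_param[where e = 1 and G = "\<lambda>\<zeta>. gauss \<zeta> * M'"])
      (use int gauss_integrable M(2) has_pd_at[OF d] in \<open>auto simp: abs_mult intro!: DERIV_cmult mult_left_mono\<close>)
  have gd: "((\<lambda>s. gauss (\<zeta> - s *\<^sub>R b)) has_real_derivative gauss (\<zeta> - s *\<^sub>R b) * ((\<zeta> - s *\<^sub>R b) \<bullet> b)) (at s)" for s and \<zeta> :: 'x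
  proof -
    have "((\<lambda>s. - ((\<zeta> - s *\<^sub>R b) \<bullet> (\<zeta> - s *\<^sub>R b)) / 2) has_real_derivative ((\<zeta> - s *\<^sub>R b) \<bullet> b)) (at s)"
      unfolding inner_diff_left inner_diff_right inner_scaleR_left inner_scaleR_right
      by (rule derivative_eq_intros refl | simp add: b inner_commute field_simps)+
    from DERIV_cmult[OF DERIV_chain2[OF DERIV_exp this], of "(1 / sqrt (2 * pi)) ^ DIM('x)"]
    show ?thesis by (simp add: gauss_def mult.assoc)
  qed
  \<comment> \<open>A majorant uniform over shifts of length below 1. With
    \<open>y = \<zeta> - s b\<close> one has \<open>\<zeta> \<bullet> \<zeta> \<le> 2 * (y \<bullet>
    y) + 2 * (s * s)\<close>, so a Gaussian in \<open>y\<close> is bounded by one in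
    \<open>\<zeta>\<close> with half the rate.\<close>
  have gb: "gauss (\<zeta> - s *\<^sub>R b) * \<bar>(\<zeta> - s *\<^sub>R b) \<bullet> b\<bar> \<le> exp (1/4) * exp (- (1/8) * (\<zeta> \<bullet> \<zeta>))" if "\<bar>s - 0\<bar> < 1" for s and \<zeta> :: 'x
  proof -
    let ?y = "\<zeta> - s *\<^sub>R b"
    have "gauss ?y * \<bar>?y \<bullet> b\<bar> \<le> gauss ?y * norm ?y"
      using Basis_le_norm[OF b] by (intro mult_left_mono) auto
    also have "\<dots> \<le> exp (- (1/4) * (?y \<bullet> ?y))"
      by (rule gauss_norm_le)
    also have "\<dots> \<le> exp (1/4 - (1/8) * (\<zeta> \<bullet> \<zeta>))"
    proof -
      have s2: "s * s \<le> 1"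
        using that by (metis abs_mult_self_eq abs_ge_zero diff_zero less_imp_le mult_le_one)
      have "0 \<le> (\<zeta> - (2 * s) *\<^sub>R b) \<bullet> (\<zeta> - (2 * s) *\<^sub>R b)" by simp
      then have "\<zeta> \<bullet> \<zeta> \<le> 2 * (?y \<bullet> ?y) + 2 * (s * s)"
        using b by (simp add: inner_diff_left inner_diff_right inner_commute)
      then show ?thesis using s2 by simp
    qed
    finally show ?thesis by (simp add: exp_diff exp_add[symmetric])
  qed
  have "((\<lambda>s. \<integral>\<zeta>. gauss (\<zeta> - s *\<^sub>R b) * \<psi> \<zeta> \<partial>lborel) has_real_derivative (\<integral>\<zeta>. gauss (\<zeta> - 0 *\<^sub>R b) * ((\<zeta> - 0 *\<^sub>R b) \<bullet> b) * \<psi> \<zeta> \<partial>lborel)) (at 0)"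
  proof (rule DERIV_integral_param[where e = 1 and G = "\<lambda>\<zeta>. exp (1/4) * exp (- (1/8) * (\<zeta> \<bullet> \<zeta>)) * \<bar>M\<bar>"])
    show "integrable lborel (\<lambda>\<zeta>. gauss (\<zeta> - s *\<^sub>R b) * \<psi> \<zeta>)" for s
      using lborel_integrable_shift[OF int[of "s *\<^sub>R b"], of "- (s *\<^sub>R b)"] by simp
    show "((\<lambda>s. gauss (\<zeta> - s *\<^sub>R b) * \<psi> \<zeta>) has_real_derivative gauss (\<zeta> - s *\<^sub>R b) * ((\<zeta> - s *\<^sub>R b) \<bullet> b) * \<psi> \<zeta>) (at s)" for s \<zeta>
      by (intro DERIV_cmult_right gd)
    show "\<bar>gauss (\<zeta> - s *\<^sub>R b) * ((\<zeta> - s *\<^sub>R b) \<bullet> b) * \<psi> \<zeta>\<bar> \<le> exp (1/4) * exp (- (1/8) * (\<zeta> \<bullet> \<zeta>)) * \<bar>M\<bar>" if "\<bar>s - 0\<bar> < 1" for s \<zeta>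
    proof -
      have "\<bar>\<psi> \<zeta>\<bar> \<le> \<bar>M\<bar>" using M(1)[of \<zeta>] by simp
      then have "gauss (\<zeta> - s *\<^sub>R b) * \<bar>(\<zeta> - s *\<^sub>R b) \<bullet> b\<bar> * \<bar>\<psi> \<zeta>\<bar> \<le> exp (1/4) * exp (- (1/8) * (\<zeta> \<bullet> \<zeta>)) * \<bar>M\<bar>"
        by (rule mult_mono[OF gb[OF that]]) auto
      then show ?thesis by (simp add: abs_mult)
    qed
    show "integrable lborel (\<lambda>\<zeta>::'x. exp (1/4) * exp (- (1/8) * (\<zeta> \<bullet> \<zeta>)) * \<bar>M\<bar>)"
      using integrable_exp_square[of "1/8", where 'x = 'x] by simp
  qed auto
  then have "(?J has_real_derivative (\<integral>\<zeta>. gauss \<zeta> * (\<zeta> \<bullet> b) * \<psi> \<zeta> \<partial>lborel)) (at 0)"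
    by (simp add: J)
  with 1 show ?thesis
    using DERIV_unique by fastforce
qed

text \<open>\<open>a\<close> is the diffusion constant, \<open>c\<close> the drift and
  \<open>\<mu>\<close> the resolvent parameter, whose damping makes the space-time kernel integrable
  with mass \<open>1 / \<mu>\<close>.\<close>

locale heat =
  fixes a \<mu> :: real and c :: "'x::euclidean_space"
  assumes a_pos: "a > 0" and \<mu>_pos: "\<mu> > 0"
begin

text \<open>For \<open>r > 0\<close> this is the density of
  \<open>r c + sqrt (2 a r) \<zeta>\<close> with \<open>\<zeta>\<close> standard normal: mean
  \<open>r c\<close>, variance \<open>2 a r\<close> in each coordinate.\<close>

definition hker :: "real \<Rightarrow> 'x \<Rightarrow> real" where
  "hker r y = (1 / sqrt (4 * pi * a * r)) ^ DIM('x) * exp (- ((y - r *\<^sub>R c) \<bullet> (y - r *\<^sub>R c)) / (4 * a * r))"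

definition K :: "real \<times> 'x \<Rightarrow> real" where
  "K z = (if fst z > 0 then exp (- \<mu> * fst z) * hker (fst z) (snd z) else 0)"

text \<open>The derivative of \<open>K\<close> along \<open>(0, b)\<close>. It is singular at time
  0, but its slices grow in mean only like the inverse square root of time.\<close>

definition K1 :: "'x \<Rightarrow> real \<times> 'x \<Rightarrow> real" where
  "K1 b z = (if fst z > 0 then - ((snd z - fst z *\<^sub>R c) \<bullet> b) / (2 * a * fst z) * K z else 0)"

lemma hker_nonneg: "r > 0 \<Longrightarrow> 0 \<le> hker r y"
  using a_pos by (simp add: hker_def)

lemma K_nonneg: "0 \<le> K z"
  by (simp add: K_def hker_nonneg)

lemma hker_measurable [measurable]: "(\<lambda>z. hker (fst z) (snd z)) \<in> borel_measurable borel"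
  unfolding hker_def by (simp add: borel_prod[symmetric]) measurable

lemma K_measurable [measurable]: "K \<in> borel_measurable borel"
proof -
  have [measurable]: "fst \<in> borel_measurable (borel :: (real \<times> 'x) measure)"
    by (simp add: borel_measurable_continuous_onI continuous_on_fst)
  show ?thesis unfolding K_def by measurable
qed

lemma K1_measurable [measurable]: "K1 b \<in> borel_measurable borel"
proof -
  have [measurable]: "fst \<in> borel_measurable (borel :: (real \<times> 'x) measure)"
    "(\<lambda>z. (snd z - fst z *\<^sub>R c) \<bullet> b) \<in> borel_measurable (borel :: (real \<times> 'x) measure)"
    by (auto intro!: borel_measurable_continuous_onI continuous_intros)
  show ?thesis unfolding K1_def by measurable
qed

lemma hker_gauss:
  assumes "r > 0"
  shows "sqrt (2 * a * r) ^ DIM('x) * hker r (r *\<^sub>R c + sqrt (2 * a * r) *\<^sub>R \<zeta>) = gauss \<zeta>"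
proof -
  define \<sigma> where "\<sigma> = sqrt (2 * a * r)"
  have \<sigma>: "\<sigma> > 0" "\<sigma> * \<sigma> = 2 * a * r"
    using assms a_pos by (auto simp: \<sigma>_def)
  have "sqrt (4 * pi * a * r) = sqrt (2 * pi) * \<sigma>"
    by (simp add: \<sigma>_def real_sqrt_mult[symmetric] algebra_simps)
  then have 1: "\<sigma> ^ DIM('x) * (1 / sqrt (4 * pi * a * r)) ^ DIM('x) = (1 / sqrt (2 * pi)) ^ DIM('x)"
    using \<sigma> by (simp add: power_mult_distrib[symmetric])
  have "- ((\<sigma> *\<^sub>R \<zeta>) \<bullet> (\<sigma> *\<^sub>R \<zeta>)) / (4 * a * r) = - (\<sigma> * \<sigma> * (\<zeta> \<bullet> \<zeta>)) / (2 * (2 * a * r))"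
    by simp
  also have "\<dots> = - (\<zeta> \<bullet> \<zeta>) / 2"
    using assms a_pos by (simp add: \<sigma>(2))
  finally show ?thesis
    unfolding hker_def gauss_def \<sigma>_def[symmetric] using 1 by (simp add: mult.assoc[symmetric])
qed

text \<open>The affine change of variables that turns each slice of the heat kernel into
  \<open>gauss\<close>; the power of \<open>sqrt (2 a r)\<close> is its Jacobian.\<close>

lemma lborel_scale:
  assumes "r > 0"
  shows "(lborel :: 'x measure) = density (distr lborel borel (\<lambda>\<zeta>. r *\<^sub>R c + sqrt (2 * a * r) *\<^sub>R \<zeta>)) (\<lambda>_. ennreal (sqrt (2 * a * r) ^ DIM('x)))"
proof -
  have "sqrt (2 * a * r) > 0" using assms a_pos by simp
  then show ?thesis
    using lborel_affine[of "sqrt (2 * a * r)" "r *\<^sub>R c"] by (metis abs_of_pos less_irrefl)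
qed

lemma hker_slice_nn:
  assumes r: "r > 0" and [measurable]: "F \<in> borel_measurable borel" and F: "\<And>y. 0 \<le> F y"
  shows "(\<integral>\<^sup>+y. ennreal (hker r y * F y) \<partial>lborel) = (\<integral>\<^sup>+\<zeta>. ennreal (gauss \<zeta> * F (r *\<^sub>R c + sqrt (2 * a * r) *\<^sub>R \<zeta>)) \<partial>lborel)"
proof -
  have [measurable]: "hker r \<in> borel_measurable borel"
    unfolding hker_def by measurable
  have s: "sqrt (2 * a * r) \<ge> 0" using r a_pos by simp
  have "(\<integral>\<^sup>+y. ennreal (hker r y * F y) \<partial>lborel)
      = (\<integral>\<^sup>+\<zeta>. ennreal (sqrt (2 * a * r) ^ DIM('x)) *
          ennreal (hker r (r *\<^sub>R c + sqrt (2 * a * r) *\<^sub>R \<zeta>) * F (r *\<^sub>R c + sqrt (2 * a * r) *\<^sub>R \<zeta>)) \<partial>lborel)"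
    by (subst lborel_scale[OF r]) (simp add: nn_integral_density nn_integral_distr)
  also have "\<dots> = (\<integral>\<^sup>+\<zeta>. ennreal (gauss \<zeta> * F (r *\<^sub>R c + sqrt (2 * a * r) *\<^sub>R \<zeta>)) \<partial>lborel)"
    using hker_gauss[OF r] hker_nonneg[OF r] F s
    by (intro nn_integral_cong) (simp add: ennreal_mult[symmetric] mult.assoc[symmetric])
  finally show ?thesis .
qed

lemma hker_slice:
  fixes F :: "'x \<Rightarrow> real"
  assumes r: "r > 0" and [measurable]: "F \<in> borel_measurable borel"
  shows "(\<integral>y. hker r y * F y \<partial>lborel) = (\<integral>\<zeta>. gauss \<zeta> * F (r *\<^sub>R c + sqrt (2 * a * r) *\<^sub>R \<zeta>) \<partial>lborel)"
proof -
  have [measurable]: "hker r \<in> borel_measurable borel"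
    unfolding hker_def by measurable
  have s: "sqrt (2 * a * r) \<ge> 0" using r a_pos by simp
  have "(\<integral>y. hker r y * F y \<partial>lborel)
      = (\<integral>\<zeta>. sqrt (2 * a * r) ^ DIM('x) *\<^sub>R
          (hker r (r *\<^sub>R c + sqrt (2 * a * r) *\<^sub>R \<zeta>) * F (r *\<^sub>R c + sqrt (2 * a * r) *\<^sub>R \<zeta>)) \<partial>lborel)"
    using zero_le_power[OF s] by (subst lborel_scale[OF r]) (subst integral_density, auto simp: integral_distr)
  also have "\<dots> = (\<integral>\<zeta>. gauss \<zeta> * F (r *\<^sub>R c + sqrt (2 * a * r) *\<^sub>R \<zeta>) \<partial>lborel)"
    using hker_gauss[OF r] by (intro Bochner_Integration.integral_cong) (simp_all add: mult.assoc[symmetric])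
  finally show ?thesis .
qed

text \<open>Fubini in time, then rescaling of each slice to the standard Gaussian. The mass of
  \<open>K\<close>, its initial layer and the gradient kernel are all computed from this
  form.\<close>

lemma K_nn:
  assumes [measurable]: "F \<in> borel_measurable borel" and F: "\<And>z. 0 \<le> F z"
  shows "(\<integral>\<^sup>+z. ennreal (K z * F z) \<partial>lborel)
    = (\<integral>\<^sup>+r. ennreal (indicator {0<..} r * exp (- \<mu> * r)) * (\<integral>\<^sup>+\<zeta>. ennreal (gauss \<zeta> * F (r, r *\<^sub>R c + sqrt (2 * a * r) *\<^sub>R \<zeta>)) \<partial>lborel) \<partial>lborel)"
proof -
  have [measurable]: "F \<in> borel_measurable (borel \<Otimes>\<^sub>M borel)" "K \<in> borel_measurable (borel \<Otimes>\<^sub>M borel)"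
    by (simp_all add: borel_prod)
  have "(\<integral>\<^sup>+z. ennreal (K z * F z) \<partial>lborel) = (\<integral>\<^sup>+r. (\<integral>\<^sup>+y. ennreal (K (r, y) * F (r, y)) \<partial>lborel) \<partial>lborel)"
    by (subst lborel_prod[symmetric], subst lborel.nn_integral_fst[symmetric]) simp_all
  also have "\<dots> = (\<integral>\<^sup>+r. ennreal (indicator {0<..} r * exp (- \<mu> * r)) * (\<integral>\<^sup>+\<zeta>. ennreal (gauss \<zeta> * F (r, r *\<^sub>R c + sqrt (2 * a * r) *\<^sub>R \<zeta>)) \<partial>lborel) \<partial>lborel)"
  proof (rule nn_integral_cong)
    fix r :: real
    show "(\<integral>\<^sup>+y. ennreal (K (r, y) * F (r, y)) \<partial>lborel) = ennreal (indicator {0<..} r * exp (- \<mu> * r)) * (\<integral>\<^sup>+\<zeta>. ennreal (gauss \<zeta> * F (r, r *\<^sub>R c + sqrt (2 * a * r) *\<^sub>R \<zeta>)) \<partial>lborel)"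
    proof (cases "r > 0")
      case True
      have [measurable]: "hker r \<in> borel_measurable borel"
        unfolding hker_def by measurable
      have "(\<integral>\<^sup>+y. ennreal (K (r, y) * F (r, y)) \<partial>lborel) = (\<integral>\<^sup>+y. ennreal (exp (- \<mu> * r)) * ennreal (hker r y * F (r, y)) \<partial>lborel)"
        using True F hker_nonneg[OF True] by (intro nn_integral_cong) (simp add: K_def ennreal_mult[symmetric] mult.assoc)
      also have "\<dots> = ennreal (exp (- \<mu> * r)) * (\<integral>\<^sup>+y. ennreal (hker r y * F (r, y)) \<partial>lborel)"
        by (rule nn_integral_cmult) measurable
      finally show ?thesis
        using True F by (subst (asm) hker_slice_nn) auto
    qed (simp add: K_def)
  qed
  finally show ?thesis .
qed

lemma exp_minus_nn: "(\<integral>\<^sup>+r. ennreal (indicator {0<..} r * exp (- \<mu> * r)) \<partial>lborel) = ennreal (1 / \<mu>)"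
proof -
  have "(\<integral>\<^sup>+r. ennreal (indicator {0<..} r * exp (- \<mu> * r)) \<partial>lborel) = (\<integral>\<^sup>+r. ennreal (indicator {0..} r * exp (- \<mu> * r)) \<partial>lborel)"
    by (rule nn_integral_cong_AE, rule AE_mp[OF AE_lborel_singleton[of 0]]) (auto simp: indicator_def)
  also have "\<dots> = ennreal (1 / \<mu>)"
    using has_bochner_integral_exp_minus[OF \<mu>_pos]
    by (subst nn_integral_eq_integral) (auto simp: has_bochner_integral_iff)
  finally show ?thesis .
qed

lemma gauss_nn: "(\<integral>\<^sup>+\<zeta>. ennreal (gauss (\<zeta>::'x)) \<partial>lborel) = 1"
  by (subst nn_integral_eq_integral) (auto simp: gauss_integrable gauss_integral)

lemma has_bochner_integral_K: "has_bochner_integral lborel K (1 / \<mu>)"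
proof (rule has_bochner_integral_nn_integral)
  show "(\<integral>\<^sup>+z. ennreal (K z) \<partial>lborel) = ennreal (1 / \<mu>)"
    using K_nn[of "\<lambda>_. 1"] exp_minus_nn by (simp add: gauss_nn)
qed (use K_nonneg \<mu>_pos in auto)

lemma K_integrable: "integrable lborel K" and K_integral: "(\<integral>z. K z \<partial>lborel) = 1 / \<mu>"
  using has_bochner_integral_K by (simp_all add: has_bochner_integral_iff)

text \<open>Every slice has mass \<open>exp (- \<mu> * r) \<le> 1\<close>, so the slices before time
  \<open>e\<close> weigh at most \<open>e\<close> together.\<close>

lemma K_initial:
  assumes e: "e > 0"
  shows "(\<integral>z. K z * indicator {z. fst z < e} z \<partial>lborel) \<le> e"
proof -
  have [measurable]: "{z. fst z < e} \<in> sets (borel :: (real \<times> 'x) measure)"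
    by (intro borel_open open_Collect_less continuous_intros)
  have "(\<integral>\<^sup>+z. ennreal (K z * indicator {z. fst z < e} z) \<partial>lborel)
     = (\<integral>\<^sup>+r. ennreal (indicator {0<..} r * exp (- \<mu> * r)) * (\<integral>\<^sup>+\<zeta>. ennreal (gauss (\<zeta>::'x) * indicator {z::real\<times>'x. fst z < e} (r, r *\<^sub>R c + sqrt (2 * a * r) *\<^sub>R \<zeta>)) \<partial>lborel) \<partial>lborel)"
    by (rule K_nn) auto
  also have "\<dots> \<le> (\<integral>\<^sup>+r. indicator {0..e} r \<partial>lborel)"
  proof (rule nn_integral_mono)
    fix r :: real
    show "ennreal (indicator {0<..} r * exp (- \<mu> * r)) * (\<integral>\<^sup>+\<zeta>. ennreal (gauss (\<zeta>::'x) * indicator {z::real\<times>'x. fst z < e} (r, r *\<^sub>R c + sqrt (2 * a * r) *\<^sub>R \<zeta>)) \<partial>lborel) \<le> indicator {0..e} r"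
    proof (cases "0 < r \<and> r < e")
      case True
      then have "exp (- \<mu> * r) \<le> 1" using \<mu>_pos by simp
      then show ?thesis using True by (simp add: gauss_nn)
    qed (auto simp: indicator_def)
  qed
  also have "\<dots> = ennreal e" using e by simp
  finally have le: "(\<integral>\<^sup>+z. ennreal (K z * indicator {z. fst z < e} z) \<partial>lborel) \<le> ennreal e" .
  have "integrable lborel (\<lambda>z. K z * indicator {z. fst z < e} z)"
    using K_integrable by (intro integrable_real_mult_indicator) auto
  then have "(\<integral>\<^sup>+z. ennreal (K z * indicator {z. fst z < e} z) \<partial>lborel) = ennreal (\<integral>z. K z * indicator {z. fst z < e} z \<partial>lborel)"
    by (rule nn_integral_eq_integral) (auto simp: K_nonneg)
  with le show ?thesis using e by (simp add: ennreal_le_iff)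
qed

text \<open>After rescaling, the slice at time \<open>r\<close> has norm in mean at most
  \<open>exp (- \<mu> * r) * C / sqrt (2 * a * r)\<close>, where \<open>C\<close> is the first
  absolute moment of the Gaussian. The inverse square root is integrable up to time 1, and beyond
  that the exponential suffices.\<close>

lemma K1_integrable:
  assumes b: "b \<in> Basis"
  shows "integrable lborel (K1 b)"
proof (rule integrableI_bounded)
  let ?F = "\<lambda>z. if fst z > 0 then \<bar>(snd z - fst z *\<^sub>R c) \<bullet> b\<bar> / (2 * a * fst z) else 0"
  define C where "C = (\<integral>\<zeta>. gauss \<zeta> * norm (\<zeta>::'x) \<partial>lborel)"
  have [measurable]: "fst \<in> borel_measurable (borel :: (real \<times> 'x) measure)"
    "(\<lambda>z. (snd z - fst z *\<^sub>R c) \<bullet> b) \<in> borel_measurable (borel :: (real \<times> 'x) measure)"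
    by (auto intro!: borel_measurable_continuous_onI continuous_intros)
  have F: "?F \<in> borel_measurable borel"
    by measurable
  have Fpos: "0 \<le> ?F z" for z using a_pos by simp
  have C0: "C \<ge> 0" unfolding C_def by (intro integral_nonneg_AE AE_I2) auto
  have C: "(\<integral>\<^sup>+\<zeta>. ennreal (gauss \<zeta> * \<bar>(\<zeta>::'x) \<bullet> b\<bar>) \<partial>lborel) \<le> ennreal C"
  proof -
    have "(\<integral>\<^sup>+\<zeta>. ennreal (gauss \<zeta> * \<bar>(\<zeta>::'x) \<bullet> b\<bar>) \<partial>lborel) \<le> (\<integral>\<^sup>+\<zeta>. ennreal (gauss \<zeta> * norm (\<zeta>::'x)) \<partial>lborel)"
      by (intro nn_integral_mono ennreal_leI mult_left_mono Basis_le_norm[OF b]) auto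
    also have "\<dots> = ennreal C"
      unfolding C_def by (rule nn_integral_eq_integral) (auto simp: gauss_norm_integrable)
    finally show ?thesis .
  qed
  have sq: "has_bochner_integral lborel (\<lambda>r::real. indicator {0..1} r * r powr (- 1/2)) (1 powr (- 1/2 + 1) / (- 1/2 + 1))"
    by (rule integrable_lborel_indicatorI) (use has_integral_powr_from_0[of "-1/2" 1] in auto)
  have "(\<integral>\<^sup>+z. ennreal (norm (K1 b z)) \<partial>lborel) = (\<integral>\<^sup>+z. ennreal (K z * ?F z) \<partial>lborel)"
    using K_nonneg a_pos by (intro nn_integral_cong) (auto simp: K1_def abs_mult)
  also have "\<dots> = (\<integral>\<^sup>+r. ennreal (indicator {0<..} r * exp (- \<mu> * r)) * (\<integral>\<^sup>+\<zeta>. ennreal (gauss \<zeta> * ?F (r, r *\<^sub>R c + sqrt (2 * a * r) *\<^sub>R \<zeta>)) \<partial>lborel) \<partial>lborel)"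
    by (rule K_nn[OF F Fpos])
  also have "\<dots> \<le> (\<integral>\<^sup>+r. ennreal (C / sqrt (2 * a)) * (ennreal (indicator {0..1} r * r powr (- 1/2)) + ennreal (indicator {0<..} r * exp (- \<mu> * r))) \<partial>lborel)"
  proof (rule nn_integral_mono)
    fix r :: real
    show "ennreal (indicator {0<..} r * exp (- \<mu> * r)) * (\<integral>\<^sup>+\<zeta>. ennreal (gauss \<zeta> * ?F (r, r *\<^sub>R c + sqrt (2 * a * r) *\<^sub>R \<zeta>)) \<partial>lborel)
      \<le> ennreal (C / sqrt (2 * a)) * (ennreal (indicator {0..1} r * r powr (- 1/2)) + ennreal (indicator {0<..} r * exp (- \<mu> * r)))"
    proof (cases "r > 0")
      case r: True
      have sq2: "sqrt (2 * a * r) / (2 * a * r) = 1 / (sqrt (2 * a) * sqrt r)"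
        using r a_pos by (simp add: real_sqrt_mult field_simps)
      have "(\<integral>\<^sup>+\<zeta>. ennreal (gauss \<zeta> * ?F (r, r *\<^sub>R c + sqrt (2 * a * r) *\<^sub>R \<zeta>)) \<partial>lborel)
          = (\<integral>\<^sup>+\<zeta>. ennreal (sqrt (2 * a * r) / (2 * a * r)) * ennreal (gauss \<zeta> * \<bar>(\<zeta>::'x) \<bullet> b\<bar>) \<partial>lborel)"
        using r a_pos by (intro nn_integral_cong) (simp add: ennreal_mult[symmetric] abs_mult mult_ac)
      also have "\<dots> = ennreal (1 / (sqrt (2 * a) * sqrt r)) * (\<integral>\<^sup>+\<zeta>. ennreal (gauss \<zeta> * \<bar>(\<zeta>::'x) \<bullet> b\<bar>) \<partial>lborel)"
        unfolding sq2 by (rule nn_integral_cmult) measurable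
      also have "\<dots> \<le> ennreal (1 / (sqrt (2 * a) * sqrt r)) * ennreal C"
        by (intro mult_left_mono C) auto
      also have "\<dots> = ennreal (C / sqrt (2 * a) * (1 / sqrt r))"
        using r a_pos C0 by (subst ennreal_mult[symmetric]) (auto simp: field_simps)
      finally have "ennreal (indicator {0<..} r * exp (- \<mu> * r)) * (\<integral>\<^sup>+\<zeta>. ennreal (gauss \<zeta> * ?F (r, r *\<^sub>R c + sqrt (2 * a * r) *\<^sub>R \<zeta>)) \<partial>lborel)
          \<le> ennreal (exp (- \<mu> * r)) * ennreal (C / sqrt (2 * a) * (1 / sqrt r))"
        using r by (intro mult_mono) auto
      also have "\<dots> = ennreal (C / sqrt (2 * a) * (exp (- \<mu> * r) * (1 / sqrt r)))"
        using r a_pos C0 by (subst ennreal_mult[symmetric]) (auto simp: mult_ac)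
      also have "\<dots> \<le> ennreal (C / sqrt (2 * a) * (indicator {0..1} r * r powr (- 1/2) + indicator {0<..} r * exp (- \<mu> * r)))"
      proof (intro ennreal_leI mult_left_mono)
        have p: "r powr (- (1/2)) = 1 / sqrt r"
          using r by (simp add: powr_minus_divide powr_half_sqrt)
        show "exp (- \<mu> * r) * (1 / sqrt r) \<le> indicator {0..1} r * r powr (- 1/2) + indicator {0<..} r * exp (- \<mu> * r)"
        proof (cases "r \<le> 1")
          case True
          have "exp (- \<mu> * r) * (1 / sqrt r) \<le> 1 * (1 / sqrt r)"
            using r \<mu>_pos by (intro mult_right_mono) auto
          then show ?thesis using True r by (simp add: p add_increasing2)
        next
          case False
          then have "exp (- \<mu> * r) * (1 / sqrt r) \<le> exp (- \<mu> * r) * 1"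
            by (intro mult_left_mono) auto
          then show ?thesis using False r by simp
        qed
      qed (use C0 a_pos in auto)
      also have "\<dots> = ennreal (C / sqrt (2 * a)) * (ennreal (indicator {0..1} r * r powr (- 1/2)) + ennreal (indicator {0<..} r * exp (- \<mu> * r)))"
        using C0 a_pos by (subst ennreal_plus[symmetric], simp, simp, subst ennreal_mult) auto
      finally show ?thesis .
    qed simp
  qed
  also have "\<dots> = ennreal (C / sqrt (2 * a)) * ((\<integral>\<^sup>+r. ennreal (indicator {0..1} r * r powr (- 1/2)) \<partial>lborel) + ennreal (1 / \<mu>))"
  proof -
    have "(\<integral>\<^sup>+r. ennreal (C / sqrt (2 * a)) * (ennreal (indicator {0..1} r * r powr (- 1/2)) + ennreal (indicator {0<..} r * exp (- \<mu> * r))) \<partial>lborel)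
        = ennreal (C / sqrt (2 * a)) * (\<integral>\<^sup>+r. (ennreal (indicator {0..1} r * r powr (- 1/2)) + ennreal (indicator {0<..} r * exp (- \<mu> * r))) \<partial>lborel)"
      by (rule nn_integral_cmult) measurable
    also have "(\<integral>\<^sup>+r. (ennreal (indicator {0..1} r * r powr (- 1/2)) + ennreal (indicator {0<..} r * exp (- \<mu> * r))) \<partial>lborel)
        = (\<integral>\<^sup>+r. ennreal (indicator {0..1} r * r powr (- 1/2)) \<partial>lborel) + (\<integral>\<^sup>+r. ennreal (indicator {0<..} r * exp (- \<mu> * r)) \<partial>lborel)"
      by (rule nn_integral_add) measurable
    finally show ?thesis
      unfolding exp_minus_nn .
  qed
  also have "(\<integral>\<^sup>+r. ennreal (indicator {0..1} r * r powr (- 1/2)) \<partial>lborel) = ennreal 2"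
    using sq by (subst nn_integral_eq_integral) (auto simp: has_bochner_integral_iff)
  also have "ennreal (C / sqrt (2 * a)) * (ennreal 2 + ennreal (1 / \<mu>)) < \<infinity>"
    by (simp add: ennreal_mult_less_top)
  finally show "(\<integral>\<^sup>+z. ennreal (norm (K1 b z)) \<partial>lborel) < \<infinity>" .
qed measurable

lemma K_isCont: "fst z \<noteq> 0 \<Longrightarrow> isCont K z"
proof (cases "fst z > 0")
  case True
  have "continuous_on {z. fst z > 0} K"
  proof -
    have "continuous_on {z::real\<times>'x. fst z > 0} (\<lambda>z. exp (- \<mu> * fst z) * hker (fst z) (snd z))"
      unfolding hker_def using a_pos by (intro continuous_intros) auto
    then show ?thesis
      by (rule continuous_on_eq) (simp add: K_def)
  qed
  moreover have "open {z::real\<times>'x. fst z > 0}"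
    by (intro open_Collect_less continuous_intros)
  ultimately show ?thesis using True continuous_on_eq_continuous_at by blast
next
  case False
  assume "fst z \<noteq> 0"
  then have z: "z \<in> {z. fst z < 0}" using False by simp
  have "continuous_on {z. fst z < 0} K"
    by (rule continuous_on_eq[of _ "\<lambda>z. 0"]) (auto simp: K_def)
  moreover have "open {z::real\<times>'x. fst z < 0}"
    by (intro open_Collect_less continuous_intros)
  ultimately show ?thesis using z continuous_on_eq_continuous_at by blast
qed

text \<open>Continuity can fail only on the hyperplane of time 0, a null set; the translation
  argument for kernels asks for no more.\<close>

lemma K_AE_isCont: "AE z in lborel. isCont K z"
proof -
  have "AE z::real\<times>'x in lborel. z \<bullet> (1, 0) \<noteq> 0"
    by (rule AE_lborel_inner_neq) (simp add: Basis_prod_def)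
  then show ?thesis
    by eventually_elim (rule K_isCont, auto simp: inner_prod_def)
qed

lemma K_lower:
  obtains d where "d > 0" "\<And>y. y \<in> cbox (1, 0) ((1, 0) + One) \<Longrightarrow> d \<le> K y"
proof -
  \<comment> \<open>One full space-time period at times 1 to 2, away from time 0, so that
    \<open>K\<close> is continuous and positive on it and attains a positive minimum.\<close>
  let ?S = "cbox (1, 0) ((1, 0) + One) :: (real \<times> 'x) set"
  have pos: "fst y \<ge> 1" if "y \<in> ?S" for y
  proof -
    have "(1, 0) \<in> (Basis :: (real\<times>'x) set)" by (simp add: Basis_prod_def)
    then have "(1::real,0::'x) \<bullet> (1, 0) \<le> y \<bullet> (1, 0)" using that unfolding mem_box by blast
    then show ?thesis by (simp add: inner_prod_def)
  qed
  have "continuous_on ?S K"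
    using K_isCont pos by (intro continuous_at_imp_continuous_on) force
  moreover have "?S \<noteq> {}"
    by (auto simp: box_ne_empty inner_add_left)
  ultimately obtain y where y: "y \<in> ?S" "\<And>x. x \<in> ?S \<Longrightarrow> K y \<le> K x"
    using continuous_attains_inf[of ?S K] compact_cbox by blast
  have "K y > 0"
    using pos[OF y(1)] a_pos by (auto simp: K_def hker_def)
  then show thesis using that y by blast
qed

lemma K1_deriv:
  assumes b: "b \<in> Basis"
  shows "((\<lambda>s. K (y + s *\<^sub>R (0, b))) has_real_derivative K1 b (y + s *\<^sub>R (0, b))) (at s)"
proof (cases "fst y > 0")
  case True
  let ?r = "fst y"
  define v where "v = snd y - ?r *\<^sub>R c"
  have e: "snd y + s *\<^sub>R b - ?r *\<^sub>R c = v + s *\<^sub>R b" for s by (simp add: v_def)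
  have "((\<lambda>s. - ((v + s *\<^sub>R b) \<bullet> (v + s *\<^sub>R b)) / (4 * a * ?r)) has_real_derivative - ((v + s *\<^sub>R b) \<bullet> b) / (2 * a * ?r)) (at s)"
    unfolding inner_add_left inner_add_right inner_scaleR_left inner_scaleR_right
    using True a_pos b
    by (auto intro!: derivative_eq_intros simp: inner_commute field_simps)
  from DERIV_cmult[OF DERIV_chain2[OF DERIV_exp this], of "exp (- \<mu> * ?r) * (1 / sqrt (4 * pi * a * ?r)) ^ DIM('x)"]
  show ?thesis
    using True by (simp add: K_def K1_def hker_def e mult_ac)
qed (simp add: K_def K1_def)

text \<open>Time is constant along \<open>(0, b)\<close>, so the singularity at time 0 is never
  crossed.\<close>

lemma K1_cont:
  assumes b: "b \<in> Basis"
  shows "continuous_on UNIV (\<lambda>s. K1 b (y + s *\<^sub>R (0, b)))"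
proof (cases "fst y > 0")
  case True
  then show ?thesis
    unfolding K1_def K_def hker_def using a_pos by (simp, intro continuous_intros) auto
qed (simp add: K1_def)

text \<open>\<open>R\<close> inverts \<open>\<mu> - \<partial>\<^sub>t - a \<Delta> - c \<bullet> \<nabla>\<close>, since \<open>R f (t, x)\<close> is the integral over \<open>r > 0\<close> of
  \<open>exp (- \<mu> r)\<close> times the Gaussian mean of \<open>f (t + r, x + r c + sqrt (2 a r) \<zeta>)\<close>.\<close>

definition R :: "(real \<times> 'x \<Rightarrow> real) \<Rightarrow> real \<times> 'x \<Rightarrow> real" where
  "R f = conv K f"

definition R1 :: "'x \<Rightarrow> (real \<times> 'x \<Rightarrow> real) \<Rightarrow> real \<times> 'x \<Rightarrow> real" where
  "R1 b f z = - conv (K1 b) f z"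

text \<open>The kernel supplies the derivative, so \<open>f\<close> enters as a merely continuous
  function. This gain of one spatial derivative drives the regularity argument.\<close>

lemma R_pd_kernel:
  assumes "b \<in> Basis" "cper f"
  shows "has_pd (R f) (0, b) (R1 b f)"
proof -
  have "has_pd (conv K f) (0, b) (\<lambda>z. - conv (K1 b) f z)"
    by (rule conv_kernel_pd) (use assms K_integrable K1_integrable K1_deriv K1_cont in auto)
  then show ?thesis by (simp add: R_def R1_def[abs_def])
qed

lemma R_cper: "cper f \<Longrightarrow> cper (R f)"
  unfolding R_def by (rule conv_cper[OF K_integrable])

lemma R1_cper: "b \<in> Basis \<Longrightarrow> cper f \<Longrightarrow> cper (R1 b f)"
  unfolding R1_def by (intro cper_uminus conv_cper K1_integrable)

end

section \<open>Derivatives, bounds and the backward equation for the resolvent\<close>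

text \<open>Converse of the fundamental theorem along \<open>b\<close>. Forward steps suffice, since
  every point is reached from \<open>z - b\<close>.\<close>

lemma has_pd_of_integral:
  assumes g: "continuous_on UNIV g"
    and eq: "\<And>z h. 0 \<le> h \<Longrightarrow> f (z + h *\<^sub>R b) = f z + integral {0..h} (\<lambda>s. g (z + s *\<^sub>R b))"
  shows "has_pd f b g"
  unfolding has_pd_def
proof
  fix z
  have cg: "continuous_on S (\<lambda>s. g (z - b + s *\<^sub>R b))" for S
    by (intro continuous_on_compose2[OF g] continuous_intros) auto
  have "((\<lambda>s. integral {0..s} (\<lambda>s. g (z - b + s *\<^sub>R b))) has_real_derivative g (z - b + 1 *\<^sub>R b)) (at 1 within {0..2})"
    by (rule integral_has_real_derivative[OF cg]) auto
  then have "((\<lambda>s. integral {0..s} (\<lambda>s. g (z - b + s *\<^sub>R b))) has_real_derivative g z) (at 1)"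
    by (simp add: at_within_Icc_at)
  then have "((\<lambda>s. f (z - b) + integral {0..s} (\<lambda>s. g (z - b + s *\<^sub>R b))) has_real_derivative (0 + g z)) (at 1)"
    by (intro derivative_intros)
  moreover have "\<forall>\<^sub>F s in nhds 1. f (z - b) + integral {0..s} (\<lambda>s. g (z - b + s *\<^sub>R b)) = f (z - b + s *\<^sub>R b)"
  proof -
    have "\<forall>\<^sub>F s in nhds (1::real). s > 0"
      by (rule order_tendstoD(1)[OF filterlim_ident]) auto
    then show ?thesis
      by eventually_elim (simp add: eq)
  qed
  ultimately have "((\<lambda>s. f (z - b + s *\<^sub>R b)) has_real_derivative g z) (at 1)"
    by (subst DERIV_cong_ev[OF refl _ refl, symmetric]) (auto intro: eventually_mono)
  then have "((\<lambda>s. f (z - b + (s + 1) *\<^sub>R b)) has_real_derivative g z) (at 0)"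
    using DERIV_shift[of "\<lambda>s. f (z - b + s *\<^sub>R b)" "g z" 0 1] by simp
  then show "((\<lambda>s. f (z + s *\<^sub>R b)) has_real_derivative g z) (at 0)"
    by (simp add: algebra_simps)
qed

text \<open>The increments of \<open>F n\<close> are integrals of \<open>G n\<close>; both sides
  pass to the limit, and the limiting identity is differentiated.\<close>

lemma has_pd_uniform_limit:
  fixes f g :: "'a::euclidean_space \<Rightarrow> real"
  assumes fl: "uniform_limit UNIV F f sequentially" and gl: "uniform_limit UNIV G g sequentially"
    and pd: "\<And>n. has_pd (F n) b (G n)" and G: "\<And>n. cper (G n)"
  shows "has_pd f b g"
proof (rule has_pd_of_integral)
  have g: "cper g" by (rule cper_uniform_limit[OF gl G])
  then show "continuous_on UNIV g" by (rule cperD)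
  fix z h assume h: "0 \<le> (h::real)"
  have "uniform_limit {0..h} (\<lambda>n s. G n (z + s *\<^sub>R b)) (\<lambda>s. g (z + s *\<^sub>R b)) sequentially"
    using uniform_limit_compose'[OF gl, of "\<lambda>s. z + s *\<^sub>R b" "{0..h}"] by simp
  then obtain I J where IJ: "\<And>n. ((\<lambda>s. G n (z + s *\<^sub>R b)) has_integral I n) (cbox 0 h)"
      "((\<lambda>s. g (z + s *\<^sub>R b)) has_integral J) (cbox 0 h)" "(I \<longlongrightarrow> J) sequentially"
    unfolding cbox_interval[symmetric]
    by (rule uniform_limit_integral_cbox)
      (auto intro!: continuous_on_compose2[OF cperD(1)[OF G]] continuous_intros)
  have "I = (\<lambda>n. F n (z + h *\<^sub>R b) - F n z)"
    using IJ(1) has_pd_FTC[OF pd cperD(1)[OF G] h] has_integral_unique by (metis (no_types, lifting) ext box_real(2))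
  moreover have "(\<lambda>n. F n (z + h *\<^sub>R b) - F n z) \<longlonglongrightarrow> f (z + h *\<^sub>R b) - f z"
    by (intro tendsto_diff tendsto_uniform_limitI[OF fl]) auto
  ultimately have "I \<longlonglongrightarrow> f (z + h *\<^sub>R b) - f z"
    by simp
  then have "J = f (z + h *\<^sub>R b) - f z"
    by (rule LIMSEQ_unique[OF IJ(3)])
  then show "f (z + h *\<^sub>R b) = f z + integral {0..h} (\<lambda>s. g (z + s *\<^sub>R b))"
    using IJ(2) by (simp add: integral_unique)
qed

lemma conv_uniform_limit:
  fixes k :: "'a::euclidean_space \<Rightarrow> real"
  assumes k: "integrable lborel k" and lim: "uniform_limit UNIV F f sequentially"
    and F: "\<And>n. cper (F n)"
  shows "uniform_limit UNIV (\<lambda>n. conv k (F n)) (conv k f) sequentially"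
  unfolding uniform_limit_iff
proof (intro allI impI)
  fix e :: real assume e: "e > 0"
  define I where "I = (\<integral>y. \<bar>k y\<bar> \<partial>lborel)"
  have f: "cper f" by (rule cper_uniform_limit[OF lim F])
  have I: "I \<ge> 0" unfolding I_def by (intro integral_nonneg_AE AE_I2) auto
  then have "e / (2 * (I + 1)) > 0" using e by simp
  then have "\<forall>\<^sub>F n in sequentially. \<forall>x\<in>UNIV. dist (F n x) (f x) < e / (2 * (I + 1))"
    using lim unfolding uniform_limit_iff by blast
  then show "\<forall>\<^sub>F n in sequentially. \<forall>x\<in>UNIV. dist (conv k (F n) x) (conv k f x) < e"
  proof eventually_elim
    case (elim n)
    show ?case
    proof
      fix x
      have "dist (conv k (F n) x) (conv k f x) = \<bar>conv k (\<lambda>x. F n x - f x) x\<bar>"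
        by (simp add: conv_diff[OF k F f] dist_real_def)
      also have "\<dots> \<le> I * (e / (2 * (I + 1)))"
        unfolding I_def
        by (rule conv_bound[OF k cper_diff[OF F f]]) (use elim in \<open>simp add: dist_real_def less_imp_le I_def\<close>)
      also have "\<dots> \<le> (I + 1) * (e / (2 * (I + 1)))"
        using I e by (intro mult_right_mono) auto
      also have "\<dots> = e / 2" using I by (simp add: field_simps)
      finally show "dist (conv k (F n) x) (conv k f x) < e" using e by simp
    qed
  qed
qed

text \<open>The coordinates of \<open>h\<close> are switched on one at a time. The error over a set
  \<open>S\<close> of coordinates is at most \<open>e * norm h\<close>; when a coordinate is added,
  half of \<open>e\<close> is left to the old set and half covers the new segment through the mean
  value inequality.\<close>

lemma C1_has_derivative:
  fixes f :: "'a::euclidean_space \<Rightarrow> real"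
  assumes pd: "\<And>b. b \<in> Basis \<Longrightarrow> has_pd f b (g b)"
    and cont: "\<And>b. b \<in> Basis \<Longrightarrow> continuous_on UNIV (g b)"
  shows "(f has_derivative (\<lambda>h. \<Sum>b\<in>Basis. (h \<bullet> b) * g b x)) (at x)"
proof -
  have claim: "\<exists>d>0. \<forall>h. norm h < d \<longrightarrow>
      \<bar>f (x + (\<Sum>b\<in>S. (h \<bullet> b) *\<^sub>R b)) - f x - (\<Sum>b\<in>S. (h \<bullet> b) * g b x)\<bar> \<le> e * norm h"
    if "finite S" "S \<subseteq> Basis" "e > 0" for S e
    using that
  proof (induction S arbitrary: e)
    case empty
    then show ?case by (intro exI[of _ 1]) auto
  next
    case (insert b S)
    then have b: "b \<in> Basis" by auto
    from insert obtain d where d: "d > 0" and D: "\<And>h. norm h < d \<Longrightarrow>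
      \<bar>f (x + (\<Sum>b\<in>S. (h \<bullet> b) *\<^sub>R b)) - f x - (\<Sum>b\<in>S. (h \<bullet> b) * g b x)\<bar> \<le> e / 2 * norm h"
      using insert.IH[of "e / 2"] by auto
    have "isCont (g b) x"
      using cont[OF b] by (simp add: continuous_on_eq_continuous_at)
    then obtain r where r: "r > 0" and rr: "\<And>y. dist y x < r \<Longrightarrow> dist (g b y) (g b x) < e / 2"
      unfolding continuous_at_eps_delta using insert.prems(2) by (meson half_gt_zero)
    \<comment> \<open>The path consists of \<open>N\<close> coordinate steps, each of length at most
      \<open>norm h\<close>; thus \<open>norm h < r / N\<close> keeps it in the ball where
      \<open>g b\<close> is nearly constant.\<close>
    define N where "N = real (card S) + 1"
    have N: "N > 0" by (simp add: N_def)
    show ?case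
    proof (intro exI conjI allI impI)
      show "min d (r / N) > 0" using d r N by simp
      fix h :: 'a assume h: "norm h < min d (r / N)"
      let ?y = "x + (\<Sum>b\<in>S. (h \<bullet> b) *\<^sub>R b)"
      let ?T = "closed_segment 0 (h \<bullet> b)"
      have nb: "\<bar>h \<bullet> i\<bar> \<le> norm h" if "i \<in> Basis" for i
        using Basis_le_norm[OF that] by simp
      have near: "dist (?y + s *\<^sub>R b) x < r" if "s \<in> ?T" for s
      proof -
        have s: "\<bar>s\<bar> \<le> norm h"
          using that nb[OF b] by (auto simp: closed_segment_eq_real_ivl split: if_splits)
        have "norm ((\<Sum>b\<in>S. (h \<bullet> b) *\<^sub>R b) + s *\<^sub>R b) \<le> (\<Sum>b\<in>S. norm ((h \<bullet> b) *\<^sub>R b)) + norm (s *\<^sub>R b)"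
          by (intro norm_triangle_le add_mono norm_sum order_refl)
        also have "\<dots> \<le> (\<Sum>b\<in>S. norm h) + norm h"
          by (intro add_mono sum_mono) (use insert.prems nb b s in auto)
        also have "\<dots> = N * norm h" by (simp add: N_def algebra_simps)
        also have "\<dots> < r" using h N by (simp add: field_simps)
        finally show ?thesis by (simp add: dist_norm add.assoc)
      qed
      have "norm ((f (?y + (h \<bullet> b) *\<^sub>R b) - (h \<bullet> b) * g b x) - (f (?y + 0 *\<^sub>R b) - 0 * g b x)) \<le> e / 2 * norm (h \<bullet> b - 0)"
      proof (rule field_differentiable_bound[of ?T "\<lambda>s. f (?y + s *\<^sub>R b) - s * g b x" "\<lambda>s. g b (?y + s *\<^sub>R b) - g b x"])
        show "((\<lambda>s. f (?y + s *\<^sub>R b) - s * g b x) has_real_derivative g b (?y + s *\<^sub>R b) - g b x) (at s within ?T)" for s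
          by (rule has_field_derivative_at_within)
            (auto intro!: derivative_eq_intros has_pd_at[OF pd[OF b]])
        show "norm (g b (?y + s *\<^sub>R b) - g b x) \<le> e / 2" if "s \<in> ?T" for s
          using rr[OF near[OF that]] by (simp add: dist_real_def)
      qed auto
      also have "\<dots> \<le> e / 2 * norm h"
        using nb[OF b] insert.prems(2) by (intro mult_left_mono) auto
      finally have 1: "\<bar>f (?y + (h \<bullet> b) *\<^sub>R b) - (h \<bullet> b) * g b x - f ?y\<bar> \<le> e / 2 * norm h"
        by simp
      have 2: "\<bar>f ?y - f x - (\<Sum>b\<in>S. (h \<bullet> b) * g b x)\<bar> \<le> e / 2 * norm h"
        using D h by simp
      have "(\<Sum>b\<in>insert b S. (h \<bullet> b) * g b x) = (h \<bullet> b) * g b x + (\<Sum>b\<in>S. (h \<bullet> b) * g b x)"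
        using insert by simp
      moreover have "f (x + (\<Sum>b\<in>insert b S. (h \<bullet> b) *\<^sub>R b)) = f (?y + (h \<bullet> b) *\<^sub>R b)"
        using insert by (simp add: add_ac)
      ultimately have "f (x + (\<Sum>b\<in>insert b S. (h \<bullet> b) *\<^sub>R b)) - f x - (\<Sum>b\<in>insert b S. (h \<bullet> b) * g b x)
          = (f (?y + (h \<bullet> b) *\<^sub>R b) - (h \<bullet> b) * g b x - f ?y) + (f ?y - f x - (\<Sum>b\<in>S. (h \<bullet> b) * g b x))"
        by simp
      then show "\<bar>f (x + (\<Sum>b\<in>insert b S. (h \<bullet> b) *\<^sub>R b)) - f x - (\<Sum>b\<in>insert b S. (h \<bullet> b) * g b x)\<bar> \<le> e * norm h"
        using order_trans[OF abs_triangle_ineq add_mono[OF 1 2]] by simp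
    qed
  qed
  show ?thesis
    unfolding has_derivative_at_alt
  proof (intro conjI allI impI)
    show "bounded_linear (\<lambda>h. \<Sum>b\<in>Basis. (h \<bullet> b) * g b x)"
      by (intro bounded_linear_sum bounded_linear_mult_left[THEN bounded_linear_compose] bounded_linear_inner_left)
    fix e :: real assume "0 < e"
    from claim[OF finite_Basis order_refl this] obtain d where d: "d > 0" "\<And>h. norm h < d \<Longrightarrow>
      \<bar>f (x + (\<Sum>b\<in>Basis. (h \<bullet> b) *\<^sub>R b)) - f x - (\<Sum>b\<in>Basis. (h \<bullet> b) * g b x)\<bar> \<le> e * norm h"
      by blast
    show "\<exists>d>0. \<forall>y. norm (y - x) < d \<longrightarrow> norm (f y - f x - (\<Sum>b\<in>Basis. ((y - x) \<bullet> b) * g b x)) \<le> e * norm (y - x)"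
      using d(2)[of "_ - x"] by (intro exI[of _ d] conjI d(1)) (simp add: euclidean_representation)
  qed
qed

lemma sum_Basis_prod:
  fixes f :: "'a::euclidean_space \<times> 'b::euclidean_space \<Rightarrow> 'c::comm_monoid_add"
  shows "sum f Basis = (\<Sum>i\<in>Basis. f (i, 0)) + (\<Sum>i\<in>Basis. f (0, i))"
proof -
  have "inj_on (\<lambda>u. (u::'a, 0::'b)) Basis" "inj_on (\<lambda>u. (0::'a, u::'b)) Basis"
    by (auto intro!: inj_onI Pair_inject)
  then show ?thesis
    unfolding Basis_prod_def
    by (subst sum.union_disjoint) (auto simp: sum.reindex)
qed

lemma integral_add_sum:
  fixes A :: "'a \<Rightarrow> real" and p :: "'b \<Rightarrow> real"
  assumes "integrable M A" "\<And>b. b \<in> I \<Longrightarrow> integrable M (U b)" "\<And>b. b \<in> I \<Longrightarrow> integrable M (W b)"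
  shows "(\<integral>x. A x + (\<Sum>b\<in>I. p b * U b x + q * W b x) \<partial>M) = (\<integral>x. A x \<partial>M) + (\<Sum>b\<in>I. p b * (\<integral>x. U b x \<partial>M) + q * (\<integral>x. W b x \<partial>M))"
proof -
  have "has_bochner_integral M (\<lambda>x. A x + (\<Sum>b\<in>I. p b * U b x + q * W b x)) ((\<integral>x. A x \<partial>M) + (\<Sum>b\<in>I. p b * (\<integral>x. U b x \<partial>M) + q * (\<integral>x. W b x \<partial>M)))"
    using assms
    by (intro has_bochner_integral_add has_bochner_integral_sum has_bochner_integral_mult_right has_bochner_integral_integrable)
  then show ?thesis by (rule has_bochner_integral_integral_eq)
qed

text \<open>Regularity of order one in time and two in space, with the derivatives as witnesses.
  Second derivatives are the pure ones, those that make up the Laplacian.\<close>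

definition C12 :: "(real \<times> 'x::euclidean_space \<Rightarrow> real) \<Rightarrow> (real \<times> 'x \<Rightarrow> real) \<Rightarrow> ('x \<Rightarrow> real \<times> 'x \<Rightarrow> real) \<Rightarrow> ('x \<Rightarrow> real \<times> 'x \<Rightarrow> real) \<Rightarrow> bool" where
  "C12 f ft D H \<longleftrightarrow> cper f \<and> cper ft \<and> has_pd f (1, 0) ft \<and>
     (\<forall>b\<in>Basis. has_pd f (0, b) (D b) \<and> cper (D b) \<and> has_pd (D b) (0, b) (H b) \<and> cper (H b))"

context heat
begin

definition LL :: "(real \<times> 'x \<Rightarrow> real) \<Rightarrow> ('x \<Rightarrow> real \<times> 'x \<Rightarrow> real) \<Rightarrow> ('x \<Rightarrow> real \<times> 'x \<Rightarrow> real) \<Rightarrow> real \<times> 'x \<Rightarrow> real" where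
  "LL ft D H z = ft z + a * (\<Sum>b\<in>Basis. H b z) + (\<Sum>b\<in>Basis. (c \<bullet> b) * D b z)"

text \<open>From time \<open>e\<close> on, the prefactor of the Gaussian is at most
  \<open>A\<close>, and half of the damping \<open>\<mu>\<close> is traded for exponential decay in
  space at rate \<open>\<eta>\<close>. The majorant is a product of one-dimensional exponentials:
  integrable, and changed only by a constant factor when its argument moves within a unit cell,
  which is what \<open>conv_upper\<close> requires.\<close>

lemma K_tail:
  assumes e: "e > 0"
  obtains C where "C \<ge> 0" "\<And>f z. cper f \<Longrightarrow> (\<And>x. 0 \<le> f x) \<Longrightarrow> conv (\<lambda>z. K z * indicator {z. fst z \<ge> e} z) f z \<le> C * avg f"
proof -
  \<comment> \<open>So small that the price \<open>\<eta> * \<eta> * a + \<eta> * norm c\<close> per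
    unit of time stays below \<open>\<mu> / 2\<close>; with \<open>\<eta> \<le> 1\<close> the square
    is estimated by \<open>\<eta>\<close> itself.\<close>
  define \<eta> where "\<eta> = min 1 (\<mu> / (2 * (a + norm c + 1)))"
  have den: "a + norm c + 1 > 0" using a_pos norm_ge_zero[of c] by linarith
  have \<eta>: "0 < \<eta>" "\<eta> \<le> 1"
    using den \<mu>_pos by (simp_all add: \<eta>_def)
  have \<eta>b: "\<eta> * \<eta> * a + \<eta> * norm c \<le> \<mu> / 2"
  proof -
    have "\<eta> * \<eta> * a + \<eta> * norm c \<le> \<eta> * a + \<eta> * norm c"
      using \<eta> a_pos by (intro add_right_mono mult_right_mono) auto
    also have "\<dots> \<le> \<eta> * (a + norm c + 1)"
      using \<eta> by (simp add: algebra_simps)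
    also have "\<dots> \<le> \<mu> / (2 * (a + norm c + 1)) * (a + norm c + 1)"
      using den by (intro mult_right_mono) (auto simp: \<eta>_def)
    also have "\<dots> = \<mu> / 2" using den by (simp add: field_simps)
    finally show ?thesis .
  qed
  define n where "n = real DIM('x)"
  have n: "n > 0" by (simp add: n_def)
  define A where "A = (1 / sqrt (4 * pi * a * e)) ^ DIM('x)"
  have A: "A \<ge> 0" using a_pos e by (simp add: A_def)
  have bound: "K z \<le> A * exp (- (\<mu> / 2) * fst z - (\<eta> / n) * (\<Sum>b\<in>Basis. \<bar>snd z \<bullet> b\<bar>))" if z: "fst z \<ge> e" for z
  proof -
    let ?r = "fst z" and ?y = "snd z"
    let ?v = "?y - ?r *\<^sub>R c"
    have r: "?r > 0" using z e by simp
    have "(1 / sqrt (4 * pi * a * ?r)) ^ DIM('x) \<le> A"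
      unfolding A_def using z e a_pos r
      by (intro power_mono divide_left_mono) (auto intro!: mult_left_mono)
    moreover have "exp (- \<mu> * ?r) * exp (- (?v \<bullet> ?v) / (4 * a * ?r)) \<le> exp (- (\<mu> / 2) * ?r - (\<eta> / n) * (\<Sum>b\<in>Basis. \<bar>?y \<bullet> b\<bar>))"
    proof -
      \<comment> \<open>Completing the square: \<open>\<eta> * norm ?v\<close> is bounded by the
        Gaussian exponent plus \<open>\<eta> * \<eta> * a * ?r\<close>, a quantity linear in time
        that the damping can absorb.\<close>
      have "(norm ?v - 2 * \<eta> * a * ?r)\<^sup>2 \<ge> 0" by simp
      then have "\<eta> * norm ?v * (4 * a * ?r) \<le> ?v \<bullet> ?v + \<eta> * \<eta> * a * ?r * (4 * a * ?r)"
        by (simp add: power2_eq_square algebra_simps dot_square_norm)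
      then have 1: "\<eta> * norm ?v - \<eta> * \<eta> * a * ?r \<le> (?v \<bullet> ?v) / (4 * a * ?r)"
        using r a_pos by (subst pos_le_divide_eq) (auto simp: left_diff_distrib)
      have "norm ?y \<le> norm ?v + norm (?r *\<^sub>R c)"
        using norm_triangle_ineq[of ?v "?r *\<^sub>R c"] by simp
      then have 2: "\<eta> * norm ?y \<le> \<eta> * norm ?v + \<eta> * norm c * ?r"
        using \<eta> r by (simp add: mult_left_mono[of "norm ?y" "norm ?v + ?r * norm c" \<eta>] algebra_simps)
          (metis (no_types, opaque_lifting) distrib_left less_eq_real_def mult.assoc mult.commute mult_left_mono)
      have "(\<Sum>b\<in>Basis. \<bar>?y \<bullet> b\<bar>) \<le> (\<Sum>b\<in>(Basis::'x set). norm ?y)"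
        by (intro sum_mono Basis_le_norm)
      then have "(\<eta> / n) * (\<Sum>b\<in>Basis. \<bar>?y \<bullet> b\<bar>) \<le> (\<eta> / n) * (n * norm ?y)"
        using \<eta> n by (intro mult_left_mono) (auto simp: n_def)
      then have 3: "(\<eta> / n) * (\<Sum>b\<in>Basis. \<bar>?y \<bullet> b\<bar>) \<le> \<eta> * norm ?y"
        using n by simp
      have 4: "(\<eta> * \<eta> * a + \<eta> * norm c) * ?r \<le> \<mu> / 2 * ?r"
        using \<eta>b r by (intro mult_right_mono) auto
      have "- \<mu> * ?r - (?v \<bullet> ?v) / (4 * a * ?r) \<le> - (\<mu> / 2) * ?r - (\<eta> / n) * (\<Sum>b\<in>Basis. \<bar>?y \<bullet> b\<bar>)"
        using 1 2 3 4 by (simp add: algebra_simps)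
      then show ?thesis by (simp add: exp_add[symmetric])
    qed
    ultimately have "(1 / sqrt (4 * pi * a * ?r)) ^ DIM('x) * (exp (- \<mu> * ?r) * exp (- (?v \<bullet> ?v) / (4 * a * ?r)))
        \<le> A * exp (- (\<mu> / 2) * ?r - (\<eta> / n) * (\<Sum>b\<in>Basis. \<bar>?y \<bullet> b\<bar>))"
      using A by (intro mult_mono) auto
    then show ?thesis
      using r by (simp add: K_def hker_def mult_ac)
  qed
  \<comment> \<open>The factor \<open>exp (\<mu> / 2 + \<eta>)\<close> absorbs a move within the
    cell: time changes by at most 1, and so does each of the \<open>n\<close> space coordinates,
    which carry the weight \<open>\<eta> / n\<close>.\<close>
  define g where "g z = (A * exp (\<mu> / 2 + \<eta>)) * (exp (- (\<mu> / 2) * \<bar>fst z\<bar>) * (\<Prod>b\<in>Basis. exp (- (\<eta> / n) * \<bar>snd z \<bullet> b\<bar>)))" for z :: "real \<times> 'x"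
  have "integrable lborel (\<lambda>y::'x. \<Prod>b\<in>Basis. exp (- (\<eta> / n) * \<bar>y \<bullet> b\<bar>))"
    by (rule integrable.intros, rule integrable_prod_Basis, rule integrable_exp_minus_abs) (use \<eta> n in auto)
  moreover have "integrable lborel (\<lambda>r. exp (- (\<mu> / 2) * \<bar>r\<bar>))"
    by (rule integrable_exp_minus_abs) (use \<mu>_pos in auto)
  ultimately have "integrable (lborel \<Otimes>\<^sub>M lborel) (\<lambda>(r, y::'x). exp (- (\<mu> / 2) * \<bar>r\<bar>) * (\<Prod>b\<in>Basis. exp (- (\<eta> / n) * \<bar>y \<bullet> b\<bar>)))"
    by (rule integrable_lborel_prod[rotated])
  then have "integrable lborel (\<lambda>z::real\<times>'x. exp (- (\<mu> / 2) * \<bar>fst z\<bar>) * (\<Prod>b\<in>Basis. exp (- (\<eta> / n) * \<bar>snd z \<bullet> b\<bar>)))"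
    unfolding lborel_prod split_beta .
  then have g: "integrable lborel g"
    unfolding g_def by (rule integrable_mult_right)
  have g0: "0 \<le> g z" for z unfolding g_def using A by (simp add: prod_nonneg)
  have g_eq: "g z = A * exp (\<mu> / 2 + \<eta> - (\<mu> / 2) * \<bar>fst z\<bar> - (\<eta> / n) * (\<Sum>b\<in>Basis. \<bar>snd z \<bullet> b\<bar>))" for z
  proof -
    have "(\<Prod>b\<in>Basis. exp (- (\<eta> / n) * \<bar>snd z \<bullet> b\<bar>)) = exp (- ((\<eta> / n) * (\<Sum>b\<in>Basis. \<bar>snd z \<bullet> b\<bar>)))"
      by (subst exp_sum[symmetric]) (simp_all add: sum_distrib_left sum_negf)
    then show ?thesis
      unfolding g_def mult.assoc by (simp only: mult_exp_exp) (simp add: algebra_simps)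
  qed
  have [measurable]: "{z. e \<le> fst z} \<in> sets (borel :: (real \<times> 'x) measure)"
    by (intro borel_closed closed_Collect_le continuous_intros)
  show thesis
  proof (rule that)
    show "0 \<le> (\<integral>s. g s \<partial>lborel)" using g0 by (intro integral_nonneg_AE AE_I2)
    fix f :: "real \<times> 'x \<Rightarrow> real" and z assume f: "cper f" "\<And>x. 0 \<le> f x"
    show "conv (\<lambda>z. K z * indicator {z. fst z \<ge> e} z) f z \<le> (\<integral>s. g s \<partial>lborel) * avg f"
    proof (rule conv_upper[OF _ g f])
      show "integrable lborel (\<lambda>z. K z * indicator {z. e \<le> fst z} z)"
        using K_integrable by (intro integrable_real_mult_indicator) auto
      fix y s :: "real \<times> 'x" assume ys: "y - s \<in> cell"
      show "K y * indicator {z. e \<le> fst z} y \<le> g s"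
      proof (cases "e \<le> fst y")
        case True
        have B: "0 \<le> (y - s) \<bullet> b \<and> (y - s) \<bullet> b \<le> 1" if "b \<in> Basis" for b
          using ys that by (simp add: mem_box)
        have 0: "\<bar>fst s\<bar> \<le> fst y + 1"
          using B[of "(1, 0)"] True e by (auto simp: Basis_prod_def inner_prod_def)
        have "\<bar>snd s \<bullet> b\<bar> \<le> \<bar>snd y \<bullet> b\<bar> + 1" if "b \<in> Basis" for b
          using B[of "(0, b)"] that by (auto simp: Basis_prod_def inner_prod_def inner_diff_left)
        then have "(\<Sum>b\<in>Basis. \<bar>snd s \<bullet> b\<bar>) \<le> (\<Sum>b\<in>Basis. \<bar>snd y \<bullet> b\<bar> + 1)"
          by (intro sum_mono)
        also have "\<dots> = (\<Sum>b\<in>Basis. \<bar>snd y \<bullet> b\<bar>) + n"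
          by (simp add: sum.distrib n_def)
        finally have "(\<eta> / n) * (\<Sum>b\<in>Basis. \<bar>snd s \<bullet> b\<bar>) \<le> (\<eta> / n) * ((\<Sum>b\<in>Basis. \<bar>snd y \<bullet> b\<bar>) + n)"
          using \<eta> n by (intro mult_left_mono) auto
        then have 1: "(\<eta> / n) * (\<Sum>b\<in>Basis. \<bar>snd s \<bullet> b\<bar>) \<le> (\<eta> / n) * (\<Sum>b\<in>Basis. \<bar>snd y \<bullet> b\<bar>) + \<eta>"
          using n by (simp add: field_simps)
        have "(\<mu> / 2) * \<bar>fst s\<bar> \<le> (\<mu> / 2) * (fst y + 1)"
          using 0 \<mu>_pos by (intro mult_left_mono) auto
        then have "- (\<mu> / 2) * fst y - (\<eta> / n) * (\<Sum>b\<in>Basis. \<bar>snd y \<bullet> b\<bar>)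
            \<le> \<mu> / 2 + \<eta> - (\<mu> / 2) * \<bar>fst s\<bar> - (\<eta> / n) * (\<Sum>b\<in>Basis. \<bar>snd s \<bullet> b\<bar>)"
          using 1 by (simp add: algebra_simps)
        then have "A * exp (- (\<mu> / 2) * fst y - (\<eta> / n) * (\<Sum>b\<in>Basis. \<bar>snd y \<bullet> b\<bar>)) \<le> g s"
          unfolding g_eq using A by (intro mult_left_mono) auto
        then show ?thesis using bound[OF True] True by simp
      qed (simp add: g0)
    qed (use K_nonneg g0 in auto)
  qed
qed

text \<open>The initial layer of the kernel has mass at most \<open>e\<close> and is tested against
  the supremum; the tail is tested against the mean only. A small \<open>e\<close> thus allows the
  supremum to be absorbed.\<close>

lemma R_upper:
  assumes e: "e > 0"
  obtains C where "C > 0" "\<And>f z M. cper f \<Longrightarrow> (\<And>x. 0 \<le> f x) \<Longrightarrow> (\<And>x. f x \<le> M) \<Longrightarrow> R f z \<le> e * M + C * avg f"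
proof -
  obtain C where C: "C \<ge> 0" "\<And>f z. cper f \<Longrightarrow> (\<And>x. 0 \<le> f x) \<Longrightarrow> conv (\<lambda>z. K z * indicator {z. fst z \<ge> e} z) f z \<le> C * avg f"
    using K_tail[OF e] by blast
  have [measurable]: "{z. fst z < e} \<in> sets (borel :: (real \<times> 'x) measure)" "{z. e \<le> fst z} \<in> sets (borel :: (real \<times> 'x) measure)"
    by (intro borel_open open_Collect_less borel_closed closed_Collect_le continuous_intros)+
  show thesis
  proof (rule that[of "C + 1"])
    show "C + 1 > 0" using C by simp
    fix f :: "real \<times> 'x \<Rightarrow> real" and z M assume f: "cper f" "\<And>x. 0 \<le> f x" and M: "\<And>x. f x \<le> M"
    let ?K1 = "\<lambda>z. K z * indicator {z. fst z < e} z" and ?K2 = "\<lambda>z. K z * indicator {z. fst z \<ge> e} z"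
    have i1: "integrable lborel ?K1" and i2: "integrable lborel ?K2"
      using K_integrable by (intro integrable_real_mult_indicator; simp)+
    have "R f z = (\<integral>y. ?K1 y * f (z + y) + ?K2 y * f (z + y) \<partial>lborel)"
      unfolding R_def conv_def by (intro Bochner_Integration.integral_cong) (auto simp: indicator_def)
    also have "\<dots> = conv ?K1 f z + conv ?K2 f z"
      unfolding conv_def by (rule Bochner_Integration.integral_add) (use conv_integrable[OF i1 f(1)] conv_integrable[OF i2 f(1)] in auto)
    also have "conv ?K1 f z \<le> (\<integral>y. \<bar>?K1 y\<bar> \<partial>lborel) * M"
      using conv_bound[OF i1 f(1), of M z] f(2) M by (simp add: abs_le_iff)
    also have "(\<integral>y. \<bar>?K1 y\<bar> \<partial>lborel) = (\<integral>y. ?K1 y \<partial>lborel)"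
      by (simp add: K_nonneg abs_mult)
    also have "(\<integral>y. ?K1 y \<partial>lborel) * M \<le> e * M"
      using K_initial[OF e] f(2)[of 0] M[of 0] by (intro mult_right_mono) auto
    also have "conv ?K2 f z \<le> C * avg f"
      by (rule C(2)[OF f])
    also have "C * avg f \<le> (C + 1) * avg f"
      using avg_nonneg[OF f] by (intro mult_right_mono) auto
    finally show "R f z \<le> e * M + (C + 1) * avg f" by simp
  qed
qed

lemma R_lower:
  obtains d where "d > 0" "\<And>f z. cper f \<Longrightarrow> (\<And>x. 0 \<le> f x) \<Longrightarrow> d * avg f \<le> R f z"
proof -
  obtain d where d: "d > 0" "\<And>y. y \<in> cbox (1, 0) ((1, 0) + One) \<Longrightarrow> d \<le> K y"
    using K_lower by blast
  show thesis
    by (rule that[OF d(1)]) (use conv_lower[OF K_integrable _ _ K_nonneg d(2)] in \<open>simp add: R_def\<close>)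
qed

section \<open>Algebra of the resolvent and the Gaussian semigroup behind it\<close>

lemma R_avg: "cper f \<Longrightarrow> avg (R f) = avg f / \<mu>"
  unfolding R_def by (simp add: conv_avg[OF K_integrable] K_integral)

lemma R_add: "cper f \<Longrightarrow> cper g \<Longrightarrow> R (\<lambda>z. f z + g z) z = R f z + R g z"
  unfolding R_def by (rule conv_add[OF K_integrable])

lemma R_diff: "cper f \<Longrightarrow> cper g \<Longrightarrow> R (\<lambda>z. f z - g z) z = R f z - R g z"
  unfolding R_def by (rule conv_diff[OF K_integrable])

lemma R_cmult: "R (\<lambda>z. r * f z) z = r * R f z"
  unfolding R_def by (rule conv_cmult)

lemma R_sum:
  assumes "finite I" "\<And>i. i \<in> I \<Longrightarrow> cper (f i)"
  shows "R (\<lambda>z. \<Sum>i\<in>I. f i z) z = (\<Sum>i\<in>I. R (f i) z)"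
  using assms
proof (induction I)
  case empty
  show ?case by (simp add: R_def conv_def)
next
  case (insert i I)
  then have "R (\<lambda>z. f i z + (\<Sum>i\<in>I. f i z)) z = R (f i) z + R (\<lambda>z. \<Sum>i\<in>I. f i z) z"
    by (intro R_add cper_sum) auto
  then show ?case using insert by simp
qed

lemma R_pd: "has_pd f b g \<Longrightarrow> cper f \<Longrightarrow> cper g \<Longrightarrow> has_pd (R f) b (R g)"
  unfolding R_def by (rule conv_pd[OF K_integrable])

lemma R_slice:
  assumes f: "cper f"
  shows "integrable lborel (\<lambda>r. indicator {0<..} r * exp (- \<mu> * r) * (\<integral>\<zeta>. gauss \<zeta> * f ((t, x) + (r, r *\<^sub>R c + sqrt (2 * a * r) *\<^sub>R \<zeta>)) \<partial>lborel))"
    and "R f (t, x) = (\<integral>r. indicator {0<..} r * exp (- \<mu> * r) * (\<integral>\<zeta>. gauss \<zeta> * f ((t, x) + (r, r *\<^sub>R c + sqrt (2 * a * r) *\<^sub>R \<zeta>)) \<partial>lborel) \<partial>lborel)"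
proof -
  have [measurable]: "f \<in> borel_measurable borel" by (rule cper_measurable[OF f])
  have int: "integrable (lborel \<Otimes>\<^sub>M lborel) (\<lambda>z. K z * f ((t, x) + z))"
    using conv_integrable[OF K_integrable f, of "(t, x)"] by (simp add: lborel_prod)
  have slice: "(\<integral>y. K (r, y) * f ((t, x) + (r, y)) \<partial>lborel) = indicator {0<..} r * exp (- \<mu> * r) * (\<integral>\<zeta>. gauss \<zeta> * f ((t, x) + (r, r *\<^sub>R c + sqrt (2 * a * r) *\<^sub>R \<zeta>)) \<partial>lborel)" for r
  proof (cases "r > 0")
    case True
    have [measurable]: "(\<lambda>y. f ((t, x) + (r, y))) \<in> borel_measurable borel"
      by (intro borel_measurable_continuous_onI continuous_on_compose2[OF cperD(1)[OF f]] continuous_intros) auto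
    have "(\<integral>y. K (r, y) * f ((t, x) + (r, y)) \<partial>lborel) = (\<integral>y. exp (- \<mu> * r) * (hker r y * f ((t, x) + (r, y))) \<partial>lborel)"
      using True by (simp add: K_def mult.assoc)
    also have "\<dots> = exp (- \<mu> * r) * (\<integral>y. hker r y * f ((t, x) + (r, y)) \<partial>lborel)"
      by simp
    also have "(\<integral>y. hker r y * f ((t, x) + (r, y)) \<partial>lborel) = (\<integral>\<zeta>. gauss \<zeta> * f ((t, x) + (r, r *\<^sub>R c + sqrt (2 * a * r) *\<^sub>R \<zeta>)) \<partial>lborel)"
      by (rule hker_slice[OF True]) measurable
    finally show ?thesis using True by simp
  qed (simp add: K_def)
  show "integrable lborel (\<lambda>r. indicator {0<..} r * exp (- \<mu> * r) * (\<integral>\<zeta>. gauss \<zeta> * f ((t, x) + (r, r *\<^sub>R c + sqrt (2 * a * r) *\<^sub>R \<zeta>)) \<partial>lborel))"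
    unfolding slice[symmetric] using lborel_pair.integrable_fst'[OF int] .
  show "R f (t, x) = (\<integral>r. indicator {0<..} r * exp (- \<mu> * r) * (\<integral>\<zeta>. gauss \<zeta> * f ((t, x) + (r, r *\<^sub>R c + sqrt (2 * a * r) *\<^sub>R \<zeta>)) \<partial>lborel) \<partial>lborel)"
    unfolding slice[symmetric] R_def conv_def
    using lborel_pair.integral_fst'[OF int] by (simp add: lborel_prod)
qed

lemma LL_cper: "C12 f ft D H \<Longrightarrow> cper (LL ft D H)"
  unfolding LL_def C12_def by (intro cper_add cper_cmult cper_sum) auto

lemma gauss_f_integrable:
  assumes "cper f" "continuous_on UNIV g"
  shows "integrable lborel (\<lambda>\<zeta>::'x. gauss \<zeta> * f (g \<zeta>))"
proof -
  obtain M where M: "\<And>z. norm (f z) \<le> M" using cper_bounded[OF assms(1)] by metis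
  have [measurable]: "(\<lambda>\<zeta>. f (g \<zeta>)) \<in> borel_measurable borel"
    by (intro borel_measurable_continuous_onI continuous_on_compose2[OF cperD(1)[OF assms(1)] assms(2)]) auto
  show ?thesis
    by (rule Bochner_Integration.integrable_bound[of _ "\<lambda>\<zeta>. gauss \<zeta> * M"])
      (use gauss_integrable order_trans[OF M abs_ge_self] in \<open>auto simp: abs_mult intro!: AE_I2 mult_left_mono\<close>)
qed

text \<open>The chain rule yields \<open>ft\<close>, the drift terms and
  \<open>?q r * (\<zeta> \<bullet> b) * D b\<close>, where \<open>?q\<close> is the derivative of
  \<open>sqrt (2 * a * r)\<close>. Gaussian integration by parts trades the factor
  \<open>\<zeta> \<bullet> b\<close> for \<open>sqrt (2 * a * r) * H b\<close>, and
  \<open>?q r * sqrt (2 * a * r) = a\<close> produces the Laplacian.\<close>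

lemma semigroup_deriv:
  assumes C: "C12 f ft D H" and r: "r > 0"
  shows "((\<lambda>r. \<integral>\<zeta>. gauss \<zeta> * f ((t, x) + (r, r *\<^sub>R c + sqrt (2 * a * r) *\<^sub>R \<zeta>)) \<partial>lborel) has_real_derivative
     (\<integral>\<zeta>. gauss \<zeta> * LL ft D H ((t, x) + (r, r *\<^sub>R c + sqrt (2 * a * r) *\<^sub>R \<zeta>)) \<partial>lborel)) (at r)"
proof -
  have f: "cper f" "cper ft" "has_pd f (1, 0) ft"
    and D: "\<And>b. b \<in> Basis \<Longrightarrow> has_pd f (0, b) (D b)" "\<And>b. b \<in> Basis \<Longrightarrow> cper (D b)"
    and H: "\<And>b. b \<in> Basis \<Longrightarrow> has_pd (D b) (0, b) (H b)" "\<And>b. b \<in> Basis \<Longrightarrow> cper (H b)"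
    using C unfolding C12_def by auto
  let ?p = "\<lambda>s \<zeta>. (t, x) + (s, s *\<^sub>R c + sqrt (2 * a * s) *\<^sub>R \<zeta>)"
  let ?q = "\<lambda>s. sqrt (2 * a) / (2 * sqrt s)"
  let ?F' = "\<lambda>s \<zeta>. gauss \<zeta> * (ft (?p s \<zeta>) + (\<Sum>b\<in>Basis. (c \<bullet> b + ?q s * (\<zeta> \<bullet> b)) * D b (?p s \<zeta>)))"
  have pc: "continuous_on UNIV (?p s)" for s by (intro continuous_intros)
  obtain M0 where M0: "\<And>z. norm (ft z) \<le> M0" using cper_bounded[OF f(2)] by metis
  have "\<forall>b\<in>Basis. \<exists>M. \<forall>z. norm (D b z) \<le> M" using cper_bounded[OF D(2)] by metis
  then obtain M1 where M1: "\<And>b z. b \<in> Basis \<Longrightarrow> norm (D b z) \<le> M1 b" by metis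
  have M1_0: "M1 b \<ge> 0" if "b \<in> Basis" for b using M1[OF that, of 0] norm_ge_zero order_trans by blast
  have fd: "(f has_derivative (\<lambda>h. fst h * ft z + (\<Sum>b\<in>Basis. (snd h \<bullet> b) * D b z))) (at z)" for z
  proof -
    have "(f has_derivative (\<lambda>h. \<Sum>b\<in>Basis. (h \<bullet> b) * (if fst b = 0 then D (snd b) z else ft z))) (at z)"
      by (rule C1_has_derivative)
        (use f D in \<open>auto simp: Basis_prod_def cper_def cong: if_cong\<close>)
    also have "(\<lambda>h. \<Sum>b\<in>Basis. (h \<bullet> b) * (if fst b = 0 then D (snd b) z else ft z))
        = (\<lambda>h. fst h * ft z + (\<Sum>b\<in>Basis. (snd h \<bullet> b) * D b z))"
    proof
      fix h :: "real \<times> 'x"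
      show "(\<Sum>b\<in>Basis. (h \<bullet> b) * (if fst b = 0 then D (snd b) z else ft z)) = fst h * ft z + (\<Sum>b\<in>Basis. (snd h \<bullet> b) * D b z)"
        by (cases h) (simp add: sum_Basis_prod)
    qed
    finally show ?thesis .
  qed
  have der: "((\<lambda>s. gauss \<zeta> * f (?p s \<zeta>)) has_real_derivative ?F' s \<zeta>) (at s)" if "s > 0" for s \<zeta>
  proof -
    have sq: "((\<lambda>s. sqrt (2 * a * s)) has_real_derivative ?q s) (at s)"
    proof -
      have "((\<lambda>s. sqrt (2 * a) * sqrt s) has_real_derivative sqrt (2 * a) * (inverse (sqrt s) / 2)) (at s)"
        by (intro DERIV_cmult DERIV_real_sqrt that)
      then show ?thesis by (simp add: real_sqrt_mult field_simps)
    qed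
    have p: "((\<lambda>s. ?p s \<zeta>) has_derivative (\<lambda>h. (h, h *\<^sub>R (c + ?q s *\<^sub>R \<zeta>)))) (at s)"
      by (rule derivative_eq_intros has_derivative_Pair sq[unfolded has_field_derivative_def] refl | simp add: algebra_simps)+
    have "((\<lambda>s. f (?p s \<zeta>)) has_derivative (\<lambda>h. h * (ft (?p s \<zeta>) + (\<Sum>b\<in>Basis. (c \<bullet> b + ?q s * (\<zeta> \<bullet> b)) * D b (?p s \<zeta>))))) (at s)"
      using has_derivative_compose[OF p fd]
      by (simp add: inner_add_left sum_distrib_left algebra_simps)
    then have "((\<lambda>s. f (?p s \<zeta>)) has_real_derivative (ft (?p s \<zeta>) + (\<Sum>b\<in>Basis. (c \<bullet> b + ?q s * (\<zeta> \<bullet> b)) * D b (?p s \<zeta>)))) (at s)"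
      by (simp add: has_field_derivative_def mult.commute[of _ "ft _ + _"])
    then show ?thesis by (rule DERIV_cmult)
  qed
  have "((\<lambda>s. \<integral>\<zeta>. gauss \<zeta> * f (?p s \<zeta>) \<partial>lborel) has_real_derivative (\<integral>\<zeta>. ?F' r \<zeta> \<partial>lborel)) (at r)"
  \<comment> \<open>A window of half the size of \<open>r\<close> keeps the parameter above
    \<open>r / 2\<close>, where \<open>?q\<close> stays below its value at
    \<open>r / 2\<close>.\<close>
  proof (rule DERIV_integral_param[where e = "r / 2" and
        G = "\<lambda>\<zeta>. gauss \<zeta> * (M0 + (\<Sum>b\<in>Basis. \<bar>c \<bullet> b\<bar> * M1 b)) + gauss \<zeta> * norm \<zeta> * (\<Sum>b\<in>Basis. ?q (r / 2) * M1 b)"])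
    show "r / 2 > 0" using r by simp
    show "integrable lborel (\<lambda>\<zeta>. gauss \<zeta> * f (?p s \<zeta>))" for s
      by (rule gauss_f_integrable[OF f(1) pc])
    show "((\<lambda>s. gauss \<zeta> * f (?p s \<zeta>)) has_real_derivative ?F' s \<zeta>) (at s)" if "\<bar>s - r\<bar> < r / 2" for s \<zeta>
    proof (rule der)
      show "s > 0" using that r by linarith
    qed
    show "\<bar>?F' s \<zeta>\<bar> \<le> gauss \<zeta> * (M0 + (\<Sum>b\<in>Basis. \<bar>c \<bullet> b\<bar> * M1 b)) + gauss \<zeta> * norm \<zeta> * (\<Sum>b\<in>Basis. ?q (r / 2) * M1 b)"
      if s: "\<bar>s - r\<bar> < r / 2" for s \<zeta>
    proof -
      have s2: "s > r / 2" using s r by (auto simp: abs_if split: if_splits)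
      have q: "0 \<le> ?q s" "?q s \<le> ?q (r / 2)"
        using s2 r a_pos by (auto intro!: divide_left_mono)
      have "\<bar>\<Sum>b\<in>Basis. (c \<bullet> b + ?q s * (\<zeta> \<bullet> b)) * D b (?p s \<zeta>)\<bar> \<le> (\<Sum>b\<in>Basis. (\<bar>c \<bullet> b\<bar> + ?q (r / 2) * norm \<zeta>) * M1 b)"
      proof (rule order_trans[OF sum_abs sum_mono])
        fix b :: 'x assume b: "b \<in> Basis"
        have "\<bar>c \<bullet> b + ?q s * (\<zeta> \<bullet> b)\<bar> \<le> \<bar>c \<bullet> b\<bar> + ?q s * \<bar>\<zeta> \<bullet> b\<bar>"
          using abs_triangle_ineq[of "c \<bullet> b" "?q s * (\<zeta> \<bullet> b)"] by (simp only: abs_mult abs_of_nonneg[OF q(1)])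
        also have "\<dots> \<le> \<bar>c \<bullet> b\<bar> + ?q (r / 2) * norm \<zeta>"
          using q Basis_le_norm[OF b, of \<zeta>] by (intro add_left_mono mult_mono) auto
        finally show "\<bar>(c \<bullet> b + ?q s * (\<zeta> \<bullet> b)) * D b (?p s \<zeta>)\<bar> \<le> (\<bar>c \<bullet> b\<bar> + ?q (r / 2) * norm \<zeta>) * M1 b"
          unfolding abs_mult using M1[OF b, of "?p s \<zeta>"] q by (intro mult_mono) auto
      qed
      then have "\<bar>ft (?p s \<zeta>) + (\<Sum>b\<in>Basis. (c \<bullet> b + ?q s * (\<zeta> \<bullet> b)) * D b (?p s \<zeta>))\<bar>
          \<le> M0 + (\<Sum>b\<in>Basis. (\<bar>c \<bullet> b\<bar> + ?q (r / 2) * norm \<zeta>) * M1 b)"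
        using M0[of "?p s \<zeta>"] by (intro order_trans[OF abs_triangle_ineq add_mono]) auto
      also have "\<dots> = (M0 + (\<Sum>b\<in>Basis. \<bar>c \<bullet> b\<bar> * M1 b)) + norm \<zeta> * (\<Sum>b\<in>Basis. ?q (r / 2) * M1 b)"
      proof -
        have "(\<Sum>b\<in>Basis. (\<bar>c \<bullet> b\<bar> + Q * norm \<zeta>) * M1 b) = (\<Sum>b\<in>Basis. \<bar>c \<bullet> b\<bar> * M1 b) + norm \<zeta> * (\<Sum>b\<in>Basis. Q * M1 b)" for Q
          by (simp add: algebra_simps sum.distrib sum_distrib_left)
        then show ?thesis by (simp only: add.assoc)
      qed
      finally have "gauss \<zeta> * \<bar>ft (?p s \<zeta>) + (\<Sum>b\<in>Basis. (c \<bullet> b + ?q s * (\<zeta> \<bullet> b)) * D b (?p s \<zeta>))\<bar>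
         \<le> gauss \<zeta> * ((M0 + (\<Sum>b\<in>Basis. \<bar>c \<bullet> b\<bar> * M1 b)) + norm \<zeta> * (\<Sum>b\<in>Basis. ?q (r / 2) * M1 b))"
        by (intro mult_left_mono) auto
      then show ?thesis
        by (subst abs_mult) (simp only: abs_of_nonneg[OF gauss_nonneg] distrib_left[of "gauss \<zeta>"] mult.assoc)
    qed
    show "integrable lborel (\<lambda>\<zeta>::'x. gauss \<zeta> * (M0 + (\<Sum>b\<in>Basis. \<bar>c \<bullet> b\<bar> * M1 b)) + gauss \<zeta> * norm \<zeta> * (\<Sum>b\<in>Basis. ?q (r / 2) * M1 b))"
      using gauss_integrable gauss_norm_integrable by (intro Bochner_Integration.integrable_add integrable_mult_left) auto
    show "?F' r \<in> borel_measurable lborel"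
    proof -
      have "continuous_on UNIV (?F' r)"
        by (intro continuous_intros gauss_continuous
          continuous_on_compose2[OF cperD(1)[OF f(2)] pc] continuous_on_compose2[OF cperD(1)[OF D(2)] pc]) (use r in auto)
      then show ?thesis
        using borel_measurable_continuous_onI by auto
    qed
  qed
  moreover have "(\<integral>\<zeta>. ?F' r \<zeta> \<partial>lborel) = (\<integral>\<zeta>. gauss \<zeta> * LL ft D H (?p r \<zeta>) \<partial>lborel)"
  proof -
    have i1: "integrable lborel (\<lambda>\<zeta>. gauss \<zeta> * ft (?p r \<zeta>))"
      by (rule gauss_f_integrable[OF f(2) pc])
    have i2: "integrable lborel (\<lambda>\<zeta>. gauss \<zeta> * D b (?p r \<zeta>))" if "b \<in> Basis" for b
      by (rule gauss_f_integrable[OF D(2)[OF that] pc])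
    have i3: "integrable lborel (\<lambda>\<zeta>. gauss \<zeta> * H b (?p r \<zeta>))" if "b \<in> Basis" for b
      by (rule gauss_f_integrable[OF H(2)[OF that] pc])
    have Dm: "(\<lambda>\<zeta>. D b (?p r \<zeta>)) \<in> borel_measurable borel" "(\<lambda>\<zeta>. H b (?p r \<zeta>)) \<in> borel_measurable borel" if "b \<in> Basis" for b
      by (intro borel_measurable_continuous_onI continuous_on_compose2[OF cperD(1)[OF D(2)[OF that]] pc]
        continuous_on_compose2[OF cperD(1)[OF H(2)[OF that]] pc]; simp)+
    have i4: "integrable lborel (\<lambda>\<zeta>. gauss \<zeta> * (\<zeta> \<bullet> b) * D b (?p r \<zeta>))" if b: "b \<in> Basis" for b
    proof (rule Bochner_Integration.integrable_bound)
      show "integrable lborel (\<lambda>\<zeta>::'x. gauss \<zeta> * norm \<zeta> * M1 b)"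
        by (intro integrable_mult_left gauss_norm_integrable)
      show "AE \<zeta> in lborel. norm (gauss \<zeta> * (\<zeta> \<bullet> b) * D b (?p r \<zeta>)) \<le> norm (gauss \<zeta> * norm \<zeta> * M1 b)"
        using Basis_le_norm[OF b] M1[OF b] M1_0[OF b]
        by (intro AE_I2) (auto simp: abs_mult mult.assoc intro!: mult_left_mono mult_mono)
    qed (use Dm[OF b] in measurable)
    have stein: "?q r * (\<integral>\<zeta>. gauss \<zeta> * (\<zeta> \<bullet> b) * D b (?p r \<zeta>) \<partial>lborel) = a * (\<integral>\<zeta>. gauss \<zeta> * H b (?p r \<zeta>) \<partial>lborel)" if b: "b \<in> Basis" for b
    proof -
      let ?s = "sqrt (2 * a * r)"
      obtain M2 where M2: "\<And>z. norm (H b z) \<le> M2" using cper_bounded[OF H(2)[OF b]] by metis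
      have "(\<integral>\<zeta>. gauss \<zeta> * (\<zeta> \<bullet> b) * D b (?p r \<zeta>) \<partial>lborel) = (\<integral>\<zeta>. gauss \<zeta> * (?s * H b (?p r \<zeta>)) \<partial>lborel)"
      proof (rule gauss_stein[OF b, where M = "M1 b" and M' = "?s * M2"])
        show "has_pd (\<lambda>\<zeta>. D b (?p r \<zeta>)) b (\<lambda>\<zeta>. ?s * H b (?p r \<zeta>))"
          unfolding has_pd_def
        proof
          fix \<zeta>
          have "((\<lambda>u. D b (?p r \<zeta> + u *\<^sub>R (0, b))) has_real_derivative H b (?p r \<zeta> + (0 * ?s) *\<^sub>R (0, b))) (at (0 * ?s))"
            by (rule has_pd_at[OF H(1)[OF b]])
          then have "((\<lambda>u. D b (?p r \<zeta> + (u * ?s) *\<^sub>R (0, b))) has_real_derivative H b (?p r \<zeta> + (0 * ?s) *\<^sub>R (0, b)) * ?s) (at 0)"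
            by (rule DERIV_chain2) (auto intro!: derivative_eq_intros)
          then show "((\<lambda>u. D b (?p r (\<zeta> + u *\<^sub>R b))) has_real_derivative ?s * H b (?p r \<zeta>)) (at 0)"
            by (simp add: algebra_simps)
        qed
        show "\<bar>?s * H b (?p r \<zeta>)\<bar> \<le> ?s * M2" for \<zeta>
          using M2 r a_pos by (auto simp: abs_mult intro: mult_left_mono)
      qed (use M1[OF b] Dm[OF b] in auto)
      also have "\<dots> = ?s * (\<integral>\<zeta>. gauss \<zeta> * H b (?p r \<zeta>) \<partial>lborel)"
        by (subst integral_mult_right_zero[symmetric]) (simp add: mult_ac)
      finally show ?thesis
        using r a_pos by (simp add: real_sqrt_mult field_simps)
    qed
    have "(\<integral>\<zeta>. ?F' r \<zeta> \<partial>lborel) = (\<integral>\<zeta>. gauss \<zeta> * ft (?p r \<zeta>) + (\<Sum>b\<in>Basis. (c \<bullet> b) * (gauss \<zeta> * D b (?p r \<zeta>)) + ?q r * (gauss \<zeta> * (\<zeta> \<bullet> b) * D b (?p r \<zeta>))) \<partial>lborel)"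
      by (intro Bochner_Integration.integral_cong refl) (simp add: algebra_simps sum_distrib_left)
    also have "\<dots> = (\<integral>\<zeta>. gauss \<zeta> * ft (?p r \<zeta>) \<partial>lborel) + (\<Sum>b\<in>Basis. (c \<bullet> b) * (\<integral>\<zeta>. gauss \<zeta> * D b (?p r \<zeta>) \<partial>lborel) + ?q r * (\<integral>\<zeta>. gauss \<zeta> * (\<zeta> \<bullet> b) * D b (?p r \<zeta>) \<partial>lborel))"
      using i1 i2 i4 by (rule integral_add_sum)
    also have "\<dots> = (\<integral>\<zeta>. gauss \<zeta> * ft (?p r \<zeta>) \<partial>lborel) + (\<Sum>b\<in>Basis. (c \<bullet> b) * (\<integral>\<zeta>. gauss \<zeta> * D b (?p r \<zeta>) \<partial>lborel) + a * (\<integral>\<zeta>. gauss \<zeta> * H b (?p r \<zeta>) \<partial>lborel))"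
      using stein by simp
    also have "\<dots> = (\<integral>\<zeta>. gauss \<zeta> * ft (?p r \<zeta>) + (\<Sum>b\<in>Basis. (c \<bullet> b) * (gauss \<zeta> * D b (?p r \<zeta>)) + a * (gauss \<zeta> * H b (?p r \<zeta>))) \<partial>lborel)"
      using i1 i2 i3 by (rule integral_add_sum[symmetric])
    also have "\<dots> = (\<integral>\<zeta>. gauss \<zeta> * LL ft D H (?p r \<zeta>) \<partial>lborel)"
      by (intro Bochner_Integration.integral_cong refl)
        (simp add: LL_def algebra_simps sum_distrib_left sum.distrib)
    finally show ?thesis .
  qed
  ultimately show ?thesis by simp
qed

end

section \<open>Uniqueness and regularity in time\<close>

lemma uniform_limit_cmult:
  fixes f :: "nat \<Rightarrow> 'a \<Rightarrow> real"
  assumes "uniform_limit S f g F"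
  shows "uniform_limit S (\<lambda>n x. r * f n x) (\<lambda>x. r * g x) F"
  using bounded_linear.uniform_limit[OF bounded_linear_mult_right assms] .

lemma uniform_limit_sum:
  fixes f :: "'i \<Rightarrow> nat \<Rightarrow> 'a \<Rightarrow> real"
  assumes "finite I" "\<And>i. i \<in> I \<Longrightarrow> uniform_limit S (f i) (g i) F"
  shows "uniform_limit S (\<lambda>n x. \<Sum>i\<in>I. f i n x) (\<lambda>x. \<Sum>i\<in>I. g i x) F"
  using assms
  by (induction I) (auto intro: uniform_limit_intros)

text \<open>Averaging in time makes a function differentiable in time while commuting with \<open>R\<close> and the
  spatial derivatives. Letting \<open>e\<close> tend to 0 shows that \<open>R f\<close> is differentiable in time even when
  \<open>f\<close> is not.\<close>

definition tav :: "real \<Rightarrow> (real \<times> 'x::euclidean_space \<Rightarrow> real) \<Rightarrow> real \<times> 'x \<Rightarrow> real" where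
  "tav e f z = integral (cbox 0 1) (\<lambda>s. f (z + (e * s) *\<^sub>R (1, 0)))"

lemma tav_cper:
  assumes f: "cper f"
  shows "cper (tav e f)"
proof (rule cperI)
  show "continuous_on UNIV (tav e f)"
    unfolding tav_def
  proof (rule integral_continuous_on_param)
    show "continuous_on (UNIV \<times> cbox 0 1) (\<lambda>(z, s). f (z + (e * s) *\<^sub>R (1, 0)))"
      unfolding split_beta
      by (intro continuous_on_compose2[OF cperD(1)[OF f]] continuous_intros) auto
  qed
  show "per (tav e f)"
    unfolding per_def tav_def
  proof (intro allI ballI)
    fix x b :: "real \<times> 'a" assume b: "b \<in> Basis"
    have "f (x + b + (e * s) *\<^sub>R (1, 0)) = f (x + (e * s) *\<^sub>R (1, 0))" for s
    proof -
      have "x + b + (e * s) *\<^sub>R (1, 0) = (x + (e * s) *\<^sub>R (1, 0)) + b" by simp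
      then show ?thesis using cperD(2)[OF f] b unfolding per_def by metis
    qed
    then show "integral (cbox 0 1) (\<lambda>s. f (x + b + (e * s) *\<^sub>R (1, 0))) = integral (cbox 0 1) (\<lambda>s. f (x + (e * s) *\<^sub>R (1, 0)))"
      by simp
  qed
qed

lemma tav_pd:
  assumes fg: "has_pd f b g" and f: "cper f" and g: "cper g"
  shows "has_pd (tav e f) b (tav e g)"
  unfolding has_pd_def
proof
  fix z
  have "((\<lambda>u. integral (cbox 0 1) (\<lambda>s. f (z + u *\<^sub>R b + (e * s) *\<^sub>R (1, 0)))) has_field_derivative
      integral (cbox 0 1) (\<lambda>s. g (z + 0 *\<^sub>R b + (e * s) *\<^sub>R (1, 0)))) (at 0 within UNIV)"
  proof (rule leibniz_rule_field_derivative)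
    fix u s :: real
    have "((\<lambda>u. f ((z + (e * s) *\<^sub>R (1, 0)) + u *\<^sub>R b)) has_real_derivative g ((z + (e * s) *\<^sub>R (1, 0)) + u *\<^sub>R b)) (at u)"
      by (rule has_pd_at[OF fg])
    then show "((\<lambda>u. f (z + u *\<^sub>R b + (e * s) *\<^sub>R (1, 0))) has_field_derivative g (z + u *\<^sub>R b + (e * s) *\<^sub>R (1, 0))) (at u within UNIV)"
      by (simp add: add_ac)
  next
    show "(\<lambda>s. f (z + u *\<^sub>R b + (e * s) *\<^sub>R (1, 0))) integrable_on cbox 0 1" for u
      by (intro integrable_continuous continuous_on_compose2[OF cperD(1)[OF f]] continuous_intros) auto
    show "continuous_on (UNIV \<times> cbox 0 1) (\<lambda>(u, s). g (z + u *\<^sub>R b + (e * s) *\<^sub>R (1, 0)))"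
      unfolding split_beta
      by (intro continuous_on_compose2[OF cperD(1)[OF g]] continuous_intros) auto
  qed auto
  then show "((\<lambda>s. tav e f (z + s *\<^sub>R b)) has_real_derivative tav e g z) (at 0)"
    by (simp add: tav_def)
qed

text \<open>With \<open>F\<close> a primitive along the time line, the average is
  \<open>(F (u + e) - F u) / e\<close>; its derivative is a difference quotient of \<open>f\<close>,
  continuous without any differentiability of \<open>f\<close>.\<close>

lemma tav_time:
  assumes f: "cper f" and e: "e > 0"
  shows "has_pd (tav e f) (1, 0) (\<lambda>z. (f (z + e *\<^sub>R (1, 0)) - f z) / e)"
proof (rule has_pd_of_integral)
  show "continuous_on UNIV (\<lambda>z. (f (z + e *\<^sub>R (1, 0)) - f z) / e)"
    using e by (intro continuous_intros continuous_on_compose2[OF cperD(1)[OF f]] cperD(1)[OF f]) auto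
  fix z :: "real \<times> 'a" and h :: real assume h: "0 \<le> h"
  define \<phi> where "\<phi> u = f (z + u *\<^sub>R (1, 0))" for u
  have \<phi>: "continuous_on S \<phi>" for S
    unfolding \<phi>_def by (intro continuous_on_compose2[OF cperD(1)[OF f]] continuous_intros) auto
  \<comment> \<open>Starting the primitive at -1 makes 0 an interior point, where the derivative is
    two-sided.\<close>
  define F where "F u = integral {-1..u} \<phi>" for u
  have F: "(F has_real_derivative \<phi> u) (at u)" if "u \<ge> 0" for u
  proof -
    have "(F has_real_derivative \<phi> u) (at u within {-1..u + 1})"
      unfolding F_def by (rule integral_has_real_derivative[OF \<phi>]) (use that in auto)
    then show ?thesis using that by (simp add: at_within_Icc_at)
  qed
  have 1: "integral (cbox 0 1) (\<lambda>s. \<phi> (v + e * s)) = (F (v + e) - F v) / e" if "v \<ge> 0" for v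
  proof -
    have "((\<lambda>s. \<phi> (v + e * s)) has_integral (F (v + e * 1) / e - F (v + e * 0) / e)) {0..1}"
    proof (rule fundamental_theorem_of_calculus)
      fix s :: real assume s: "s \<in> {0..1}"
      have "((\<lambda>s. F (v + e * s)) has_real_derivative \<phi> (v + e * s) * e) (at s)"
        by (rule DERIV_chain2[OF F]) (use that s e in \<open>auto intro!: derivative_eq_intros\<close>)
      then have "((\<lambda>s. F (v + e * s) / e) has_real_derivative \<phi> (v + e * s) * e / e) (at s)"
        by (rule DERIV_cdivide)
      then show "((\<lambda>s. F (v + e * s) / e) has_vector_derivative \<phi> (v + e * s)) (at s within {0..1})"
        using e by (simp add: has_real_derivative_iff_has_vector_derivative[symmetric] has_field_derivative_at_within)
    qed simp
    then show ?thesis by (simp add: integral_unique diff_divide_distrib)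
  qed
  have 2: "integral {0..h} (\<lambda>s. (\<phi> (s + e) - \<phi> s) / e) = (F (h + e) - F h) / e - (F e - F 0) / e"
  proof -
    have "((\<lambda>s. (\<phi> (s + e) - \<phi> s) / e) has_integral ((F (h + e) - F h) / e - (F (0 + e) - F 0) / e)) {0..h}"
    proof (rule fundamental_theorem_of_calculus[OF h])
      fix s :: real assume s: "s \<in> {0..h}"
      have "((\<lambda>s. F (s + e)) has_real_derivative \<phi> (s + e)) (at s)"
        using F[of "s + e"] s e by (simp add: DERIV_shift)
      then have "((\<lambda>s. (F (s + e) - F s) / e) has_real_derivative (\<phi> (s + e) - \<phi> s) / e) (at s)"
        by (intro DERIV_cdivide DERIV_diff F) (use s in auto)
      then show "((\<lambda>s. (F (s + e) - F s) / e) has_vector_derivative (\<phi> (s + e) - \<phi> s) / e) (at s within {0..h})"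
        by (simp add: has_real_derivative_iff_has_vector_derivative[symmetric] has_field_derivative_at_within)
    qed
    from integral_unique[OF this] show ?thesis by (simp only: add_0)
  qed
  have "tav e f (z + h *\<^sub>R (1, 0)) = integral (cbox 0 1) (\<lambda>s. \<phi> (h + e * s))"
    unfolding tav_def \<phi>_def by (simp add: algebra_simps)
  moreover have "tav e f z = integral (cbox 0 1) (\<lambda>s. \<phi> (0 + e * s))"
    unfolding tav_def \<phi>_def by simp
  moreover have "integral {0..h} (\<lambda>s. (f (z + s *\<^sub>R (1, 0) + e *\<^sub>R (1, 0)) - f (z + s *\<^sub>R (1, 0))) / e)
      = integral {0..h} (\<lambda>s. (\<phi> (s + e) - \<phi> s) / e)"
    unfolding \<phi>_def by (simp add: algebra_simps)
  ultimately show "tav e f (z + h *\<^sub>R (1, 0)) = tav e f z + integral {0..h} (\<lambda>s. (f (z + s *\<^sub>R (1, 0) + e *\<^sub>R (1, 0)) - f (z + s *\<^sub>R (1, 0))) / e)"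
    using 1[OF h] 1[OF order_refl] 2 unfolding add_0_left by linarith
qed

lemma tav_uniform_limit:
  assumes f: "cper f"
  shows "uniform_limit UNIV (\<lambda>n. tav (1 / real (Suc n)) f) f sequentially"
  unfolding uniform_limit_iff
proof (intro allI impI)
  fix e :: real assume e: "e > 0"
  then obtain d where d: "d > 0" "\<And>x y. dist y x < d \<Longrightarrow> dist (f y) (f x) < e / 2"
    using cper_uniformly_continuous[OF f] unfolding uniformly_continuous_on_def
    by (meson UNIV_I half_gt_zero)
  have "\<forall>\<^sub>F n in sequentially. 1 / real (Suc n) < d"
    using LIMSEQ_inverse_real_of_nat d(1) by (simp add: order_tendstoD(2) inverse_eq_divide)
  then show "\<forall>\<^sub>F n in sequentially. \<forall>x\<in>UNIV. dist (tav (1 / real (Suc n)) f x) (f x) < e"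
  proof eventually_elim
    case (elim n)
    show ?case
    proof
      fix z
      let ?u = "1 / real (Suc n)"
      have int: "(\<lambda>s. f (z + (?u * s) *\<^sub>R (1, 0))) integrable_on cbox 0 1"
        by (intro integrable_continuous continuous_on_compose2[OF cperD(1)[OF f]] continuous_intros) auto
      have "tav ?u f z - f z = integral (cbox 0 1) (\<lambda>s. f (z + (?u * s) *\<^sub>R (1, 0)) - f z)"
        unfolding tav_def by (subst integral_diff[OF int]) auto
      also have "norm \<dots> \<le> e / 2 * measure lborel (cbox 0 (1::real))"
      proof (rule integrable_bound)
        show "0 \<le> e / 2" using e by simp
        show "(\<lambda>s. f (z + (?u * s) *\<^sub>R (1, 0)) - f z) integrable_on cbox 0 1"
          by (intro integrable_diff int) auto
        fix s :: real assume s: "s \<in> cbox 0 1"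
        have "?u * s \<le> ?u * 1" using s by (intro mult_left_mono) auto
        then have "dist (z + (?u * s) *\<^sub>R (1, 0)) z < d"
          using elim s by (simp add: dist_norm norm_Pair)
        then show "norm (f (z + (?u * s) *\<^sub>R (1, 0)) - f z) \<le> e / 2"
          using d(2) by (simp add: dist_norm less_imp_le)
      qed
      finally show "dist (tav ?u f z) (f z) < e" using e by (simp add: dist_norm)
    qed
  qed
qed

context heat
begin

text \<open>The point \<open>r = 0\<close> is included, where \<open>sqrt\<close> is not
  differentiable: the resolvent identity integrates a derivative over the open half line and relies
  on continuity at its end.\<close>

lemma semigroup_cont:
  assumes f: "cper f"
  shows "continuous_on {0..} (\<lambda>r. \<integral>\<zeta>. gauss \<zeta> * f ((t, x) + (r, r *\<^sub>R c + sqrt (2 * a * r) *\<^sub>R \<zeta>)) \<partial>lborel)"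
  unfolding continuous_on_sequentially
proof (intro allI impI ballI, clarsimp simp: o_def)
  fix X :: "nat \<Rightarrow> real" and r :: real assume X: "X \<longlonglongrightarrow> r"
  obtain M where M: "\<And>z. norm (f z) \<le> M" using cper_bounded[OF f] by metis
  have [measurable]: "f \<in> borel_measurable borel" by (rule cper_measurable[OF f])
  have m: "(\<lambda>\<zeta>::'x. gauss \<zeta> * f (t + r, x + (r *\<^sub>R c + sqrt (2 * a * r) *\<^sub>R \<zeta>))) \<in> borel_measurable borel" for r
    by (intro borel_measurable_continuous_onI continuous_intros gauss_continuous continuous_on_compose2[OF cperD(1)[OF f]]) auto
  show "(\<lambda>n. \<integral>\<zeta>. gauss \<zeta> * f (t + X n, x + (X n *\<^sub>R c + sqrt (2 * a * X n) *\<^sub>R \<zeta>)) \<partial>lborel)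
      \<longlonglongrightarrow> (\<integral>\<zeta>. gauss \<zeta> * f (t + r, x + (r *\<^sub>R c + sqrt (2 * a * r) *\<^sub>R \<zeta>)) \<partial>lborel)"
  proof (rule integral_dominated_convergence)
    show "integrable lborel (\<lambda>\<zeta>::'x. gauss \<zeta> * M)" by (intro integrable_mult_left gauss_integrable)
    have "isCont f z" for z
      using cperD(1)[OF f] continuous_on_eq_continuous_at open_UNIV by blast
    then show "AE \<zeta> in lborel. (\<lambda>n. gauss \<zeta> * f (t + X n, x + (X n *\<^sub>R c + sqrt (2 * a * X n) *\<^sub>R \<zeta>)))
        \<longlonglongrightarrow> gauss \<zeta> * f (t + r, x + (r *\<^sub>R c + sqrt (2 * a * r) *\<^sub>R \<zeta>))"
      by (intro AE_I2 tendsto_intros isCont_tendsto_compose[of _ f] X)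
    show "AE \<zeta> in lborel. norm (gauss \<zeta> * f (t + X n, x + (X n *\<^sub>R c + sqrt (2 * a * X n) *\<^sub>R \<zeta>))) \<le> gauss \<zeta> * M" for n
      using M by (intro AE_I2) (auto simp: abs_mult intro: mult_left_mono)
  qed (use m in auto)
qed

text \<open>With \<open>\<psi> r\<close> the Gaussian mean of \<open>f\<close> at time
  \<open>r\<close>, the integrand defining the left side is minus the derivative of
  \<open>exp (- \<mu> * r) * \<psi> r\<close>. The integral is therefore the value at
  \<open>r = 0\<close>, which is \<open>f z\<close>; at infinity the damping leaves nothing.\<close>

lemma R_resolvent:
  assumes C: "C12 f ft D H"
  shows "R (\<lambda>z. \<mu> * f z - LL ft D H z) z = f z"
proof (cases z)
  case (Pair t x)
  have f: "cper f" using C by (simp add: C12_def)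
  have L: "cper (LL ft D H)" by (rule LL_cper[OF C])
  let ?F = "\<lambda>z. \<mu> * f z - LL ft D H z"
  have F: "cper ?F" by (intro cper_diff cper_cmult f L)
  let ?p = "\<lambda>r \<zeta>. (t, x) + (r, r *\<^sub>R c + sqrt (2 * a * r) *\<^sub>R \<zeta>)"
  have pc: "continuous_on UNIV (?p s)" for s by (intro continuous_intros)
  define \<psi> where "\<psi> r = (\<integral>\<zeta>. gauss \<zeta> * f (?p r \<zeta>) \<partial>lborel)" for r
  define \<xi> where "\<xi> r = (\<integral>\<zeta>. gauss \<zeta> * ?F (?p r \<zeta>) \<partial>lborel)" for r
  define E where "E r = exp (- \<mu> * r) * \<psi> r" for r
  define g where "g r = indicator {0<..} r * exp (- \<mu> * r) * \<xi> r" for r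
  have g: "integrable lborel g" and Rg: "R ?F (t, x) = (\<integral>r. g r \<partial>lborel)"
    using R_slice[OF F, of t x] unfolding g_def \<xi>_def by auto
  have \<xi>_eq: "\<xi> r = \<mu> * \<psi> r - (\<integral>\<zeta>. gauss \<zeta> * LL ft D H (?p r \<zeta>) \<partial>lborel)" for r
  proof -
    have "\<xi> r = (\<integral>\<zeta>. \<mu> * (gauss \<zeta> * f (?p r \<zeta>)) - gauss \<zeta> * LL ft D H (?p r \<zeta>) \<partial>lborel)"
      unfolding \<xi>_def by (intro Bochner_Integration.integral_cong) (auto simp: algebra_simps)
    also have "\<dots> = \<mu> * \<psi> r - (\<integral>\<zeta>. gauss \<zeta> * LL ft D H (?p r \<zeta>) \<partial>lborel)"
      unfolding \<psi>_def using gauss_f_integrable[OF f pc] gauss_f_integrable[OF L pc]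
      by (subst Bochner_Integration.integral_diff) auto
    finally show ?thesis .
  qed
  have dE: "((\<lambda>r. - E r) has_real_derivative exp (- \<mu> * r) * \<xi> r) (at r)" if "r > 0" for r
  proof -
    have "((\<lambda>r. exp (- \<mu> * r)) has_real_derivative exp (- \<mu> * r) * (- \<mu>)) (at r)"
      by (auto intro!: derivative_eq_intros)
    from DERIV_minus[OF DERIV_mult[OF this semigroup_deriv[OF C that, of t x]]]
    show ?thesis unfolding E_def \<psi>_def[symmetric] \<xi>_eq by (simp add: algebra_simps)
  qed
  have \<psi>c: "continuous_on {0..} \<psi>"
    unfolding \<psi>_def by (rule semigroup_cont[OF f])
  have key: "(\<integral>r. indicator {..n} r *\<^sub>R g r \<partial>lborel) = E 0 - E n" if n: "n > 0" for n
  proof -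
    have "integrable lborel (\<lambda>r. g r * indicator {..n} r)"
      using g by (intro integrable_real_mult_indicator) auto
    then have i: "integrable lborel (\<lambda>r. indicator {..n} r *\<^sub>R g r)"
      by (simp add: mult.commute)
    have "((\<lambda>r. exp (- \<mu> * r) * \<xi> r) has_integral (- E n) - (- E 0)) {0..n}"
    proof (rule fundamental_theorem_of_calculus_interior)
      show "continuous_on {0..n} (\<lambda>r. - E r)"
        unfolding E_def by (intro continuous_intros continuous_on_subset[OF \<psi>c]) auto
      show "((\<lambda>r. - E r) has_vector_derivative exp (- \<mu> * r) * \<xi> r) (at r)" if "r \<in> {0<..<n}" for r
        using dE[of r] that by (simp add: has_real_derivative_iff_has_vector_derivative[symmetric])
    qed (use n in auto)
    then have "((\<lambda>r. if r \<in> {0..n} then exp (- \<mu> * r) * \<xi> r else 0) has_integral (E 0 - E n)) UNIV"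
      unfolding has_integral_restrict_UNIV by simp
    then have "((\<lambda>r. indicator {..n} r *\<^sub>R g r) has_integral (E 0 - E n)) UNIV"
      by (rule has_integral_spike[of "{0}", rotated 2]) (auto simp: g_def indicator_def)
    then show ?thesis
      using has_integral_integral_lborel[OF i] has_integral_unique by blast
  qed
  have "((\<lambda>n. \<integral>r. indicator {..n} r *\<^sub>R g r \<partial>lborel) \<longlongrightarrow> (\<integral>r. g r \<partial>lborel)) at_top"
    by (rule tendsto_integral_at_top) (use g in auto)
  moreover have "((\<lambda>n. \<integral>r. indicator {..n} r *\<^sub>R g r \<partial>lborel) \<longlongrightarrow> E 0 - 0) at_top"
  proof -
    obtain M where M: "\<And>z. norm (f z) \<le> M" using cper_bounded[OF f] by metis
    have \<psi>b: "norm (\<psi> r) \<le> M" for r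
    proof -
      have "norm (\<psi> r) \<le> (\<integral>\<zeta>. norm (gauss \<zeta> * f (?p r \<zeta>)) \<partial>lborel)"
        unfolding \<psi>_def by (rule integral_norm_bound)
      also have "\<dots> \<le> (\<integral>\<zeta>. gauss (\<zeta>::'x) * M \<partial>lborel)"
        by (rule integral_mono) (use integrable_norm[OF gauss_f_integrable[OF f pc]] gauss_integrable M in \<open>auto simp: abs_mult intro: mult_left_mono\<close>)
      also have "\<dots> = M" by (simp add: gauss_integral)
      finally show ?thesis .
    qed
    have "((\<lambda>r. exp (- \<mu> * r)) \<longlongrightarrow> 0) at_top"
      using \<mu>_pos by real_asymp
    then have "(E \<longlongrightarrow> 0) at_top"
      by (rule tendsto_0_le[where K = M]) (use \<psi>b in \<open>auto simp: E_def abs_mult intro!: mult_left_mono always_eventually\<close>)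
    then have "((\<lambda>n. E 0 - E n) \<longlongrightarrow> E 0 - 0) at_top" by (intro tendsto_intros)
    then show ?thesis
      by (rule Lim_transform_eventually) (use key in \<open>auto intro!: eventually_at_top_linorderI[of 1]\<close>)
  qed
  ultimately have "(\<integral>r. g r \<partial>lborel) = E 0"
    using tendsto_unique[OF trivial_limit_at_top_linorder] by force
  moreover have "E 0 = f (t, x)"
    unfolding E_def \<psi>_def by (simp add: gauss_integral)
  ultimately show ?thesis using Rg Pair by simp
qed

text \<open>The resolvent identity solved for \<open>R ft\<close>, the one term in which a time
  derivative of \<open>f\<close> occurs.\<close>

lemma R_PDE_C12:
  assumes C: "C12 f ft D H"
  shows "R ft z = \<mu> * R f z - f z - a * (\<Sum>b\<in>Basis. R (H b) z) - (\<Sum>b\<in>Basis. (c \<bullet> b) * R (D b) z)"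
proof -
  have f: "cper f" "cper ft" and D: "\<And>b. b \<in> Basis \<Longrightarrow> cper (D b)" and H: "\<And>b. b \<in> Basis \<Longrightarrow> cper (H b)"
    using C unfolding C12_def by auto
  have "f z = R (\<lambda>z. \<mu> * f z - LL ft D H z) z"
    by (rule R_resolvent[OF C, symmetric])
  also have "\<dots> = \<mu> * R f z - R (LL ft D H) z"
    by (simp add: R_diff R_cmult cper_cmult f LL_cper[OF C])
  also have "R (LL ft D H) z = R ft z + a * (\<Sum>b\<in>Basis. R (H b) z) + (\<Sum>b\<in>Basis. (c \<bullet> b) * R (D b) z)"
    unfolding LL_def[abs_def]
    by (simp add: R_add R_cmult R_sum cper_add cper_sum cper_cmult f D H)
  finally show ?thesis by simp
qed

lemma R_time:
  assumes f: "cper f"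
    and D: "\<And>b. b \<in> Basis \<Longrightarrow> has_pd f (0, b) (D b)" "\<And>b. b \<in> Basis \<Longrightarrow> cper (D b)"
    and H: "\<And>b. b \<in> Basis \<Longrightarrow> has_pd (D b) (0, b) (H b)" "\<And>b. b \<in> Basis \<Longrightarrow> cper (H b)"
  shows "has_pd (R f) (1, 0) (\<lambda>z. \<mu> * R f z - f z - a * (\<Sum>b\<in>Basis. R (H b) z) - (\<Sum>b\<in>Basis. (c \<bullet> b) * R (D b) z))"
proof -
  define \<epsilon> where "\<epsilon> n = 1 / real (Suc n)" for n
  define ft where "ft n z = (f (z + \<epsilon> n *\<^sub>R (1, 0)) - f z) / \<epsilon> n" for n z
  have C: "C12 (tav (\<epsilon> n) f) (ft n) (\<lambda>b. tav (\<epsilon> n) (D b)) (\<lambda>b. tav (\<epsilon> n) (H b))" for n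
  proof -
    have "cper (ft n)"
      using cper_cmult[OF cper_diff[OF cper_shift[OF f] f], of "1 / \<epsilon> n"] unfolding ft_def by simp
    moreover have "has_pd (tav (\<epsilon> n) f) (1, 0) (ft n)"
      unfolding ft_def by (rule tav_time[OF f]) (simp add: \<epsilon>_def)
    ultimately show ?thesis
      unfolding C12_def using f D H by (auto intro!: tav_cper tav_pd)
  qed
  have lim: "uniform_limit UNIV (\<lambda>n. tav (\<epsilon> n) h) h sequentially" if "cper h" for h :: "real \<times> 'x \<Rightarrow> real"
    unfolding \<epsilon>_def by (rule tav_uniform_limit[OF that])
  have limR: "uniform_limit UNIV (\<lambda>n. R (tav (\<epsilon> n) h)) (R h) sequentially" if "cper h" for h
    unfolding R_def by (rule conv_uniform_limit[OF K_integrable lim[OF that] tav_cper[OF that]])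
  show ?thesis
  proof (rule has_pd_uniform_limit[OF limR[OF f]])
    show "has_pd (R (tav (\<epsilon> n) f)) (1, 0) (R (ft n))" for n
      using C[of n] unfolding C12_def by (intro R_pd) auto
    show "cper (R (ft n))" for n
      using C[of n] unfolding C12_def by (intro R_cper) auto
    \<comment> \<open>The quotients \<open>ft n\<close> themselves need not converge. The resolvent
      identity expresses \<open>R (ft n)\<close> through averages of \<open>f\<close>,
      \<open>D b\<close> and \<open>H b\<close>, and these converge uniformly.\<close>
    have "uniform_limit UNIV (\<lambda>n z. \<mu> * R (tav (\<epsilon> n) f) z - tav (\<epsilon> n) f z - a * (\<Sum>b\<in>Basis. R (tav (\<epsilon> n) (H b)) z) - (\<Sum>b\<in>Basis. (c \<bullet> b) * R (tav (\<epsilon> n) (D b)) z))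
       (\<lambda>z. \<mu> * R f z - f z - a * (\<Sum>b\<in>Basis. R (H b) z) - (\<Sum>b\<in>Basis. (c \<bullet> b) * R (D b) z)) sequentially"
      by (intro uniform_limit_intros uniform_limit_cmult uniform_limit_sum limR lim f D H) auto
    then show "uniform_limit UNIV (\<lambda>n. R (ft n)) (\<lambda>z. \<mu> * R f z - f z - a * (\<Sum>b\<in>Basis. R (H b) z) - (\<Sum>b\<in>Basis. (c \<bullet> b) * R (D b) z)) sequentially"
      by (subst R_PDE_C12[OF C, abs_def])
  qed
qed

end

section \<open>An approximate Schauder fixed point theorem\<close>

text \<open>An approximate Schauder theorem: Kuhn's combinatorial lemma is applied to the barycentric
  coordinates of the Schauder projection onto the hull of an \<^term>\<open>e\<close>-net. The small weight
  \<^term>\<open>\<tau>\<close> keeps the map from cube to hull defined at the origin.\<close>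

lemma schauder_approx:
  fixes f :: "'e::real_normed_vector \<Rightarrow> 'e"
  assumes K: "convex K" and fK: "f ` K \<subseteq> K" and cont: "continuous_on K f"
    and Y: "finite Y" "Y \<subseteq> K" "Y \<noteq> {}" and net: "\<And>x. x \<in> K \<Longrightarrow> \<exists>y\<in>Y. dist (f x) y < e" and e: "e > 0"
  shows "\<exists>x\<in>K. dist (f x) x \<le> 2 * e"
proof -
  define m where "m = card Y"
  have m: "m > 0" using Y by (simp add: m_def card_gt_0_iff)
  obtain y where "bij_betw y {0..<m} Y"
    unfolding m_def using ex_bij_betw_nat_finite[OF Y(1)] by blast
  then have yY: "y ` {..<m} = Y"
    by (simp add: bij_betw_def lessThan_atLeast0)
  define C where "C = convex hull Y"
  have CK: "C \<subseteq> K" unfolding C_def using hull_minimal[of Y K convex] Y(2) K by blast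
  have yC: "y i \<in> C" if "i < m" for i
    using yY that hull_subset[of Y convex] unfolding C_def by blast
  have Ccomp: "compact C" unfolding C_def by (rule finite_imp_compact_convex_hull[OF Y(1)])
  then obtain D where D: "D > 0" "\<And>x. x \<in> C \<Longrightarrow> norm x \<le> D"
    using compact_imp_bounded bounded_pos by metis
  \<comment> \<open>Weights of the projection: \<open>y i\<close> counts only if it lies within
    \<open>e\<close> of \<open>f x\<close>, and the net makes the sum of the weights
    positive.\<close>
  define \<phi> where "\<phi> i x = max 0 (e - dist (f x) (y i))" for i x
  define S where "S x = (\<Sum>i<m. \<phi> i x)" for x
  define p where "p i x = \<phi> i x / S x" for i x
  have \<phi>0: "\<phi> i x \<ge> 0" for i x by (simp add: \<phi>_def)
  have S: "S x > 0" if x: "x \<in> K" for x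
  proof -
    obtain i where i: "i < m" "dist (f x) (y i) < e"
      using net[OF x] yY by blast
    then have "\<phi> i x > 0" by (simp add: \<phi>_def)
    then show ?thesis unfolding S_def using i \<phi>0 by (intro sum_pos2[of _ i]) auto
  qed
  have p0: "p i x \<ge> 0" if "x \<in> K" for i x
    using \<phi>0 S[OF that] by (simp add: p_def less_imp_le)
  have p_sum: "(\<Sum>i<m. p i x) = 1" if "x \<in> K" for x
    using S[OF that] by (simp add: p_def sum_divide_distrib[symmetric] S_def[symmetric])
  have p1: "p i x \<le> 1" if "x \<in> K" "i < m" for i x
    using member_le_sum[of i "{..<m}" "\<lambda>i. p i x"] p0[OF that(1)] p_sum[OF that(1)] that by auto
  have p_near: "norm ((\<Sum>i<m. p i x *\<^sub>R y i) - f x) \<le> e" if x: "x \<in> K" for x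
  proof -
    have "(\<Sum>i<m. p i x *\<^sub>R y i) - f x = (\<Sum>i<m. p i x *\<^sub>R (y i - f x))"
      using p_sum[OF x] by (simp add: scaleR_diff_right sum_subtractf scaleR_left.sum[symmetric])
    also have "norm \<dots> \<le> (\<Sum>i<m. p i x * e)"
    proof (rule order_trans[OF norm_sum sum_mono])
      fix i
      show "norm (p i x *\<^sub>R (y i - f x)) \<le> p i x * e"
      proof (cases "p i x = 0")
        case False
        then have "\<phi> i x \<noteq> 0" by (auto simp: p_def)
        then have "dist (f x) (y i) < e" by (auto simp: \<phi>_def max_def split: if_splits)
        then show ?thesis using p0[OF x, of i] by (auto simp: dist_norm norm_minus_commute intro: mult_left_mono)
      qed simp
    qed
    also have "\<dots> = e" using p_sum[OF x] by (simp add: sum_distrib_right[symmetric])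
    finally show ?thesis .
  qed
  have pc: "continuous_on C (p i)" for i
  proof -
    have fc: "continuous_on C f" by (rule continuous_on_subset[OF cont CK])
    have \<phi>c: "continuous_on C (\<phi> i)" for i
      unfolding \<phi>_def by (intro continuous_intros fc)
    show ?thesis
      unfolding p_def S_def by (intro continuous_intros \<phi>c) (use S CK in \<open>force simp: S_def\<close>)
  qed
  \<comment> \<open>Both constants are fitted to the closing estimate, where they have to satisfy
    \<open>2 * D * (2 * m * \<epsilon> + \<tau>) = e / 2\<close>.\<close>
  define \<tau> where "\<tau> = e / (8 * D)"
  define \<epsilon> where "\<epsilon> = e / (16 * real m * D)"
  have \<tau>: "\<tau> > 0" and \<epsilon>: "\<epsilon> > 0" using e D m by (auto simp: \<tau>_def \<epsilon>_def)
  have "\<exists>d>0. \<forall>x\<in>C. \<forall>x'\<in>C. dist x' x < d \<longrightarrow> dist (p i x') (p i x) < \<epsilon>" for i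
    using compact_uniformly_continuous[OF pc Ccomp] \<epsilon> unfolding uniformly_continuous_on_def by blast
  then obtain d0 where d0: "\<And>i. d0 i > 0" "\<And>i x x'. x \<in> C \<Longrightarrow> x' \<in> C \<Longrightarrow> dist x' x < d0 i \<Longrightarrow> dist (p i x') (p i x) < \<epsilon>"
    by metis
  define d where "d = Min (d0 ` {..<m})"
  have d: "d > 0" and dd: "\<And>i. i < m \<Longrightarrow> d \<le> d0 i"
  proof -
    have "d0 ` {..<m} \<noteq> {}" using m by auto
    then show "d > 0" unfolding d_def using d0(1) by (subst Min_gr_iff) auto
    show "d \<le> d0 i" if "i < m" for i unfolding d_def using that by (intro Min_le) auto
  qed
  \<comment> \<open>\<open>X a\<close> is the normalised combination of the net with coefficients
    \<open>a\<close>, where \<open>y 0\<close> carries the extra weight \<open>\<tau>\<close>. Since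
    the denominator is at least \<open>\<tau>\<close>, the map is Lipschitz on the whole
    cube.\<close>
  define n where "n a = \<tau> *\<^sub>R y 0 + (\<Sum>i<m. a i *\<^sub>R y i)" for a :: "nat \<Rightarrow> real"
  define s where "s a = \<tau> + (\<Sum>i<m. a i)" for a :: "nat \<Rightarrow> real"
  define X where "X a = (1 / s a) *\<^sub>R n a" for a
  have s: "s a \<ge> \<tau>" if "\<And>i. i < m \<Longrightarrow> a i \<ge> 0" for a
    unfolding s_def using sum_nonneg[of "{..<m}" a] that by auto
  have XC: "X a \<in> C" if a: "\<And>i. i < m \<Longrightarrow> a i \<ge> 0" for a
  proof -
    have "s a \<ge> \<tau>" by (rule s) (rule a)
    then have sp: "s a > 0" using \<tau> by linarith
    have "X a = (\<Sum>i<m. (((if i = 0 then \<tau> else 0) + a i) / s a) *\<^sub>R y i)"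
    proof -
      have "(\<Sum>i<m. (if i = 0 then \<tau> else 0) *\<^sub>R y i) = (\<Sum>i<m. if i = 0 then \<tau> *\<^sub>R y 0 else 0)"
        by (intro sum.cong) auto
      then have "(\<Sum>i<m. (if i = 0 then \<tau> else 0) *\<^sub>R y i) = \<tau> *\<^sub>R y 0"
        using m by simp
      then have "n a = (\<Sum>i<m. ((if i = 0 then \<tau> else 0) + a i) *\<^sub>R y i)"
        by (simp only: n_def scaleR_add_left sum.distrib)
      then show ?thesis
        by (simp add: X_def scaleR_sum_right)
    qed
    also have "\<dots> \<in> C"
    proof (rule convex_sum)
      show "convex C" by (simp add: C_def)
      show "(\<Sum>i<m. ((if i = 0 then \<tau> else 0) + a i) / s a) = 1"
        using sp m by (simp add: sum_divide_distrib[symmetric] sum.distrib s_def)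
    qed (use a sp yC \<tau> in \<open>auto intro!: divide_nonneg_pos add_nonneg_nonneg\<close>)
    finally show ?thesis .
  qed
  have XL: "norm (X a - X b) \<le> 2 * real m * D / \<tau> * \<eta>"
    if a: "\<And>i. i < m \<Longrightarrow> a i \<ge> 0" and b: "\<And>i. i < m \<Longrightarrow> b i \<ge> 0" and \<eta>: "\<And>i. i < m \<Longrightarrow> \<bar>a i - b i\<bar> \<le> \<eta>" for a b \<eta>
  proof -
    have sa: "s a \<ge> \<tau>" by (rule s) (rule a)
    have sb: "s b \<ge> \<tau>" by (rule s) (rule b)
    with sa \<tau> have sa: "s a \<ge> \<tau>" "s a > 0" and sb: "s b > 0" by auto
    have nb: "n b = s b *\<^sub>R X b" using sb by (simp add: X_def)
    have "s a *\<^sub>R (X a - X b) = (n a - n b) + (s b - s a) *\<^sub>R X b"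
      using sa by (simp add: nb algebra_simps) (simp add: X_def)
    moreover have "norm (n a - n b) \<le> real m * \<eta> * D"
    proof -
      have "n a - n b = (\<Sum>i<m. (a i - b i) *\<^sub>R y i)"
        by (simp add: n_def scaleR_diff_left sum_subtractf)
      also have "norm \<dots> \<le> (\<Sum>i<m. \<eta> * D)"
        by (rule order_trans[OF norm_sum sum_mono]) (use \<eta> D yC in \<open>auto intro!: mult_mono order_trans[OF abs_ge_zero \<eta>]\<close>)
      finally show ?thesis by simp
    qed
    moreover have "norm ((s b - s a) *\<^sub>R X b) \<le> real m * \<eta> * D"
    proof -
      have "\<bar>s b - s a\<bar> = \<bar>\<Sum>i<m. a i - b i\<bar>"
        by (simp add: s_def sum_subtractf abs_minus_commute)
      also have "\<dots> \<le> (\<Sum>i<m. \<eta>)"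
        by (rule order_trans[OF sum_abs sum_mono]) (use \<eta> in auto)
      finally show ?thesis
        using D(2)[OF XC[of b]] b D(1) by (auto intro!: mult_mono)
    qed
    ultimately have "norm (s a *\<^sub>R (X a - X b)) \<le> real m * \<eta> * D + real m * \<eta> * D"
      using norm_triangle_mono by metis
    then have "norm (s a *\<^sub>R (X a - X b)) \<le> 2 * real m * \<eta> * D" by linarith
    then have "s a * norm (X a - X b) \<le> 2 * real m * \<eta> * D"
      using sa by simp
    moreover have "\<tau> * norm (X a - X b) \<le> s a * norm (X a - X b)"
      using sa by (intro mult_right_mono) auto
    ultimately have "\<tau> * norm (X a - X b) \<le> 2 * real m * \<eta> * D" by linarith
    then show ?thesis using \<tau> by (simp add: field_simps)
  qed
  \<comment> \<open>The grid width \<open>1 / P\<close> is below \<open>\<epsilon>\<close> and so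
    fine that neighbouring grid points have images under \<open>X\<close> closer than the modulus
    \<open>d\<close> of the weights.\<close>
  obtain P :: nat where P: "P > 0" "1 / real P < \<epsilon>" "2 * real m * D / \<tau> * (1 / real P) < d"
  proof -
    define \<kappa> where "\<kappa> = min \<epsilon> (d / (2 * real m * D / \<tau> + 1))"
    have pos: "2 * real m * D / \<tau> + 1 > 0" using D \<tau> by (simp add: add_nonneg_pos)
    have "\<kappa> > 0" using \<epsilon> d pos by (simp add: \<kappa>_def)
    then obtain P where P: "1 / real (Suc P) < \<kappa>"
      using nat_approx_posE by blast
    then have "1 / real (Suc P) < d / (2 * real m * D / \<tau> + 1)" by (simp add: \<kappa>_def)
    then have "(2 * real m * D / \<tau> + 1) * (1 / real (Suc P)) < d"
      using pos by (simp add: field_simps)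
    moreover have "2 * real m * D / \<tau> * (1 / real (Suc P)) \<le> (2 * real m * D / \<tau> + 1) * (1 / real (Suc P))"
      by (intro mult_right_mono) auto
    ultimately show thesis using that[of "Suc P"] P by (simp add: \<kappa>_def)
  qed
  define pt where "pt x i = real (x i) / real P" for x :: "nat \<Rightarrow> nat" and i
  have pt0: "pt x i \<ge> 0" for x i by (simp add: pt_def)
  have XK: "X (pt x) \<in> C" "X (pt x) \<in> K" for x using XC[of "pt x"] pt0 CK by auto
  \<comment> \<open>Label 1 says that the coordinate exceeds the weight. On the face
    \<open>x i = P\<close> it is prescribed, in accordance with \<open>p i \<le> 1\<close>; on the
    face \<open>x i = 0\<close> nonnegative weights give label 0.\<close>
  define label where "label x i = (if x i = P \<or> p i (X (pt x)) < pt x i then 1 else 0 :: nat)" for x i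
  obtain q where q: "\<forall>i<m. q i < P"
    and lab: "\<forall>i<m. \<exists>r s. (\<forall>j<m. q j \<le> r j \<and> r j \<le> q j + 1) \<and> (\<forall>j<m. q j \<le> s j \<and> s j \<le> q j + 1) \<and> label r i \<noteq> label s i"
  proof (rule kuhn_lemma[of P m label])
    show "\<forall>x. (\<forall>i<m. x i \<le> P) \<longrightarrow> (\<forall>i<m. x i = 0 \<longrightarrow> label x i = 0)"
    proof (intro allI impI)
      fix x :: "nat \<Rightarrow> nat" and i assume "x i = 0"
      then have "pt x i = 0" by (simp add: pt_def)
      then show "label x i = 0"
        using P(1) p0[OF XK(2), of i x] \<open>x i = 0\<close> by (simp add: label_def)
    qed
  qed (use P in \<open>auto simp: label_def\<close>)
  let ?a = "pt q" and ?x = "X (pt q)"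
  have fix_i: "\<bar>p i ?x - ?a i\<bar> \<le> 2 * \<epsilon>" if i: "i < m" for i
  proof -
    have close: "\<bar>p i (X (pt r)) - p i ?x\<bar> < \<epsilon>" "pt q i \<le> pt r i" "pt r i \<le> pt q i + 1 / real P"
      if r: "\<forall>j<m. q j \<le> r j \<and> r j \<le> q j + 1" for r
    proof -
      have rj: "pt q j \<le> pt r j" "pt r j \<le> pt q j + 1 / real P" if "j < m" for j
      proof -
        have "real (q j) \<le> real (r j)" "real (r j) \<le> real (q j) + 1" using r that by force+
        then show "pt q j \<le> pt r j" "pt r j \<le> pt q j + 1 / real P"
          using P(1) by (auto simp: pt_def divide_right_mono add_divide_distrib[symmetric])
      qed
      have "norm (X (pt r) - ?x) \<le> 2 * real m * D / \<tau> * (1 / real P)"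
        by (rule XL) (use rj pt0 in \<open>force simp: abs_le_iff\<close>)+
      then have "dist (X (pt r)) ?x < d0 i"
        using P(3) dd[OF i] by (simp add: dist_norm)
      then show "\<bar>p i (X (pt r)) - p i ?x\<bar> < \<epsilon>"
        using d0(2)[OF XK(1) XK(1)] by (simp add: dist_real_def)
      show "pt q i \<le> pt r i" "pt r i \<le> pt q i + 1 / real P" using rj i by auto
    qed
    obtain r s where rs: "\<forall>j<m. q j \<le> r j \<and> r j \<le> q j + 1" "\<forall>j<m. q j \<le> s j \<and> s j \<le> q j + 1" "label r i \<noteq> label s i"
      using lab i by blast
    then obtain r0 r1 where r0: "\<forall>j<m. q j \<le> r0 j \<and> r0 j \<le> q j + 1" "label r0 i = 0"
      and r1: "\<forall>j<m. q j \<le> r1 j \<and> r1 j \<le> q j + 1" "label r1 i \<noteq> 0"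
      by (metis label_def)
    \<comment> \<open>Two neighbouring points with different labels squeeze the coordinate: at one
      of them it is at most the weight, at the other at least.\<close>
    have "p i (X (pt r0)) \<ge> pt r0 i" using r0(2) by (auto simp: label_def split: if_splits)
    moreover have "p i (X (pt r1)) \<le> pt r1 i"
      using r1(2) p1[OF XK(2) i, of r1] P(1) by (auto simp: label_def pt_def split: if_splits)
    ultimately show ?thesis
      using close[OF r0(1)] close[OF r1(1)] P(2) by (auto simp: abs_le_iff)
  qed
  \<comment> \<open>The coefficients nearly equal the weights, so they nearly sum to 1. The
    combination \<open>n ?a\<close> before normalisation is then close both to \<open>?x\<close> and
    to the projection of \<open>f ?x\<close>.\<close>
  have "norm (?x - (\<Sum>i<m. p i ?x *\<^sub>R y i)) \<le> e"
  proof -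
    have "s ?a \<ge> \<tau>" by (rule s) (rule pt0)
    then have sa: "s ?a > 0" using \<tau> by simp
    have D0: "norm ?x \<le> D" by (rule D(2)[OF XK(1)])
    have "\<bar>(\<Sum>i<m. ?a i) - 1\<bar> = \<bar>\<Sum>i<m. ?a i - p i ?x\<bar>"
      by (simp add: sum_subtractf p_sum[OF XK(2)])
    also have "\<dots> \<le> (\<Sum>i<m. 2 * \<epsilon>)"
      by (rule order_trans[OF sum_abs sum_mono]) (use fix_i in \<open>auto simp: abs_minus_commute\<close>)
    finally have A: "\<bar>(\<Sum>i<m. ?a i) - 1\<bar> \<le> 2 * real m * \<epsilon>" by simp
    have n1: "norm (n ?a - ?x) \<le> D * (2 * real m * \<epsilon> + \<tau>)"
    proof -
      have "n ?a = s ?a *\<^sub>R ?x" using sa by (simp add: X_def)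
      then have "n ?a - ?x = (s ?a - 1) *\<^sub>R ?x" by (simp add: algebra_simps)
      moreover have "\<bar>s ?a - 1\<bar> \<le> 2 * real m * \<epsilon> + \<tau>"
        unfolding s_def using A \<tau> by (simp add: abs_le_iff)
      ultimately show ?thesis
        using D0 D(1) by (auto simp: mult.commute[of D] intro!: mult_mono)
    qed
    have n2: "norm (n ?a - (\<Sum>i<m. p i ?x *\<^sub>R y i)) \<le> D * (2 * real m * \<epsilon> + \<tau>)"
    proof -
      have "n ?a - (\<Sum>i<m. p i ?x *\<^sub>R y i) = \<tau> *\<^sub>R y 0 + (\<Sum>i<m. (?a i - p i ?x) *\<^sub>R y i)"
        by (simp add: n_def scaleR_diff_left sum_subtractf)
      also have "norm \<dots> \<le> \<tau> * D + (\<Sum>i<m. 2 * \<epsilon> * D)"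
      proof (intro norm_triangle_le add_mono order_trans[OF norm_sum sum_mono])
        show "norm (\<tau> *\<^sub>R y 0) \<le> \<tau> * D" using \<tau> D(2)[OF yC[OF m]] by (simp add: mult_left_mono)
        show "norm ((?a i - p i ?x) *\<^sub>R y i) \<le> 2 * \<epsilon> * D" if "i \<in> {..<m}" for i
          using fix_i[of i] D(2)[OF yC[of i]] that \<epsilon> D(1) by (auto simp: abs_minus_commute intro!: mult_mono)
      qed
      finally show ?thesis by (simp add: algebra_simps)
    qed
    have "norm (?x - (\<Sum>i<m. p i ?x *\<^sub>R y i)) \<le> D * (2 * real m * \<epsilon> + \<tau>) + D * (2 * real m * \<epsilon> + \<tau>)"
    proof -
      have "?x - (\<Sum>i<m. p i ?x *\<^sub>R y i) = (n ?a - (\<Sum>i<m. p i ?x *\<^sub>R y i)) - (n ?a - ?x)"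
        by (simp add: algebra_simps)
      then show ?thesis
        by (simp only:) (rule order_trans[OF norm_triangle_ineq4 add_mono[OF n2 n1]])
    qed
    also have "\<dots> = e / 2"
      using D m by (simp add: \<epsilon>_def \<tau>_def field_simps)
    finally show ?thesis using e by simp
  qed
  then have "dist (f ?x) ?x \<le> e + e"
    using p_near[OF XK(2), of q] dist_triangle_le[of "f ?x" "\<Sum>i<m. p i ?x *\<^sub>R y i" ?x "e + e"]
    by (simp add: dist_norm norm_minus_commute)
  then show ?thesis using XK(2) by (intro bexI[of _ ?x]) auto
qed

text \<open>Arzela-Ascoli is applied on the compact cell; periodicity carries the uniform estimate
  to all points, and completeness of the bounded continuous functions provides the limit.\<close>

lemma per_arzela:
  fixes F :: "nat \<Rightarrow> 'a::euclidean_space \<Rightarrow>\<^sub>C 'b::euclidean_space"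
  assumes per: "\<And>n. per (apply_bcontfun (F n))" and M: "\<And>n z. norm (apply_bcontfun (F n) z) \<le> M"
    and eq: "\<And>e. e > 0 \<Longrightarrow> \<exists>d>0. \<forall>n z h. norm h < d \<longrightarrow> norm (F n (z + h) - F n z) \<le> e"
  obtains l r where "strict_mono r" "(\<lambda>n. F (r n)) \<longlonglongrightarrow> l"
proof -
  obtain g r where r: "strict_mono (r :: nat \<Rightarrow> nat)"
    and g: "\<And>e. 0 < e \<Longrightarrow> \<exists>N. \<forall>n x. n \<ge> N \<and> x \<in> cell \<longrightarrow> norm (F (r n) x - g x) < e"
  proof (rule Arzela_Ascoli[of cell "\<lambda>n. apply_bcontfun (F n)" M])
    fix x :: 'a and e :: real assume e: "0 < e"
    then obtain d where d: "d > 0" "\<And>n z h. norm h < d \<Longrightarrow> norm (F n (z + h) - F n z) \<le> e / 2"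
      using eq[of "e / 2"] by auto
    have "norm (F n x - F n y) < e" if "norm (x - y) < d" for n y
      using d(2)[of "x - y" n y] that e by simp
    then show "\<exists>d>0. \<forall>n y. y \<in> cell \<and> norm (x - y) < d \<longrightarrow> norm (F n x - F n y) < e"
      using d(1) by blast
  qed (use M in auto)
  have "Cauchy (\<lambda>n. F (r n))"
  proof (rule metric_CauchyI)
    fix e :: real assume e: "e > 0"
    then obtain N where N: "\<And>n x. n \<ge> N \<Longrightarrow> x \<in> cell \<Longrightarrow> norm (F (r n) x - g x) < e / 4"
      using g[of "e / 4"] by auto
    have "dist (F (r i)) (F (r j)) < e" if ij: "i \<ge> N" "j \<ge> N" for i j
    proof -
      have "dist (F (r i) z) (F (r j) z) \<le> e / 2" for z
      proof -
        obtain k where k: "k \<in> lattice" "z + k \<in> cell" using lattice_reduce by blast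
        have "dist (F (r i) (z + k)) (F (r j) (z + k)) < e / 2"
          using N[OF ij(1) k(2)] N[OF ij(2) k(2)] dist_triangle_half_l[of "F (r i) (z + k)" "g (z + k)" "e / 2"]
          by (simp add: dist_norm)
        then show ?thesis using per_lattice[OF per k(1)] by simp
      qed
      then have "dist (F (r i)) (F (r j)) \<le> e / 2" by (rule dist_bound)
      then show ?thesis using e by simp
    qed
    then show "\<exists>M. \<forall>m\<ge>M. \<forall>n\<ge>M. dist (F (r m)) (F (r n)) < e" by blast
  qed
  then obtain l where "(\<lambda>n. F (r n)) \<longlonglongrightarrow> l"
    using Cauchy_convergent_iff convergent_def by blast
  with r show thesis using that by blast
qed

section \<open>The fixed point problem after the Hopf-Cole transform\<close>

lemma cper_slice:
  fixes f :: "real \<times> 'x::euclidean_space \<Rightarrow> 'b::topological_space"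
  assumes "cper f"
  shows "cper (\<lambda>x. f (t, x))"
proof (rule cperI)
  show "continuous_on UNIV (\<lambda>x. f (t, x))"
    by (intro continuous_on_compose2[OF cperD(1)[OF assms]] continuous_intros) auto
  show "per (\<lambda>x. f (t, x))"
    unfolding per_def
  proof (intro allI ballI)
    fix x b :: 'x assume "b \<in> Basis"
    then have "(0, b) \<in> (Basis :: (real \<times> 'x) set)" by (simp add: Basis_prod_def)
    then have "f ((t, x) + (0, b)) = f (t, x)"
      using cperD(2)[OF assms] unfolding per_def by blast
    then show "f (t, x + b) = f (t, x)" by simp
  qed
qed

lemma per_prodI:
  assumes "\<And>t x. f (t + 1, x) = f (t, x)" "\<And>t x b. b \<in> Basis \<Longrightarrow> f (t, x + b) = f (t, x)"
  shows "per (f :: real \<times> 'x::euclidean_space \<Rightarrow> 'b)"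
  unfolding per_def using assms by (auto simp: Basis_prod_def)

lemma per_prodD:
  fixes f :: "real \<times> 'x::euclidean_space \<Rightarrow> 'b"
  assumes "per f"
  shows "f (t + 1, x) = f (t, x)" "b \<in> Basis \<Longrightarrow> f (t, x + b) = f (t, x)"
proof -
  have *: "f ((t, x) + b) = f (t, x)" if "b \<in> Basis" for b
    using assms that unfolding per_def by blast
  show "f (t + 1, x) = f (t, x)" using *[of "(1, 0)"] by (simp add: Basis_prod_def)
  show "b \<in> Basis \<Longrightarrow> f (t, x + b) = f (t, x)" using *[of "(0, b)"] by (simp add: Basis_prod_def)
qed

lemma cper_swap_minus:
  fixes W :: "'x::euclidean_space \<Rightarrow> real"
  assumes "cper W"
  shows "cper (\<lambda>y. W (x - y))"
  using cper_reflect[OF cper_shift[OF assms, of x]] by (simp add: add.commute)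

lemma cper_slice_avg:
  fixes f :: "real \<times> 'x::euclidean_space \<Rightarrow> real" and W :: "'x \<Rightarrow> real"
  assumes f: "cper f" and W: "cper W"
  shows "cper (\<lambda>z. avg (\<lambda>y. W (snd z - y) * f (fst z, y)))"
proof (rule cperI)
  show "continuous_on UNIV (\<lambda>z::real \<times> 'x. avg (\<lambda>y. W (snd z - y) * f (fst z, y)))"
    unfolding avg_def
  proof (rule integral_continuous_on_param)
    show "continuous_on (UNIV \<times> cell) (\<lambda>(z, y). W (snd z - y) * f (fst z, y))"
      unfolding split_beta
      by (intro continuous_intros continuous_on_compose2[OF cperD(1)[OF f]] continuous_on_compose2[OF cperD(1)[OF W]]) auto
  qed
  show "per (\<lambda>z::real \<times> 'x. avg (\<lambda>y. W (snd z - y) * f (fst z, y)))"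
  proof (rule per_prodI)
    show "avg (\<lambda>y. W (snd (t, x + b) - y) * f (fst (t, x + b), y)) = avg (\<lambda>y. W (snd (t, x) - y) * f (fst (t, x), y))"
      if "b \<in> Basis" for t x b
    proof -
      have "W (x + b - y) = W (x - y)" for y
        using cperD(2)[OF W] that unfolding per_def by (metis add_diff_eq add.commute diff_add_eq)
      then show ?thesis by simp
    qed
  qed (simp add: per_prodD[OF cperD(2)[OF f]])
qed

text \<open>The kernel may depend on \<open>z\<close>, which covers both uses: the interaction
  \<open>W (x - y)\<close> and the constant 1 of the normalisation.\<close>

lemma slice_avg_uniform_limit:
  fixes F :: "nat \<Rightarrow> real \<times> 'x::euclidean_space \<Rightarrow> real" and k :: "real \<times> 'x \<Rightarrow> 'x \<Rightarrow> real"
  assumes lim: "uniform_limit UNIV F f sequentially" and F: "\<And>n. cper (F n)"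
    and k: "\<And>z. cper (k z)" and C: "\<And>z y. \<bar>k z y\<bar> \<le> C"
  shows "uniform_limit UNIV (\<lambda>n z. avg (\<lambda>y. k z y * F n (fst z, y))) (\<lambda>z. avg (\<lambda>y. k z y * f (fst z, y))) sequentially"
  unfolding uniform_limit_iff
proof (intro allI impI)
  fix e :: real assume e: "e > 0"
  have C0: "C \<ge> 0" using C[of undefined undefined] by linarith
  have f: "cper f" by (rule cper_uniform_limit[OF lim F])
  have "e / (2 * (C + 1)) > 0" using e C0 by simp
  then have "\<forall>\<^sub>F n in sequentially. \<forall>x\<in>UNIV. dist (F n x) (f x) < e / (2 * (C + 1))"
    using lim unfolding uniform_limit_iff by blast
  then show "\<forall>\<^sub>F n in sequentially. \<forall>z\<in>UNIV. dist (avg (\<lambda>y. k z y * F n (fst z, y))) (avg (\<lambda>y. k z y * f (fst z, y))) < e"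
  proof eventually_elim
    case (elim n)
    show ?case
    proof
      fix z :: "real \<times> 'x"
      have c1: "cper (\<lambda>y. k z y * F n (fst z, y))" and c2: "cper (\<lambda>y. k z y * f (fst z, y))"
        by (intro cper_mult k cper_slice F f)+
      have "dist (avg (\<lambda>y. k z y * F n (fst z, y))) (avg (\<lambda>y. k z y * f (fst z, y)))
          = \<bar>avg (\<lambda>y. k z y * F n (fst z, y) - k z y * f (fst z, y))\<bar>"
        by (simp add: avg_diff[OF c1 c2] dist_real_def)
      also have "\<dots> \<le> C * (e / (2 * (C + 1)))"
      proof (rule avg_abs_le)
        show "cper (\<lambda>y. k z y * F n (fst z, y) - k z y * f (fst z, y))" by (intro cper_diff c1 c2)
        fix y
        have "\<bar>F n (fst z, y) - f (fst z, y)\<bar> \<le> e / (2 * (C + 1))"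
          using elim by (simp add: dist_real_def less_imp_le)
        then have "\<bar>k z y\<bar> * \<bar>F n (fst z, y) - f (fst z, y)\<bar> \<le> C * (e / (2 * (C + 1)))"
          by (intro mult_mono C) (use C0 in auto)
        then show "\<bar>k z y * F n (fst z, y) - k z y * f (fst z, y)\<bar> \<le> C * (e / (2 * (C + 1)))"
          by (simp add: abs_mult[symmetric] right_diff_distrib)
      qed
      also have "\<dots> \<le> (C + 1) * (e / (2 * (C + 1)))"
        using C0 e by (intro mult_right_mono) auto
      also have "\<dots> = e / 2" using C0 by (simp add: field_simps)
      finally show "dist (avg (\<lambda>y. k z y * F n (fst z, y))) (avg (\<lambda>y. k z y * f (fst z, y))) < e"
        using e by simp
    qed
  qed
qed

lemma uniform_limit_real_const:
  assumes "l \<longlonglongrightarrow> (L::real)"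
  shows "uniform_limit S (\<lambda>n z. l n) (\<lambda>z. L) sequentially"
  unfolding uniform_limit_iff using tendstoD[OF assms] by (auto elim: eventually_mono)

lemma cper_bounded_image: "cper (f :: _ \<Rightarrow> real) \<Longrightarrow> bounded (f ` S)"
  using cper_bounded[of f] by (metis (no_types, lifting) boundedI imageE)

lemma uniform_limit_reflect:
  assumes "uniform_limit UNIV f g F"
  shows "uniform_limit UNIV (\<lambda>n z. f n (- z :: 'a::euclidean_space)) (\<lambda>z. g (- z)) F"
  using uniform_limit_compose'[OF assms, of uminus UNIV] by simp

section \<open>One eigenvalue equation with a given potential\<close>

context heat
begin

text \<open>Since \<open>avg (R f) = avg f / \<mu>\<close>, subtracting \<open>avg (q w)\<close> is exactly what preserves
  \<open>avg w = 1\<close>; at a fixed point this number is the eigenvalue.\<close>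

definition hh :: "(real \<times> 'x \<Rightarrow> real) \<Rightarrow> (real \<times> 'x \<Rightarrow> real) \<Rightarrow> real \<times> 'x \<Rightarrow> real" where
  "hh q w z = (q z + \<mu> - avg (\<lambda>z. q z * w z)) * w z"

definition T :: "(real \<times> 'x \<Rightarrow> real) \<Rightarrow> (real \<times> 'x \<Rightarrow> real) \<Rightarrow> real \<times> 'x \<Rightarrow> real" where
  "T q w = R (hh q w)"

lemma hh_cper: "cper q \<Longrightarrow> cper w \<Longrightarrow> cper (hh q w)"
  unfolding hh_def by (intro cper_mult cper_diff cper_add cper_const)

lemma T_cper: "cper q \<Longrightarrow> cper w \<Longrightarrow> cper (T q w)"
  unfolding T_def by (intro R_cper hh_cper)

lemma T_avg:
  assumes "cper q" "cper w" "avg w = 1"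
  shows "avg (T q w) = 1"
proof -
  have "avg (hh q w) = avg (\<lambda>z. q z * w z + (\<mu> - avg (\<lambda>z. q z * w z)) * w z)"
    unfolding hh_def by (simp add: algebra_simps)
  also have "\<dots> = \<mu>"
    using assms by (simp add: avg_add cper_mult cper_cmult avg_cmult)
  finally show ?thesis
    unfolding T_def using assms \<mu>_pos by (simp add: R_avg hh_cper)
qed

text \<open>Since \<open>w\<close> is nonnegative with mean 1, both \<open>q\<close> and its
  weighted mean lie between \<open>- B\<close> and \<open>B\<close>; the coefficient of
  \<open>w\<close> thus differs from \<open>\<mu>\<close> by at most
  \<open>2 * B \<le> \<mu> / 2\<close>.\<close>

lemma hh_bounds:
  assumes q: "cper q" "\<And>z. \<bar>q z\<bar> \<le> B" and B: "4 * B \<le> \<mu>" and w: "cper w" "\<And>z. 0 \<le> w z" "avg w = 1"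
  shows "\<mu> / 2 * w z \<le> hh q w z" "hh q w z \<le> 2 * \<mu> * w z"
proof -
  have "avg (\<lambda>z. q z * w z) \<le> avg (\<lambda>z. B * w z)"
    using q(2) w by (intro avg_mono cper_mult cper_cmult q w mult_right_mono) (auto simp: abs_le_iff)
  moreover have "avg (\<lambda>z. (- B) * w z) \<le> avg (\<lambda>z. q z * w z)"
  proof (intro avg_mono cper_mult cper_const q w mult_right_mono)
    show "- B \<le> q x" for x using q(2)[of x] by linarith
  qed
  ultimately have l: "avg (\<lambda>z. q z * w z) \<le> B" "- B \<le> avg (\<lambda>z. q z * w z)"
    using w(3) by (simp_all only: avg_cmult)
  have "- B \<le> q z" "q z \<le> B" using q(2)[of z] by linarith+
  then have "\<mu> / 2 \<le> q z + \<mu> - avg (\<lambda>z. q z * w z)" "q z + \<mu> - avg (\<lambda>z. q z * w z) \<le> 2 * \<mu>"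
    using l B \<mu>_pos by linarith+
  note le = this
  show "\<mu> / 2 * w z \<le> hh q w z"
    unfolding hh_def by (rule mult_right_mono[OF le(1) w(2)])
  show "hh q w z \<le> 2 * \<mu> * w z"
    unfolding hh_def by (rule mult_right_mono[OF le(2) w(2)])
qed

text \<open>The constants do not depend on \<open>q\<close> or \<open>w\<close>. The last claim has
  no bound on \<open>w\<close> among its premises, as arbitrary solutions demand: the supremum
  \<open>S\<close> of a periodic continuous fixed point is finite, and
  \<open>S \<le> S / 2 + 2 * \<mu> * C\<close> then limits it.\<close>

lemma T_bounds:
  assumes B: "4 * B \<le> \<mu>"
  obtains \<delta> M where "\<delta> > 0" "M > 0" "\<delta> \<le> 1" "1 \<le> M"
    "\<And>q w z. cper q \<Longrightarrow> (\<And>z. \<bar>q z\<bar> \<le> B) \<Longrightarrow> cper w \<Longrightarrow> (\<And>z. 0 \<le> w z) \<Longrightarrow> avg w = 1 \<Longrightarrow> \<delta> \<le> T q w z"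
    "\<And>q w z. cper q \<Longrightarrow> (\<And>z. \<bar>q z\<bar> \<le> B) \<Longrightarrow> cper w \<Longrightarrow> (\<And>z. 0 \<le> w z) \<Longrightarrow> avg w = 1 \<Longrightarrow> (\<And>z. w z \<le> M) \<Longrightarrow> T q w z \<le> M"
    "\<And>q w z. cper q \<Longrightarrow> (\<And>z. \<bar>q z\<bar> \<le> B) \<Longrightarrow> cper w \<Longrightarrow> (\<And>z. 0 \<le> w z) \<Longrightarrow> avg w = 1 \<Longrightarrow> w = T q w \<Longrightarrow> w z \<le> M"
proof -
  obtain d where d: "d > 0" "\<And>f z. cper f \<Longrightarrow> (\<And>x. 0 \<le> f x) \<Longrightarrow> d * avg f \<le> R f z"
    using R_lower by blast
  \<comment> \<open>Matched to the estimate of \<open>hh\<close> by \<open>2 * \<mu> * w\<close>, so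
    that the supremum returns with the factor 1/2.\<close>
  have "1 / (4 * \<mu>) > 0" using \<mu>_pos by simp
  then obtain C where C: "C > 0" "\<And>f z M. cper f \<Longrightarrow> (\<And>x. 0 \<le> f x) \<Longrightarrow> (\<And>x. f x \<le> M) \<Longrightarrow> R f z \<le> 1 / (4 * \<mu>) * M + C * avg f"
    using R_upper by blast
  have up: "T q w z \<le> M / 2 + 2 * \<mu> * C"
    if "cper q" "\<And>z. \<bar>q z\<bar> \<le> B" "cper w" "\<And>z. 0 \<le> w z" "avg w = 1" "\<And>z. w z \<le> M" for q w z M
  proof -
    have "T q w z \<le> R (\<lambda>z. 2 * \<mu> * w z) z"
      unfolding T_def R_def using hh_bounds[OF that(1,2) B that(3,4,5)] that
      by (intro conv_mono[OF K_integrable] hh_cper cper_cmult K_nonneg)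
    also have "\<dots> = 2 * \<mu> * R w z" by (rule R_cmult)
    also have "\<dots> \<le> 2 * \<mu> * (1 / (4 * \<mu>) * M + C * avg w)"
      using C(2)[OF that(3,4,6)] \<mu>_pos by (intro mult_left_mono) auto
    also have "\<dots> = M / 2 + 2 * \<mu> * C" using \<mu>_pos that(5) by (simp add: field_simps)
    finally show ?thesis .
  qed
  \<comment> \<open>The cut-offs at 1 here and in \<open>M\<close> leave the constant function 1
    admissible; \<open>4 * \<mu> * C\<close> is the number reproduced by
    \<open>m \<mapsto> m / 2 + 2 * \<mu> * C\<close>.\<close>
  define \<delta> where "\<delta> = min 1 (\<mu> / 2 * d)"
  define M where "M = max 1 (4 * \<mu> * C)"
  show thesis
  proof (rule that[of \<delta> M])
    show "\<delta> > 0" "\<delta> \<le> 1" "M > 0" "1 \<le> M" using d(1) \<mu>_pos by (auto simp: \<delta>_def M_def)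
    fix q w :: "real \<times> 'x \<Rightarrow> real" and z assume q: "cper q" "\<And>z. \<bar>q z\<bar> \<le> B" and w: "cper w" "\<And>z. 0 \<le> w z" "avg w = 1"
    have "\<mu> / 2 * d \<le> \<mu> / 2 * R w z"
      using d(2)[OF w(1,2), of z] w(3) \<mu>_pos by (intro mult_left_mono) auto
    also have "\<dots> = R (\<lambda>z. \<mu> / 2 * w z) z" by (rule R_cmult[symmetric])
    also have "\<dots> \<le> T q w z"
      unfolding T_def R_def using hh_bounds[OF q B w] q w
      by (intro conv_mono[OF K_integrable] hh_cper cper_cmult K_nonneg)
    finally show "\<delta> \<le> T q w z" by (simp add: \<delta>_def)
    have M: "2 * \<mu> * C \<le> M / 2" by (simp add: M_def)
    show "T q w z \<le> M" if "\<And>z. w z \<le> M"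
      using up[OF q w that, of z] M by simp
    show "w z \<le> M" if fp: "w = T q w"
    proof -
      obtain m where m: "\<And>x. norm (w x) \<le> m" using cper_bounded[OF w(1)] by metis
      have bdd: "bdd_above (range w)"
        using m by (intro bdd_aboveI[of _ m]) (auto simp: abs_le_iff)
      define S where "S = (SUP z. w z)"
      have wS: "w z \<le> S" for z unfolding S_def by (rule cSUP_upper[OF _ bdd]) simp
      have "S \<le> S / 2 + 2 * \<mu> * C"
        unfolding S_def
      proof (rule cSUP_least)
        fix x
        show "w x \<le> (SUP z. w z) / 2 + 2 * \<mu> * C"
          using up[OF q w wS, of x] fp by (metis S_def)
      qed simp
      then show ?thesis using wS[of z] M by linarith
    qed
  qed
qed

lemma hh_limit:
  assumes q: "uniform_limit UNIV q q' sequentially" "\<And>n. cper (q n)"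
    and w: "uniform_limit UNIV w w' sequentially" "\<And>n. cper (w n)"
  shows "uniform_limit UNIV (\<lambda>n. hh (q n) (w n)) (hh q' w') sequentially"
proof -
  have c: "cper q'" "cper w'" using cper_uniform_limit q w by blast+
  have qw: "uniform_limit UNIV (\<lambda>n z. q n z * w n z) (\<lambda>z. q' z * w' z) sequentially"
    by (intro uniform_lim_mult q w cper_bounded_image c)
  have "(\<lambda>n. avg (\<lambda>z. q n z * w n z)) \<longlonglongrightarrow> avg (\<lambda>z. q' z * w' z)"
    by (rule avg_uniform_limit[OF qw]) (intro cper_mult q w)
  then have l: "uniform_limit UNIV (\<lambda>n z. avg (\<lambda>z. q n z * w n z)) (\<lambda>z. avg (\<lambda>z. q' z * w' z)) sequentially"
    by (rule uniform_limit_real_const)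
  have "uniform_limit UNIV (\<lambda>n z. (q n z + \<mu> - avg (\<lambda>z. q n z * w n z)) * w n z) (\<lambda>z. (q' z + \<mu> - avg (\<lambda>z. q' z * w' z)) * w' z) sequentially"
    by (intro uniform_lim_mult uniform_limit_intros q w l cper_bounded_image c cper_add cper_diff cper_const)
  then show ?thesis by (simp add: hh_def[abs_def])
qed

lemma T_limit:
  assumes q: "uniform_limit UNIV q q' sequentially" "\<And>n. cper (q n)"
    and w: "uniform_limit UNIV w w' sequentially" "\<And>n. cper (w n)"
  shows "uniform_limit UNIV (\<lambda>n. T (q n) (w n)) (T q' w') sequentially"
  unfolding T_def R_def
  by (rule conv_uniform_limit[OF K_integrable hh_limit[OF assms]]) (intro hh_cper q w)

lemma R1_limit:
  assumes b: "b \<in> Basis" and "uniform_limit UNIV f g sequentially" "\<And>n. cper (f n)"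
  shows "uniform_limit UNIV (\<lambda>n. R1 b (f n)) (R1 b g) sequentially"
  unfolding R1_def[abs_def]
  by (intro uniform_limit_intros conv_uniform_limit[OF K1_integrable[OF b]] assms)

lemma T_equicontinuous:
  assumes B: "4 * B \<le> \<mu>" and e: "e > 0"
  obtains d where "d > 0"
    "\<And>q w z h. cper q \<Longrightarrow> (\<And>z. \<bar>q z\<bar> \<le> B) \<Longrightarrow> cper w \<Longrightarrow> (\<And>z. 0 \<le> w z) \<Longrightarrow> avg w = 1 \<Longrightarrow> (\<And>z. w z \<le> M) \<Longrightarrow>
       norm h < d \<Longrightarrow> \<bar>T q w (z + h) - T q w z\<bar> \<le> e"
proof -
  obtain d where d: "d > 0" "\<And>(f::real\<times>'x \<Rightarrow> real) z h. cper f \<Longrightarrow> (\<And>x. \<bar>f x\<bar> \<le> 2 * \<mu> * M) \<Longrightarrow> norm h < d \<Longrightarrow> \<bar>conv K f (z + h) - conv K f z\<bar> \<le> e"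
    using conv_equicontinuous[OF K_integrable K_nonneg K_AE_isCont e] by metis
  show thesis
  proof (rule that[OF d(1)])
    fix q w :: "real \<times> 'x \<Rightarrow> real" and z h :: "real \<times> 'x"
    assume q: "cper q" "\<And>z. \<bar>q z\<bar> \<le> B" and w: "cper w" "\<And>z. 0 \<le> w z" "avg w = 1" "\<And>z. w z \<le> M" and h: "norm h < d"
    have "\<bar>hh q w x\<bar> \<le> 2 * \<mu> * M" for x
    proof -
      have "0 \<le> \<mu> / 2 * w x" using \<mu>_pos w(2)[of x] by simp
      moreover have "2 * \<mu> * w x \<le> 2 * \<mu> * M" using \<mu>_pos w(4)[of x] by simp
      ultimately show ?thesis using hh_bounds[OF q B w(1,2,3), of x] by linarith
    qed
    then show "\<bar>T q w (z + h) - T q w z\<bar> \<le> e"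
      unfolding T_def R_def by (intro d(2) hh_cper q w h)
  qed
qed

end

text \<open>Continuity and bounds of the data appear here; their smoothness enters with the
  regularity of fixed points. The value of \<open>\<mu>\<close> is four times the bound on the
  potential, as \<open>hh_bounds\<close> asks, plus 1 to be positive.\<close>

locale mfg = heat a \<mu> c for a \<mu> :: real and c :: "'x::euclidean_space" +
  fixes \<beta> bV bW :: real and V :: "real \<times> 'x \<Rightarrow> real" and W :: "'x \<Rightarrow> real"
  assumes \<beta>_pos: "\<beta> > 0" and a_eq: "a = 1 / (2 * \<beta>)"
    and V: "cper V" "\<And>z. \<bar>V z\<bar> \<le> bV" and W: "cper W" "\<And>x. \<bar>W x\<bar> \<le> bW"
    and \<mu>_eq: "\<mu> = 4 * (\<beta> * (bV + bW)) + 1"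
begin

text \<open>At a fixed point \<open>Nf\<close> does not depend on time. Away from fixed points the normalisation keeps
  \<open>rho\<close> a probability density, and hence \<open>Q\<close> bounded by \<open>BQ\<close>.\<close>

definition Nf :: "(real \<times> 'x \<Rightarrow> real) \<Rightarrow> (real \<times> 'x \<Rightarrow> real) \<Rightarrow> real \<Rightarrow> real" where
  "Nf w v t = avg (\<lambda>x. w (t, x) * v (t, x))"

definition rho :: "(real \<times> 'x \<Rightarrow> real) \<Rightarrow> (real \<times> 'x \<Rightarrow> real) \<Rightarrow> real \<times> 'x \<Rightarrow> real" where
  "rho w v z = w z * v z / Nf w v (fst z)"

definition Wc :: "(real \<times> 'x \<Rightarrow> real) \<Rightarrow> real \<times> 'x \<Rightarrow> real" where
  "Wc \<rho> z = avg (\<lambda>y. W (snd z - y) * \<rho> (fst z, y))"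

definition Qf :: "(real \<times> 'x \<Rightarrow> real) \<Rightarrow> real \<times> 'x \<Rightarrow> real" where
  "Qf \<rho> z = \<beta> * (V z + Wc \<rho> z)"

definition Q :: "(real \<times> 'x \<Rightarrow> real) \<Rightarrow> (real \<times> 'x \<Rightarrow> real) \<Rightarrow> real \<times> 'x \<Rightarrow> real" where
  "Q w v = Qf (rho w v)"

definition Phi1 :: "(real \<times> 'x \<Rightarrow> real) \<Rightarrow> (real \<times> 'x \<Rightarrow> real) \<Rightarrow> real \<times> 'x \<Rightarrow> real" where
  "Phi1 w v = T (Q w v) w"

text \<open>The equation for \<open>v\<close> runs forward in time; reflecting space-time turns its operator into the
  one for \<open>w\<close>.\<close>

definition Phi2 :: "(real \<times> 'x \<Rightarrow> real) \<Rightarrow> (real \<times> 'x \<Rightarrow> real) \<Rightarrow> real \<times> 'x \<Rightarrow> real" where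
  "Phi2 w v z = T (\<lambda>z. Q w v (- z)) (\<lambda>z. v (- z)) (- z)"

definition BQ :: real where "BQ = \<beta> * (bV + bW)"

lemma BQ: "4 * BQ \<le> \<mu>" using \<mu>_eq by (simp add: BQ_def)

lemma Wc_cper: "cper \<rho> \<Longrightarrow> cper (Wc \<rho>)"
  unfolding Wc_def by (intro cper_slice_avg W)

lemma Qf_cper: "cper \<rho> \<Longrightarrow> cper (Qf \<rho>)"
  unfolding Qf_def by (intro cper_cmult cper_add V Wc_cper)

text \<open>An average of \<open>W\<close> against a probability density: the size of
  \<open>\<rho>\<close> does not enter, and therefore the coupling counts as a bounded
  potential.\<close>

lemma Wc_bound:
  assumes "cper \<rho>" "\<And>z. 0 \<le> \<rho> z" "\<And>t. avg (\<lambda>x. \<rho> (t, x)) = 1"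
  shows "\<bar>Wc \<rho> z\<bar> \<le> bW"
proof -
  have c: "cper (\<lambda>y. W (snd z - y) * \<rho> (fst z, y))"
    by (intro cper_mult cper_swap_minus W cper_slice assms)
  have s: "cper (\<lambda>y. \<rho> (fst z, y))" by (intro cper_slice assms)
  have "avg (\<lambda>y. W (snd z - y) * \<rho> (fst z, y)) \<le> avg (\<lambda>y. bW * \<rho> (fst z, y))"
  proof (intro avg_mono c cper_cmult s mult_right_mono assms)
    show "W (snd z - x) \<le> bW" for x using W(2)[of "snd z - x"] by linarith
  qed
  moreover have "avg (\<lambda>y. (- bW) * \<rho> (fst z, y)) \<le> avg (\<lambda>y. W (snd z - y) * \<rho> (fst z, y))"
  proof (intro avg_mono c cper_cmult s mult_right_mono assms)
    show "- bW \<le> W (snd z - x)" for x using W(2)[of "snd z - x"] by linarith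
  qed
  ultimately show ?thesis unfolding Wc_def avg_cmult assms(3) by linarith
qed

lemma Qf_bound:
  assumes "cper \<rho>" "\<And>z. 0 \<le> \<rho> z" "\<And>t. avg (\<lambda>x. \<rho> (t, x)) = 1"
  shows "\<bar>Qf \<rho> z\<bar> \<le> BQ"
proof -
  have "\<bar>V z + Wc \<rho> z\<bar> \<le> bV + bW"
    using V(2)[of z] Wc_bound[OF assms, of z] by linarith
  then show ?thesis
    unfolding Qf_def BQ_def abs_mult using \<beta>_pos by (intro mult_mono) auto
qed

lemma Nf_cper: "cper w \<Longrightarrow> cper v \<Longrightarrow> cper (\<lambda>z::real \<times> 'x. Nf w v (fst z))"
  using cper_slice_avg[OF cper_mult[of w v] cper_const[of "1::real"]] by (simp add: Nf_def)

context
  fixes w v :: "real \<times> 'x \<Rightarrow> real" and \<delta> M :: real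
  assumes w: "cper w" "\<And>z. \<delta> \<le> w z" "\<And>z. w z \<le> M" and v: "cper v" "\<And>z. \<delta> \<le> v z" "\<And>z. v z \<le> M" and \<delta>: "\<delta> > 0"
begin

lemma Nf_lower: "\<delta> * \<delta> \<le> Nf w v t"
  unfolding Nf_def
proof (rule avg_ge_const)
  show "\<delta> * \<delta> \<le> w (t, x) * v (t, x)" for x
    using w(2)[of "(t, x)"] v(2)[of "(t, x)"] \<delta> by (intro mult_mono) auto
qed (intro cper_mult cper_slice w v)

lemma Nf_pos: "Nf w v t > 0"
  using Nf_lower[of t] \<delta> by (smt (verit) mult_pos_pos)

lemma rho_cper: "cper (rho w v)"
proof -
  have "cper (\<lambda>z. (w z * v z) * (1 / Nf w v (fst z)))"
    by (intro cper_mult cper_inverse Nf_cper w v) (use Nf_pos in \<open>auto simp: less_imp_neq[symmetric] dest: less_imp_neq\<close>)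
  then show ?thesis by (simp add: rho_def[abs_def])
qed

lemma rho_pos: "0 < rho w v z"
proof -
  have "0 < w z" "0 < v z" using w(2)[of z] v(2)[of z] \<delta> by linarith+
  then show ?thesis unfolding rho_def using Nf_pos by simp
qed

lemma rho_avg: "avg (\<lambda>x. rho w v (t, x)) = 1"
  unfolding rho_def using Nf_pos[of t] by (simp add: avg_divide Nf_def)

lemma Q_cper: "cper (Q w v)"
  unfolding Q_def by (intro Qf_cper rho_cper)

lemma Q_bound: "\<bar>Q w v z\<bar> \<le> BQ"
  unfolding Q_def by (intro Qf_bound rho_cper less_imp_le rho_pos rho_avg)

end

lemma Qf_limit:
  assumes "uniform_limit UNIV \<rho> \<rho>' sequentially" "\<And>n. cper (\<rho> n)"
  shows "uniform_limit UNIV (\<lambda>n. Wc (\<rho> n)) (Wc \<rho>') sequentially"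
    "uniform_limit UNIV (\<lambda>n. Qf (\<rho> n)) (Qf \<rho>') sequentially"
proof -
  show *: "uniform_limit UNIV (\<lambda>n. Wc (\<rho> n)) (Wc \<rho>') sequentially"
    unfolding Wc_def[abs_def]
    by (rule slice_avg_uniform_limit[OF assms cper_swap_minus[OF W(1)] W(2)])
  show "uniform_limit UNIV (\<lambda>n. Qf (\<rho> n)) (Qf \<rho>') sequentially"
    unfolding Qf_def[abs_def]
    by (intro uniform_limit_cmult uniform_limit_intros *)
qed

text \<open>The lower bound on \<open>w\<close> and \<open>v\<close> keeps the normalisation above
  \<open>\<delta> * \<delta>\<close>, so the quotient passes to the limit uniformly.\<close>

lemma rho_limit:
  assumes w: "uniform_limit UNIV w w' sequentially" "\<And>n. cper (w n)" "\<And>n z. \<delta> \<le> w n z" "\<And>n z. w n z \<le> M"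
    and v: "uniform_limit UNIV v v' sequentially" "\<And>n. cper (v n)" "\<And>n z. \<delta> \<le> v n z" "\<And>n z. v n z \<le> M"
    and w': "\<And>z. \<delta> \<le> w' z" "\<And>z. w' z \<le> M" and v': "\<And>z. \<delta> \<le> v' z" "\<And>z. v' z \<le> M"
    and \<delta>: "\<delta> > 0"
  shows "uniform_limit UNIV (\<lambda>n. rho (w n) (v n)) (rho w' v') sequentially"
proof -
  have c: "cper w'" "cper v'" using cper_uniform_limit w v by blast+
  have wv: "uniform_limit UNIV (\<lambda>n z. w n z * v n z) (\<lambda>z. w' z * v' z) sequentially"
    by (intro uniform_lim_mult w v cper_bounded_image c)
  have N: "uniform_limit UNIV (\<lambda>n z. Nf (w n) (v n) (fst z)) (\<lambda>z::real \<times> 'x. Nf w' v' (fst z)) sequentially"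
    using slice_avg_uniform_limit[OF wv cper_mult[OF w(2) v(2)], of "\<lambda>_ _. 1" 1] by (simp add: Nf_def cper_const)
  show ?thesis
    unfolding rho_def[abs_def]
  proof (rule uniform_lim_divide[OF wv N])
    show "bounded ((\<lambda>z. w' z * v' z) ` UNIV)" by (intro cper_bounded_image cper_mult c)
    show "\<delta> * \<delta> > 0" using \<delta> by simp
    show "\<delta> * \<delta> \<le> norm (Nf w' v' (fst x))" for x :: "real \<times> 'x"
      using Nf_lower[OF c(1) w' c(2) v' \<delta>, of "fst x"] by (simp add: abs_le_iff)
  qed
qed

section \<open>The self-map on pairs of functions and its compactness\<close>

lemma Lim_transform_dist:
  fixes f :: "'i \<Rightarrow> 'b::metric_space"
  assumes f: "(f \<longlongrightarrow> l) F" and d: "((\<lambda>n. dist (f n) (g n)) \<longlongrightarrow> 0) F"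
  shows "(g \<longlongrightarrow> l) F"
  unfolding tendsto_dist_iff[of g]
proof (rule tendsto_sandwich[OF _ _ tendsto_const])
  show "((\<lambda>n. dist (f n) l + dist (f n) (g n)) \<longlongrightarrow> 0) F"
    using tendsto_add[OF f[unfolded tendsto_dist_iff[of f]] d] by simp
  show "\<forall>\<^sub>F n in F. dist (g n) l \<le> dist (f n) l + dist (f n) (g n)"
    using dist_triangle3[of "g _" l "f _"] by (intro always_eventually allI) (simp add: add.commute)
qed simp

text \<open>A pair of functions is stored as one bounded continuous map into the plane; the norm and
  the completeness of that type then serve both components at once.\<close>

type_synonym 'y state = "(real \<times> 'y) \<Rightarrow>\<^sub>C (real \<times> real)"

definition ws :: "'x state \<Rightarrow> real \<times> 'x \<Rightarrow> real" where "ws s z = fst (apply_bcontfun s z)"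
definition vs :: "'x state \<Rightarrow> real \<times> 'x \<Rightarrow> real" where "vs s z = snd (apply_bcontfun s z)"

text \<open>The two averages remove the two scaling freedoms of the eigenfunctions. The set is
  convex and closed, and compactness is supplied by the image under \<open>Phi\<close>.\<close>

definition KK :: "real \<Rightarrow> real \<Rightarrow> 'x state set" where
  "KK \<delta> M = {s. cper (ws s) \<and> cper (vs s) \<and> avg (ws s) = 1 \<and> avg (vs s) = 1 \<and>
     (\<forall>z. \<delta> \<le> ws s z \<and> ws s z \<le> M \<and> \<delta> \<le> vs s z \<and> vs s z \<le> M)}"

lemma KKD:
  assumes "s \<in> KK \<delta> M"
  shows "cper (ws s)" "cper (vs s)" "avg (ws s) = 1" "avg (vs s) = 1"
    "\<delta> \<le> ws s z" "ws s z \<le> M" "\<delta> \<le> vs s z" "vs s z \<le> M"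
  using assms unfolding KK_def by blast+

text \<open>\<open>Bcontfun\<close> returns the intended map only for bounded continuous functions,
  which is secured on \<open>KK\<close> by \<open>Phi_apply\<close>.\<close>

definition Phi :: "'x state \<Rightarrow> 'x state" where
  "Phi s = Bcontfun (\<lambda>z. (Phi1 (ws s) (vs s) z, Phi2 (ws s) (vs s) z))"

lemma state_limit:
  assumes "s \<longlonglongrightarrow> l"
  shows "uniform_limit UNIV (\<lambda>n. ws (s n)) (ws l) sequentially" "uniform_limit UNIV (\<lambda>n. vs (s n)) (vs l) sequentially"
proof -
  have *: "uniform_limit UNIV (\<lambda>n. apply_bcontfun (s n)) (apply_bcontfun l) sequentially"
    by (rule tendsto_bcontfun_uniform_limit[OF assms])
  show "uniform_limit UNIV (\<lambda>n. ws (s n)) (ws l) sequentially"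
    using bounded_linear.uniform_limit[OF bounded_linear_fst *] by (simp add: ws_def[abs_def])
  show "uniform_limit UNIV (\<lambda>n. vs (s n)) (vs l) sequentially"
    using bounded_linear.uniform_limit[OF bounded_linear_snd *] by (simp add: vs_def[abs_def])
qed

lemma state_limitI:
  assumes "uniform_limit UNIV (\<lambda>n. ws (s n)) (ws l) sequentially" "uniform_limit UNIV (\<lambda>n. vs (s n)) (vs l) sequentially"
  shows "s \<longlonglongrightarrow> l"
proof (rule uniform_limit_tendsto_bcontfun)
  show "uniform_limit UNIV (\<lambda>n. apply_bcontfun (s n)) (apply_bcontfun l) sequentially"
    unfolding uniform_limit_iff
  proof (intro allI impI)
    fix e :: real assume e: "e > 0"
    have "\<forall>\<^sub>F n in sequentially. \<forall>z\<in>UNIV. dist (ws (s n) z) (ws l z) < e / 2" "\<forall>\<^sub>F n in sequentially. \<forall>z\<in>UNIV. dist (vs (s n) z) (vs l z) < e / 2"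
      using assms e unfolding uniform_limit_iff by (meson half_gt_zero)+
    then show "\<forall>\<^sub>F n in sequentially. \<forall>z\<in>UNIV. dist (apply_bcontfun (s n) z) (apply_bcontfun l z) < e"
    proof eventually_elim
      case (elim n)
      show ?case
      proof
        fix z
        have "dist (apply_bcontfun (s n) z) (apply_bcontfun l z) \<le> dist (ws (s n) z) (ws l z) + dist (vs (s n) z) (vs l z)"
          unfolding ws_def vs_def dist_prod_def by (rule sqrt_sum_squares_le_sum) auto
        also have "\<dots> < e" using elim by (metis (no_types, lifting) UNIV_I add_strict_mono field_sum_of_halves)
        finally show "dist (apply_bcontfun (s n) z) (apply_bcontfun l z) < e" .
      qed
    qed
  qed
qed

lemma KK_closed:
  assumes "\<And>n. s n \<in> KK \<delta> M" "s \<longlonglongrightarrow> l"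
  shows "l \<in> KK \<delta> M"
proof -
  note lim = state_limit[OF assms(2)]
  have s: "cper (ws (s n))" "cper (vs (s n))" "avg (ws (s n)) = 1" "avg (vs (s n)) = 1"
    "\<delta> \<le> ws (s n) z" "ws (s n) z \<le> M" "\<delta> \<le> vs (s n) z" "vs (s n) z \<le> M" for n z
    by (rule KKD[OF assms(1)])+
  have pw: "(\<lambda>n. ws (s n) z) \<longlonglongrightarrow> ws l z" "(\<lambda>n. vs (s n) z) \<longlonglongrightarrow> vs l z" for z
    by (rule tendsto_uniform_limitI[OF lim(1)], simp, rule tendsto_uniform_limitI[OF lim(2)], simp)
  have "avg (ws l) = 1" "avg (vs l) = 1"
    using avg_uniform_limit[OF lim(1) s(1)] avg_uniform_limit[OF lim(2) s(2)] s(3,4)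
    by (simp_all add: LIMSEQ_const_iff)
  moreover have "cper (ws l)" "cper (vs l)"
    using cper_uniform_limit lim s(1,2) by blast+
  moreover have "\<delta> \<le> ws l z" "ws l z \<le> M" "\<delta> \<le> vs l z" "vs l z \<le> M" for z
    using LIMSEQ_le_const[OF pw(1)] LIMSEQ_le_const2[OF pw(1)] LIMSEQ_le_const[OF pw(2)] LIMSEQ_le_const2[OF pw(2)] s(5-8)
    by blast+
  ultimately show ?thesis unfolding KK_def by blast
qed

lemma KK_convex: "convex (KK \<delta> M)"
proof (rule convexI)
  fix s t :: "'x state" and p q :: real
  assume st: "s \<in> KK \<delta> M" "t \<in> KK \<delta> M" and pq: "0 \<le> p" "0 \<le> q" "p + q = 1"
  have e: "ws (p *\<^sub>R s + q *\<^sub>R t) = (\<lambda>z. p * ws s z + q * ws t z)" "vs (p *\<^sub>R s + q *\<^sub>R t) = (\<lambda>z. p * vs s z + q * vs t z)"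
    by (auto simp: ws_def vs_def fun_eq_iff)
  have lo: "\<delta> \<le> p * x + q * y" if "\<delta> \<le> x" "\<delta> \<le> y" for x y
    using convex_bound_le[of "- x" "- \<delta>" "- y" p q] that pq by simp
  have hi: "p * x + q * y \<le> M" if "x \<le> M" "y \<le> M" for x y
    using convex_bound_le[of x M y p q] that pq by simp
  note S = KKD[OF st(1)] and T = KKD[OF st(2)]
  have "cper (ws (p *\<^sub>R s + q *\<^sub>R t))" "cper (vs (p *\<^sub>R s + q *\<^sub>R t))"
    unfolding e by (intro cper_add cper_cmult S T)+
  moreover have "avg (ws (p *\<^sub>R s + q *\<^sub>R t)) = 1" "avg (vs (p *\<^sub>R s + q *\<^sub>R t)) = 1"
    unfolding e using pq(3) S(3,4) T(3,4) by (simp_all add: avg_add cper_cmult S T avg_cmult)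
  moreover have "\<delta> \<le> ws (p *\<^sub>R s + q *\<^sub>R t) z" "ws (p *\<^sub>R s + q *\<^sub>R t) z \<le> M"
    "\<delta> \<le> vs (p *\<^sub>R s + q *\<^sub>R t) z" "vs (p *\<^sub>R s + q *\<^sub>R t) z \<le> M" for z
    unfolding e by (intro lo hi S T)+
  ultimately show "p *\<^sub>R s + q *\<^sub>R t \<in> KK \<delta> M"
    unfolding KK_def by blast
qed

lemma Phi1_cper:
  assumes "s \<in> KK \<delta> M" "\<delta> > 0"
  shows "cper (Phi1 (ws s) (vs s))" "cper (Phi2 (ws s) (vs s))" "cper (Q (ws s) (vs s))" "\<bar>Q (ws s) (vs s) z\<bar> \<le> BQ"
proof -
  have s: "cper (ws s)" "cper (vs s)" "\<And>z. \<delta> \<le> ws s z" "\<And>z. ws s z \<le> M" "\<And>z. \<delta> \<le> vs s z" "\<And>z. vs s z \<le> M"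
    by (rule KKD[OF assms(1)])+
  show Q: "cper (Q (ws s) (vs s))" by (rule Q_cper) (use s assms in auto)
  show "\<bar>Q (ws s) (vs s) z\<bar> \<le> BQ" by (rule Q_bound) (use s assms in auto)
  show "cper (Phi1 (ws s) (vs s))" unfolding Phi1_def by (intro T_cper Q s)
  show "cper (Phi2 (ws s) (vs s))" unfolding Phi2_def
    by (intro cper_reflect[of "T (\<lambda>z. Q (ws s) (vs s) (- z)) (\<lambda>z. vs s (- z))"] T_cper cper_reflect Q s)
qed

lemma Phi_apply:
  assumes "s \<in> KK \<delta> M" "\<delta> > 0"
  shows "ws (Phi s) = Phi1 (ws s) (vs s)" "vs (Phi s) = Phi2 (ws s) (vs s)"
proof -
  let ?f = "\<lambda>z. (Phi1 (ws s) (vs s) z, Phi2 (ws s) (vs s) z)"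
  have c: "cper (Phi1 (ws s) (vs s))" "cper (Phi2 (ws s) (vs s))"
    using Phi1_cper[OF assms] by auto
  obtain M1 M2 where M: "\<And>x. norm (Phi1 (ws s) (vs s) x) \<le> M1" "\<And>x. norm (Phi2 (ws s) (vs s) x) \<le> M2"
    using cper_bounded[OF c(1)] cper_bounded[OF c(2)] by metis
  have "?f \<in> bcontfun"
  proof (rule bcontfun_normI)
    show "continuous_on UNIV ?f" by (intro continuous_intros cperD(1) c)
    show "norm (?f x) \<le> M1 + M2" for x
      using order_trans[OF norm_Pair_le add_mono[OF M]] .
  qed
  then have "apply_bcontfun (Phi s) = ?f"
    unfolding Phi_def by (simp add: Bcontfun_inverse)
  then show "ws (Phi s) = Phi1 (ws s) (vs s)" "vs (Phi s) = Phi2 (ws s) (vs s)"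
    by (auto simp: ws_def vs_def fun_eq_iff)
qed

lemma Phi_limit:
  assumes s: "\<And>n. s n \<in> KK \<delta> M" and lim: "s \<longlonglongrightarrow> l" and \<delta>: "\<delta> > 0"
  shows "(\<lambda>n. Phi (s n)) \<longlonglongrightarrow> Phi l"
proof (rule state_limitI)
  have l: "l \<in> KK \<delta> M" by (rule KK_closed[OF s lim])
  note ul = state_limit[OF lim]
  have S: "cper (ws (s n))" "cper (vs (s n))"
    "\<delta> \<le> ws (s n) z" "ws (s n) z \<le> M" "\<delta> \<le> vs (s n) z" "vs (s n) z \<le> M" for n z
    by (rule KKD[OF s])+
  have L: "\<delta> \<le> ws l z" "ws l z \<le> M" "\<delta> \<le> vs l z" "vs l z \<le> M" for z
    by (rule KKD[OF l])+
  have "uniform_limit UNIV (\<lambda>n. rho (ws (s n)) (vs (s n))) (rho (ws l) (vs l)) sequentially"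
    by (rule rho_limit[where \<delta> = \<delta> and M = M]) (use ul S L \<delta> in auto)
  moreover have "cper (rho (ws (s n)) (vs (s n)))" for n
    by (rule rho_cper[where \<delta> = \<delta> and M = M]) (use S \<delta> in auto)
  ultimately have Q: "uniform_limit UNIV (\<lambda>n. Q (ws (s n)) (vs (s n))) (Q (ws l) (vs l)) sequentially"
    unfolding Q_def by (rule Qf_limit)
  have Qc: "cper (Q (ws (s n)) (vs (s n)))" for n by (rule Phi1_cper[OF s \<delta>])
  show "uniform_limit UNIV (\<lambda>n. ws (Phi (s n))) (ws (Phi l)) sequentially"
    unfolding Phi_apply[OF s \<delta>] Phi_apply[OF l \<delta>] Phi1_def
    by (rule T_limit[OF Q Qc ul(1) S(1)])
  have "uniform_limit UNIV (\<lambda>n. T (\<lambda>z. Q (ws (s n)) (vs (s n)) (- z)) (\<lambda>z. vs (s n) (- z))) (T (\<lambda>z. Q (ws l) (vs l) (- z)) (\<lambda>z. vs l (- z))) sequentially"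
    by (intro T_limit uniform_limit_reflect Q ul cper_reflect Qc S)
  then show "uniform_limit UNIV (\<lambda>n. vs (Phi (s n))) (vs (Phi l)) sequentially"
    unfolding Phi_apply[OF s \<delta>] Phi_apply[OF l \<delta>] Phi2_def[abs_def]
    by (rule uniform_limit_reflect)
qed

text \<open>Derivatives of the states do not enter. Equicontinuity is a property of the kernel, and
  its mass \<open>1 / \<mu>\<close> against \<open>hh \<le> 2 * \<mu> * M\<close> gives the bound
  \<open>2 * M\<close> for each component.\<close>

lemma Phi_compact:
  assumes s: "\<And>n. s n \<in> KK \<delta> M" and \<delta>: "\<delta> > 0"
  obtains r l where "strict_mono (r :: nat \<Rightarrow> nat)" "(\<lambda>n. Phi (s (r n))) \<longlonglongrightarrow> l"
proof -
  have S: "cper (ws (s n))" "cper (vs (s n))" "avg (ws (s n)) = 1" "avg (vs (s n)) = 1"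
    "\<delta> \<le> ws (s n) z" "ws (s n) z \<le> M" "\<delta> \<le> vs (s n) z" "vs (s n) z \<le> M" for n z
    by (rule KKD[OF s])+
  have S0: "0 \<le> ws (s n) z" "0 \<le> vs (s n) z" for n z using S(5,7)[of n z] \<delta> by linarith+
  note Q = Phi1_cper(3,4)[OF s \<delta>]
  have eq: "\<exists>d>0. \<forall>n z h. norm h < d \<longrightarrow> norm (apply_bcontfun (Phi (s n)) (z + h) - apply_bcontfun (Phi (s n)) z) \<le> e" if e: "e > 0" for e
  proof -
    have "e / 2 > 0" using e by simp
    then obtain d where d: "d > 0"
      "\<And>q w z h. cper q \<Longrightarrow> (\<And>z. \<bar>q z\<bar> \<le> BQ) \<Longrightarrow> cper w \<Longrightarrow> (\<And>z. 0 \<le> w z) \<Longrightarrow> avg w = 1 \<Longrightarrow> (\<And>z. w z \<le> M) \<Longrightarrow>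
       norm h < d \<Longrightarrow> \<bar>T q w (z + h) - T q w z\<bar> \<le> e / 2"
      using T_equicontinuous[OF BQ] by metis
    have "norm (apply_bcontfun (Phi (s n)) (z + h) - apply_bcontfun (Phi (s n)) z) \<le> e" if h: "norm h < d" for n z h
    proof -
      have 1: "\<bar>ws (Phi (s n)) (z + h) - ws (Phi (s n)) z\<bar> \<le> e / 2"
        unfolding Phi_apply[OF s \<delta>] Phi1_def by (rule d(2)) (use Q S S0 h in auto)
      have "\<bar>T (\<lambda>z. Q (ws (s n)) (vs (s n)) (- z)) (\<lambda>z. vs (s n) (- z)) (- z + - h) - T (\<lambda>z. Q (ws (s n)) (vs (s n)) (- z)) (\<lambda>z. vs (s n) (- z)) (- z)\<bar> \<le> e / 2"
        by (rule d(2)) (use Q S S0 h in \<open>auto simp: avg_reflect intro!: cper_reflect\<close>)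
      then have 2: "\<bar>vs (Phi (s n)) (z + h) - vs (Phi (s n)) z\<bar> \<le> e / 2"
        unfolding Phi_apply[OF s \<delta>] Phi2_def by (simp add: add.commute)
      have "norm (apply_bcontfun (Phi (s n)) (z + h) - apply_bcontfun (Phi (s n)) z) \<le>
         norm (ws (Phi (s n)) (z + h) - ws (Phi (s n)) z) + norm (vs (Phi (s n)) (z + h) - vs (Phi (s n)) z)"
      proof -
        have "norm p \<le> norm (fst p) + norm (snd p)" for p :: "real \<times> real"
          by (metis norm_Pair_le prod.collapse)
        from this[of "apply_bcontfun (Phi (s n)) (z + h) - apply_bcontfun (Phi (s n)) z"]
        show ?thesis unfolding ws_def vs_def by (simp only: fst_diff snd_diff)
      qed
      also have "\<dots> \<le> e" using 1 2 by simp
      finally show ?thesis .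
    qed
    with d(1) show ?thesis by blast
  qed
  have hb: "hh q w z \<le> 2 * \<mu> * M"
    if "cper q" "\<And>z. \<bar>q z\<bar> \<le> BQ" "cper w" "\<And>z. 0 \<le> w z" "avg w = 1" "\<And>z. w z \<le> M" for q w z
    using hh_bounds(2)[OF that(1,2) BQ that(3,4,5), of z] that(6)[of z] \<mu>_pos
    by (smt (verit) mult_left_mono)
  have Tb: "\<bar>T q w z\<bar> \<le> 2 * M"
    if "cper q" "\<And>z. \<bar>q z\<bar> \<le> BQ" "cper w" "\<And>z. 0 \<le> w z" "avg w = 1" "\<And>z. w z \<le> M" for q w z
  proof -
    have "\<bar>conv K (hh q w) z\<bar> \<le> (\<integral>y. \<bar>K y\<bar> \<partial>lborel) * (2 * \<mu> * M)"
    proof (rule conv_bound[OF K_integrable])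
      show "cper (hh q w)" using that by (intro hh_cper)
      fix x
      have "0 \<le> \<mu> / 2 * w x" using that(4)[of x] \<mu>_pos by simp
      then have "0 \<le> hh q w x" using hh_bounds(1)[OF that(1,2) BQ that(3,4,5), of x] by linarith
      then show "\<bar>hh q w x\<bar> \<le> 2 * \<mu> * M" using hb[OF that] by simp
    qed
    also have "(\<integral>y. \<bar>K y\<bar> \<partial>lborel) = 1 / \<mu>" using K_nonneg by (simp add: K_integral)
    finally show ?thesis using \<mu>_pos by (simp add: T_def R_def)
  qed
  show thesis
  proof (rule per_arzela[of "\<lambda>n. Phi (s n)" "2 * M + 2 * M"])
    fix n
    have c: "cper (ws (Phi (s n)))" "cper (vs (Phi (s n)))"
      unfolding Phi_apply[OF s \<delta>] by (rule Phi1_cper[OF s \<delta>])+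
    show "per (apply_bcontfun (Phi (s n)))"
      using cperD(2)[OF c(1)] cperD(2)[OF c(2)] unfolding per_def ws_def vs_def by (simp add: prod_eq_iff)
    fix z
    have 1: "\<bar>ws (Phi (s n)) z\<bar> \<le> 2 * M"
      unfolding Phi_apply[OF s \<delta>] Phi1_def by (rule Tb) (use Q S S0 in auto)
    have 2: "\<bar>vs (Phi (s n)) z\<bar> \<le> 2 * M"
      unfolding Phi_apply[OF s \<delta>] Phi2_def
      by (rule Tb) (use Q S S0 in \<open>auto simp: avg_reflect intro!: cper_reflect\<close>)
    show "norm (apply_bcontfun (Phi (s n)) z) \<le> 2 * M + 2 * M"
      using norm_Pair_le[of "fst (apply_bcontfun (Phi (s n)) z)" "snd (apply_bcontfun (Phi (s n)) z)"] 1 2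
      unfolding ws_def vs_def by simp
  qed (use eq that in auto)
qed

text \<open>Addresses every nonnegative normalised fixed point, whether or not it is known to lie in
  \<open>KK\<close>. It brings functions built from an arbitrary classical solution into the set
  over which the action is minimised.\<close>

definition fixpoint_bound :: "real \<Rightarrow> real \<Rightarrow> bool" where
  "fixpoint_bound \<delta> M \<longleftrightarrow> (\<forall>q w. cper q \<longrightarrow> (\<forall>z. \<bar>q z\<bar> \<le> BQ) \<longrightarrow> cper w \<longrightarrow> (\<forall>z. 0 \<le> w z) \<longrightarrow>
     avg w = 1 \<longrightarrow> w = T q w \<longrightarrow> (\<forall>z. \<delta> \<le> w z \<and> w z \<le> M))"

text \<open>The invariant set and the bound for fixed points share their constants, so solutions
  found and solutions given end up in the same set.\<close>

lemma Phi_KK: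
  obtains \<delta> M where "\<delta> > 0" "M > 0" "\<delta> \<le> 1" "1 \<le> M" "\<And>s. s \<in> KK \<delta> M \<Longrightarrow> Phi s \<in> KK \<delta> M"
    "fixpoint_bound \<delta> M"
proof -
  obtain \<delta> M where \<delta>: "\<delta> > 0" "M > 0" "\<delta> \<le> 1" "1 \<le> M"
    and lo: "\<And>q w z. cper q \<Longrightarrow> (\<And>z. \<bar>q z\<bar> \<le> BQ) \<Longrightarrow> cper w \<Longrightarrow> (\<And>z. 0 \<le> w z) \<Longrightarrow> avg w = 1 \<Longrightarrow> \<delta> \<le> T q w z"
    and hi: "\<And>q w z. cper q \<Longrightarrow> (\<And>z. \<bar>q z\<bar> \<le> BQ) \<Longrightarrow> cper w \<Longrightarrow> (\<And>z. 0 \<le> w z) \<Longrightarrow> avg w = 1 \<Longrightarrow> (\<And>z. w z \<le> M) \<Longrightarrow> T q w z \<le> M"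
    and fp: "\<And>q w z. cper q \<Longrightarrow> (\<And>z. \<bar>q z\<bar> \<le> BQ) \<Longrightarrow> cper w \<Longrightarrow> (\<And>z. 0 \<le> w z) \<Longrightarrow> avg w = 1 \<Longrightarrow> w = T q w \<Longrightarrow> w z \<le> M"
    by (rule T_bounds[OF BQ]) blast
  show thesis
  proof (rule that[OF \<delta>])
    have "\<delta> \<le> w z \<and> w z \<le> M" if "cper q" "\<And>z. \<bar>q z\<bar> \<le> BQ" "cper w" "\<And>z. 0 \<le> w z" "avg w = 1" "w = T q w" for q w z
      using lo[OF that(1-5), of z] fp[OF that, of z] that(6) by simp
    then show "fixpoint_bound \<delta> M" unfolding fixpoint_bound_def by blast
  next
    fix s assume s: "s \<in> KK \<delta> M"
    note S = KKD[OF s] and Q = Phi1_cper(3,4)[OF s \<delta>(1)]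
    have S0: "0 \<le> ws s z" "0 \<le> vs s z" for z using S(5,7)[of z] \<delta> by linarith+
    note Qr = cper_reflect[OF Q(1)] and vr = cper_reflect[OF S(2)]
    have avr: "avg (\<lambda>z. vs s (- z)) = 1" using S(2,4) by (simp add: avg_reflect)
    have "avg (Phi1 (ws s) (vs s)) = 1" unfolding Phi1_def by (rule T_avg[OF Q(1) S(1,3)])
    moreover have "avg (Phi2 (ws s) (vs s)) = 1"
      unfolding Phi2_def[abs_def] using T_avg[OF Qr vr avr] T_cper[OF Qr vr] by (simp add: avg_reflect)
    moreover have "\<delta> \<le> Phi1 (ws s) (vs s) z" "Phi1 (ws s) (vs s) z \<le> M" for z
      unfolding Phi1_def by (rule lo hi; use Q S S0 in blast)+
    moreover have "\<delta> \<le> Phi2 (ws s) (vs s) z" "Phi2 (ws s) (vs s) z \<le> M" for z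
      unfolding Phi2_def by (rule lo[OF Qr Q(2) vr S0(2) avr], rule hi[OF Qr Q(2) vr S0(2) avr S(8)])
    ultimately show "Phi s \<in> KK \<delta> M"
      using Phi1_cper(1,2)[OF s \<delta>(1)] unfolding KK_def mem_Collect_eq Phi_apply[OF s \<delta>(1)] by blast
  qed
qed

definition Sol :: "real \<Rightarrow> real \<Rightarrow> 'x state set" where
  "Sol \<delta> M = {s \<in> KK \<delta> M. Phi s = s}"

lemma KK_nonempty: "\<delta> \<le> 1 \<Longrightarrow> 1 \<le> M \<Longrightarrow> KK \<delta> M \<noteq> {}"
proof -
  assume "\<delta> \<le> 1" "1 \<le> M"
  moreover have "ws (const_bcontfun (1, 1)) = (\<lambda>_. 1)" "vs (const_bcontfun (1, 1)) = (\<lambda>_. 1)"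
    by (auto simp: ws_def vs_def const_bcontfun.rep_eq)
  ultimately have "const_bcontfun (1, 1) \<in> KK \<delta> M"
    by (simp add: KK_def cper_const avg_const)
  then show ?thesis by blast
qed

text \<open>The closure of the image is compact, hence has finite nets of any fineness and
  approximate fixed points with error tending to 0. Their images converge along a subsequence, they
  converge to the same limit, and continuity makes the limit a fixed point.\<close>

lemma Sol_nonempty:
  assumes \<delta>: "\<delta> > 0" "\<delta> \<le> 1" "1 \<le> M" and PK: "\<And>s. s \<in> KK \<delta> M \<Longrightarrow> Phi s \<in> KK \<delta> M"
  shows "Sol \<delta> M \<noteq> {}"
proof -
  let ?K = "KK \<delta> M" and ?A = "closure (Phi ` KK \<delta> M)"
  have Kcl: "closed ?K"
    unfolding closed_sequential_limits using KK_closed by blast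
  then have AK: "?A \<subseteq> ?K" using PK by (intro closure_minimal) auto
  have cont: "continuous_on ?K Phi"
    unfolding continuous_on_sequentially
    using Phi_limit[OF _ _ \<delta>(1)] by (auto simp: o_def)
  have "seq_compact ?A"
    unfolding seq_compact_def
  proof (intro allI impI)
    fix x :: "nat \<Rightarrow> 'x state" assume x: "\<forall>n. x n \<in> ?A"
    \<comment> \<open>Points of the closure are replaced by true images at vanishing distance, which
      possess a convergent subsequence.\<close>
    have "\<exists>s\<in>?K. dist (Phi s) (x n) < inverse (real (Suc n))" for n
    proof -
      have "inverse (real (Suc n)) > 0" by simp
      then obtain y where "y \<in> Phi ` ?K" "dist y (x n) < inverse (real (Suc n))"
        using x closure_approachable by blast
      then show ?thesis by blast
    qed
    then obtain s where s: "\<And>n. s n \<in> ?K" "\<And>n. dist (Phi (s n)) (x n) < inverse (real (Suc n))" by metis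
    obtain r l where r: "strict_mono (r :: nat \<Rightarrow> nat)" and l: "(\<lambda>n. Phi (s (r n))) \<longlonglongrightarrow> l"
      by (rule Phi_compact[OF s(1) \<delta>(1)])
    have "(\<lambda>n. dist (Phi (s n)) (x n)) \<longlonglongrightarrow> 0"
    proof (rule tendsto_sandwich[OF _ _ tendsto_const LIMSEQ_inverse_real_of_nat])
      show "\<forall>\<^sub>F n in sequentially. dist (Phi (s n)) (x n) \<le> inverse (real (Suc n))"
        by (intro always_eventually allI less_imp_le s(2))
    qed simp
    then have "(\<lambda>n. dist (Phi (s (r n))) (x (r n))) \<longlonglongrightarrow> 0"
      by (rule LIMSEQ_subseq_LIMSEQ[OF _ r, unfolded o_def])
    then have xl: "(x \<circ> r) \<longlonglongrightarrow> l"
      unfolding o_def by (rule Lim_transform_dist[OF l])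
    moreover have "l \<in> ?A"
      using closed_sequentially[OF closed_closure _ xl] x by simp
    ultimately show "\<exists>l\<in>?A. \<exists>r. strict_mono r \<and> (x \<circ> r) \<longlonglongrightarrow> l" using r by blast
  qed
  then have comp: "compact ?A" by (simp add: compact_eq_seq_compact_metric)
  have "\<exists>s\<in>?K. dist (Phi s) s \<le> 2 * inverse (real (Suc n))" for n
  proof -
    let ?e = "inverse (real (Suc n))"
    have "\<exists>k. finite k \<and> k \<subseteq> ?A \<and> ?A \<subseteq> (\<Union>x\<in>k. ball x ?e)"
    proof -
      have "?A \<subseteq> (\<Union>x\<in>?A. ball x ?e)" by auto
      then obtain C where "C \<subseteq> ?A" "finite C" "?A \<subseteq> (\<Union>x\<in>C. ball x ?e)"
        by (rule compactE_image[OF comp, of ?A "\<lambda>x. ball x ?e", rotated]) simp_all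
      then show ?thesis by blast
    qed
    then obtain k where k: "finite k" "k \<subseteq> ?A" "?A \<subseteq> (\<Union>x\<in>k. ball x ?e)" by blast
    show ?thesis
    proof (rule schauder_approx[OF KK_convex _ cont k(1)])
      show "Phi ` ?K \<subseteq> ?K" using PK by blast
      show "k \<subseteq> ?K" using k AK by blast
      show "k \<noteq> {}" using k(3) KK_nonempty[OF \<delta>(2,3)] closure_subset[of "Phi ` ?K"] by auto
      show "\<exists>y\<in>k. dist (Phi x) y < ?e" if "x \<in> ?K" for x
      proof -
        have "Phi x \<in> ?A" by (rule subsetD[OF closure_subset imageI[OF that]])
        then have "Phi x \<in> (\<Union>x\<in>k. ball x ?e)" by (rule subsetD[OF k(3)])
        then obtain y where "y \<in> k" "dist y (Phi x) < ?e" by (elim UN_E) (simp only: mem_ball)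
        then show ?thesis by (intro bexI[of _ y]) (simp_all only: dist_commute)
      qed
    qed simp
  qed
  then obtain s where s: "\<And>n. s n \<in> ?K" "\<And>n. dist (Phi (s n)) (s n) \<le> 2 * inverse (real (Suc n))" by metis
  obtain r l where r: "strict_mono (r :: nat \<Rightarrow> nat)" and l: "(\<lambda>n. Phi (s (r n))) \<longlonglongrightarrow> l"
    by (rule Phi_compact[OF s(1) \<delta>(1)])
  have "(\<lambda>n. dist (Phi (s n)) (s n)) \<longlonglongrightarrow> 0"
  proof (rule tendsto_sandwich[OF _ _ tendsto_const])
    show "(\<lambda>n. 2 * inverse (real (Suc n))) \<longlonglongrightarrow> 0"
      using tendsto_mult_right_zero[OF LIMSEQ_inverse_real_of_nat] by simp
  qed (use s(2) in \<open>auto intro!: always_eventually\<close>)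
  then have "(\<lambda>n. dist (Phi (s (r n))) (s (r n))) \<longlonglongrightarrow> 0"
    by (rule LIMSEQ_subseq_LIMSEQ[OF _ r, unfolded o_def])
  then have sl: "(\<lambda>n. s (r n)) \<longlonglongrightarrow> l"
    by (rule Lim_transform_dist[OF l])
  have "(\<lambda>n. Phi (s (r n))) \<longlonglongrightarrow> Phi l" by (rule Phi_limit[OF s(1) sl \<delta>(1)])
  then have "Phi l = l" using l LIMSEQ_unique by blast
  moreover have "l \<in> ?K" by (rule KK_closed[OF s(1) sl])
  ultimately show ?thesis by (auto simp: Sol_def)
qed

text \<open>A fixed point is its own image, so the compactness of \<open>Phi\<close> applies to the
  points themselves.\<close>

lemma Sol_compact:
  assumes \<delta>: "\<delta> > 0"
  shows "compact (Sol \<delta> M)"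
  unfolding compact_eq_seq_compact_metric seq_compact_def
proof (intro allI impI)
  fix x :: "nat \<Rightarrow> 'x state" assume x: "\<forall>n. x n \<in> Sol \<delta> M"
  then have K: "x n \<in> KK \<delta> M" and fp: "Phi (x n) = x n" for n by (auto simp: Sol_def)
  obtain r l where r: "strict_mono (r :: nat \<Rightarrow> nat)" and "(\<lambda>n. Phi (x (r n))) \<longlonglongrightarrow> l"
    by (rule Phi_compact[OF K \<delta>])
  then have l: "(\<lambda>n. x (r n)) \<longlonglongrightarrow> l" by (simp add: fp)
  have "(\<lambda>n. x (r n)) \<longlonglongrightarrow> Phi l"
    using Phi_limit[OF K l \<delta>] fp by simp
  then have "Phi l = l" using l LIMSEQ_unique by blast
  moreover have "l \<in> KK \<delta> M" by (rule KK_closed[OF K l])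
  ultimately show "\<exists>l\<in>Sol \<delta> M. \<exists>r. strict_mono r \<and> (x \<circ> r) \<longlonglongrightarrow> l"
    using r l by (auto simp: Sol_def o_def)
qed

text \<open>Equal to the derivative of \<open>w\<close> along \<open>b\<close> only if
  \<open>w\<close> is a fixed point. As a convolution it makes sense for every state and follows
  uniform limits.\<close>

definition gw :: "'x \<Rightarrow> (real \<times> 'x \<Rightarrow> real) \<Rightarrow> (real \<times> 'x \<Rightarrow> real) \<Rightarrow> real \<times> 'x \<Rightarrow> real" where
  "gw b w v = R1 b (hh (Q w v) w)"

text \<open>The integrand of the action for \<open>u = - ln w / \<beta>\<close>, whose derivative along \<open>b\<close> is
  \<open>- gw b w v / (\<beta> w)\<close> at a fixed point.\<close>

definition act_int :: "(real \<times> 'x \<Rightarrow> real) \<Rightarrow> (real \<times> 'x \<Rightarrow> real) \<Rightarrow> real \<times> 'x \<Rightarrow> real" where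
  "act_int w v z = (1/2 * (\<Sum>b\<in>Basis. (- (1 / \<beta>) * (gw b w v z / w z)) * (- (1 / \<beta>) * (gw b w v z / w z)))
      - (\<Sum>b\<in>Basis. (c \<bullet> b) * (- (1 / \<beta>) * (gw b w v z / w z)))
      - (V z + 1/2 * Wc (rho w v) z)) * rho w v z"

text \<open>Uniform convergence passes through all ingredients of the integrand; division by
  \<open>ws\<close> is harmless since it is at least \<open>\<delta>\<close>.\<close>

lemma act_minimizer:
  assumes \<delta>: "\<delta> > 0" and ne: "Sol \<delta> M \<noteq> {}"
  obtains s where "s \<in> Sol \<delta> M" "\<And>t. t \<in> Sol \<delta> M \<Longrightarrow> avg (act_int (ws s) (vs s)) \<le> avg (act_int (ws t) (vs t))"
proof -
  have "continuous_on (Sol \<delta> M) (\<lambda>s. avg (act_int (ws s) (vs s)))"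
    unfolding continuous_on_sequentially
  proof (intro allI impI ballI, clarsimp simp: o_def)
    fix s l assume s: "\<forall>n. s n \<in> Sol \<delta> M" and lS: "l \<in> Sol \<delta> M" and lim: "s \<longlonglongrightarrow> l"
    have K: "s n \<in> KK \<delta> M" for n using s by (simp add: Sol_def)
    have l: "l \<in> KK \<delta> M" using lS by (simp add: Sol_def)
    note ul = state_limit[OF lim] and S = KKD[OF K] and L = KKD[OF l]
    have rl: "uniform_limit UNIV (\<lambda>n. rho (ws (s n)) (vs (s n))) (rho (ws l) (vs l)) sequentially"
      by (rule rho_limit[where \<delta> = \<delta> and M = M]) (use ul S L \<delta> in auto)
    have rc: "cper (rho (ws (s n)) (vs (s n)))" for n
      by (rule rho_cper[where \<delta> = \<delta> and M = M]) (use S \<delta> in auto)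
    have Qc: "cper (Q (ws (s n)) (vs (s n)))" for n by (rule Phi1_cper[OF K \<delta>])
    have Ql: "uniform_limit UNIV (\<lambda>n. Q (ws (s n)) (vs (s n))) (Q (ws l) (vs l)) sequentially"
      unfolding Q_def by (rule Qf_limit[OF rl rc])
    have gl: "uniform_limit UNIV (\<lambda>n. gw b (ws (s n)) (vs (s n))) (gw b (ws l) (vs l)) sequentially" if "b \<in> Basis" for b
      unfolding gw_def by (intro R1_limit that hh_limit hh_cper Ql Qc ul S)
    have gc: "cper (gw b (ws (s n)) (vs (s n)))" if "b \<in> Basis" for b n
      unfolding gw_def by (intro R1_cper that hh_cper Qc S)
    have wpos: "ws (s n) z \<noteq> 0" "ws l z \<noteq> 0" for n z
      using S(5)[of n z] L(5)[of z] \<delta> by auto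
    define G where "G n b z = - (1 / \<beta>) * (gw b (ws (s n)) (vs (s n)) z / ws (s n) z)" for n b z
    define G' where "G' b z = - (1 / \<beta>) * (gw b (ws l) (vs l) z / ws l z)" for b z
    have Gl: "uniform_limit UNIV (\<lambda>n. G n b) (G' b) sequentially" if b: "b \<in> Basis" for b
      unfolding G_def G'_def
    proof (intro uniform_limit_cmult uniform_lim_divide[OF gl[OF b] ul(1) _ _ \<delta>])
      show "bounded (gw b (ws l) (vs l) ` UNIV)"
        by (intro cper_bounded_image cper_uniform_limit[OF gl[OF b] gc[OF b]])
      show "\<delta> \<le> norm (ws l x)" for x using L(5)[of x] \<delta> by simp
    qed
    have Gc: "cper (G n b)" if b: "b \<in> Basis" for n b
    proof -
      have "cper (\<lambda>z. - (1 / \<beta>) * (gw b (ws (s n)) (vs (s n)) z * (1 / ws (s n) z)))"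
        by (intro cper_cmult cper_mult gc b cper_inverse S wpos)
      then show ?thesis by (simp add: G_def[abs_def])
    qed
    have G'c: "cper (G' b)" if "b \<in> Basis" for b using cper_uniform_limit[OF Gl Gc] that by blast
    have r'c: "cper (rho (ws l) (vs l))" by (rule cper_uniform_limit[OF rl rc])
    have e: "act_int (ws (s n)) (vs (s n)) = (\<lambda>z. (1/2 * (\<Sum>b\<in>Basis. G n b z * G n b z) - (\<Sum>b\<in>Basis. (c \<bullet> b) * G n b z)
        - (V z + 1/2 * Wc (rho (ws (s n)) (vs (s n))) z)) * rho (ws (s n)) (vs (s n)) z)" for n
      by (simp add: act_int_def[abs_def] G_def)
    have e': "act_int (ws l) (vs l) = (\<lambda>z. (1/2 * (\<Sum>b\<in>Basis. G' b z * G' b z) - (\<Sum>b\<in>Basis. (c \<bullet> b) * G' b z)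
        - (V z + 1/2 * Wc (rho (ws l) (vs l)) z)) * rho (ws l) (vs l) z)"
      by (simp add: act_int_def[abs_def] G'_def)
    show "(\<lambda>n. avg (act_int (ws (s n)) (vs (s n)))) \<longlonglongrightarrow> avg (act_int (ws l) (vs l))"
    proof (rule avg_uniform_limit)
      show "cper (act_int (ws (s n)) (vs (s n)))" for n
        unfolding e by (intro cper_mult cper_diff cper_add cper_sum cper_const Gc rc V Wc_cper)
      show "uniform_limit UNIV (\<lambda>n. act_int (ws (s n)) (vs (s n))) (act_int (ws l) (vs l)) sequentially"
        unfolding e e'
        by (intro uniform_lim_mult uniform_limit_minus uniform_limit_add uniform_limit_cmult uniform_limit_sum finite_Basis
            cper_bounded_image Gl rl uniform_limit_const Qf_limit(1) rc G'c r'c cper_mult cper_diff cper_add cper_sum cper_const V Wc_cper)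
    qed
  qed
  then obtain s where "s \<in> Sol \<delta> M" "\<And>t. t \<in> Sol \<delta> M \<Longrightarrow> avg (act_int (ws s) (vs s)) \<le> avg (act_int (ws t) (vs t))"
    using continuous_attains_inf[OF Sol_compact[OF \<delta>] ne] by blast
  then show thesis using that by blast
qed

end

section \<open>Spatial regularity\<close>

text \<open>The class \<open>C^k\<close> on the torus in terms of \<open>has_pd\<close>, so that
  membership can be shown by exhibiting derivatives.\<close>

fun CS :: "nat \<Rightarrow> ('x::euclidean_space \<Rightarrow> real) \<Rightarrow> bool" where
  "CS 0 f \<longleftrightarrow> cper f"
| "CS (Suc k) f \<longleftrightarrow> cper f \<and> (\<forall>b\<in>Basis. \<exists>g. has_pd f b g \<and> CS k g)"

text \<open>Counts derivatives in space only, mixed ones included, each jointly continuous in time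
  and space: the pointwise form of continuity in time with values in \<open>C^k\<close>.\<close>

fun CT :: "nat \<Rightarrow> (real \<times> 'x::euclidean_space \<Rightarrow> real) \<Rightarrow> bool" where
  "CT 0 f \<longleftrightarrow> cper f"
| "CT (Suc k) f \<longleftrightarrow> cper f \<and> (\<forall>b\<in>Basis. \<exists>g. has_pd f (0, b) g \<and> CT k g)"

lemma CT_cper: "CT k f \<Longrightarrow> cper f"
  by (cases k) auto

lemma CS_cper: "CS k f \<Longrightarrow> cper f"
  by (cases k) auto

lemma CT_Suc_imp: "CT (Suc k) f \<Longrightarrow> CT k f"
proof (induction k arbitrary: f)
  case (Suc k)
  have "\<exists>g. has_pd f (0, b) g \<and> CT k g" if b: "b \<in> Basis" for b
  proof -
    obtain g where "has_pd f (0, b) g" "CT (Suc k) g"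
      using Suc.prems b by auto
    then show ?thesis using Suc.IH[of g] by blast
  qed
  then show ?case using CT_cper[OF Suc.prems] by simp
qed auto

lemma CT_le: "j \<le> k \<Longrightarrow> CT k f \<Longrightarrow> CT j f"
  by (induction rule: inc_induct) (blast dest: CT_Suc_imp)+

lemma CT_pd: "CT (Suc k) f \<Longrightarrow> b \<in> Basis \<Longrightarrow> \<exists>g. has_pd f (0, b) g \<and> CT k g"
  by auto

section \<open>Calculus of directional derivatives and of the class \<open>CT\<close>\<close>

lemma has_pd_const: "has_pd (\<lambda>z. r) b (\<lambda>z. 0)"
  by (simp add: has_pd_def)

lemma has_pd_add: "has_pd f b f' \<Longrightarrow> has_pd g b g' \<Longrightarrow> has_pd (\<lambda>z. f z + g z) b (\<lambda>z. f' z + g' z)"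
  unfolding has_pd_def by (auto intro!: derivative_intros)

lemma has_pd_diff: "has_pd f b f' \<Longrightarrow> has_pd g b g' \<Longrightarrow> has_pd (\<lambda>z. f z - g z) b (\<lambda>z. f' z - g' z)"
  unfolding has_pd_def by (auto intro!: derivative_intros)

lemma has_pd_mult: "has_pd f b f' \<Longrightarrow> has_pd g b g' \<Longrightarrow> has_pd (\<lambda>z. f z * g z) b (\<lambda>z. f' z * g z + f z * g' z)"
  unfolding has_pd_def
proof (intro allI)
  fix z
  assume "\<forall>z. ((\<lambda>s. f (z + s *\<^sub>R b)) has_real_derivative f' z) (at 0)" "\<forall>z. ((\<lambda>s. g (z + s *\<^sub>R b)) has_real_derivative g' z) (at 0)"
  then have "((\<lambda>s. f (z + s *\<^sub>R b)) has_real_derivative f' z) (at 0)" "((\<lambda>s. g (z + s *\<^sub>R b)) has_real_derivative g' z) (at 0)" by auto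
  from DERIV_mult[OF this] show "((\<lambda>s. f (z + s *\<^sub>R b) * g (z + s *\<^sub>R b)) has_real_derivative f' z * g z + f z * g' z) (at 0)"
    by (simp add: mult.commute)
qed

lemma has_pd_cmult: "has_pd g b g' \<Longrightarrow> has_pd (\<lambda>z. r * g z) b (\<lambda>z. r * g' z)"
  unfolding has_pd_def by (auto intro!: DERIV_cmult)

lemma has_pd_chain:
  assumes f: "has_pd f b f'" and \<phi>: "\<And>z. (\<phi> has_real_derivative \<phi>' (f z)) (at (f z))"
  shows "has_pd (\<lambda>z. \<phi> (f z)) b (\<lambda>z. \<phi>' (f z) * f' z)"
  unfolding has_pd_def
proof
  fix z
  have "((\<lambda>s. f (z + s *\<^sub>R b)) has_real_derivative f' z) (at 0)"
    using f unfolding has_pd_def by blast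
  moreover have "(\<phi> has_real_derivative \<phi>' (f z)) (at (f (z + 0 *\<^sub>R b)))"
    using \<phi>[of z] by simp
  ultimately show "((\<lambda>s. \<phi> (f (z + s *\<^sub>R b))) has_real_derivative \<phi>' (f z) * f' z) (at 0)"
    by (rule DERIV_chain2[rotated])
qed

lemma has_pd_reflect: "has_pd f b g \<Longrightarrow> has_pd (\<lambda>z. f (- z)) b (\<lambda>z. - g (- z))"
  unfolding has_pd_def
proof
  fix z
  assume "\<forall>z. ((\<lambda>s. f (z + s *\<^sub>R b)) has_real_derivative g z) (at 0)"
  then have "((\<lambda>s. f (- z + s *\<^sub>R b)) has_real_derivative g (- z)) (at 0)" by blast
  then have "((\<lambda>s. f (- z + s *\<^sub>R b)) has_real_derivative g (- z)) (at (- 0))" by (simp only: minus_zero)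
  then have "((\<lambda>s. f (- z + (- s) *\<^sub>R b)) has_real_derivative g (- z) * (- 1)) (at 0)"
    by (rule DERIV_chain2) (auto intro!: derivative_eq_intros)
  then show "((\<lambda>s. f (- (z + s *\<^sub>R b))) has_real_derivative - g (- z)) (at 0)"
    by simp
qed

lemma CT_const: "CT k (\<lambda>z. r)"
proof (induction k arbitrary: r)
  case (Suc k)
  then show ?case using cper_const has_pd_const by (metis CT.simps(2))
qed (simp add: cper_const)

lemma CT_add: "CT k f \<Longrightarrow> CT k g \<Longrightarrow> CT k (\<lambda>z. f z + g z)"
proof (induction k arbitrary: f g)
  case (Suc k)
  have "\<exists>h. has_pd (\<lambda>z. f z + g z) (0, b) h \<and> CT k h" if b: "b \<in> Basis" for b
    using CT_pd[OF Suc.prems(1) b] CT_pd[OF Suc.prems(2) b] Suc.IH has_pd_add by metis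
  then show ?case using Suc.prems by (simp add: cper_add)
qed (simp add: cper_add)

lemma CT_mult: "CT k f \<Longrightarrow> CT k g \<Longrightarrow> CT k (\<lambda>z. f z * g z)"
proof (induction k arbitrary: f g)
  case (Suc k)
  have "\<exists>h. has_pd (\<lambda>z. f z * g z) (0, b) h \<and> CT k h" if b: "b \<in> Basis" for b
  proof -
    obtain f' g' where "has_pd f (0, b) f'" "CT k f'" "has_pd g (0, b) g'" "CT k g'"
      using CT_pd[OF Suc.prems(1) b] CT_pd[OF Suc.prems(2) b] by blast
    then show ?thesis
      using has_pd_mult[of f "(0, b)" f' g g'] CT_add[OF Suc.IH Suc.IH] CT_Suc_imp[OF Suc.prems(1)] CT_Suc_imp[OF Suc.prems(2)]
      by blast
  qed
  then show ?case using Suc.prems by (simp add: cper_mult)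
qed (simp add: cper_mult)

lemma CT_cmult: "CT k g \<Longrightarrow> CT k (\<lambda>z. r * g z)"
  by (intro CT_mult CT_const)

lemma CT_uminus: "CT k g \<Longrightarrow> CT k (\<lambda>z. - g z)"
  using CT_cmult[of k g "-1"] by simp

lemma CT_diff: "CT k f \<Longrightarrow> CT k g \<Longrightarrow> CT k (\<lambda>z. f z - g z)"
  using CT_add[OF _ CT_uminus, of k f g] by simp

lemma CT_sum: "(\<And>i. i \<in> I \<Longrightarrow> CT k (f i)) \<Longrightarrow> CT k (\<lambda>z. \<Sum>i\<in>I. f i z)"
  by (induction I rule: infinite_finite_induct) (auto intro: CT_const CT_add)

lemma CT_inverse: "CT k f \<Longrightarrow> (\<And>z. f z \<noteq> 0) \<Longrightarrow> CT k (\<lambda>z. 1 / f z)"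
proof (induction k)
  case (Suc k)
  have I: "CT k (\<lambda>z. 1 / f z)" using Suc CT_Suc_imp by blast
  have "\<exists>h. has_pd (\<lambda>z. 1 / f z) (0, b) h \<and> CT k h" if b: "b \<in> Basis" for b
  proof -
    obtain g where g: "has_pd f (0, b) g" "CT k g" using CT_pd[OF Suc.prems(1) b] by blast
    have "has_pd (\<lambda>z. 1 / f z) (0, b) (\<lambda>z. (- (1 / f z * (1 / f z))) * g z)"
    proof (rule has_pd_chain[OF g(1), where \<phi>' = "\<lambda>x. - (1 / x * (1 / x))"])
      fix z
      show "((\<lambda>x. 1 / x) has_real_derivative - (1 / f z * (1 / f z))) (at (f z))"
        using Suc.prems(2)[of z] by (auto intro!: derivative_eq_intros simp: field_simps)
    qed
    moreover have "CT k (\<lambda>z. (- (1 / f z * (1 / f z))) * g z)"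
      by (intro CT_mult CT_uminus I g)
    ultimately show ?thesis by blast
  qed
  then show ?case using Suc.prems by (simp add: cper_inverse)
qed (simp add: cper_inverse)

text \<open>A case distinction replaces induction: the derivative is \<open>g / f\<close>, and
  \<open>CT_inverse\<close> settles its order.\<close>

lemma CT_ln:
  assumes "CT k f" "\<And>z. f z > 0"
  shows "CT k (\<lambda>z. ln (f z))"
proof (cases k)
  case 0
  then show ?thesis using assms
    by (auto intro!: cper_compose[of f ln] continuous_intros simp: less_imp_neq[symmetric])
next
  case (Suc j)
  have nz: "f z \<noteq> 0" for z using assms(2)[of z] by simp
  have "\<exists>h. has_pd (\<lambda>z. ln (f z)) (0, b) h \<and> CT j h" if b: "b \<in> Basis" for b
  proof -
    obtain g where g: "has_pd f (0, b) g" "CT j g" using CT_pd[of j f b] assms(1) b Suc by blast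
    have "has_pd (\<lambda>z. ln (f z)) (0, b) (\<lambda>z. (1 / f z) * g z)"
      by (rule has_pd_chain[OF g(1)]) (use assms(2) in \<open>auto intro!: derivative_eq_intros\<close>)
    moreover have "CT j (\<lambda>z. (1 / f z) * g z)"
      by (intro CT_mult CT_inverse g nz) (use assms(1) Suc CT_Suc_imp in blast)
    ultimately show ?thesis by blast
  qed
  moreover have "cper (\<lambda>z. ln (f z))"
    using CT_cper[OF assms(1)] nz by (auto intro!: cper_compose[of f ln] continuous_intros simp del: split_paired_All)
  ultimately show ?thesis using Suc by simp
qed

lemma CT_reflect: "CT k f \<Longrightarrow> CT k (\<lambda>z. f (- z))"
proof (induction k arbitrary: f)
  case (Suc k)
  have "\<exists>h. has_pd (\<lambda>z. f (- z)) (0, b) h \<and> CT k h" if b: "b \<in> Basis" for b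
  proof -
    obtain g where g: "has_pd f (0, b) g" "CT k g" using CT_pd[OF Suc.prems b] by blast
    then show ?thesis using has_pd_reflect[OF g(1)] CT_uminus[OF Suc.IH[OF g(2)]] by blast
  qed
  then show ?case using Suc.prems by (simp add: cper_reflect)
qed (simp add: cper_reflect)

lemma has_pd_slice: "has_pd f (0, b) g \<Longrightarrow> has_pd (\<lambda>x. f (t, x)) b (\<lambda>x. g (t, x))"
  unfolding has_pd_def
proof
  fix x
  assume "\<forall>z. ((\<lambda>s. f (z + s *\<^sub>R (0, b))) has_real_derivative g z) (at 0)"
  then have "((\<lambda>s. f ((t, x) + s *\<^sub>R (0, b))) has_real_derivative g (t, x)) (at 0)" by blast
  then show "((\<lambda>s. f (t, x + s *\<^sub>R b)) has_real_derivative g (t, x)) (at 0)" by simp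
qed

lemma CT_slice: "CT k f \<Longrightarrow> CS k (\<lambda>x. f (t, x))"
proof (induction k arbitrary: f)
  case (Suc k)
  have "\<exists>h. has_pd (\<lambda>x. f (t, x)) b h \<and> CS k h" if b: "b \<in> Basis" for b
  proof -
    obtain g where g: "has_pd f (0, b) g" "CT k g" using CT_pd[OF Suc.prems b] by blast
    then show ?thesis using has_pd_slice[OF g(1)] Suc.IH[OF g(2)] by blast
  qed
  then show ?case using Suc.prems by (simp add: cper_slice)
qed (simp add: cper_slice)

lemma has_pd_time: "has_pd f (1, 0) g \<Longrightarrow> ((\<lambda>s. f (s, x)) has_real_derivative g (t, x)) (at t)"
proof -
  assume "has_pd f (1, 0) g"
  from has_pd_at[OF this, of "(0, x)" t] show ?thesis by simp
qed

text \<open>All derivatives fall on \<open>W\<close>, while \<open>f\<close> is merely continuous.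
  The potential thus has its three spatial derivatives before anything is known about the smoothness
  of the density.\<close>

lemma CT_slice_avg:
  fixes f :: "real \<times> 'x::euclidean_space \<Rightarrow> real"
  assumes f: "cper f"
  shows "CS k W \<Longrightarrow> CT k (\<lambda>z. avg (\<lambda>y. W (snd z - y) * f (fst z, y)))"
proof (induction k arbitrary: W)
  case (Suc k)
  have W: "cper W" using CS_cper[OF Suc.prems] .
  have "\<exists>h. has_pd (\<lambda>z. avg (\<lambda>y. W (snd z - y) * f (fst z, y))) (0, b) h \<and> CT k h" if b: "b \<in> Basis" for b
  proof -
    obtain W' where W': "has_pd W b W'" "CS k W'" using Suc.prems b by auto
    have cW': "cper W'" using CS_cper[OF W'(2)] .
    have "has_pd (\<lambda>z. avg (\<lambda>y. W (snd z - y) * f (fst z, y))) (0, b) (\<lambda>z. avg (\<lambda>y. W' (snd z - y) * f (fst z, y)))"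
      unfolding has_pd_def
    proof
      fix z :: "real \<times> 'x"
      have "((\<lambda>s. integral cell (\<lambda>y. W (snd z + s *\<^sub>R b - y) * f (fst z, y))) has_field_derivative
          integral cell (\<lambda>y. W' (snd z + 0 *\<^sub>R b - y) * f (fst z, y))) (at 0 within UNIV)"
      proof (rule leibniz_rule_field_derivative)
        fix s and y :: 'x
        have "((\<lambda>s. W ((snd z - y) + s *\<^sub>R b)) has_real_derivative W' ((snd z - y) + s *\<^sub>R b)) (at s)"
          by (rule has_pd_at[OF W'(1)])
        then have "((\<lambda>s. W (snd z + s *\<^sub>R b - y)) has_real_derivative W' (snd z + s *\<^sub>R b - y)) (at s)"
          by (simp add: algebra_simps)
        then show "((\<lambda>s. W (snd z + s *\<^sub>R b - y) * f (fst z, y)) has_field_derivative W' (snd z + s *\<^sub>R b - y) * f (fst z, y)) (at s within UNIV)"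
          by (rule DERIV_cmult_right)
      next
        show "(\<lambda>y. W (snd z + s *\<^sub>R b - y) * f (fst z, y)) integrable_on cell" for s
          by (intro cper_integrable_on cper_mult cper_swap_minus W cper_slice f)
        show "continuous_on (UNIV \<times> cell) (\<lambda>(s, y). W' (snd z + s *\<^sub>R b - y) * f (fst z, y))"
          unfolding split_beta
          by (intro continuous_intros continuous_on_compose2[OF cperD(1)[OF f]] continuous_on_compose2[OF cperD(1)[OF cW']]) auto
      qed auto
      then show "((\<lambda>s. avg (\<lambda>y. W (snd (z + s *\<^sub>R (0, b)) - y) * f (fst (z + s *\<^sub>R (0, b)), y))) has_real_derivative
          avg (\<lambda>y. W' (snd z - y) * f (fst z, y))) (at 0)"
        by (simp add: avg_def)
    qed
    then show ?thesis using Suc.IH[OF W'(2)] by blast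
  qed
  then show ?case using cper_slice_avg[OF f W] by simp
qed (simp add: cper_slice_avg f)

text \<open>Existence of one order of differentiation yields the other: \<open>f\<close> is the
  integral of \<open>G\<close> along \<open>e\<close>, and differentiating this formula along
  \<open>b\<close> shows that the increment of \<open>D\<close> along \<open>e\<close> is the
  integral of \<open>H\<close>.\<close>

lemma has_pd_mixed:
  fixes f :: "'a::euclidean_space \<Rightarrow> real"
  assumes D: "has_pd f b D" and E: "has_pd f e G" and G: "has_pd G b H"
    and c: "cper f" "cper G" "cper H"
  shows "has_pd D e H"
proof (rule has_pd_of_integral)
  show "continuous_on UNIV H" by (rule cperD[OF c(3)])
  fix z and h :: real assume h: "0 \<le> h"
  have FE: "f (z + h *\<^sub>R e) = f z + integral {0..h} (\<lambda>s. G (z + s *\<^sub>R e))" for z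
    using integral_unique[OF has_pd_FTC[OF E cperD(1)[OF c(2)] h, of z]] by simp
  have "((\<lambda>u. integral (cbox 0 h) (\<lambda>s. G (z + u *\<^sub>R b + s *\<^sub>R e))) has_field_derivative
      integral (cbox 0 h) (\<lambda>s. H (z + 0 *\<^sub>R b + s *\<^sub>R e))) (at 0 within UNIV)"
  proof (rule leibniz_rule_field_derivative)
    fix u s :: real
    have "((\<lambda>u. G ((z + s *\<^sub>R e) + u *\<^sub>R b)) has_real_derivative H ((z + s *\<^sub>R e) + u *\<^sub>R b)) (at u)"
      by (rule has_pd_at[OF G])
    then show "((\<lambda>u. G (z + u *\<^sub>R b + s *\<^sub>R e)) has_field_derivative H (z + u *\<^sub>R b + s *\<^sub>R e)) (at u within UNIV)"
      by (simp add: add_ac)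
  next
    show "(\<lambda>s. G (z + u *\<^sub>R b + s *\<^sub>R e)) integrable_on cbox 0 h" for u
      by (intro integrable_continuous continuous_on_compose2[OF cperD(1)[OF c(2)]] continuous_intros) auto
    show "continuous_on (UNIV \<times> cbox 0 h) (\<lambda>(u, s). H (z + u *\<^sub>R b + s *\<^sub>R e))"
      unfolding split_beta
      by (intro continuous_on_compose2[OF cperD(1)[OF c(3)]] continuous_intros) auto
  qed auto
  then have "((\<lambda>u. integral {0..h} (\<lambda>s. G (z + u *\<^sub>R b + s *\<^sub>R e))) has_real_derivative integral {0..h} (\<lambda>s. H (z + s *\<^sub>R e))) (at 0)"
    by simp
  moreover have "((\<lambda>u. f (z + u *\<^sub>R b)) has_real_derivative D z) (at 0)" "((\<lambda>u. f (z + h *\<^sub>R e + u *\<^sub>R b)) has_real_derivative D (z + h *\<^sub>R e)) (at 0)"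
    using D unfolding has_pd_def by auto
  ultimately have "((\<lambda>u. f (z + u *\<^sub>R b) + integral {0..h} (\<lambda>s. G (z + u *\<^sub>R b + s *\<^sub>R e))) has_real_derivative D z + integral {0..h} (\<lambda>s. H (z + s *\<^sub>R e))) (at 0)"
    by (intro DERIV_add)
  moreover have "f (z + u *\<^sub>R b) + integral {0..h} (\<lambda>s. G (z + u *\<^sub>R b + s *\<^sub>R e)) = f (z + h *\<^sub>R e + u *\<^sub>R b)" for u
    using FE[of "z + u *\<^sub>R b"] by (simp add: add_ac)
  ultimately show "D (z + h *\<^sub>R e) = D z + integral {0..h} (\<lambda>s. H (z + s *\<^sub>R e))"
    using DERIV_unique \<open>((\<lambda>u. f (z + h *\<^sub>R e + u *\<^sub>R b)) has_real_derivative D (z + h *\<^sub>R e)) (at 0)\<close> by simp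
qed

context heat
begin

text \<open>The last derivative is taken on the kernel; all earlier ones pass through the
  convolution to \<open>f\<close>.\<close>

lemma CT_R: "CT k f \<Longrightarrow> CT (Suc k) (R f)"
proof (induction k arbitrary: f)
  case 0
  then show ?case using R_pd_kernel R1_cper R_cper by (metis CT.simps)
next
  case (Suc k)
  have f: "cper f" using CT_cper[OF Suc.prems] .
  have "\<exists>g. has_pd (R f) (0, b) g \<and> CT (Suc k) g" if b: "b \<in> Basis" for b
  proof -
    obtain g where g: "has_pd f (0, b) g" "CT k g" using CT_pd[OF Suc.prems b] by blast
    then show ?thesis using R_pd[OF g(1) f CT_cper[OF g(2)]] Suc.IH[OF g(2)] by blast
  qed
  then show ?case unfolding CT.simps(2)[of "Suc k"] using R_cper[OF f] by blast
qed

text \<open>In \<open>w = R h\<close> the function \<open>h\<close> is as smooth as \<open>w\<close>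
  up to order 3, so every round raises the order of \<open>w\<close> by one. \<open>D\<close> and
  \<open>H\<close> are resolvents of derivatives of \<open>h\<close>, and \<open>R_time\<close>
  delivers the time derivative together with the equation.\<close>

lemma T_regular:
  assumes q: "CT 3 q" and w: "cper w" and fp: "w = T q w"
  obtains wt D H where "CT 3 w" "has_pd w (1, 0) wt" "CT 1 wt"
    "\<And>b. b \<in> Basis \<Longrightarrow> has_pd w (0, b) (D b)" "\<And>b. b \<in> Basis \<Longrightarrow> CT 2 (D b)"
    "\<And>b. b \<in> Basis \<Longrightarrow> has_pd (D b) (0, b) (H b)" "\<And>b. b \<in> Basis \<Longrightarrow> CT 1 (H b)"
    "\<And>z. wt z = - (q z - avg (\<lambda>z. q z * w z)) * w z - a * (\<Sum>b\<in>Basis. H b z) - (\<Sum>b\<in>Basis. (c \<bullet> b) * D b z)"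
proof -
  define h where "h = hh q w"
  have wR: "w = R h" using fp by (simp add: h_def T_def)
  have hk: "CT k h" if "k \<le> 3" "CT k w" for k
    unfolding h_def hh_def by (intro CT_mult CT_diff CT_add CT_const CT_le[OF _ q] that)
  have "CT 0 w" using w by simp
  then have "CT 1 w" using hk[of 0] CT_R[of 0 h] wR by simp
  then have "CT 2 w" using hk[of 1] CT_R[of 1 h] wR by (simp add: numeral_2_eq_2)
  then have w3: "CT 3 w" using hk[of 2] CT_R[of 2 h] wR by (simp add: numeral_3_eq_3 numeral_2_eq_2)
  then have h3: "CT (Suc (Suc (Suc 0))) h" using hk[of 3] by (simp add: numeral_3_eq_3)
  have h: "cper h" using CT_cper[OF h3] .
  have "\<forall>b\<in>Basis. \<exists>D. has_pd h (0, b) D \<and> CT (Suc (Suc 0)) D" using CT_pd[OF h3] by blast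
  then obtain hD where hD: "\<And>b. b \<in> Basis \<Longrightarrow> has_pd h (0, b) (hD b)" "\<And>b. b \<in> Basis \<Longrightarrow> CT (Suc (Suc 0)) (hD b)" by metis
  have "\<forall>b\<in>Basis. \<exists>D. has_pd (hD b) (0, b) D \<and> CT (Suc 0) D" using CT_pd[OF hD(2)] by blast
  then obtain hH where hH: "\<And>b. b \<in> Basis \<Longrightarrow> has_pd (hD b) (0, b) (hH b)" "\<And>b. b \<in> Basis \<Longrightarrow> CT (Suc 0) (hH b)" by metis
  define D where "D b = R (hD b)" for b
  define H where "H b = R (hH b)" for b
  define wt where "wt z = - (q z - avg (\<lambda>z. q z * w z)) * w z - a * (\<Sum>b\<in>Basis. H b z) - (\<Sum>b\<in>Basis. (c \<bullet> b) * D b z)" for z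
  have hDc: "cper (hD b)" and hHc: "cper (hH b)" if "b \<in> Basis" for b
    using CT_cper hD(2) hH(2) that by blast+
  have D: "has_pd w (0, b) (D b)" "CT 2 (D b)" "has_pd (D b) (0, b) (H b)" "CT 1 (H b)" if b: "b \<in> Basis" for b
  proof -
    show "has_pd w (0, b) (D b)" unfolding wR D_def by (rule R_pd[OF hD(1)[OF b] h hDc[OF b]])
    show "has_pd (D b) (0, b) (H b)" unfolding D_def H_def by (rule R_pd[OF hH(1)[OF b] hDc[OF b] hHc[OF b]])
    show "CT 2 (D b)" unfolding D_def using CT_R[OF hD(2)[OF b]] CT_Suc_imp by (metis numeral_2_eq_2)
    show "CT 1 (H b)" unfolding H_def using CT_R[OF hH(2)[OF b]] CT_Suc_imp by (metis One_nat_def)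
  qed
  have "has_pd (R h) (1, 0) (\<lambda>z. \<mu> * R h z - h z - a * (\<Sum>b\<in>Basis. R (hH b) z) - (\<Sum>b\<in>Basis. (c \<bullet> b) * R (hD b) z))"
    by (rule R_time[OF h hD(1) hDc hH(1) hHc])
  also have "(\<lambda>z. \<mu> * R h z - h z - a * (\<Sum>b\<in>Basis. R (hH b) z) - (\<Sum>b\<in>Basis. (c \<bullet> b) * R (hD b) z)) = wt"
    by (simp add: wt_def D_def H_def wR[symmetric] fun_eq_iff) (simp add: h_def hh_def algebra_simps)
  finally have wt: "has_pd w (1, 0) wt" using wR by simp
  have "CT 1 wt"
    unfolding wt_def
    by (intro CT_diff CT_mult CT_uminus CT_const CT_sum D CT_le[OF _ q] CT_le[OF _ w3] CT_le[OF _ D(2)]) auto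
  then show thesis
    by (intro that[OF w3 wt _ D(1) D(2) D(3) D(4)]) (auto simp: wt_def)
qed

end

section \<open>Comparison with the function spaces on the torus\<close>

lemma Basis_vec_range: "(Basis :: (real^'n) set) = range (\<lambda>i. axis i 1)"
  by (auto simp: Basis_vec_def)

lemma axis_Basis [simp]: "axis i (1::real) \<in> Basis"
  by (simp add: Basis_vec_range)

lemma sum_Basis_vec: "(\<Sum>b\<in>(Basis::(real^'n) set). f b) = (\<Sum>i\<in>UNIV. f (axis i 1))"
proof -
  have "inj (\<lambda>i::'n. axis i (1::real))" by (auto simp: inj_on_def axis_eq_axis)
  then show ?thesis unfolding Basis_vec_range by (simp add: sum.reindex o_def)
qed

lemma periodic_space_iff: "periodic_space f \<longleftrightarrow> per (f :: real^'n \<Rightarrow> 'a)"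
proof
  assume *: "periodic_space f"
  show "per f"
    unfolding per_def
  proof (intro allI ballI)
    fix x b :: "real^'n" assume "b \<in> Basis"
    then obtain i where b: "b = axis i 1" by (auto simp: Basis_vec_range)
    have "\<forall>j. b $ j \<in> \<int>" by (auto simp: b axis_def)
    then show "f (x + b) = f x" using * unfolding periodic_space_def by blast
  qed
next
  assume *: "per f"
  show "periodic_space f"
    unfolding periodic_space_def
  proof (intro allI impI)
    fix x k :: "real^'n" assume "\<forall>i. k $ i \<in> \<int>"
    then have "k \<in> lattice" by (auto simp: lattice_def Basis_vec_range inner_axis)
    then show "f (x + k) = f x" by (rule per_lattice[OF *])
  qed
qed

lemma pd_eq: "has_pd f (axis i 1) g \<Longrightarrow> pd i f = g"
  by (rule ext) (simp add: has_pd_def pd_def DERIV_imp_deriv)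

lemma has_pd_pd:
  fixes f :: "real^'n \<Rightarrow> real"
  assumes "f differentiable_on UNIV"
  shows "has_pd f (axis i 1) (pd i f)"
  unfolding has_pd_def
proof
  fix x
  have "f differentiable (at x)" using assms by (simp add: differentiable_on_def)
  then have "(f \<circ> (\<lambda>s::real. x + s *\<^sub>R axis i 1)) differentiable (at 0)"
    by (intro differentiable_chain_at) (auto intro!: derivative_intros)
  then show "((\<lambda>s. f (x + s *\<^sub>R axis i 1)) has_real_derivative pd i f x) (at 0)"
    unfolding pd_def by (simp add: o_def DERIV_deriv_iff_real_differentiable)
qed

lemma CS_pd: "CS (Suc k) f \<Longrightarrow> has_pd f (axis i 1) (pd i f) \<and> CS k (pd i f)"
  using pd_eq by (metis CS.simps(2) axis_Basis)

text \<open>\<open>Ck\<close> demands total differentiability at each stage, \<open>CS\<close>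
  directional derivatives; continuity of the latter closes the gap by
  \<open>C1_has_derivative\<close>.\<close>

lemma Ck_torus_iff: "f \<in> Ck_torus k \<longleftrightarrow> CS k f"
proof (induction k arbitrary: f)
  case 0
  then show ?case by (simp add: Ck_torus_def cper_def periodic_space_iff)
next
  case (Suc k)
  show ?case
  proof
    assume f: "f \<in> Ck_torus (Suc k)"
    then have d: "f differentiable_on UNIV" and p: "per f" and k: "\<And>i. Ck k (pd i f)"
      by (auto simp: Ck_torus_def periodic_space_iff)
    have "pd i f \<in> Ck_torus k" for i
      unfolding Ck_torus_def using k has_pd_per[OF has_pd_pd[OF d] p] by (simp add: periodic_space_iff)
    then have "CS k (pd i f)" for i using Suc by blast
    then have "\<exists>g. has_pd f b g \<and> CS k g" if "b \<in> Basis" for b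
      using that has_pd_pd[OF d] by (auto simp: Basis_vec_range)
    then show "CS (Suc k) f"
      using d p by (auto intro: cperI differentiable_imp_continuous_on)
  next
    assume f: "CS (Suc k) f"
    have pd: "has_pd f (axis i 1) (pd i f)" "CS k (pd i f)" for i using CS_pd[OF f] by auto
    have k: "pd i f \<in> Ck_torus k" for i using pd(2) Suc by blast
    have "f differentiable_on UNIV"
      unfolding differentiable_on_def
    proof
      fix x
      \<comment> \<open>The description turns the derivatives indexed by coordinates into a family
        indexed by basis vectors.\<close>
      have "(f has_derivative (\<lambda>h. \<Sum>b\<in>Basis. (h \<bullet> b) * (THE g. has_pd f b g) x)) (at x)"
      proof (rule C1_has_derivative)
        fix b :: "real^'a" assume "b \<in> Basis"
        then obtain i where b: "b = axis i 1" by (auto simp: Basis_vec_range)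
        have e: "(THE g. has_pd f b g) = pd i f"
          unfolding b using pd(1) has_pd_unique by (intro the_equality) blast+
        show "has_pd f b (THE g. has_pd f b g)" "continuous_on UNIV (THE g. has_pd f b g)"
          unfolding e using pd(1)[of i] CS_cper[OF pd(2)[of i]] by (auto simp: b cper_def)
      qed
      then show "f differentiable at x within UNIV" by (auto simp: differentiable_def)
    qed
    then show "f \<in> Ck_torus (Suc k)"
      using k CS_cper[OF f] by (auto simp: Ck_torus_def periodic_space_iff cper_def)
  qed
qed

lemma CS_add_cmult: "CS k f \<Longrightarrow> CS k g \<Longrightarrow> CS k (\<lambda>x. p * f x + q * g x)"
proof (induction k arbitrary: f g)
  case (Suc k)
  have "\<exists>h. has_pd (\<lambda>x. p * f x + q * g x) b h \<and> CS k h" if b: "b \<in> Basis" for b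
  proof -
    obtain f' g' where "has_pd f b f'" "CS k f'" "has_pd g b g'" "CS k g'"
      using Suc.prems b unfolding CS.simps(2) by blast
    then show ?thesis using has_pd_add[OF has_pd_cmult has_pd_cmult] Suc.IH by metis
  qed
  then show ?case using Suc.prems by (simp add: cper_add cper_cmult)
qed (simp add: cper_add cper_cmult)

lemma CS_diff: "CS k f \<Longrightarrow> CS k g \<Longrightarrow> CS k (\<lambda>x. f x - g x)"
  using CS_add_cmult[of k f g 1 "-1"] by simp

lemma CS_quotient: "CS k f \<Longrightarrow> CS k g \<Longrightarrow> CS k e \<Longrightarrow> CS k (\<lambda>x. (f x - g x) / h - e x)"
  using CS_diff[OF CS_add_cmult[of k f g "1/h" "-1/h"], of e] by (simp add: diff_divide_distrib)

lemma pd_diff: "CS (Suc k) f \<Longrightarrow> CS (Suc k) g \<Longrightarrow> pd i (\<lambda>x. f x - g x) = (\<lambda>x. pd i f x - pd i g x)"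
  using CS_pd[of k f i] CS_pd[of k g i] by (intro pd_eq has_pd_diff) auto

lemma pd_quotient:
  assumes "CS (Suc k) f" "CS (Suc k) g" "CS (Suc k) e"
  shows "pd i (\<lambda>x. (f x - g x) / h - e x) = (\<lambda>x. (pd i f x - pd i g x) / h - pd i e x)"
proof -
  have "has_pd (\<lambda>x. (1 / h) * (f x - g x) - e x) (axis i 1) (\<lambda>x. (1 / h) * (pd i f x - pd i g x) - pd i e x)"
    using CS_pd[OF assms(1), of i] CS_pd[OF assms(2), of i] CS_pd[OF assms(3), of i]
    by (intro has_pd_diff has_pd_cmult) auto
  from pd_eq[OF this] show ?thesis by simp
qed

text \<open>\<open>foldr\<close> applies the last index first, so inductions on derivatives split
  index lists at the end.\<close>

lemma pds_snoc: "pds (is @ [i]) f = pds is (pd i f)"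
  by (simp add: pds_def)

lemma pds_cper: "CS k d \<Longrightarrow> length is \<le> k \<Longrightarrow> cper (pds is d)"
proof (induction "is" arbitrary: k d rule: rev_induct)
  case Nil
  then show ?case using CS_cper by (auto simp: pds_def)
next
  case (snoc i js)
  then obtain j where k: "k = Suc j" by (cases k) auto
  then show ?case
    using snoc.IH[of j "pd i d"] CS_pd[of j d i] snoc.prems by (simp add: pds_snoc)
qed

text \<open>The supremum in \<open>Ck_norm\<close> can be used only once it is known to be bounded:
  there are finitely many index lists, and each derivative is continuous and periodic.\<close>

lemma Ck_norm_bdd:
  fixes d :: "real^'n \<Rightarrow> real"
  assumes "CS k d"
  shows "bdd_above ((\<lambda>(is, x). \<bar>pds is d x\<bar>) ` ({is. length is \<le> k} \<times> UNIV))"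
proof -
  have fin: "finite {is :: 'n list. length is \<le> k}"
    using finite_lists_length_le[of "UNIV :: 'n set" k] by simp
  have "(\<lambda>(is, x). \<bar>pds is d x\<bar>) ` ({is. length is \<le> k} \<times> UNIV) = (\<Union>is\<in>{is. length is \<le> k}. range (\<lambda>x. \<bar>pds is d x\<bar>))"
    by (auto simp: image_iff)
  moreover have "bdd_above (range (\<lambda>x. \<bar>pds is d x\<bar>))" if "length is \<le> k" for "is"
    using cper_bounded[OF pds_cper[OF assms that]] by (metis (no_types, lifting) bdd_aboveI2 real_norm_def)
  ultimately show ?thesis using fin by simp
qed

lemma Ck_norm_ge: "CS k d \<Longrightarrow> length is \<le> k \<Longrightarrow> \<bar>pds is d x\<bar> \<le> Ck_norm k d"
  unfolding Ck_norm_def using cSUP_upper[OF _ Ck_norm_bdd, of "(is, x)" k d] by auto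

lemma Ck_norm_le: "(\<And>is x. length is \<le> k \<Longrightarrow> \<bar>pds is d x\<bar> \<le> C) \<Longrightarrow> Ck_norm k d \<le> C"
  unfolding Ck_norm_def by (rule cSUP_least) (auto intro: exI[of _ "[]"])

lemma Ck_norm_ge0: "CS k d \<Longrightarrow> \<bar>d x\<bar> \<le> Ck_norm k d"
  using Ck_norm_ge[of k d "[]" x] by (simp add: pds_def)

lemma Ck_norm_nonneg: "CS k d \<Longrightarrow> 0 \<le> Ck_norm k d"
  using Ck_norm_ge0[of k d 0] by linarith

lemma Ck_norm_zero_le: "CS k d \<Longrightarrow> Ck_norm 0 d \<le> Ck_norm k d"
  by (rule Ck_norm_le) (simp add: pds_def Ck_norm_ge0)

lemma Ck_norm_pd_le:
  fixes d :: "real^'n \<Rightarrow> real"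
  assumes "CS (Suc k) d"
  shows "Ck_norm k (pd i d) \<le> Ck_norm (Suc k) d"
proof (rule Ck_norm_le)
  fix "is" :: "'n list" and x assume "length is \<le> k"
  then show "\<bar>pds is (pd i d) x\<bar> \<le> Ck_norm (Suc k) d"
    using Ck_norm_ge[OF assms, of "is @ [i]" x] by (simp add: pds_snoc)
qed

text \<open>Splitting off the innermost derivative reduces convergence at order \<open>k + 1\<close>
  to convergence of the function in the sup norm and of its first derivatives at order
  \<open>k\<close>.\<close>

lemma Ck_norm_Suc_le:
  fixes d :: "real^'n \<Rightarrow> real"
  assumes d: "CS (Suc k) d"
  shows "Ck_norm (Suc k) d \<le> Ck_norm 0 d + (\<Sum>i\<in>UNIV. Ck_norm k (pd i d))"
proof (rule Ck_norm_le)
  fix "is" :: "'n list" and x assume l: "length is \<le> Suc k"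
  have c: "CS 0 d" using CS_cper[OF d] by simp
  have n: "0 \<le> Ck_norm k (pd i d)" for i using CS_pd[OF d] Ck_norm_nonneg by blast
  show "\<bar>pds is d x\<bar> \<le> Ck_norm 0 d + (\<Sum>i\<in>UNIV. Ck_norm k (pd i d))"
  proof (cases "is" rule: rev_cases)
    case Nil
    then show ?thesis using Ck_norm_ge0[OF c, of x] sum_nonneg[of UNIV "\<lambda>i. Ck_norm k (pd i d)"] n
      by (simp add: pds_def)
  next
    case (snoc js i)
    have "\<bar>pds js (pd i d) x\<bar> \<le> Ck_norm k (pd i d)"
      using CS_pd[OF d, of i] l snoc by (intro Ck_norm_ge) auto
    also have "\<dots> \<le> (\<Sum>i\<in>UNIV. Ck_norm k (pd i d))"
      using n by (intro member_le_sum) auto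
    finally show ?thesis using Ck_norm_nonneg[OF c] snoc by (simp add: pds_snoc)
  qed
qed

text \<open>Closeness of \<open>f s\<close> to \<open>f t\<close> uniformly in space is combined
  with continuity of the single slice \<open>f t\<close>.\<close>

lemma C0_time_cper:
  fixes f :: "real \<Rightarrow> real^'n \<Rightarrow> real"
  assumes "f \<in> C0_time_Ck k"
  shows "cper (\<lambda>(t, x). f t x)"
proof (rule cperI)
  have CS: "CS k (f t)" for t using assms by (simp add: C0_time_Ck_def Ck_torus_iff)
  have lim: "((\<lambda>s. Ck_norm k (\<lambda>x. f s x - f t x)) \<longlongrightarrow> 0) (at t)" for t
    using assms by (simp add: C0_time_Ck_def)
  show "per (\<lambda>(t, x). f t x)"
  proof (rule per_prodI)
    show "(case (t + 1, x) of (t, x) \<Rightarrow> f t x) = (case (t, x) of (t, x) \<Rightarrow> f t x)" for t x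
      using assms by (simp add: C0_time_Ck_def periodic_time_def)
    show "(case (t, x + b) of (t, x) \<Rightarrow> f t x) = (case (t, x) of (t, x) \<Rightarrow> f t x)" if "b \<in> Basis" for t x b
      using cperD(2)[OF CS_cper[OF CS[of t]]] that by (simp add: per_def)
  qed
  show "continuous_on UNIV (\<lambda>(t, x). f t x)"
    unfolding continuous_on_iff
  proof (intro ballI allI impI)
    fix z :: "real \<times> (real^'n)" and e :: real assume e: "e > 0"
    obtain t x where z: "z = (t, x)" by (cases z)
    have "\<forall>\<^sub>F s in at t. dist (Ck_norm k (\<lambda>x. f s x - f t x)) 0 < e / 2"
      by (rule tendstoD[OF lim]) (use e in simp)
    then obtain d1 where d1: "d1 > 0" "\<And>s. s \<noteq> t \<Longrightarrow> dist s t < d1 \<Longrightarrow> \<bar>Ck_norm k (\<lambda>x. f s x - f t x)\<bar> < e / 2"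
      unfolding eventually_at by auto
    obtain d2 where d2: "d2 > 0" "\<And>y. dist y x < d2 \<Longrightarrow> dist (f t y) (f t x) < e / 2"
      using cperD(1)[OF CS_cper[OF CS[of t]]] e unfolding continuous_on_iff by (meson UNIV_I half_gt_zero)
    show "\<exists>d>0. \<forall>x'\<in>UNIV. dist x' z < d \<longrightarrow> dist (case x' of (t, x) \<Rightarrow> f t x) (case z of (t, x) \<Rightarrow> f t x) < e"
    proof (intro exI conjI ballI impI)
      show "min d1 d2 > 0" using d1 d2 by simp
      fix z' assume z': "dist z' z < min d1 d2"
      obtain s y where zs: "z' = (s, y)" by (cases z')
      have st: "dist s t < d1" and yx: "dist y x < d2"
        using z' dist_fst_le[of z' z] dist_snd_le[of z' z] by (auto simp: z zs)
      have "\<bar>f s y - f t y\<bar> < e / 2"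
      proof (cases "s = t")
        case False
        have "\<bar>f s y - f t y\<bar> \<le> Ck_norm k (\<lambda>x. f s x - f t x)"
          using Ck_norm_ge0[OF CS_diff[OF CS CS]] .
        then show ?thesis using d1(2)[OF False st] by simp
      qed (use e in simp)
      moreover have "\<bar>f t y - f t x\<bar> < e / 2" using d2(2)[OF yx] by (simp add: dist_real_def)
      ultimately have "\<bar>f s y - f t x\<bar> < e" by linarith
      then show "dist (case z' of (t, x) \<Rightarrow> f t x) (case z of (t, x) \<Rightarrow> f t x) < e"
        by (simp add: z zs dist_real_def)
    qed
  qed
qed

lemma C0_time_imp_CT:
  fixes f :: "real \<Rightarrow> real^'n \<Rightarrow> real"
  assumes "f \<in> C0_time_Ck k"
  shows "CT k (\<lambda>(t, x). f t x)"
  using assms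
proof (induction k arbitrary: f)
  case 0
  then show ?case using C0_time_cper by simp
next
  case (Suc k)
  have CS: "CS (Suc k) (f t)" for t using Suc.prems by (simp add: C0_time_Ck_def Ck_torus_iff del: CS.simps)
  have lim: "((\<lambda>s. Ck_norm (Suc k) (\<lambda>x. f s x - f t x)) \<longlongrightarrow> 0) (at t)" for t
    using Suc.prems by (simp add: C0_time_Ck_def)
  have pt: "periodic_time f" using Suc.prems by (simp add: C0_time_Ck_def)
  have "\<exists>g. has_pd (\<lambda>(t, x). f t x) (0, b) g \<and> CT k g" if b: "b \<in> Basis" for b
  proof -
    obtain i where i: "b = axis i 1" using b by (auto simp: Basis_vec_range)
    have "(\<lambda>t. pd i (f t)) \<in> C0_time_Ck k"
      unfolding C0_time_Ck_def
    proof (intro CollectI conjI allI)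
      show "periodic_time (\<lambda>t. pd i (f t))"
        using pt unfolding periodic_time_def by simp
      show "pd i (f t) \<in> Ck_torus k" for t using CS_pd[OF CS] by (simp add: Ck_torus_iff)
      show "((\<lambda>s. Ck_norm k (\<lambda>x. pd i (f s) x - pd i (f t) x)) \<longlongrightarrow> 0) (at t)" for t
      proof (rule tendsto_sandwich[OF _ _ tendsto_const lim[of t]])
        have e: "(\<lambda>x. pd i (f s) x - pd i (f t) x) = pd i (\<lambda>x. f s x - f t x)" for s
          using pd_diff[OF CS CS] by metis
        have d: "CS (Suc k) (\<lambda>x. f s x - f t x)" for s by (rule CS_diff[OF CS CS])
        show "\<forall>\<^sub>F s in at t. 0 \<le> Ck_norm k (\<lambda>x. pd i (f s) x - pd i (f t) x)"
          unfolding e using Ck_norm_nonneg CS_pd[OF d] by (intro always_eventually allI) blast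
        show "\<forall>\<^sub>F s in at t. Ck_norm k (\<lambda>x. pd i (f s) x - pd i (f t) x) \<le> Ck_norm (Suc k) (\<lambda>x. f s x - f t x)"
          unfolding e using Ck_norm_pd_le[OF d] by (intro always_eventually allI)
      qed
    qed
    then have "CT k (\<lambda>(t, x). pd i (f t) x)" by (rule Suc.IH)
    moreover have "has_pd (\<lambda>(t, x). f t x) (0, b) (\<lambda>(t, x). pd i (f t) x)"
      unfolding has_pd_def
    proof (intro allI)
      fix z :: "real \<times> (real^'n)"
      obtain t x where z: "z = (t, x)" by (cases z)
      show "((\<lambda>s. case z + s *\<^sub>R (0, b) of (t, x) \<Rightarrow> f t x) has_real_derivative (case z of (t, x) \<Rightarrow> pd i (f t) x)) (at 0)"
        using CS_pd[OF CS[of t], of i] unfolding has_pd_def by (simp add: z i)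
    qed
    ultimately show ?thesis by blast
  qed
  then show ?case using C0_time_cper[OF Suc.prems] by simp
qed

lemma CT_pd_slice:
  fixes F :: "real \<times> (real^'n) \<Rightarrow> real"
  shows "has_pd F (0, axis i 1) g \<Longrightarrow> pd i (\<lambda>x. F (t, x)) = (\<lambda>x. g (t, x))"
  by (rule pd_eq) (rule has_pd_slice)

text \<open>A periodic continuous function is uniformly continuous, which makes joint continuity
  into continuity in time for the sup norm; higher orders apply this to derivatives.\<close>

lemma CT_imp_C0_time:
  fixes F :: "real \<times> (real^'n) \<Rightarrow> real"
  assumes "CT k F"
  shows "(\<lambda>t x. F (t, x)) \<in> C0_time_Ck k"
  unfolding C0_time_Ck_def
proof (intro CollectI conjI allI)
  show "periodic_time (\<lambda>t x. F (t, x))"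
    using per_prodD(1)[OF cperD(2)[OF CT_cper[OF assms]]] by (simp add: periodic_time_def)
  show "(\<lambda>x. F (t, x)) \<in> Ck_torus k" for t
    using CT_slice[OF assms] by (simp add: Ck_torus_iff)
  show "((\<lambda>s. Ck_norm k (\<lambda>x. F (s, x) - F (t, x))) \<longlongrightarrow> 0) (at t)" for t
    using assms
  proof (induction k arbitrary: F)
    case 0
    then have F: "cper F" by simp
    show ?case
    proof (rule tendstoI)
      fix e :: real assume e: "e > 0"
      then obtain d where d: "d > 0" "\<And>x y. dist y x < d \<Longrightarrow> dist (F y) (F x) < e / 2"
        using cper_uniformly_continuous[OF F] unfolding uniformly_continuous_on_def
        by (meson UNIV_I half_gt_zero)
      have "dist (Ck_norm 0 (\<lambda>x. F (s, x) - F (t, x))) 0 < e" if "dist s t < d" for s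
      proof -
        have "Ck_norm 0 (\<lambda>x. F (s, x) - F (t, x)) \<le> e / 2"
        proof (rule Ck_norm_le)
          fix "is" :: "'n list" and x assume "length is \<le> 0"
          then show "\<bar>pds is (\<lambda>x. F (s, x) - F (t, x)) x\<bar> \<le> e / 2"
            using d(2)[of "(s, x)" "(t, x)"] that by (simp add: pds_def dist_Pair_Pair dist_real_def)
        qed
        moreover have "0 \<le> Ck_norm 0 (\<lambda>x. F (s, x) - F (t, x))"
          using F by (intro Ck_norm_nonneg) (simp add: cper_diff cper_slice)
        ultimately show ?thesis using e by simp
      qed
      then show "\<forall>\<^sub>F s in at t. dist (Ck_norm 0 (\<lambda>x. F (s, x) - F (t, x))) 0 < e"
        unfolding eventually_at using d(1) by blast
    qed
  next
    case (Suc k)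
    have S: "CS (Suc k) (\<lambda>x. F (s, x))" for s by (rule CT_slice[OF Suc.prems])
    have d: "CS (Suc k) (\<lambda>x. F (s, x) - F (t, x))" for s by (rule CS_diff[OF S S])
    have "CT 0 F" using CT_cper[OF Suc.prems] by simp
    \<comment> \<open>The induction hypothesis concerns order \<open>k\<close>. For
      \<open>k > 0\<close> the sup norm is dominated by the norm of that order.\<close>
    have z: "((\<lambda>s. Ck_norm 0 (\<lambda>x. F (s, x) - F (t, x))) \<longlongrightarrow> 0) (at t)"
    proof (cases k)
      case 0
      then show ?thesis using Suc.IH \<open>CT 0 F\<close> by simp
    next
      case (Suc j)
      have "((\<lambda>s. Ck_norm k (\<lambda>x. F (s, x) - F (t, x))) \<longlongrightarrow> 0) (at t)"
        using Suc.IH CT_Suc_imp[OF Suc.prems] by blast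
      then show ?thesis
      proof (rule tendsto_sandwich[OF _ _ tendsto_const, rotated 2])
        have "CS k (\<lambda>x. F (s, x) - F (t, x))" for s
          using CT_slice[OF CT_Suc_imp[OF Suc.prems]] by (rule CS_diff) (rule CT_slice[OF CT_Suc_imp[OF Suc.prems]])
        then show "\<forall>\<^sub>F s in at t. Ck_norm 0 (\<lambda>x. F (s, x) - F (t, x)) \<le> Ck_norm k (\<lambda>x. F (s, x) - F (t, x))"
          using Ck_norm_zero_le by (intro always_eventually allI) blast
        show "\<forall>\<^sub>F s in at t. 0 \<le> Ck_norm 0 (\<lambda>x. F (s, x) - F (t, x))"
          using CS_cper[OF d] by (intro always_eventually allI Ck_norm_nonneg) simp
      qed
    qed
    have "((\<lambda>s. Ck_norm k (pd i (\<lambda>x. F (s, x) - F (t, x)))) \<longlongrightarrow> 0) (at t)" for i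
    proof -
      obtain g where g: "has_pd F (0, axis i 1) g" "CT k g" using CT_pd[OF Suc.prems axis_Basis] by blast
      have "pd i (\<lambda>x. F (s, x) - F (t, x)) = (\<lambda>x. g (s, x) - g (t, x))" for s
        using pd_diff[OF S S] CT_pd_slice[OF g(1)] by metis
      then show ?thesis using Suc.IH[OF g(2)] by simp
    qed
    then have "((\<lambda>s. Ck_norm 0 (\<lambda>x. F (s, x) - F (t, x)) + (\<Sum>i\<in>UNIV. Ck_norm k (pd i (\<lambda>x. F (s, x) - F (t, x))))) \<longlongrightarrow> 0 + (\<Sum>i\<in>(UNIV::'n set). 0)) (at t)"
      by (intro tendsto_add z tendsto_sum)
    then have "((\<lambda>s. Ck_norm 0 (\<lambda>x. F (s, x) - F (t, x)) + (\<Sum>i\<in>UNIV. Ck_norm k (pd i (\<lambda>x. F (s, x) - F (t, x))))) \<longlongrightarrow> 0) (at t)"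
      by simp
    then show ?case
      by (rule tendsto_sandwich[OF _ _ tendsto_const, rotated 2])
        (auto intro!: always_eventually Ck_norm_nonneg d Ck_norm_Suc_le simp del: CS.simps)
  qed
qed

text \<open>The mean value inequality for \<open>s \<mapsto> U (s, x) - s * G (t, x)\<close> bounds
  the error by the oscillation of \<open>G\<close> between the times \<open>t\<close> and
  \<open>t + h\<close>, which is small uniformly in \<open>x\<close>.\<close>

lemma quotient_uniform:
  fixes U G :: "real \<times> (real^'n) \<Rightarrow> real"
  assumes U: "cper U" and G: "cper G" and pd: "has_pd U (1, 0) G"
  shows "((\<lambda>h. Ck_norm 0 (\<lambda>x. (U (t + h, x) - U (t, x)) / h - G (t, x))) \<longlongrightarrow> 0) (at 0)"
proof (rule tendstoI)
  fix e :: real assume e: "e > 0"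
  then obtain d where d: "d > 0" "\<And>x y. dist y x < d \<Longrightarrow> dist (G y) (G x) < e / 2"
    using cper_uniformly_continuous[OF G] unfolding uniformly_continuous_on_def
    by (meson UNIV_I half_gt_zero)
  have "dist (Ck_norm 0 (\<lambda>x. (U (t + h, x) - U (t, x)) / h - G (t, x))) 0 < e" if h: "h \<noteq> 0" "dist h 0 < d" for h
  proof -
    have "\<bar>(U (t + h, x) - U (t, x)) / h - G (t, x)\<bar> \<le> e / 2" for x
    proof -
      let ?T = "closed_segment t (t + h)"
      have "norm ((U (t + h, x) - (t + h) * G (t, x)) - (U (t, x) - t * G (t, x))) \<le> e / 2 * norm (t + h - t)"
      proof (rule field_differentiable_bound[of ?T "\<lambda>s. U (s, x) - s * G (t, x)" "\<lambda>s. G (s, x) - G (t, x)"])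
        show "((\<lambda>s. U (s, x) - s * G (t, x)) has_real_derivative G (s, x) - G (t, x)) (at s within ?T)" for s
          by (rule has_field_derivative_at_within) (auto intro!: derivative_eq_intros has_pd_time[OF pd])
        show "norm (G (s, x) - G (t, x)) \<le> e / 2" if "s \<in> ?T" for s
        proof -
          have "dist s t < d"
            using that h(2) by (auto simp: closed_segment_eq_real_ivl dist_real_def split: if_splits)
          then show ?thesis using d(2)[of "(s, x)" "(t, x)"] by (simp add: dist_Pair_Pair dist_real_def)
        qed
      qed auto
      then have "\<bar>(U (t + h, x) - U (t, x)) - h * G (t, x)\<bar> \<le> e / 2 * \<bar>h\<bar>"
        by (simp add: algebra_simps)
      moreover have "(U (t + h, x) - U (t, x)) / h - G (t, x) = ((U (t + h, x) - U (t, x)) - h * G (t, x)) / h"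
        using h(1) by (simp add: field_simps)
      ultimately show ?thesis using h(1) by (simp add: pos_divide_le_eq)
    qed
    then have "Ck_norm 0 (\<lambda>x. (U (t + h, x) - U (t, x)) / h - G (t, x)) \<le> e / 2"
      by (intro Ck_norm_le) (simp add: pds_def)
    moreover have "CS 0 (\<lambda>x. (U (t + h, x) - U (t, x)) / h - G (t, x))"
      using U G by (intro CS_quotient) (simp_all add: cper_slice)
    then have "0 \<le> Ck_norm 0 (\<lambda>x. (U (t + h, x) - U (t, x)) / h - G (t, x))"
      by (rule Ck_norm_nonneg)
    ultimately show ?thesis using e by simp
  qed
  then show "\<forall>\<^sub>F h in at 0. dist (Ck_norm 0 (\<lambda>x. (U (t + h, x) - U (t, x)) / h - G (t, x))) 0 < e"
    unfolding eventually_at using d(1) by blast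
qed

text \<open>The difference quotient has to converge along with its spatial derivatives. For those,
  \<open>has_pd_mixed\<close> identifies the time derivative of \<open>D\<close> with the spatial
  derivative of \<open>G\<close>.\<close>

lemma C1_timeI:
  fixes U G :: "real \<times> (real^'n) \<Rightarrow> real"
  assumes U: "CT 1 U" and G: "CT 1 G" and pd: "has_pd U (1, 0) G"
  shows "(\<lambda>t x. U (t, x)) \<in> C1_time_Ck 1"
  unfolding C1_time_Ck_def
proof (intro CollectI conjI allI)
  have U': "CT (Suc 0) U" and G': "CT (Suc 0) G" using U G by simp_all
  show "periodic_time (\<lambda>t x. U (t, x))"
    using per_prodD(1)[OF cperD(2)[OF CT_cper[OF U]]] by (simp add: periodic_time_def)
  show "(\<lambda>x. U (t, x)) \<in> Ck_torus 1" for t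
    using CT_slice[OF U] by (simp only: Ck_torus_iff)
  show "\<exists>g\<in>C0_time_Ck 1. \<forall>t. ((\<lambda>h. Ck_norm 1 (\<lambda>x. (U (t + h, x) - U (t, x)) / h - g t x)) \<longlongrightarrow> 0) (at 0)"
  proof (intro bexI[of _ "\<lambda>t x. G (t, x)"] allI)
    show "(\<lambda>t x. G (t, x)) \<in> C0_time_Ck 1" by (rule CT_imp_C0_time[OF G])
    fix t
    have SU: "CS (Suc 0) (\<lambda>x. U (t, x))" for t by (rule CT_slice[OF U'])
    have SG: "CS (Suc 0) (\<lambda>x. G (t, x))" for t by (rule CT_slice[OF G'])
    let ?d = "\<lambda>h x. (U (t + h, x) - U (t, x)) / h - G (t, x)"
    have d: "CS (Suc 0) (?d h)" for h by (intro CS_quotient SU SG)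
    have "((\<lambda>h. Ck_norm 0 (pd i (?d h))) \<longlongrightarrow> 0) (at 0)" for i
    proof -
      obtain D where D: "has_pd U (0, axis i 1) D" "CT 0 D" using CT_pd[OF U' axis_Basis] by blast
      obtain E where E: "has_pd G (0, axis i 1) E" "CT 0 E" using CT_pd[OF G' axis_Basis] by blast
      have m: "has_pd D (1, 0) E"
        by (rule has_pd_mixed[OF D(1) pd E(1)]) (use CT_cper U G E(2) in auto)
      have "pd i (?d h) = (\<lambda>x. (D (t + h, x) - D (t, x)) / h - E (t, x))" for h
        unfolding pd_quotient[OF SU SU SG] CT_pd_slice[OF D(1)] CT_pd_slice[OF E(1)] ..
      then show ?thesis using quotient_uniform[OF _ _ m] D(2) E(2) by simp
    qed
    then have "((\<lambda>h. Ck_norm 0 (?d h) + (\<Sum>i\<in>UNIV. Ck_norm 0 (pd i (?d h)))) \<longlongrightarrow> 0 + (\<Sum>i\<in>(UNIV::'n set). 0)) (at 0)"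
      by (intro tendsto_add tendsto_sum quotient_uniform[OF _ _ pd]) (use CT_cper U G in auto)
    then have "((\<lambda>h. Ck_norm 0 (?d h) + (\<Sum>i\<in>UNIV. Ck_norm 0 (pd i (?d h)))) \<longlongrightarrow> 0) (at 0)"
      by simp
    then have "((\<lambda>h. Ck_norm (Suc 0) (?d h)) \<longlongrightarrow> 0) (at 0)"
      by (rule tendsto_sandwich[OF _ _ tendsto_const, rotated 2])
        (auto intro!: always_eventually Ck_norm_nonneg d Ck_norm_Suc_le simp del: CS.simps)
    then show "((\<lambda>h. Ck_norm 1 (\<lambda>x. (U (t + h, x) - U (t, x)) / h - G (t, x))) \<longlongrightarrow> 0) (at 0)"
      by simp
  qed
qed

lemma C1_timeD:
  fixes u :: "real \<Rightarrow> real^'n \<Rightarrow> real"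
  assumes "u \<in> C1_time_Ck k"
  obtains G where "cper G" "has_pd (\<lambda>(t, x). u t x) (1, 0) G"
proof -
  obtain g where g: "g \<in> C0_time_Ck k" "\<And>t. ((\<lambda>h. Ck_norm k (\<lambda>x. (u (t + h) x - u t x) / h - g t x)) \<longlongrightarrow> 0) (at 0)"
    using assms by (auto simp: C1_time_Ck_def)
  have S: "CS k (u t)" "CS k (g t)" for t
    using assms g(1) by (auto simp: C1_time_Ck_def C0_time_Ck_def Ck_torus_iff)
  have "has_pd (\<lambda>(t, x). u t x) (1, 0) (\<lambda>(t, x). g t x)"
    unfolding has_pd_def
  proof (intro allI)
    fix z :: "real \<times> (real^'n)"
    obtain t x where z: "z = (t, x)" by (cases z)
    have "((\<lambda>h. (u (t + h) x - u t x) / h - g t x) \<longlongrightarrow> 0) (at 0)"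
      by (rule Lim_null_comparison[OF _ g(2)[of t]])
        (use Ck_norm_ge0[OF CS_quotient[OF S(1) S(1) S(2)]] in \<open>auto intro!: always_eventually\<close>)
    then have "((\<lambda>h. (u (t + h) x - u t x) / h) \<longlongrightarrow> g t x) (at 0)"
      by (rule LIM_zero_cancel)
    then show "((\<lambda>s. case z + s *\<^sub>R (1, 0) of (t, x) \<Rightarrow> u t x) has_real_derivative (case z of (t, x) \<Rightarrow> g t x)) (at 0)"
      by (simp add: z DERIV_def)
  qed
  then show thesis using that C0_time_cper[OF g(1)] by blast
qed

lemma C1_time_torusI:
  fixes F Ft :: "real \<times> (real^'n) \<Rightarrow> real"
  assumes F: "CT 1 F" and Ft: "cper Ft" and pd: "has_pd F (1, 0) Ft"
  shows "(\<lambda>t x. F (t, x)) \<in> C1_time_torus"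
  unfolding C1_time_torus_def
proof (intro CollectI conjI allI)
  have c: "cper F" using CT_cper[OF F] .
  show "periodic_time (\<lambda>t x. F (t, x))"
    using per_prodD(1)[OF cperD(2)[OF c]] by (simp add: periodic_time_def)
  show "periodic_space (\<lambda>x. F (t, x))" for t
    using cperD(2)[OF cper_slice[OF c]] by (simp add: periodic_space_iff)
  have "\<forall>b\<in>Basis. \<exists>g. has_pd F (0, b) g \<and> cper g" using F by simp
  then obtain D where D: "\<And>b. b \<in> Basis \<Longrightarrow> has_pd F (0, b) (D b)" "\<And>b. b \<in> Basis \<Longrightarrow> cper (D b)" by metis
  define g where "g b = (if fst b = 0 then D (snd b) else Ft)" for b :: "real \<times> (real^'n)"
  have g: "has_pd F b (g b)" "continuous_on UNIV (g b)" if "b \<in> Basis" for b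
    using that D pd Ft by (auto simp: Basis_prod_def g_def cper_def)
  define f' where "f' z = (\<Sum>b\<in>Basis. g b z *\<^sub>R blinfun_inner_left b)" for z
  show "\<exists>f'. (\<forall>z. ((\<lambda>(t, x). F (t, x)) has_derivative blinfun_apply (f' z)) (at z)) \<and> continuous_on UNIV f'"
  proof (intro exI[of _ f'] conjI allI)
    show "continuous_on UNIV f'" unfolding f'_def by (intro continuous_intros g)
    fix z
    have "(F has_derivative (\<lambda>h. \<Sum>b\<in>Basis. (h \<bullet> b) * g b z)) (at z)"
      by (rule C1_has_derivative[OF g])
    moreover have "(\<lambda>h. \<Sum>b\<in>Basis. (h \<bullet> b) * g b z) = blinfun_apply (f' z)"
      by (auto simp: f'_def blinfun.sum_left blinfun.scaleR_left inner_commute mult.commute fun_eq_iff)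
    ultimately show "((\<lambda>(t, x). F (t, x)) has_derivative blinfun_apply (f' z)) (at z)" by simp
  qed
qed

lemma C1_time_torusD:
  fixes f :: "real \<Rightarrow> real^'n \<Rightarrow> real"
  assumes "f \<in> C1_time_torus" and c: "cper (\<lambda>(t, x). f t x)"
  obtains G where "cper G" "has_pd (\<lambda>(t, x). f t x) (1, 0) G"
proof -
  obtain f' where f': "\<And>z. ((\<lambda>(t, x). f t x) has_derivative blinfun_apply (f' z)) (at z)" "continuous_on UNIV f'"
    using assms by (auto simp: C1_time_torus_def)
  define G where "G z = blinfun_apply (f' z) (1, 0)" for z
  have pd: "has_pd (\<lambda>(t, x). f t x) (1, 0) G"
    unfolding has_pd_def
  proof
    fix z :: "real \<times> (real^'n)"
    have l: "((\<lambda>s. z + s *\<^sub>R (1, 0)) has_derivative (\<lambda>s. s *\<^sub>R (1, 0))) (at 0)"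
      by (auto intro!: derivative_eq_intros)
    have "((\<lambda>s. (\<lambda>(t, x). f t x) (z + s *\<^sub>R (1, 0))) has_derivative (\<lambda>s. blinfun_apply (f' (z + 0 *\<^sub>R (1, 0))) (s *\<^sub>R (1, 0)))) (at 0)"
      by (rule has_derivative_compose[OF l f'(1)])
    then show "((\<lambda>s. (\<lambda>(t, x). f t x) (z + s *\<^sub>R (1, 0))) has_real_derivative G z) (at 0)"
      by (simp add: has_field_derivative_def G_def blinfun.scaleR_right mult_commute_abs del: scaleR_Pair)
  qed
  moreover have "continuous_on UNIV G"
    unfolding G_def by (intro continuous_intros f')
  ultimately show thesis using that has_pd_per[OF pd cperD(2)[OF c]] by (simp add: cper_def)
qed

section \<open>Fixed points and classical solutions\<close>

text \<open>Serves to show that the constants by which the two factors are normalised do not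
  vanish.\<close>

lemma avg_zero_imp:
  fixes f :: "'a::euclidean_space \<Rightarrow> real"
  assumes f: "cper f" and f0: "\<And>x. 0 \<le> f x" and z: "avg f = 0"
  shows "f x = 0"
proof -
  obtain y where y: "y \<in> cell" "f x = f y" using per_reduce[OF cperD(2)[OF f]] by blast
  have "(f has_integral 0) cell"
    using integrable_integral[OF cper_integrable_on[OF f]] z by (metis avg_def)
  then have "f y = 0"
    by (rule has_integral_0_cbox_imp_0[rotated 2])
      (use f0 y cper_continuous_on[OF f] in \<open>auto simp: box_ne_empty\<close>)
  then show ?thesis using y by simp
qed

context heat
begin

text \<open>The eigenvalue \<open>l\<close> is left open: averaging
  \<open>w = R ((q + \<mu> - l) w)\<close> with \<open>avg w = 1\<close> forces it to be the mean of
  \<open>q w\<close>, the number built into \<open>hh\<close>.\<close>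

lemma T_fixpointI:
  assumes C: "C12 w wt D H" and eq: "\<And>z. LL wt D H z = - (q z - l) * w z"
    and q: "cper q" and w: "avg w = 1"
  shows "w = T q w"
proof -
  have wc: "cper w" using C by (simp add: C12_def)
  have e: "w = R (\<lambda>z. (q z + \<mu> - l) * w z)"
  proof
    fix z
    have "w z = R (\<lambda>z. \<mu> * w z - LL wt D H z) z" by (rule R_resolvent[OF C, symmetric])
    also have "(\<lambda>z. \<mu> * w z - LL wt D H z) = (\<lambda>z. (q z + \<mu> - l) * w z)"
      by (simp add: eq fun_eq_iff algebra_simps)
    finally show "w z = R (\<lambda>z. (q z + \<mu> - l) * w z) z" .
  qed
  have "1 = avg (R (\<lambda>z. (q z + \<mu> - l) * w z))" using e w by simp
  also have "\<dots> = avg (\<lambda>z. (q z + \<mu> - l) * w z) / \<mu>"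
    by (intro R_avg cper_mult cper_diff cper_add cper_const q wc)
  also have "(\<lambda>z. (q z + \<mu> - l) * w z) = (\<lambda>z. q z * w z + (\<mu> - l) * w z)"
    by (simp add: algebra_simps)
  also have "avg \<dots> = avg (\<lambda>z. q z * w z) + (\<mu> - l)"
    using w by (simp add: avg_add cper_mult cper_cmult q wc avg_cmult)
  finally have "avg (\<lambda>z. q z * w z) = l" using \<mu>_pos by (simp add: field_simps)
  then have "hh q w = (\<lambda>z. (q z + \<mu> - l) * w z)" by (simp add: hh_def fun_eq_iff)
  then show ?thesis unfolding T_def using e by simp
qed

end

context mfg
begin

section \<open>From fixed points to the equations and from solutions to fixed points\<close>

lemma Nf_deriv:
  assumes w: "cper w" "cper wt" "has_pd w (1, 0) wt" and v: "cper v" "cper vt" "has_pd v (1, 0) vt"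
  shows "(Nf w v has_real_derivative avg (\<lambda>x. wt (t, x) * v (t, x) + w (t, x) * vt (t, x))) (at t)"
proof -
  note pd = has_pd_mult[OF w(3) v(3)]
  have c: "cper (\<lambda>z. w z * v z)" "cper (\<lambda>z. wt z * v z + w z * vt z)"
    by (intro cper_add cper_mult w v)+
  have "((\<lambda>s. integral cell (\<lambda>x. w (s, x) * v (s, x))) has_field_derivative
      integral cell (\<lambda>x. wt (t, x) * v (t, x) + w (t, x) * vt (t, x))) (at t within UNIV)"
  proof (rule leibniz_rule_field_derivative)
    show "((\<lambda>s. w (s, x) * v (s, x)) has_field_derivative wt (s, x) * v (s, x) + w (s, x) * vt (s, x)) (at s within UNIV)" for s x
      using has_pd_time[OF pd, of x s] by simp
    show "(\<lambda>x. w (s, x) * v (s, x)) integrable_on cell" for s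
      by (intro cper_integrable_on cper_mult cper_slice w v)
    show "continuous_on (UNIV \<times> cell) (\<lambda>(s, x). wt (s, x) * v (s, x) + w (s, x) * vt (s, x))"
      using cper_continuous_on[OF c(2)] by (simp add: split_beta)
  qed auto
  then show ?thesis by (simp add: Nf_def[abs_def] avg_def)
qed

lemma Sol_fixpoint:
  assumes s: "s \<in> Sol \<delta> M" and \<delta>: "\<delta> > 0"
  shows "ws s = T (Q (ws s) (vs s)) (ws s)"
    "(\<lambda>z. vs s (- z)) = T (\<lambda>z. Q (ws s) (vs s) (- z)) (\<lambda>z. vs s (- z))"
proof -
  have K: "s \<in> KK \<delta> M" and f: "Phi s = s" using s by (auto simp: Sol_def)
  note P = Phi_apply[OF K \<delta>, unfolded f]
  show "ws s = T (Q (ws s) (vs s)) (ws s)" using P(1) by (simp add: Phi1_def)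
  show "(\<lambda>z. vs s (- z)) = T (\<lambda>z. Q (ws s) (vs s) (- z)) (\<lambda>z. vs s (- z))"
  proof
    fix z
    show "vs s (- z) = T (\<lambda>z. Q (ws s) (vs s) (- z)) (\<lambda>z. vs s (- z)) z"
      by (subst P(2)) (simp add: Phi2_def)
  qed
qed

text \<open>The two fixed point equations bring separate eigenvalues \<open>l\<close> and
  \<open>l'\<close>. The mass satisfies \<open>N' = (l - l') N\<close> and is positive and periodic
  in time; the mean value theorem over one period gives \<open>l = l'\<close>, after which the mass
  is constant.\<close>

lemma Sol_structure:
  assumes s: "s \<in> Sol \<delta> M" and \<delta>: "\<delta> > 0" and V3: "CT 3 V" and W3: "CS 3 W"
  obtains l N wt vt D E H J where
    "CT 3 (ws s)" "CT 3 (vs s)" "has_pd (ws s) (1, 0) wt" "has_pd (vs s) (1, 0) vt" "CT 1 wt" "CT 1 vt"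
    "\<And>b. b \<in> Basis \<Longrightarrow> has_pd (ws s) (0, b) (D b) \<and> has_pd (D b) (0, b) (H b)"
    "\<And>b. b \<in> Basis \<Longrightarrow> has_pd (vs s) (0, b) (E b) \<and> has_pd (E b) (0, b) (J b)"
    "\<And>z. wt z = - (Q (ws s) (vs s) z - l) * ws s z - a * (\<Sum>b\<in>Basis. H b z) - (\<Sum>b\<in>Basis. (c \<bullet> b) * D b z)"
    "\<And>z. vt z = (Q (ws s) (vs s) z - l) * vs s z + a * (\<Sum>b\<in>Basis. J b z) - (\<Sum>b\<in>Basis. (c \<bullet> b) * E b z)"
    "N > 0" "\<And>z. rho (ws s) (vs s) z = 1 / N * (ws s z * vs s z)"
proof -
  let ?w = "ws s" and ?v = "vs s"
  let ?q = "Q ?w ?v"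
  have K: "s \<in> KK \<delta> M" using s by (auto simp: Sol_def)
  note S = KKD[OF K]
  have rc: "cper (rho ?w ?v)" by (rule rho_cper[where \<delta> = \<delta> and M = M]) (use S \<delta> in auto)
  have Npos: "Nf ?w ?v t > 0" for t by (rule Nf_pos[where \<delta> = \<delta> and M = M]) (use S \<delta> in auto)
  have q3: "CT 3 ?q"
    unfolding Q_def Qf_def[abs_def] Wc_def
    by (intro CT_cmult CT_add V3 CT_slice_avg[OF rc W3])
  obtain wt D H where w: "CT 3 ?w" "has_pd ?w (1, 0) wt" "CT 1 wt"
    and D: "\<And>b. b \<in> Basis \<Longrightarrow> has_pd ?w (0, b) (D b)" "\<And>b. b \<in> Basis \<Longrightarrow> CT 2 (D b)"
    and H: "\<And>b. b \<in> Basis \<Longrightarrow> has_pd (D b) (0, b) (H b)" "\<And>b. b \<in> Basis \<Longrightarrow> CT 1 (H b)"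
    and weq: "\<And>z. wt z = - (?q z - avg (\<lambda>z. ?q z * ?w z)) * ?w z - a * (\<Sum>b\<in>Basis. H b z) - (\<Sum>b\<in>Basis. (c \<bullet> b) * D b z)"
    by (rule T_regular[OF q3 S(1) Sol_fixpoint(1)[OF s \<delta>]]) blast
  obtain rt F G where r: "CT 3 (\<lambda>z. ?v (- z))" "has_pd (\<lambda>z. ?v (- z)) (1, 0) rt" "CT 1 rt"
    and F: "\<And>b. b \<in> Basis \<Longrightarrow> has_pd (\<lambda>z. ?v (- z)) (0, b) (F b)" "\<And>b. b \<in> Basis \<Longrightarrow> CT 2 (F b)"
    and G: "\<And>b. b \<in> Basis \<Longrightarrow> has_pd (F b) (0, b) (G b)" "\<And>b. b \<in> Basis \<Longrightarrow> CT 1 (G b)"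
    and req: "\<And>z. rt z = - (?q (- z) - avg (\<lambda>z. ?q (- z) * ?v (- z))) * ?v (- z) - a * (\<Sum>b\<in>Basis. G b z) - (\<Sum>b\<in>Basis. (c \<bullet> b) * F b z)"
    by (rule T_regular[OF CT_reflect[OF q3] cper_reflect[OF S(2)] Sol_fixpoint(2)[OF s \<delta>]]) blast
  \<comment> \<open>Undoing the reflection changes the sign of first derivatives and keeps that of
    second ones.\<close>
  define vt where "vt z = - rt (- z)" for z
  define E where "E b z = - F b (- z)" for b z
  define J where "J b z = G b (- z)" for b z
  have v: "CT 3 ?v" "has_pd ?v (1, 0) vt" "CT 1 vt"
    using CT_reflect[OF r(1)] has_pd_reflect[OF r(2)] CT_uminus[OF CT_reflect[OF r(3)]]
    by (simp_all add: vt_def[abs_def])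
  have E: "has_pd ?v (0, b) (E b)" "cper (E b)" if b: "b \<in> Basis" for b
    using has_pd_reflect[OF F(1)[OF b]] cper_uminus[OF cper_reflect[OF CT_cper[OF F(2)[OF b]]]]
    by (simp_all add: E_def[abs_def])
  have J: "has_pd (E b) (0, b) (J b)" "cper (J b)" if b: "b \<in> Basis" for b
  proof -
    have "has_pd (\<lambda>z. (- 1) * F b (- z)) (0, b) (\<lambda>z. (- 1) * - G b (- z))"
      by (intro has_pd_cmult has_pd_reflect G b)
    then show "has_pd (E b) (0, b) (J b)" by (simp add: E_def[abs_def] J_def[abs_def])
    show "cper (J b)" using cper_reflect[OF CT_cper[OF G(2)[OF b]]] by (simp add: J_def[abs_def])
  qed
  define l where "l = avg (\<lambda>z. ?q z * ?w z)"
  define l' where "l' = avg (\<lambda>z. ?q z * ?v z)"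
  have qc: "cper ?q" using CT_cper[OF q3] .
  have "avg (\<lambda>z. ?q (- z) * ?v (- z)) = l'"
    unfolding l'_def by (rule avg_reflect) (intro cper_mult qc S)
  then have veq: "vt z = (?q z - l') * ?v z + a * (\<Sum>b\<in>Basis. J b z) - (\<Sum>b\<in>Basis. (c \<bullet> b) * E b z)" for z
    unfolding vt_def using req[of "- z"] by (simp add: J_def E_def sum_negf left_diff_distrib)
  have Dc: "cper (D b)" and Hc: "cper (H b)" if "b \<in> Basis" for b using CT_cper D(2) H(2) that by blast+
  have wc: "cper ?w" "cper ?v" "cper wt" "cper vt" using CT_cper w v by blast+
  have Nd: "(Nf ?w ?v has_real_derivative (l - l') * Nf ?w ?v t) (at t)" for t
  proof -
    \<comment> \<open>Apart from the eigenvalue term, the time derivative of the product is a sum of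
      derivatives of \<open>a * (w * E b - v * D b) - (c \<bullet> b) * (w * v)\<close>, which have
      mean zero on the torus.\<close>
    let ?X = "\<lambda>b z. a * (?w z * J b z - ?v z * H b z) - (c \<bullet> b) * (D b z * ?v z + ?w z * E b z)"
    have X0: "avg (\<lambda>x. ?X b (t, x)) = 0" if b: "b \<in> Basis" for b
    proof (rule avg_pd_zero)
      have "has_pd (\<lambda>z. a * (?w z * E b z - ?v z * D b z) - (c \<bullet> b) * (?w z * ?v z)) (0, b)
         (\<lambda>z. a * ((D b z * E b z + ?w z * J b z) - (E b z * D b z + ?v z * H b z)) - (c \<bullet> b) * (D b z * ?v z + ?w z * E b z))"
        by (intro has_pd_diff has_pd_cmult has_pd_mult D E J H b)
      also have "(\<lambda>z. a * ((D b z * E b z + ?w z * J b z) - (E b z * D b z + ?v z * H b z)) - (c \<bullet> b) * (D b z * ?v z + ?w z * E b z)) = ?X b"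
        by (simp add: algebra_simps)
      finally show "has_pd (\<lambda>x. a * (?w (t, x) * E b (t, x) - ?v (t, x) * D b (t, x)) - (c \<bullet> b) * (?w (t, x) * ?v (t, x))) b (\<lambda>x. ?X b (t, x))"
        by (rule has_pd_slice)
      show "cper (\<lambda>x. a * (?w (t, x) * E b (t, x) - ?v (t, x) * D b (t, x)) - (c \<bullet> b) * (?w (t, x) * ?v (t, x)))"
        by (intro cper_diff cper_cmult cper_mult cper_slice wc E Dc b)
      show "cper (\<lambda>x. ?X b (t, x))"
        by (intro cper_diff cper_add cper_cmult cper_mult cper_slice wc E Dc J Hc b)
    qed
    have "wt z * ?v z + ?w z * vt z = (l - l') * (?w z * ?v z) + (\<Sum>b\<in>Basis. ?X b z)" for z
      unfolding weq[of z] veq[of z] l_def[symmetric]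
      by (simp add: algebra_simps sum.distrib sum_subtractf sum_distrib_left)
    then have "avg (\<lambda>x. wt (t, x) * ?v (t, x) + ?w (t, x) * vt (t, x)) = avg (\<lambda>x. (l - l') * (?w (t, x) * ?v (t, x)) + (\<Sum>b\<in>Basis. ?X b (t, x)))"
      by simp
    also have "\<dots> = avg (\<lambda>x. (l - l') * (?w (t, x) * ?v (t, x))) + avg (\<lambda>x. (\<Sum>b\<in>Basis. ?X b (t, x)))"
      by (rule avg_add) (intro cper_sum cper_diff cper_add cper_cmult cper_mult cper_slice wc E Dc J Hc; assumption)+
    also have "avg (\<lambda>x. (\<Sum>b\<in>Basis. ?X b (t, x))) = (\<Sum>b\<in>Basis. avg (\<lambda>x. ?X b (t, x)))"
      by (rule avg_sum) (auto intro!: cper_diff cper_add cper_cmult cper_mult cper_slice wc E Dc J Hc)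
    also have "\<dots> = 0" using X0 by simp
    finally show ?thesis
      using Nf_deriv[OF wc(1,3) w(2) wc(2,4) v(2), of t] by (simp add: avg_cmult Nf_def)
  qed
  have "?w (1, x) * ?v (1, x) = ?w (0, x) * ?v (0, x)" for x
    using per_prodD(1)[OF cperD(2)[OF wc(1)], of 0 x] per_prodD(1)[OF cperD(2)[OF wc(2)], of 0 x] by simp
  then have "Nf ?w ?v 1 = Nf ?w ?v 0" by (simp add: Nf_def)
  moreover obtain \<xi> where "Nf ?w ?v 1 - Nf ?w ?v 0 = (1 - 0) * ((l - l') * Nf ?w ?v \<xi>)"
    using MVT2[of 0 1 "Nf ?w ?v" "\<lambda>t. (l - l') * Nf ?w ?v t"] Nd by auto
  ultimately have ll: "l' = l" using Npos[of \<xi>] by simp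
  have Nc: "Nf ?w ?v t = Nf ?w ?v 0" for t
    using DERIV_isconst_all[of "Nf ?w ?v" t 0] Nd ll by simp
  show thesis
  proof (rule that[OF w(1) v(1) w(2) v(2) w(3) v(3)])
    show "rho ?w ?v z = 1 / Nf ?w ?v 0 * (?w z * ?v z)" for z
      using Nc[of "fst z"] by (simp add: rho_def)
    show "Nf ?w ?v 0 > 0" by (rule Npos)
    show "vt z = (?q z - l) * ?v z + a * (\<Sum>b\<in>Basis. J b z) - (\<Sum>b\<in>Basis. (c \<bullet> b) * E b z)" for z
      using veq[of z] ll by simp
    show "wt z = - (?q z - l) * ?w z - a * (\<Sum>b\<in>Basis. H b z) - (\<Sum>b\<in>Basis. (c \<bullet> b) * D b z)" for z
      using weq[of z] by (simp add: l_def)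
  qed (use D E H J in auto)
qed

text \<open>\<open>w\<close> and \<open>v\<close> are formed from the solution and scaled to mean 1.
  As the density is only known to be nonnegative, \<open>v\<close> could vanish at first; the bound
  for fixed points makes it at least \<open>\<delta>\<close>. The last conclusion recovers the
  gradient of the solution, and the action depends on \<open>u\<close> only through it.\<close>

lemma solution_in_Sol:
  assumes bnd: "fixpoint_bound \<delta> M"
    and \<delta>: "\<delta> > 0"
    and U: "cper U" "cper Ut" "has_pd U (1, 0) Ut"
    and UD: "\<And>b. b \<in> Basis \<Longrightarrow> has_pd U (0, b) (UD b)" "\<And>b. b \<in> Basis \<Longrightarrow> cper (UD b)"
    and UH: "\<And>b. b \<in> Basis \<Longrightarrow> has_pd (UD b) (0, b) (UH b)" "\<And>b. b \<in> Basis \<Longrightarrow> cper (UH b)"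
    and \<rho>: "cper \<rho>" "cper \<rho>t" "has_pd \<rho> (1, 0) \<rho>t"
    and \<rho>D: "\<And>b. b \<in> Basis \<Longrightarrow> has_pd \<rho> (0, b) (\<rho>D b)" "\<And>b. b \<in> Basis \<Longrightarrow> cper (\<rho>D b)"
    and \<rho>H: "\<And>b. b \<in> Basis \<Longrightarrow> has_pd (\<rho>D b) (0, b) (\<rho>H b)" "\<And>b. b \<in> Basis \<Longrightarrow> cper (\<rho>H b)"
    and pos: "\<And>z. 0 \<le> \<rho> z" and mass: "\<And>t. avg (\<lambda>x. \<rho> (t, x)) = 1"
    and eq1: "\<And>z. a * (\<Sum>b\<in>Basis. UH b z) + Ut z - (1/2 * (\<Sum>b\<in>Basis. (c \<bullet> b - UD b z) * (c \<bullet> b - UD b z)) + (V z + Wc \<rho> z)) + h = 0"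
    and eq2: "\<And>z. a * (\<Sum>b\<in>Basis. \<rho>H b z) - (\<Sum>b\<in>Basis. \<rho>D b z * (c \<bullet> b - UD b z) - \<rho> z * UH b z) - \<rho>t z = 0"
  obtains s where "s \<in> Sol \<delta> M" "rho (ws s) (vs s) = \<rho>"
    "\<And>b z. b \<in> Basis \<Longrightarrow> - (1 / \<beta>) * (gw b (ws s) (vs s) z / ws s z) = UD b z"
proof -
  define q where "q = Qf \<rho>"
  \<comment> \<open>Expanding the square of \<open>c - UD\<close> leaves half of the square of
    \<open>c\<close> as a constant, which joins \<open>h\<close>; the factor \<open>\<beta>\<close>
    comes from the exponent of \<open>w\<close>.\<close>
  define l where "l = \<beta> * (h - 1/2 * (\<Sum>b\<in>Basis. (c \<bullet> b) * (c \<bullet> b)))"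
  have qc: "cper q" unfolding q_def by (rule Qf_cper[OF \<rho>(1)])
  have qb: "\<bar>q z\<bar> \<le> BQ" for z unfolding q_def by (rule Qf_bound[OF \<rho>(1) pos mass])
  have a\<beta>: "a * \<beta> = 1 / 2" using a_eq \<beta>_pos by simp
  have expc: "cper (\<lambda>z. exp (r * U z))" for r
    by (rule cper_compose[OF U(1), of "\<lambda>u. exp (r * u)"]) (intro continuous_intros)
  have expd: "has_pd (\<lambda>z. exp (r * U z)) e (\<lambda>z. r * exp (r * U z) * X z)" if "has_pd U e X" for r e X
    by (rule has_pd_chain[OF that, where \<phi> = "\<lambda>u. exp (r * u)" and \<phi>' = "\<lambda>u. r * exp (r * u)"])
      (auto intro!: derivative_eq_intros)
  have kw0: "avg (\<lambda>z. exp (- \<beta> * U z)) > 0"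
    using avg_zero_imp[OF expc[of "- \<beta>"]] avg_nonneg[OF expc[of "- \<beta>"]] by (metis exp_ge_zero exp_not_eq_zero less_le)
  have v0c: "cper (\<lambda>z. \<rho> z * exp (\<beta> * U z))" by (intro cper_mult \<rho> expc)
  have v00: "0 \<le> \<rho> z * exp (\<beta> * U z)" for z using pos by simp
  have kv0: "avg (\<lambda>z. \<rho> z * exp (\<beta> * U z)) > 0"
  proof -
    have "avg (\<lambda>z. \<rho> z * exp (\<beta> * U z)) \<noteq> 0"
    proof
      assume "avg (\<lambda>z. \<rho> z * exp (\<beta> * U z)) = 0"
      from avg_zero_imp[OF v0c v00 this] have "\<rho> z = 0" for z by auto
      then show False using mass[of 0] by (simp add: avg_const)
    qed
    then show ?thesis using avg_nonneg[OF v0c v00] by simp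
  qed
  define \<kappa> where "\<kappa> = 1 / avg (\<lambda>z. exp (- \<beta> * U z))"
  define \<kappa>' where "\<kappa>' = 1 / avg (\<lambda>z. \<rho> z * exp (\<beta> * U z))"
  have \<kappa>: "\<kappa> > 0" "\<kappa>' > 0" using kw0 kv0 by (simp_all add: \<kappa>_def \<kappa>'_def)
  define w where "w z = \<kappa> * exp (- \<beta> * U z)" for z
  define v where "v z = \<kappa>' * (\<rho> z * exp (\<beta> * U z))" for z
  have wc: "cper w" "cper v" unfolding w_def v_def by (intro cper_cmult cper_mult \<rho> expc)+
  have w1: "avg w = 1" "avg v = 1"
    using kw0 kv0 by (simp_all add: w_def[abs_def] v_def[abs_def] avg_divide \<kappa>_def \<kappa>'_def)
  have wpos: "w z > 0" "v z \<ge> 0" for z using \<kappa> pos[of z] by (simp_all add: w_def v_def)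
  define wt where "wt z = - \<beta> * Ut z * w z" for z
  define D where "D b z = - \<beta> * UD b z * w z" for b z
  define H where "H b z = (- \<beta> * UH b z + \<beta> * \<beta> * UD b z * UD b z) * w z" for b z
  have wd: "has_pd w e (\<lambda>z. - \<beta> * X z * w z)" if "has_pd U e X" for e X
    using has_pd_cmult[OF expd[OF that, of "- \<beta>"], of \<kappa>] by (simp add: w_def[abs_def] mult_ac)
  have Hd: "has_pd (D b) (0, b) (H b)" if b: "b \<in> Basis" for b
  proof -
    have "has_pd (\<lambda>z. - \<beta> * (UD b z * w z)) (0, b) (\<lambda>z. - \<beta> * (UH b z * w z + UD b z * (- \<beta> * UD b z * w z)))"
      by (intro has_pd_cmult has_pd_mult UH wd UD b)
    then show ?thesis by (simp add: D_def[abs_def] H_def[abs_def] algebra_simps)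
  qed
  have Cw: "C12 w wt D H"
    unfolding C12_def
  proof (intro conjI ballI wc)
    show "has_pd w (1, 0) wt" unfolding wt_def[abs_def] by (rule wd[OF U(3)])
    show "cper wt" unfolding wt_def by (intro cper_mult cper_const U wc)
    fix b :: 'x assume b: "b \<in> Basis"
    show "has_pd w (0, b) (D b)" unfolding D_def[abs_def] by (rule wd[OF UD(1)[OF b]])
    show "cper (D b)" unfolding D_def by (intro cper_mult cper_const UD b wc)
    show "has_pd (D b) (0, b) (H b)" by (rule Hd[OF b])
    show "cper (H b)" unfolding H_def by (intro cper_mult cper_add cper_const UD UH b wc)
  qed
  define SU where "SU z = (\<Sum>b\<in>Basis. UH b z)" for z
  define S2 where "S2 z = (\<Sum>b\<in>Basis. UD b z * UD b z)" for z
  define Sc where "Sc z = (\<Sum>b\<in>Basis. (c \<bullet> b) * UD b z)" for z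
  define cc where "cc = (\<Sum>b\<in>Basis. (c \<bullet> b) * (c \<bullet> b))"
  have sq: "(\<Sum>b\<in>Basis. (c \<bullet> b - UD b z) * (c \<bullet> b - UD b z)) = cc - 2 * Sc z + S2 z" for z
    by (simp add: cc_def Sc_def S2_def algebra_simps sum.distrib sum_subtractf sum_distrib_left)
  have e1: "a * SU z + Ut z = 1/2 * cc - Sc z + 1/2 * S2 z + (V z + Wc \<rho> z) - h" for z
    using eq1[of z] unfolding sq SU_def[symmetric] by (simp add: algebra_simps)
  have qz: "q z - l = \<beta> * (V z + Wc \<rho> z) - \<beta> * h + \<beta> * (1/2 * cc)" for z
    unfolding q_def Qf_def l_def cc_def by (simp add: algebra_simps)
  have LLw: "LL wt D H z = - (q z - l) * w z" for z
  proof -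
    \<comment> \<open>The second derivative of the exponential contributes a multiple of
      \<open>S2\<close>, and \<open>a * \<beta> = 1 / 2\<close> makes it cancel the quadratic term
      of the Hamiltonian.\<close>
    have "LL wt D H z = (- \<beta> * (Ut z + a * SU z - (a * \<beta>) * S2 z + Sc z)) * w z"
      unfolding LL_def wt_def D_def H_def SU_def S2_def Sc_def
      by (simp add: algebra_simps sum.distrib sum_subtractf sum_distrib_left sum_distrib_right sum_negf)
    also have "Ut z + a * SU z - (a * \<beta>) * S2 z + Sc z = 1/2 * cc + (V z + Wc \<rho> z) - h"
      using e1[of z] unfolding a\<beta> by linarith
    also have "- \<beta> * (1/2 * cc + (V z + Wc \<rho> z) - h) = - (q z - l)"
      unfolding qz by (simp add: algebra_simps)
    finally show ?thesis .
  qed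
  have fw: "w = T q w" by (rule T_fixpointI[OF Cw LLw qc w1(1)])
  define vt where "vt z = \<kappa>' * (\<rho>t z * exp (\<beta> * U z) + \<rho> z * (\<beta> * exp (\<beta> * U z) * Ut z))" for z
  define E where "E b z = \<kappa>' * (\<rho>D b z * exp (\<beta> * U z) + \<rho> z * (\<beta> * exp (\<beta> * U z) * UD b z))" for b z
  define J where "J b z = \<kappa>' * ((\<rho>H b z * exp (\<beta> * U z) + \<rho>D b z * (\<beta> * exp (\<beta> * U z) * UD b z))
      + (\<rho>D b z * (\<beta> * exp (\<beta> * U z) * UD b z) + \<rho> z * (\<beta> * (\<beta> * exp (\<beta> * U z) * UD b z) * UD b z + \<beta> * exp (\<beta> * U z) * UH b z)))" for b z
  have vtd: "has_pd v (1, 0) vt" unfolding v_def[abs_def] vt_def[abs_def]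
    by (intro has_pd_cmult has_pd_mult \<rho> expd U)
  have Ed: "has_pd v (0, b) (E b)" if b: "b \<in> Basis" for b
    unfolding v_def[abs_def] E_def[abs_def] by (intro has_pd_cmult has_pd_mult \<rho>D expd UD b)
  have Jd: "has_pd (E b) (0, b) (J b)" if b: "b \<in> Basis" for b
    unfolding J_def[abs_def] E_def[abs_def]
    by (intro has_pd_cmult has_pd_mult has_pd_add \<rho>D \<rho>H expd UD UH b)
  have vtc: "cper vt" unfolding vt_def by (intro cper_mult cper_add cper_const \<rho> U expc)
  have Ec: "cper (E b)" if b: "b \<in> Basis" for b unfolding E_def by (intro cper_mult cper_add cper_const \<rho> \<rho>D UD b expc)
  have Jc: "cper (J b)" if b: "b \<in> Basis" for b unfolding J_def by (intro cper_mult cper_add cper_const \<rho> \<rho>D \<rho>H UD UH b expc)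
  have Cv: "C12 (\<lambda>z. v (- z)) (\<lambda>z. - vt (- z)) (\<lambda>b z. - E b (- z)) (\<lambda>b z. J b (- z))"
    unfolding C12_def
  proof (intro conjI ballI)
    show "cper (\<lambda>z. v (- z))" by (intro cper_reflect wc)
    show "cper (\<lambda>z. - vt (- z))" by (intro cper_uminus cper_reflect vtc)
    show "has_pd (\<lambda>z. v (- z)) (1, 0) (\<lambda>z. - vt (- z))" by (rule has_pd_reflect[OF vtd])
    fix b :: 'x assume b: "b \<in> Basis"
    show "has_pd (\<lambda>z. v (- z)) (0, b) (\<lambda>z. - E b (- z))" by (rule has_pd_reflect[OF Ed[OF b]])
    show "cper (\<lambda>z. - E b (- z))" by (intro cper_uminus cper_reflect Ec b)
    show "has_pd (\<lambda>z. - E b (- z)) (0, b) (\<lambda>z. J b (- z))"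
      using has_pd_cmult[OF has_pd_reflect[OF Jd[OF b]], of "-1"] by simp
    show "cper (\<lambda>z. J b (- z))" by (intro cper_reflect Jc b)
  qed
  define S\<rho>H where "S\<rho>H z = (\<Sum>b\<in>Basis. \<rho>H b z)" for z
  define S\<rho>U where "S\<rho>U z = (\<Sum>b\<in>Basis. \<rho>D b z * UD b z)" for z
  define S\<rho>c where "S\<rho>c z = (\<Sum>b\<in>Basis. (c \<bullet> b) * \<rho>D b z)" for z
  have e2: "\<rho>t z = a * S\<rho>H z - S\<rho>c z + S\<rho>U z + \<rho> z * SU z" for z
    using eq2[of z] unfolding S\<rho>H_def S\<rho>U_def S\<rho>c_def SU_def
    by (simp add: algebra_simps sum.distrib sum_subtractf sum_distrib_left)
  have LLv: "LL (\<lambda>z. - vt (- z)) (\<lambda>b z. - E b (- z)) (\<lambda>b z. J b (- z)) z = - (q (- z) - l) * v (- z)" for z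
  proof -
    have "- vt y + a * (\<Sum>b\<in>Basis. J b y) - (\<Sum>b\<in>Basis. (c \<bullet> b) * E b y) = - (q y - l) * v y" for y
    proof -
      let ?e = "exp (\<beta> * U y)"
      have J: "(\<Sum>b\<in>Basis. J b y) = \<kappa>' * ?e * (S\<rho>H y + 2 * \<beta> * S\<rho>U y + \<rho> y * (\<beta> * \<beta> * S2 y + \<beta> * SU y))"
        unfolding J_def S\<rho>H_def S\<rho>U_def S2_def SU_def
        by (simp add: algebra_simps sum.distrib sum_distrib_left sum_distrib_right)
      have E: "(\<Sum>b\<in>Basis. (c \<bullet> b) * E b y) = \<kappa>' * ?e * (S\<rho>c y + \<rho> y * \<beta> * Sc y)"
        unfolding E_def S\<rho>c_def Sc_def
        by (simp add: algebra_simps sum.distrib sum_distrib_left sum_distrib_right)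
      have "- vt y + a * (\<Sum>b\<in>Basis. J b y) - (\<Sum>b\<in>Basis. (c \<bullet> b) * E b y)
        = \<kappa>' * ?e * (- \<rho>t y - \<rho> y * \<beta> * Ut y + a * S\<rho>H y + 2 * (a * \<beta>) * S\<rho>U y + \<rho> y * ((a * \<beta>) * \<beta> * S2 y + (a * \<beta>) * SU y) - S\<rho>c y - \<rho> y * \<beta> * Sc y)"
        unfolding J E vt_def by (simp add: algebra_simps)
      \<comment> \<open>The density equation eliminates \<open>\<rho>t\<close> together with all
        derivatives of \<open>\<rho>\<close>. What is left is \<open>\<rho>\<close> times an
        expression to which the equation for \<open>U\<close> applies.\<close>
      also have "- \<rho>t y - \<rho> y * \<beta> * Ut y + a * S\<rho>H y + 2 * (a * \<beta>) * S\<rho>U y + \<rho> y * ((a * \<beta>) * \<beta> * S2 y + (a * \<beta>) * SU y) - S\<rho>c y - \<rho> y * \<beta> * Sc y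
        = \<rho> y * (- \<beta> * (Ut y - 1/2 * S2 y + Sc y) - 1/2 * SU y)"
        unfolding a\<beta> e2 by (simp add: algebra_simps)
      also have "- \<beta> * (Ut y - 1/2 * S2 y + Sc y) - 1/2 * SU y = - (q y - l)"
      proof -
        have u: "Ut y = 1/2 * cc - Sc y + 1/2 * S2 y + (V y + Wc \<rho> y) - h - a * SU y" using e1[of y] by linarith
        have "- \<beta> * (Ut y - 1/2 * S2 y + Sc y) - 1/2 * SU y = - \<beta> * (1/2 * cc + (V y + Wc \<rho> y) - h) + (a * \<beta>) * SU y - 1/2 * SU y"
          unfolding u by (simp add: algebra_simps)
        also have "\<dots> = - (q y - l)" unfolding a\<beta> qz by (simp add: algebra_simps)
        finally show ?thesis .
      qed
      finally show ?thesis by (simp add: v_def algebra_simps)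
    qed
    from this[of "- z"] show ?thesis
      unfolding LL_def by (simp add: sum_negf)
  qed
  have fv: "(\<lambda>z. v (- z)) = T (\<lambda>z. q (- z)) (\<lambda>z. v (- z))"
    by (rule T_fixpointI[OF Cv LLv cper_reflect[OF qc]]) (simp add: avg_reflect wc w1)
  have bnd': "\<And>q w z. cper q \<Longrightarrow> (\<And>z. \<bar>q z\<bar> \<le> BQ) \<Longrightarrow> cper w \<Longrightarrow> (\<And>z. 0 \<le> w z) \<Longrightarrow> avg w = 1 \<Longrightarrow> w = T q w \<Longrightarrow> \<delta> \<le> w z \<and> w z \<le> M"
    using bnd unfolding fixpoint_bound_def by blast
  have wb: "\<delta> \<le> w z \<and> w z \<le> M" for z
    by (rule bnd'[OF qc qb wc(1) _ w1(1) fw]) (use wpos in \<open>auto intro: less_imp_le\<close>)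
  have "\<delta> \<le> v (- z) \<and> v (- z) \<le> M" for z
    by (rule bnd'[OF cper_reflect[OF qc] qb cper_reflect[OF wc(2)] _ _ fv]) (use wpos w1 wc in \<open>auto simp: avg_reflect\<close>)
  from this[of "- _"] have vb: "\<delta> \<le> v z \<and> v z \<le> M" for z by simp
  define s where "s = Bcontfun (\<lambda>z. (w z, v z))"
  have "(\<lambda>z. (w z, v z)) \<in> bcontfun"
  proof (rule bcontfun_normI)
    show "continuous_on UNIV (\<lambda>z. (w z, v z))" by (intro continuous_intros cperD(1) wc)
    show "norm (w x, v x) \<le> M + M" for x
      using order_trans[OF norm_Pair_le, of "w x" "v x" "M + M"] wb[of x] vb[of x] \<delta> by simp
  qed
  then have sw: "ws s = w" "vs s = v"
    by (auto simp: s_def ws_def vs_def Bcontfun_inverse fun_eq_iff)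
  have K: "s \<in> KK \<delta> M" unfolding KK_def using wc w1 wb vb by (simp add: sw)
  have wv: "w z * v z = \<kappa> * \<kappa>' * \<rho> z" for z
    by (simp add: w_def v_def exp_minus field_simps)
  have "Nf w v t = \<kappa> * \<kappa>'" for t
    unfolding Nf_def wv by (simp add: avg_cmult mass)
  then have rho: "rho w v = \<rho>"
    using \<kappa> by (simp add: rho_def[abs_def] wv)
  have Qq: "Q w v = q" unfolding Q_def q_def rho ..
  have "Phi s = s"
  proof (rule bcontfun_eqI)
    fix z
    have "ws (Phi s) z = ws s z" "vs (Phi s) z = vs s z"
      unfolding Phi_apply[OF K \<delta>] sw Phi1_def Phi2_def Qq
      using fw fun_cong[OF fv, of "- z"] by simp_all
    then show "apply_bcontfun (Phi s) z = apply_bcontfun s z"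
      by (simp add: ws_def vs_def prod_eq_iff)
  qed
  then have "s \<in> Sol \<delta> M" using K by (simp add: Sol_def)
  moreover have "- (1 / \<beta>) * (gw b w v z / w z) = UD b z" if b: "b \<in> Basis" for b z
  proof -
    have "has_pd w (0, b) (gw b w v)"
      unfolding gw_def Qq using R_pd_kernel[OF b hh_cper[OF qc wc(1)]] fw by (simp add: T_def)
    moreover have "has_pd w (0, b) (D b)" unfolding D_def[abs_def] by (rule wd[OF UD(1)[OF b]])
    ultimately have "gw b w v = D b" by (rule has_pd_unique)
    then show ?thesis using \<beta>_pos wpos(1)[of z] by (simp add: D_def)
  qed
  ultimately show thesis using that rho sw by simp
qed

end

text \<open>One coordinate of the density equation for \<open>w v / N\<close>. The terms in
  \<open>D * D\<close> cancel, those in \<open>D * E\<close> cancel because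
  \<open>2 * a = 1 / \<beta>\<close>, and those in \<open>H * v\<close> combine to
  \<open>- a * H * v\<close>.\<close>

lemma hopf_cole_term:
  fixes a \<beta> w v N H D E J cb :: real
  assumes "w \<noteq> 0" "N \<noteq> 0" "\<beta> \<noteq> 0" and a: "a = 1 / (2 * \<beta>)"
  shows "a * (1 / N * ((H * v + D * E) + (D * E + w * J)))
      - ((1 / N * (D * v + w * E)) * (cb - - (1 / \<beta>) * (D / w)) - (1 / N * (w * v)) * (- (1 / \<beta>) * (H / w - D * D / (w * w))))
    = 1 / N * (- a * H * v + a * w * J - cb * (D * v + w * E))"
  unfolding a using assms(1-3) by (simp add: field_simps)

section \<open>Existence and minimality\<close>

lemma grad_inner: "grad f x \<bullet> axis i 1 = pd i f x"
  by (simp add: inner_axis grad_def)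

text \<open>Joins the problem on space-time with the curried functions and the smoothness classes
  used to state the equations.\<close>

locale torus_mfg = mfg a \<mu> c \<beta> bV bW "\<lambda>(t, x). V0 t x" W
  for a \<mu> :: real and c :: "real^'n" and \<beta> bV bW :: real and V0 :: "real \<Rightarrow> real^'n \<Rightarrow> real" and W +
  assumes V0: "V0 \<in> C0_time_Ck 3" and W3: "W \<in> Ck_torus 3"
begin

lemma potential_eq: "potential V0 W \<rho> t x = V0 t x + Wc (\<lambda>(t, x). \<rho> t x) (t, x)"
  by (simp add: potential_def Wc_def avg_def torus_cell_def)

lemma potential_half_eq: "potential V0 W (\<lambda>s y. 1/2 * \<rho> s y) t x = V0 t x + 1/2 * Wc (\<lambda>(t, x). \<rho> t x) (t, x)"
proof -
  have "avg (\<lambda>y. W (x - y) * (1/2 * \<rho> t y)) = avg (\<lambda>y. 1/2 * (W (x - y) * \<rho> t y))"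
    by (simp add: mult_ac)
  then show ?thesis
    by (simp only: potential_eq Wc_def fst_conv snd_conv prod.case avg_cmult)
qed

section \<open>The equations and the action in terms of directional derivatives\<close>

context
  fixes U Ut \<rho> \<rho>t :: "real \<times> (real^'n) \<Rightarrow> real" and UD UH \<rho>D \<rho>H :: "real^'n \<Rightarrow> real \<times> (real^'n) \<Rightarrow> real"
  assumes Ut: "has_pd U (1, 0) Ut"
    and UD: "\<And>b. b \<in> Basis \<Longrightarrow> has_pd U (0, b) (UD b)"
    and UH: "\<And>b. b \<in> Basis \<Longrightarrow> has_pd (UD b) (0, b) (UH b)"
begin

lemma grad_eq: "grad (\<lambda>x. U (t, x)) x \<bullet> b = UD b (t, x)" if b: "b \<in> Basis"
proof -
  obtain i where i: "b = axis i 1" using b by (auto simp: Basis_vec_range)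
  have "pd i (\<lambda>x. U (t, x)) = (\<lambda>x. UD (axis i 1) (t, x))"
    by (rule CT_pd_slice[OF UD]) simp
  then show ?thesis unfolding i grad_inner by simp
qed

lemma laplacian_eq: "laplacian (\<lambda>x. U (t, x)) x = (\<Sum>b\<in>Basis. UH b (t, x))"
proof -
  have "pd i (pd i (\<lambda>x. U (t, x))) = (\<lambda>x. UH (axis i 1) (t, x))" for i
    using CT_pd_slice[OF UD[OF axis_Basis]] CT_pd_slice[OF UH[OF axis_Basis]] by metis
  then show ?thesis by (simp add: laplacian_def sum_Basis_vec)
qed

lemma dt_eq: "dt (\<lambda>t x. U (t, x)) t x = Ut (t, x)"
  unfolding dt_def by (rule DERIV_imp_deriv) (rule has_pd_time[OF Ut])

lemma HJ_eq:
  "1 / (2 * \<beta>) * laplacian (\<lambda>x. U (t, x)) x + dt (\<lambda>t x. U (t, x)) t x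
     - hamiltonian V0 W (\<lambda>t x. \<rho> (t, x)) t x (c - grad (\<lambda>x. U (t, x)) x) + h
   = a * (\<Sum>b\<in>Basis. UH b (t, x)) + Ut (t, x)
     - (1/2 * (\<Sum>b\<in>Basis. (c \<bullet> b - UD b (t, x)) * (c \<bullet> b - UD b (t, x))) + ((case (t, x) of (t, x) \<Rightarrow> V0 t x) + Wc \<rho> (t, x))) + h"
proof -
  have "(norm (c - grad (\<lambda>x. U (t, x)) x))\<^sup>2 = (\<Sum>b\<in>Basis. (c \<bullet> b - UD b (t, x)) * (c \<bullet> b - UD b (t, x)))"
    unfolding power2_norm_eq_inner by (subst euclidean_inner) (simp add: inner_diff_left grad_eq)
  then show ?thesis
    unfolding hamiltonian_def laplacian_eq dt_eq by (simp add: potential_eq a_eq)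
qed

lemma FP_eq:
  assumes \<rho>t: "has_pd \<rho> (1, 0) \<rho>t"
    and \<rho>D: "\<And>b. b \<in> Basis \<Longrightarrow> has_pd \<rho> (0, b) (\<rho>D b)"
    and \<rho>H: "\<And>b. b \<in> Basis \<Longrightarrow> has_pd (\<rho>D b) (0, b) (\<rho>H b)"
  shows "1 / (2 * \<beta>) * laplacian (\<lambda>x. \<rho> (t, x)) x
     - divg (\<lambda>y. \<rho> (t, y) *\<^sub>R (c - grad (\<lambda>x. U (t, x)) y)) x - dt (\<lambda>t x. \<rho> (t, x)) t x
   = a * (\<Sum>b\<in>Basis. \<rho>H b (t, x)) - (\<Sum>b\<in>Basis. \<rho>D b (t, x) * (c \<bullet> b - UD b (t, x)) - \<rho> (t, x) * UH b (t, x)) - \<rho>t (t, x)"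
proof -
  have "pd i (pd i (\<lambda>x. \<rho> (t, x))) = (\<lambda>x. \<rho>H (axis i 1) (t, x))" for i
    using CT_pd_slice[OF \<rho>D[OF axis_Basis]] CT_pd_slice[OF \<rho>H[OF axis_Basis]] by metis
  then have 1: "laplacian (\<lambda>x. \<rho> (t, x)) x = (\<Sum>b\<in>Basis. \<rho>H b (t, x))"
    by (simp add: laplacian_def sum_Basis_vec)
  have 2: "dt (\<lambda>t x. \<rho> (t, x)) t x = \<rho>t (t, x)"
    unfolding dt_def by (rule DERIV_imp_deriv) (rule has_pd_time[OF \<rho>t])
  have "pd i (\<lambda>y. (\<rho> (t, y) *\<^sub>R (c - grad (\<lambda>x. U (t, x)) y)) $ i) x
      = \<rho>D (axis i 1) (t, x) * (c \<bullet> axis i 1 - UD (axis i 1) (t, x)) - \<rho> (t, x) * UH (axis i 1) (t, x)" for i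
  proof -
    let ?b = "axis i 1 :: real^'n"
    have "(\<lambda>y. (\<rho> (t, y) *\<^sub>R (c - grad (\<lambda>x. U (t, x)) y)) $ i) = (\<lambda>y. \<rho> (t, y) * (c \<bullet> ?b - UD ?b (t, y)))"
      using grad_eq[OF axis_Basis, of t _ i] by (simp add: inner_axis fun_eq_iff)
    moreover have "has_pd (\<lambda>z. \<rho> z * (c \<bullet> ?b - UD ?b z)) (0, ?b) (\<lambda>z. \<rho>D ?b z * (c \<bullet> ?b - UD ?b z) + \<rho> z * (0 - UH ?b z))"
      by (intro has_pd_mult has_pd_diff has_pd_const \<rho>D UH axis_Basis)
    from CT_pd_slice[OF this, of t] have "pd i (\<lambda>y. \<rho> (t, y) * (c \<bullet> ?b - UD ?b (t, y))) = (\<lambda>x. \<rho>D ?b (t, x) * (c \<bullet> ?b - UD ?b (t, x)) + \<rho> (t, x) * (0 - UH ?b (t, x)))" .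
    ultimately show ?thesis by simp
  qed
  then have 3: "divg (\<lambda>y. \<rho> (t, y) *\<^sub>R (c - grad (\<lambda>x. U (t, x)) y)) x
      = (\<Sum>b\<in>Basis. \<rho>D b (t, x) * (c \<bullet> b - UD b (t, x)) - \<rho> (t, x) * UH b (t, x))"
    by (simp add: divg_def sum_Basis_vec)
  show ?thesis unfolding 1 2 3 by (simp add: a_eq)
qed

lemma action_eq:
  assumes "\<And>b z. b \<in> Basis \<Longrightarrow> UD b z = - (1 / \<beta>) * (gw b w v z / w z)"
  shows "action V0 W c (\<lambda>t x. rho w v (t, x)) (\<lambda>t x. U (t, x)) = avg (act_int w v)"
proof -
  have cell: "time_torus_cell = (cell :: (real \<times> (real^'n)) set)"
  proof -
    \<comment> \<open>The cell of the product space is the time interval times the space cell, so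
      both integrals are over the same set.\<close>
    have "(One :: real \<times> (real^'n)) = (1, One)"
      unfolding sum_Basis_prod by (simp add: prod_eq_iff fst_sum snd_sum)
    then show ?thesis
      by (simp add: time_torus_cell_def torus_cell_def cbox_Pair_eq zero_prod_def)
  qed
  have "(case z of (t, x) \<Rightarrow> lagrangian V0 W c (\<lambda>s y. 1/2 * rho w v (s, y)) t x (grad (\<lambda>x. U (t, x)) x) * rho w v (t, x)) = act_int w v z" for z
  proof -
    obtain t x where z: "z = (t, x)" by (cases z)
    have n: "(norm (grad (\<lambda>x. U (t, x)) x))\<^sup>2 = (\<Sum>b\<in>Basis. UD b (t, x) * UD b (t, x))"
      unfolding power2_norm_eq_inner by (subst euclidean_inner) (simp add: grad_eq)
    have i: "c \<bullet> grad (\<lambda>x. U (t, x)) x = (\<Sum>b\<in>Basis. (c \<bullet> b) * UD b (t, x))"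
      by (subst euclidean_inner) (simp add: grad_eq)
    show ?thesis
      unfolding z prod.case lagrangian_def n i potential_half_eq act_int_def
      by (simp add: assms)
  qed
  then show ?thesis
    unfolding action_def cell avg_def by (intro arg_cong[where f = "integral cell"] ext)
qed

end

text \<open>Positivity of \<open>w\<close> makes \<open>u = - ln w / \<beta>\<close> as smooth as
  \<open>w\<close>. Its spatial derivatives are those inside \<open>act_int\<close>, because at a
  fixed point \<open>gw\<close> is the derivative of \<open>w\<close>.\<close>

lemma Sol_solution:
  assumes s: "s \<in> Sol \<delta> M" and \<delta>: "\<delta> > 0"
  obtains \<rho> u h where "mfg_solution V0 W c \<beta> \<rho> u h" "action V0 W c \<rho> u = avg (act_int (ws s) (vs s))"
proof -
  let ?w = "ws s" and ?v = "vs s"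
  let ?q = "Q ?w ?v" and ?\<rho> = "rho ?w ?v"
  have V3: "CT 3 (\<lambda>(t, x). V0 t x)" by (rule C0_time_imp_CT[OF V0])
  have CW: "CS 3 W" using W3 by (simp add: Ck_torus_iff)
  have K: "s \<in> KK \<delta> M" using s by (auto simp: Sol_def)
  note S = KKD[OF K]
  have wpos: "?w z > 0" for z using S(5)[of z] \<delta> by linarith
  obtain l N wt vt D E H J where
    w3: "CT 3 ?w" "CT 3 ?v" and wt: "has_pd ?w (1, 0) wt" "has_pd ?v (1, 0) vt" "CT 1 wt" "CT 1 vt"
    and DH: "\<And>b. b \<in> Basis \<Longrightarrow> has_pd ?w (0, b) (D b) \<and> has_pd (D b) (0, b) (H b)"
    and EJ: "\<And>b. b \<in> Basis \<Longrightarrow> has_pd ?v (0, b) (E b) \<and> has_pd (E b) (0, b) (J b)"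
    and weq: "\<And>z. wt z = - (?q z - l) * ?w z - a * (\<Sum>b\<in>Basis. H b z) - (\<Sum>b\<in>Basis. (c \<bullet> b) * D b z)"
    and veq: "\<And>z. vt z = (?q z - l) * ?v z + a * (\<Sum>b\<in>Basis. J b z) - (\<Sum>b\<in>Basis. (c \<bullet> b) * E b z)"
    and N: "N > 0" and rho: "\<And>z. ?\<rho> z = 1 / N * (?w z * ?v z)"
    by (rule Sol_structure[OF s \<delta> V3 CW]) blast
  define U where "U z = - (1 / \<beta>) * ln (?w z)" for z
  define Ut where "Ut z = - (1 / \<beta>) * (wt z / ?w z)" for z
  define UD where "UD b z = - (1 / \<beta>) * (D b z / ?w z)" for b z
  define UH where "UH b z = - (1 / \<beta>) * (H b z / ?w z - D b z * D b z / (?w z * ?w z))" for b z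
  have wnz: "?w z \<noteq> 0" for z using wpos[of z] by simp
  have Ud: "has_pd U e (\<lambda>z. - (1 / \<beta>) * (X z / ?w z))" if "has_pd ?w e X" for e X
  proof -
    have "has_pd (\<lambda>z. ln (?w z)) e (\<lambda>z. 1 / ?w z * X z)"
      by (rule has_pd_chain[OF that]) (use wpos in \<open>auto intro!: derivative_eq_intros\<close>)
    from has_pd_cmult[OF this, of "- (1 / \<beta>)"] show ?thesis by (simp add: U_def[abs_def])
  qed
  have Utd: "has_pd U (1, 0) Ut" unfolding Ut_def[abs_def] by (rule Ud[OF wt(1)])
  have UDd: "has_pd U (0, b) (UD b)" if "b \<in> Basis" for b
    unfolding UD_def[abs_def] by (rule Ud) (use DH that in blast)
  have UHd: "has_pd (UD b) (0, b) (UH b)" if b: "b \<in> Basis" for b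
  proof -
    have inv: "has_pd (\<lambda>z. 1 / ?w z) (0, b) (\<lambda>z. - (1 / ?w z * (1 / ?w z)) * D b z)"
    proof (rule has_pd_chain[where \<phi> = "\<lambda>x. 1 / x" and \<phi>' = "\<lambda>x. - (1 / x * (1 / x))"])
      show "has_pd ?w (0, b) (D b)" using DH b by blast
      show "((\<lambda>x. 1 / x) has_real_derivative - (1 / ?w z * (1 / ?w z))) (at (?w z))" for z
        using wnz[of z] by (auto intro!: derivative_eq_intros simp: field_simps)
    qed
    have "has_pd (\<lambda>z. - (1 / \<beta>) * (D b z * (1 / ?w z))) (0, b)
        (\<lambda>z. - (1 / \<beta>) * (H b z * (1 / ?w z) + D b z * (- (1 / ?w z * (1 / ?w z)) * D b z)))"
      using DH b by (intro has_pd_cmult has_pd_mult inv) blast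
    then show ?thesis by (simp add: UD_def[abs_def] UH_def[abs_def])
  qed
  define \<rho>t where "\<rho>t z = 1 / N * (wt z * ?v z + ?w z * vt z)" for z
  define \<rho>D where "\<rho>D b z = 1 / N * (D b z * ?v z + ?w z * E b z)" for b z
  define \<rho>H where "\<rho>H b z = 1 / N * ((H b z * ?v z + D b z * E b z) + (D b z * E b z + ?w z * J b z))" for b z
  have rho': "?\<rho> = (\<lambda>z. 1 / N * (?w z * ?v z))" using rho by (simp add: fun_eq_iff)
  have \<rho>td: "has_pd ?\<rho> (1, 0) \<rho>t" unfolding rho' \<rho>t_def[abs_def]
    by (intro has_pd_cmult has_pd_mult wt)
  have \<rho>Dd: "has_pd ?\<rho> (0, b) (\<rho>D b)" if "b \<in> Basis" for b
    unfolding rho' \<rho>D_def[abs_def] using DH EJ that by (intro has_pd_cmult has_pd_mult) blast+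
  have \<rho>Hd: "has_pd (\<rho>D b) (0, b) (\<rho>H b)" if "b \<in> Basis" for b
    unfolding \<rho>D_def[abs_def] \<rho>H_def[abs_def] using DH EJ that by (intro has_pd_cmult has_pd_add has_pd_mult) blast+
  have \<rho>3: "CT 3 ?\<rho>" unfolding rho' by (intro CT_cmult CT_mult w3)
  have \<rho>tc: "CT 1 \<rho>t" unfolding \<rho>t_def by (intro CT_cmult CT_add CT_mult wt CT_le[OF _ w3(1)] CT_le[OF _ w3(2)]) auto
  have U3: "CT 3 U" unfolding U_def by (intro CT_cmult CT_ln w3 wpos)
  have Utc: "CT 1 Ut"
  proof -
    have "CT 1 (\<lambda>z. - (1 / \<beta>) * (wt z * (1 / ?w z)))"
      by (intro CT_cmult CT_mult CT_inverse wt wnz CT_le[OF _ w3(1)]) simp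
    then show ?thesis by (simp add: Ut_def[abs_def])
  qed
  \<comment> \<open>Read off the constant terms of the first equation: the eigenvalue over
    \<open>\<beta>\<close>, and half of the square of \<open>c\<close> from the Hamiltonian at
    \<open>c - grad u\<close>.\<close>
  define h where "h = l / \<beta> + 1/2 * (\<Sum>b\<in>Basis. (c \<bullet> b) * (c \<bullet> b))"
  have \<beta>nz: "\<beta> \<noteq> 0" using \<beta>_pos by simp
  have Q_eq: "?q z = \<beta> * ((case z of (t, x) \<Rightarrow> V0 t x) + Wc ?\<rho> z)" for z
    by (simp add: Q_def Qf_def)
  have eq1: "a * (\<Sum>b\<in>Basis. UH b z) + Ut z
     - (1/2 * (\<Sum>b\<in>Basis. (c \<bullet> b - UD b z) * (c \<bullet> b - UD b z)) + ((case z of (t, x) \<Rightarrow> V0 t x) + Wc ?\<rho> z)) + h = 0" for z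
  proof -
    define SH where "SH = (\<Sum>b\<in>Basis. H b z)"
    define S2 where "S2 = (\<Sum>b\<in>Basis. D b z * D b z)"
    define Sc where "Sc = (\<Sum>b\<in>Basis. (c \<bullet> b) * D b z)"
    define cc where "cc = (\<Sum>b\<in>Basis. (c \<bullet> b) * (c \<bullet> b))"
    define P where "P = (case z of (t, x) \<Rightarrow> V0 t x) + Wc ?\<rho> z"
    define \<omega> where "\<omega> = ?w z"
    have \<omega>: "\<omega> \<noteq> 0" using wnz by (simp add: \<omega>_def)
    have 1: "(\<Sum>b\<in>Basis. UH b z) = - (1 / \<beta>) * (SH / \<omega> - S2 / (\<omega> * \<omega>))"
      unfolding UH_def SH_def S2_def \<omega>_def by (simp add: sum_subtractf sum_distrib_left sum_divide_distrib right_diff_distrib sum_negf)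
    have 2: "(\<Sum>b\<in>Basis. (c \<bullet> b - UD b z) * (c \<bullet> b - UD b z)) = cc + 2 * (1 / \<beta>) * (Sc / \<omega>) + (1 / \<beta>) * (1 / \<beta>) * (S2 / (\<omega> * \<omega>))"
      unfolding UD_def cc_def Sc_def S2_def \<omega>_def
      by (simp add: algebra_simps sum.distrib sum_distrib_left sum_divide_distrib)
    have 3: "Ut z = - (1 / \<beta>) * ((- (\<beta> * P - l) * \<omega> - a * SH - Sc) / \<omega>)"
      unfolding Ut_def weq Q_eq P_def SH_def Sc_def \<omega>_def ..
    show ?thesis
      unfolding 1 2 3 h_def cc_def[symmetric] P_def[symmetric] a_eq
      using \<omega> \<beta>nz by (simp add: field_simps)
  qed
  have eq2: "a * (\<Sum>b\<in>Basis. \<rho>H b z) - (\<Sum>b\<in>Basis. \<rho>D b z * (c \<bullet> b - UD b z) - ?\<rho> z * UH b z) - \<rho>t z = 0" for z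
  proof -
    have "a * (\<Sum>b\<in>Basis. \<rho>H b z) - (\<Sum>b\<in>Basis. \<rho>D b z * (c \<bullet> b - UD b z) - ?\<rho> z * UH b z)
       = (\<Sum>b\<in>Basis. a * \<rho>H b z - (\<rho>D b z * (c \<bullet> b - UD b z) - ?\<rho> z * UH b z))"
      by (simp add: sum_subtractf sum_distrib_left)
    also have "\<dots> = (\<Sum>b\<in>Basis. 1 / N * (- a * H b z * ?v z + a * ?w z * J b z - (c \<bullet> b) * (D b z * ?v z + ?w z * E b z)))"
    proof (rule sum.cong[OF refl])
      fix b :: "real^'n"
      show "a * \<rho>H b z - (\<rho>D b z * (c \<bullet> b - UD b z) - ?\<rho> z * UH b z)
          = 1 / N * (- a * H b z * ?v z + a * ?w z * J b z - (c \<bullet> b) * (D b z * ?v z + ?w z * E b z))"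
        unfolding \<rho>H_def \<rho>D_def UD_def UH_def rho
        by (rule hopf_cole_term) (use wnz N \<beta>nz a_eq in auto)
    qed
    also have "\<dots> = 1 / N * (wt z * ?v z + ?w z * vt z)"
      unfolding weq veq
      by (simp add: algebra_simps sum.distrib sum_subtractf sum_distrib_left sum_divide_distrib sum_negf)
    finally show ?thesis by (simp add: \<rho>t_def)
  qed
  have "mfg_solution V0 W c \<beta> (\<lambda>t x. ?\<rho> (t, x)) (\<lambda>t x. U (t, x)) h"
    unfolding mfg_solution_def
  proof (intro conjI IntI allI)
    show "(\<lambda>t x. ?\<rho> (t, x)) \<in> C1_time_torus"
      by (rule C1_time_torusI[OF _ CT_cper[OF \<rho>tc] \<rho>td]) (rule CT_le[OF _ \<rho>3], simp)
    show "(\<lambda>t x. ?\<rho> (t, x)) \<in> C0_time_Ck 2"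
      by (rule CT_imp_C0_time) (rule CT_le[OF _ \<rho>3], simp)
    show "(\<lambda>t x. U (t, x)) \<in> C1_time_Ck 1"
      by (rule C1_timeI[OF _ Utc Utd]) (rule CT_le[OF _ U3], simp)
    show "(\<lambda>t x. U (t, x)) \<in> C0_time_Ck 3"
      by (rule CT_imp_C0_time[OF U3])
    show "0 \<le> ?\<rho> (t, x)" for t x
      by (rule less_imp_le, rule rho_pos[where \<delta> = \<delta> and M = M]) (use S \<delta> in auto)
    show "integral torus_cell (\<lambda>x. ?\<rho> (t, x)) = 1" for t
      unfolding torus_cell_def avg_def[symmetric]
      by (rule rho_avg[where \<delta> = \<delta> and M = M]) (use S \<delta> in auto)
    show "1 / (2 * \<beta>) * laplacian (\<lambda>x. U (t, x)) x + dt (\<lambda>t x. U (t, x)) t x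
       - hamiltonian V0 W (\<lambda>t x. ?\<rho> (t, x)) t x (c - grad (\<lambda>x. U (t, x)) x) + h = 0" for t x
      using HJ_eq[OF Utd UDd UHd, where \<rho> = ?\<rho>] eq1[of "(t, x)"] by simp
    show "1 / (2 * \<beta>) * laplacian (\<lambda>x. ?\<rho> (t, x)) x
       - divg (\<lambda>y. ?\<rho> (t, y) *\<^sub>R (c - grad (\<lambda>x. U (t, x)) y)) x - dt (\<lambda>t x. ?\<rho> (t, x)) t x = 0" for t x
      using FP_eq[OF Utd UDd UHd \<rho>td \<rho>Dd \<rho>Hd] eq2[of "(t, x)"] by simp
  qed
  moreover have "action V0 W c (\<lambda>t x. ?\<rho> (t, x)) (\<lambda>t x. U (t, x)) = avg (act_int ?w ?v)"
  proof (rule action_eq[OF Utd UDd UHd])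
    fix b z assume b: "b \<in> (Basis :: (real^'n) set)"
    have qc: "cper ?q" by (rule Phi1_cper[OF K \<delta>])
    have "has_pd ?w (0, b) (gw b ?w ?v)"
      unfolding gw_def using R_pd_kernel[OF b hh_cper[OF qc S(1)]] Sol_fixpoint(1)[OF s \<delta>] by (simp add: T_def)
    then have "gw b ?w ?v = D b" using DH b has_pd_unique by blast
    then show "UD b z = - (1 / \<beta>) * (gw b ?w ?v z / ?w z)" by (simp add: UD_def)
  qed
  ultimately show thesis by (rule that)
qed

text \<open>Every competitor has the same action as some state in \<open>Sol\<close>, so a minimiser
  over this compact set is minimal among all solutions.\<close>

lemma solution_action:
  assumes bnd: "fixpoint_bound \<delta> M"
    and \<delta>: "\<delta> > 0" and sol: "mfg_solution V0 W c \<beta> \<rho> u h"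
  obtains s where "s \<in> Sol \<delta> M" "action V0 W c \<rho> u = avg (act_int (ws s) (vs s))"
proof -
  define U where "U = (\<lambda>(t, x). u t x)"
  define r where "r = (\<lambda>(t, x). \<rho> t x)"
  have u: "(\<lambda>t x. U (t, x)) = u" and \<rho>: "(\<lambda>t x. r (t, x)) = \<rho>" by (simp_all add: U_def r_def)
  have U3: "CT (Suc (Suc (Suc 0))) U"
    using sol C0_time_imp_CT[of u 3] unfolding mfg_solution_def U_def by (simp only: numeral_3_eq_3) blast
  have r2: "CT (Suc (Suc 0)) r"
    using sol C0_time_imp_CT[of \<rho> 2] unfolding mfg_solution_def r_def by (simp only: numeral_2_eq_2) blast
  obtain Ut where Ut: "cper Ut" "has_pd U (1, 0) Ut"
    using sol C1_timeD[of u 1] unfolding mfg_solution_def U_def by blast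
  obtain rt where rt: "cper rt" "has_pd r (1, 0) rt"
    using sol C1_time_torusD[of \<rho>] CT_cper[OF r2] unfolding mfg_solution_def r_def by blast
  have "\<forall>b\<in>Basis. \<exists>g. has_pd U (0, b) g \<and> CT (Suc (Suc 0)) g" using CT_pd[OF U3] by blast
  then obtain UD where UD: "\<And>b. b \<in> Basis \<Longrightarrow> has_pd U (0, b) (UD b)" "\<And>b. b \<in> Basis \<Longrightarrow> CT (Suc (Suc 0)) (UD b)" by metis
  have "\<forall>b\<in>Basis. \<exists>g. has_pd (UD b) (0, b) g \<and> CT (Suc 0) g" using CT_pd[OF UD(2)] by blast
  then obtain UH where UH: "\<And>b. b \<in> Basis \<Longrightarrow> has_pd (UD b) (0, b) (UH b)" "\<And>b. b \<in> Basis \<Longrightarrow> CT (Suc 0) (UH b)" by metis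
  have "\<forall>b\<in>Basis. \<exists>g. has_pd r (0, b) g \<and> CT (Suc 0) g" using CT_pd[OF r2] by blast
  then obtain rD where rD: "\<And>b. b \<in> Basis \<Longrightarrow> has_pd r (0, b) (rD b)" "\<And>b. b \<in> Basis \<Longrightarrow> CT (Suc 0) (rD b)" by metis
  have "\<forall>b\<in>Basis. \<exists>g. has_pd (rD b) (0, b) g \<and> CT 0 g" using CT_pd[OF rD(2)] by blast
  then obtain rH where rH: "\<And>b. b \<in> Basis \<Longrightarrow> has_pd (rD b) (0, b) (rH b)" "\<And>b. b \<in> Basis \<Longrightarrow> CT 0 (rH b)" by metis
  have pos: "0 \<le> r z" for z using sol by (cases z) (simp add: mfg_solution_def r_def)
  have mass: "avg (\<lambda>x. r (t, x)) = 1" for t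
    using sol by (simp add: mfg_solution_def r_def avg_def torus_cell_def)
  have eq1: "a * (\<Sum>b\<in>Basis. UH b z) + Ut z - (1/2 * (\<Sum>b\<in>Basis. (c \<bullet> b - UD b z) * (c \<bullet> b - UD b z)) + ((case z of (t, x) \<Rightarrow> V0 t x) + Wc r z)) + h = 0" for z
  proof -
    obtain t x where z: "z = (t, x)" by (cases z)
    have "1 / (2 * \<beta>) * laplacian (u t) x + dt u t x - hamiltonian V0 W \<rho> t x (c - grad (u t) x) + h = 0"
      using sol by (simp add: mfg_solution_def)
    then show ?thesis
      unfolding z using HJ_eq[OF Ut(2) UD(1) UH(1), of t x r h] unfolding u \<rho> by (simp add: U_def)
  qed
  have eq2: "a * (\<Sum>b\<in>Basis. rH b z) - (\<Sum>b\<in>Basis. rD b z * (c \<bullet> b - UD b z) - r z * UH b z) - rt z = 0" for z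
  proof -
    obtain t x where z: "z = (t, x)" by (cases z)
    have "1 / (2 * \<beta>) * laplacian (\<rho> t) x - divg (\<lambda>y. \<rho> t y *\<^sub>R (c - grad (u t) y)) x - dt \<rho> t x = 0"
      using sol by (simp add: mfg_solution_def)
    then show ?thesis
      unfolding z using FP_eq[OF Ut(2) UD(1) UH(1) rt(2) rD(1) rH(1), of t x] unfolding u \<rho> by (simp add: U_def r_def)
  qed
  obtain s where s: "s \<in> Sol \<delta> M" "rho (ws s) (vs s) = r"
    and g: "\<And>b z. b \<in> Basis \<Longrightarrow> - (1 / \<beta>) * (gw b (ws s) (vs s) z / ws s z) = UD b z"
    by (rule solution_in_Sol[where \<delta> = \<delta> and M = M and U = U and Ut = Ut and UD = UD and UH = UH and \<rho> = r and \<rho>t = rt and \<rho>D = rD and \<rho>H = rH and h = h,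
          OF bnd \<delta> CT_cper[OF U3] Ut UD(1) CT_cper[OF UD(2)] UH(1) CT_cper[OF UH(2)]
          CT_cper[OF r2] rt rD(1) CT_cper[OF rD(2)] rH(1) CT_cper[OF rH(2)] pos mass eq1 eq2]) blast+
  have "action V0 W c (\<lambda>t x. rho (ws s) (vs s) (t, x)) (\<lambda>t x. U (t, x)) = avg (act_int (ws s) (vs s))"
    by (rule action_eq[OF Ut(2) UD(1) UH(1) g[symmetric]])
  then show thesis using that s u \<rho> by simp
qed

end

theorem theorem1:
  fixes V :: "real \<Rightarrow> real^'n \<Rightarrow> real"
    and W :: "real^'n \<Rightarrow> real"
    and c :: "real^'n"
    and \<beta> :: real
  assumes "V \<in> C0_time_Ck 3"
    and "W \<in> Ck_torus 3"
    and "\<And>x. W (- x) = W x"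
    and "W 0 = 0"
    and "\<beta> > 0"
  shows "(\<exists>\<rho> u h. mfg_solution V W c \<beta> \<rho> u h) \<and>
         (\<exists>\<rho> u h. mfg_solution V W c \<beta> \<rho> u h \<and>
            (\<forall>\<rho>' u' h'. mfg_solution V W c \<beta> \<rho>' u' h' \<longrightarrow>
               action V W c \<rho> u \<le> action V W c \<rho>' u'))"
proof -
  have V: "cper (\<lambda>(t, x). V t x)" by (rule C0_time_cper[OF assms(1)])
  have W: "cper W" using assms(2) CS_cper by (auto simp: Ck_torus_iff)
  obtain bV where bV: "bV > 0" "\<And>z. norm (case z of (t, x) \<Rightarrow> V t x) \<le> bV" using cper_bounded[OF V] by blast
  obtain bW where bW: "bW > 0" "\<And>x. norm (W x) \<le> bW" using cper_bounded[OF W] by blast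
  define \<mu> where "\<mu> = 4 * (\<beta> * (bV + bW)) + 1"
  have \<mu>: "\<mu> > 0" using assms(5) bV(1) bW(1) by (simp add: \<mu>_def add_pos_pos)
  interpret torus_mfg "1 / (2 * \<beta>)" \<mu> c \<beta> bV bW V W
    by unfold_locales (use assms V W bV(2) bW(2) \<mu> in \<open>simp_all add: \<mu>_def\<close>)
  obtain \<delta> M where \<delta>: "\<delta> > 0" "\<delta> \<le> 1" "1 \<le> M" and inv: "\<And>s. s \<in> KK \<delta> M \<Longrightarrow> Phi s \<in> KK \<delta> M"
    and bnd: "fixpoint_bound \<delta> M"
    by (rule Phi_KK) blast
  obtain s where s: "s \<in> Sol \<delta> M" and min: "\<And>t. t \<in> Sol \<delta> M \<Longrightarrow> avg (act_int (ws s) (vs s)) \<le> avg (act_int (ws t) (vs t))"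
    by (rule act_minimizer[OF \<delta>(1) Sol_nonempty[OF \<delta> inv]]) blast+
  obtain \<rho> u h where sol: "mfg_solution V W c \<beta> \<rho> u h" and act: "action V W c \<rho> u = avg (act_int (ws s) (vs s))"
    by (rule Sol_solution[OF s \<delta>(1)])
  have "action V W c \<rho> u \<le> action V W c \<rho>' u'" if sol': "mfg_solution V W c \<beta> \<rho>' u' h'" for \<rho>' u' h'
  proof -
    obtain t where "t \<in> Sol \<delta> M" "action V W c \<rho>' u' = avg (act_int (ws t) (vs t))"
      by (rule solution_action[where \<delta> = \<delta> and M = M, OF bnd \<delta>(1) sol']) blast+
    then show ?thesis using min act by simp
  qed
  with sol show ?thesis by blast
qed

end
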